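(* Let $X$ be a complex Banach space, $A$ an injective sectorial operator in $X$ with dense domain and dense range, $s\in[1,\infty]$, $\theta\in(0,1)$, $\sigma>\omega(A)$ and $\varphi\in\Phi^\Sigma_{\sigma,\theta}$. Then $$x\mapsto\|x\|_X+\Big(\sum_{j\in\mathbb Z}\|2^{-j\theta}\varphi(2^jA)x\|_X^s\Big)^{1/s}$$ (with the sum replaced by the supremum over $j\in\mathbb Z$ if $s=\infty$) defines an equivalent norm for the real interpolation space $(X,D(A))_{\theta,s}$.
   Context: **Sectors and operators.** $\Sigma_\sigma=\{z\in\mathbb C\setminus(-\infty,0]:|\arg z|<\sigma\}$ for $\sigma\in(0,\pi]$, $\Sigma_0=(0,\infty)$. $A$ is sectorial of type $\omega\in[0,\pi)$ if $\sigma(A)\subseteq\overline{\Sigma}_\omega$ and $\sup_{z\notin\overline\Sigma_\sigma}\|zR(z,A)\|<\infty$ for every $\sigma\in(\omega,\pi)$; $\omega(A)$ is the infimum of such $\omega$. $D(A)$ carries the graph norm. **Functional calculus.** $H^\infty(\Sigma_\sigma)$: bounded analytic functions on $\Sigma_\sigma$ with norm $\|f\|_{\infty,\sigma}=\sup_{\Sigma_\sigma}|f|$. $H_0^\infty(\Sigma_\sigma)$: those with $\sup_{z\in\Sigma_\sigma}(|z|^\varepsilon\vee|z|^{-\varepsilon})|f(z)|<\infty$ for some $\varepsilon>0$. For $\varphi\in H_0^\infty(\Sigma_\sigma)$, $\varphi(A)=\frac1{2\pi i}\int_{\partial\Sigma_\omega}\varphi(\lambda)R(\lambda,A)\,d\lambda$,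 $\omega\in(\omega(A),\sigma)$ ($\sigma(A)$ lying to the left of the contour). $\mathcal E(\Sigma_\sigma)=H_0^\infty(\Sigma_\sigma)\oplus\mathbb C\frac1{1+z}\oplus\mathbb C\mathbf 1$; its elements have limits $f(0),f(\infty)$ at $0$ and $\infty$, and for $f=\varphi+\frac{a}{1+z}+b$ one has $f(A)=\varphi(A)+a(1+A)^{-1}+b\,\mathrm{Id}$; $f(tA)=(f(t\,\cdot))(A)$. **Auxiliary classes.** $\Phi_{\sigma,\theta}=\{\varphi\in\mathcal E(\Sigma_\sigma)\setminus\{0\}: z\mapsto z^{-\theta}\varphi(z)\in H_0^\infty(\Sigma_\sigma)\}$. $\Phi^\Sigma_{\sigma,0}$ is the set of $\varphi\in H_0^\infty(\Sigma_\sigma)$ with $0\notin\varphi(\Sigma_\sigma)$ for which there are $d\in\mathbb Z$ and a set $\mathcal F\subseteq\mathcal E(\Sigma_\sigma)$ such that for some $\varepsilon>0$ $$\sup_{f\in\mathcal F}\|f\|_{\infty,\sigma}<\infty,\qquad \sup_{f\in\mathcal F}\sup_{z\in\Sigma_\sigma}(|z|^\varepsilon\vee|z|^{-\varepsilon})\Big|f(z)-\frac{f(0)+f(\infty)z}{1+z}\Big|<\infty,$$ and $\{\varphi(2^jt\,\cdot)/\varphi(2^{j-d}\,\cdot),\ \varphi(2^{j+d}\,\cdot)/\varphi(2^jt\,\cdot): j\in\mathbb Z,\ t\in[1,2]\}\subseteq\{f(r\,\cdot):f\in\mathcal F,\ r>0\}$. $\Phi^\Sigma_{\sigma,\theta}=\{\varphi\in\Phi_{\sigma,\theta}: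 z\mapsto z^{-\theta}\varphi(z)\in\Phi^\Sigma_{\sigma,0}\}$. *)

theory Defs
  imports "HOL-Analysis.Analysis"
begin

section \<open>Complex Banach spaces\<close>

class scaleC =
  fixes scaleC :: "complex \<Rightarrow> 'a \<Rightarrow> 'a"  (infixr "*\<^sub>C" 75)

class complex_normed_vector = real_normed_vector + scaleC +
  assumes scaleC_add_right: "a *\<^sub>C (x + y) = a *\<^sub>C x + a *\<^sub>C y"
    and scaleC_add_left: "(a + b) *\<^sub>C x = a *\<^sub>C x + b *\<^sub>C x"
    and scaleC_scaleC: "a *\<^sub>C (b *\<^sub>C x) = (a * b) *\<^sub>C x"
    and scaleC_of_real: "complex_of_real r *\<^sub>C x = r *\<^sub>R x"
    and norm_scaleC: "norm (a *\<^sub>C x) = cmod a * norm x"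

class complex_banach = complex_normed_vector + banach

instantiation complex :: complex_banach
begin

definition scaleC_complex :: "complex \<Rightarrow> complex \<Rightarrow> complex"
  where "scaleC_complex a x = a * x"

instance
  by standard
    (auto simp: scaleC_complex_def algebra_simps norm_mult scaleR_conv_of_real)

end

section \<open>Sectorial operators\<close>

definition sector :: "real \<Rightarrow> complex set" where
  "sector \<sigma> = (if \<sigma> = 0 then complex_of_real ` {0<..}
               else {z. z \<notin> \<real>\<^sub>\<le>\<^sub>0 \<and> \<bar>Arg z\<bar> < \<sigma>})"

text \<open>An unbounded operator is given by its domain \<open>D\<close> and a function \<open>A\<close>, of which only the
  values on \<open>D\<close> matter.\<close>

definition linear_operator :: "'a::complex_banach set \<Rightarrow> ('a \<Rightarrow> 'a) \<Rightarrow> bool" where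
  "linear_operator D A \<longleftrightarrow>
     0 \<in> D \<and>
     (\<forall>x\<in>D. \<forall>y\<in>D. x + y \<in> D \<and> A (x + y) = A x + A y) \<and>
     (\<forall>c. \<forall>x\<in>D. c *\<^sub>C x \<in> D \<and> A (c *\<^sub>C x) = c *\<^sub>C A x)"

definition resolvent :: "'a::complex_banach set \<Rightarrow> ('a \<Rightarrow> 'a) \<Rightarrow> complex \<Rightarrow> 'a \<Rightarrow> 'a" where
  "resolvent D A z = inv_into D (\<lambda>x. z *\<^sub>C x - A x)"

definition resolvent_set :: "'a::complex_banach set \<Rightarrow> ('a \<Rightarrow> 'a) \<Rightarrow> complex set" where
  "resolvent_set D A =
     {z. bij_betw (\<lambda>x. z *\<^sub>C x - A x) D UNIV \<and> bounded_linear (resolvent D A z)}"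

definition op_spectrum :: "'a::complex_banach set \<Rightarrow> ('a \<Rightarrow> 'a) \<Rightarrow> complex set" where
  "op_spectrum D A = - resolvent_set D A"

definition sectorial_of_type :: "'a::complex_banach set \<Rightarrow> ('a \<Rightarrow> 'a) \<Rightarrow> real \<Rightarrow> bool" where
  "sectorial_of_type D A \<omega> \<longleftrightarrow>
     linear_operator D A \<and> 0 \<le> \<omega> \<and> \<omega> < pi \<and>
     op_spectrum D A \<subseteq> closure (sector \<omega>) \<and>
     (\<forall>\<sigma>. \<omega> < \<sigma> \<and> \<sigma> < pi \<longrightarrow>
        bdd_above ((\<lambda>z. onorm (\<lambda>x. z *\<^sub>C resolvent D A z x)) ` (- closure (sector \<sigma>))))"

definition sectorial :: "'a::complex_banach set \<Rightarrow> ('a \<Rightarrow> 'a) \<Rightarrow> bool" where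
  "sectorial D A \<longleftrightarrow> (\<exists>\<omega>. sectorial_of_type D A \<omega>)"

definition sectoriality_angle :: "'a::complex_banach set \<Rightarrow> ('a \<Rightarrow> 'a) \<Rightarrow> real" where
  "sectoriality_angle D A = Inf {\<omega>. sectorial_of_type D A \<omega>}"

section \<open>Functional calculus\<close>

text \<open>Functions on a sector are functions on the complex plane whose values off the sector
  are irrelevant.\<close>

definition H0_inf :: "real \<Rightarrow> (complex \<Rightarrow> complex) set" where
  "H0_inf \<sigma> = {f. f holomorphic_on sector \<sigma> \<and>
     (\<exists>\<epsilon>>0. bdd_above
        ((\<lambda>z. max (cmod z powr \<epsilon>) (cmod z powr (-\<epsilon>)) * cmod (f z)) ` sector \<sigma>))}"

definition elementary_class :: "real \<Rightarrow> (complex \<Rightarrow> complex) set" where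
  "elementary_class \<sigma> =
     {f. \<exists>\<phi>\<in>H0_inf \<sigma>. \<exists>a b. \<forall>z\<in>sector \<sigma>. f z = \<phi> z + a / (1 + z) + b}"

definition value_zero :: "real \<Rightarrow> (complex \<Rightarrow> complex) \<Rightarrow> complex" where
  "value_zero \<sigma> f = Lim (at 0 within sector \<sigma>) f"

definition value_infinity :: "real \<Rightarrow> (complex \<Rightarrow> complex) \<Rightarrow> complex" where
  "value_infinity \<sigma> f = Lim (inf at_infinity (principal (sector \<sigma>))) f"

text \<open>The integral of \<open>\<phi>(\<lambda>) R(\<lambda>, A) x\<close> along the ray through \<open>exp (\<i> \<alpha>)\<close>, directed
  away from the origin, parametrised by \<open>\<lambda> = exp (t + \<i> \<alpha>)\<close> for real \<open>t\<close>, so that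
  \<open>d\<lambda> = \<lambda> dt\<close>.\<close>

definition ray_integral ::
  "'a::complex_banach set \<Rightarrow> ('a \<Rightarrow> 'a) \<Rightarrow> real \<Rightarrow> (complex \<Rightarrow> complex) \<Rightarrow> 'a \<Rightarrow> 'a" where
  "ray_integral D A \<alpha> \<phi> x =
     integral UNIV (\<lambda>t::real. let l = exp (Complex t \<alpha>) in (l * \<phi> l) *\<^sub>C resolvent D A l x)"

text \<open>The boundary of the sector of angle \<open>\<nu>\<close> is traversed with the sector on the left: inwards
  on the upper ray, outwards on the lower one.\<close>

definition H0_calculus ::
  "'a::complex_banach set \<Rightarrow> ('a \<Rightarrow> 'a) \<Rightarrow> real \<Rightarrow> (complex \<Rightarrow> complex) \<Rightarrow> 'a \<Rightarrow> 'a" where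
  "H0_calculus D A \<nu> \<phi> x =
     (1 / (2 * pi * \<i>)) *\<^sub>C (ray_integral D A (-\<nu>) \<phi> x - ray_integral D A \<nu> \<phi> x)"

definition elementary_calculus ::
  "'a::complex_banach set \<Rightarrow> ('a \<Rightarrow> 'a) \<Rightarrow> real \<Rightarrow> real \<Rightarrow> (complex \<Rightarrow> complex) \<Rightarrow> 'a \<Rightarrow> 'a" where
  "elementary_calculus D A \<sigma> \<nu> f x =
     (THE y. \<exists>\<phi>\<in>H0_inf \<sigma>. \<exists>a b. (\<forall>z\<in>sector \<sigma>. f z = \<phi> z + a / (1 + z) + b) \<and>
        y = H0_calculus D A \<nu> \<phi> x + a *\<^sub>C inv_into D (\<lambda>u. u + A u) x + b *\<^sub>C x)"

section \<open>Auxiliary classes of functions\<close>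

definition Phi_class :: "real \<Rightarrow> real \<Rightarrow> (complex \<Rightarrow> complex) set" where
  "Phi_class \<sigma> \<theta> =
     {\<phi>\<in>elementary_class \<sigma>. (\<exists>z\<in>sector \<sigma>. \<phi> z \<noteq> 0) \<and>
        (\<lambda>z. z powr (- complex_of_real \<theta>) * \<phi> z) \<in> H0_inf \<sigma>}"

definition Phi_Sigma_zero :: "real \<Rightarrow> (complex \<Rightarrow> complex) set" where
  "Phi_Sigma_zero \<sigma> =
     {\<phi>\<in>H0_inf \<sigma>. 0 \<notin> \<phi> ` sector \<sigma> \<and>
        (\<exists>(d::int) F. F \<subseteq> elementary_class \<sigma> \<and>
           bdd_above {cmod (f z) | f z. f \<in> F \<and> z \<in> sector \<sigma>} \<and>
           (\<exists>\<epsilon>>0. bdd_above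
              {max (cmod z powr \<epsilon>) (cmod z powr (-\<epsilon>)) *
                 cmod (f z - (value_zero \<sigma> f + value_infinity \<sigma> f * z) / (1 + z)) | f z.
               f \<in> F \<and> z \<in> sector \<sigma>}) \<and>
           (\<forall>j::int. \<forall>t\<in>{1..2::real}.
              (\<exists>f\<in>F. \<exists>r>0. \<forall>z\<in>sector \<sigma>.
                 \<phi> (2 powi j * complex_of_real t * z) / \<phi> (2 powi (j - d) * z)
                   = f (complex_of_real r * z)) \<and>
              (\<exists>f\<in>F. \<exists>r>0. \<forall>z\<in>sector \<sigma>.
                 \<phi> (2 powi (j + d) * z) / \<phi> (2 powi j * complex_of_real t * z)
                   = f (complex_of_real r * z))))}"

definition Phi_Sigma :: "real \<Rightarrow> real \<Rightarrow> (complex \<Rightarrow> complex) set" where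
  "Phi_Sigma \<sigma> \<theta> =
     {\<phi>\<in>Phi_class \<sigma> \<theta>. (\<lambda>z. z powr (- complex_of_real \<theta>) * \<phi> z) \<in> Phi_Sigma_zero \<sigma>}"

section \<open>Real interpolation\<close>

definition ennreal_powr :: "ennreal \<Rightarrow> real \<Rightarrow> ennreal" where
  "ennreal_powr a p = (if a = \<infinity> then \<infinity> else ennreal (enn2real a powr p))"

definition graph_norm :: "('a::complex_banach \<Rightarrow> 'a) \<Rightarrow> 'a \<Rightarrow> real" where
  "graph_norm A x = norm x + norm (A x)"

text \<open>K-method for the couple \<open>(X, Y)\<close>, where \<open>Y\<close> is a subspace of \<open>X\<close> normed by \<open>n\<close>. As
  \<open>X + Y = X\<close>, the interpolation space consists of the \<open>x\<close> in \<open>X\<close> with finite interpolation norm.\<close>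

definition K_functional :: "'a::complex_banach set \<Rightarrow> ('a \<Rightarrow> real) \<Rightarrow> real \<Rightarrow> 'a \<Rightarrow> real" where
  "K_functional Y n t x = Inf {norm a + t * n b | a b. b \<in> Y \<and> x = a + b}"

definition real_interp_norm ::
  "'a::complex_banach set \<Rightarrow> ('a \<Rightarrow> real) \<Rightarrow> real \<Rightarrow> ennreal \<Rightarrow> 'a \<Rightarrow> ennreal" where
  "real_interp_norm Y n \<theta> s x =
     (if s = \<infinity> then (SUP t\<in>{0<..}. ennreal (t powr (-\<theta>) * K_functional Y n t x))
      else ennreal_powr
        (\<integral>\<^sup>+t\<in>{0<..}. ennreal ((t powr (-\<theta>) * K_functional Y n t x) powr enn2real s / t) \<partial>lborel)
        (1 / enn2real s))"

definition real_interp_space ::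
  "'a::complex_banach set \<Rightarrow> ('a \<Rightarrow> real) \<Rightarrow> real \<Rightarrow> ennreal \<Rightarrow> 'a set" where
  "real_interp_space Y n \<theta> s = {x. real_interp_norm Y n \<theta> s x < \<infinity>}"

definition lseq_norm :: "ennreal \<Rightarrow> (int \<Rightarrow> real) \<Rightarrow> ennreal" where
  "lseq_norm s a =
     (if s = \<infinity> then (SUP j. ennreal \<bar>a j\<bar>)
      else ennreal_powr (\<Sum>\<^sub>\<infinity>j. ennreal (\<bar>a j\<bar> powr enn2real s)) (1 / enn2real s))"

text \<open>\<open>N\<close> defines an equivalent norm for the space \<open>V\<close> normed by \<open>n\<close>: the elements of \<open>V\<close> are
  exactly those at which \<open>N\<close> is finite, and on \<open>V\<close> it is a norm equivalent to \<open>n\<close>.\<close>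

definition defines_equivalent_norm ::
  "('a::complex_banach \<Rightarrow> ennreal) \<Rightarrow> 'a set \<Rightarrow> ('a \<Rightarrow> ennreal) \<Rightarrow> bool" where
  "defines_equivalent_norm N V n \<longleftrightarrow>
     V = {x. N x < \<infinity>} \<and>
     (\<forall>x\<in>V. N x = 0 \<longleftrightarrow> x = 0) \<and>
     (\<forall>c. \<forall>x\<in>V. N (c *\<^sub>C x) = ennreal (cmod c) * N x) \<and>
     (\<forall>x\<in>V. \<forall>y\<in>V. N (x + y) \<le> N x + N y) \<and>
     (\<exists>C>0. \<forall>x\<in>V. N x \<le> ennreal C * n x \<and> n x \<le> ennreal C * N x)"

end

theory Submission
  imports Defs "HOL-Complex_Analysis.Complex_Analysis" "HOL-Real_Asymp.Real_Asymp"
begin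

text \<open>The interpolation norm of \<open>x\<close> is comparable to the \<open>l\<^sup>s\<close> norm over the integers of
  \<open>k\<^sub>i = 2 powr (-i\<theta>) * K(2\<^sup>i, x)\<close>, and \<open>K(t, x)\<close> is comparable to
  \<open>\<parallel>x - (1 + tA)\<^sup>-\<^sup>1 x\<parallel> + min 1 t * \<parallel>x\<parallel>\<close>. The sequences \<open>k\<^sub>i\<close> and \<open>2 powr (-j\<theta>) * \<parallel>\<phi>(2\<^sup>jA)x\<parallel>\<close>
  dominate each other up to convolution with a geometric kernel \<open>r powr \<bar>i - j\<bar>\<close>, which is bounded on
  \<open>l\<^sup>s\<close>. In one direction, \<open>\<phi>(2\<^sup>jA)x\<close> is an integral of \<open>\<phi>(2\<^sup>j\<lambda>) A R(\<lambda>, A)x d\<lambda>/\<lambda>\<close>, and \<open>A R(\<lambda>, A)x\<close> is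
  bounded by \<open>K(1/\<bar>\<lambda>\<bar>, x)\<close>. In the other one, the bound on the quotients \<open>\<phi>(tz)/\<phi>(2\<^sup>-\<^sup>dz)\<close> yields a
  decaying \<open>g\<close> with \<open>\<Sum>\<^sub>j g(2\<^sup>jz) \<phi>(2\<^sup>j\<^sup>-\<^sup>dz) = 1\<close>, so that \<open>x - (1 + \<tau>A)\<^sup>-\<^sup>1x\<close> is the sum of the vectors
  \<open>(1 - (1 + \<tau>A)\<^sup>-\<^sup>1) g(2\<^sup>jA) \<phi>(2\<^sup>j\<^sup>-\<^sup>dA)x\<close>, whose operator factors decay geometrically away from
  \<open>2\<^sup>j = \<tau>\<close>.\<close>

text \<open>The operator factors only satisfy a bound by min 1 (\<tau> 2^-j), which decays on one
  side of 2^j = \<tau>. The weight 2 powr (-j\<theta>) makes the decay two-sided, at the rates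
  \<theta> and 1 - \<theta>; this is where 0 < \<theta> < 1 enters. In the opposite direction,
  \<phi> vanishes at 0 to an order above \<theta> but has merely a limit b at infinity, so b z/(1 +
  z) is split off and estimated through x - (1 + tA)^-1 x. The lower bounds on \<phi> are purely
  relative: \<phi> is compared only with itself at the scale 2^-d. Hence g is a quotient with
  denominator \<phi>(2^-d z), and d reappears as a shift of the index j. The reproducing formula is
  a pointwise identity of scalar functions whose partial sums are just uniformly bounded. A decaying
  factor u has to be inserted before the calculus can pass to the limit, and u(A) is removed again
  by the injectivity of A. Products in the calculus need two different contours, since 1/(\<mu> -
  \<lambda>) is singular on a common one.\<close>

lemma bounded_bilinear_scaleC:
  "bounded_bilinear (scaleC :: complex \<Rightarrow> 'a::complex_normed_vector \<Rightarrow> 'a)"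
proof
  fix a a' :: complex and b b' :: 'a and r :: real
  show "(a + a') *\<^sub>C b = a *\<^sub>C b + a' *\<^sub>C b" by (rule scaleC_add_left)
  show "a *\<^sub>C (b + b') = a *\<^sub>C b + a *\<^sub>C b'" by (rule scaleC_add_right)
  show "(r *\<^sub>R a) *\<^sub>C b = r *\<^sub>R (a *\<^sub>C b)"
    by (simp add: scaleR_conv_of_real scaleC_scaleC flip: scaleC_of_real)
  show "a *\<^sub>C (r *\<^sub>R b) = r *\<^sub>R (a *\<^sub>C b)"
    by (simp add: scaleC_scaleC mult.commute flip: scaleC_of_real)
  show "\<exists>K. \<forall>a (b::'a). norm (a *\<^sub>C b) \<le> norm a * norm b * K"
    by (intro exI[of _ 1]) (simp add: norm_scaleC)
qed

interpretation scaleC: bounded_bilinear "scaleC :: complex \<Rightarrow> 'a::complex_normed_vector \<Rightarrow> 'a"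
  by (rule bounded_bilinear_scaleC)

lemmas scaleC_simps = scaleC.add_left scaleC.add_right scaleC.diff_left scaleC.diff_right
  scaleC.minus_left scaleC.minus_right

lemma scaleC_one [simp]: "1 *\<^sub>C (x::'a::complex_normed_vector) = x"
  using scaleC_of_real[of 1 x] by simp

lemma scaleC_zero_left [simp]: "0 *\<^sub>C (x::'a::complex_normed_vector) = 0"
  by (rule scaleC.zero_left)

lemma scaleC_zero_right [simp]: "c *\<^sub>C (0::'a::complex_normed_vector) = 0"
  by (rule scaleC.zero_right)

lemma scaleC_minus1 [simp]: "(-1) *\<^sub>C (x::'a::complex_normed_vector) = - x"
  by (simp add: scaleC.minus_left)

lemma scaleC_eq_iff: "c \<noteq> 0 \<Longrightarrow> c *\<^sub>C x = c *\<^sub>C y \<longleftrightarrow> x = (y::'a::complex_normed_vector)"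
  by (metis scaleC_scaleC scaleC_one left_inverse)

lemma scaleC_mult_complex [simp]: "(c::complex) *\<^sub>C z = c * z"
  by (simp add: scaleC_complex_def)

lemmas [continuous_intros] = scaleC.continuous_on

section \<open>Exponentially dominated integrals\<close>

text \<open>The value does not depend on the shift \<open>a\<close>. A dilation z -> cz becomes the
  translation t -> t + ln c in logarithmic coordinates, so this is what makes bounds on the calculus
  uniform over all dilates of a function.\<close>

lemma has_integral_exp_abs:
  fixes \<epsilon> a :: real
  assumes "\<epsilon> > 0"
  shows "((\<lambda>t. exp (-\<epsilon> * \<bar>t + a\<bar>)) has_integral 2 / \<epsilon>) UNIV"
proof -
  let ?f = "\<lambda>t::real. exp (-\<epsilon> * \<bar>t\<bar>)"
  have 1: "((\<lambda>t. exp (-\<epsilon> * t)) has_integral 1 / \<epsilon>) {0..}"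
    using has_integral_exp_minus_to_infinity[OF assms, of 0] by simp
  have right: "(?f has_integral 1 / \<epsilon>) {0..}"
    by (rule has_integral_eq[OF _ 1]) simp
  then have "?f absolutely_integrable_on {0..} \<and> integral {0..} ?f = 1 / \<epsilon>"
    by (intro conjI nonnegative_absolutely_integrable_1) (auto simp: has_integral_iff)
  then have "(\<lambda>t. ?f (-t)) absolutely_integrable_on {..0} \<and> integral {..0} (\<lambda>t. ?f (-t)) = 1 / \<epsilon>"
    by (subst has_absolute_integral_reflect_real[where B="{0..}"]) auto
  then have left: "(?f has_integral 1 / \<epsilon>) {..0}"
    by (auto simp: has_integral_iff absolutely_integrable_on_def)
  have "(?f has_integral 1 / \<epsilon> + 1 / \<epsilon>) ({0..} \<union> {..0})"
    by (rule has_integral_Un[OF right left]) (auto intro: negligible_subset[OF negligible_sing[of 0]])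
  moreover have "{0..} \<union> {..0} = (UNIV :: real set)" by auto
  ultimately have "(?f has_integral 2 / \<epsilon>) UNIV" by simp
  then have "has_bochner_integral lborel ?f (2 / \<epsilon>)"
    using assms by (intro has_bochner_integral_nn_integral nn_integral_has_integral_lborel) auto
  then have "has_bochner_integral lborel (\<lambda>t. ?f (a + 1 * t)) ((2 / \<epsilon>) /\<^sub>R \<bar>1\<bar>)"
    by (subst lborel_has_bochner_integral_real_affine_iff[symmetric]) auto
  then have "((\<lambda>t. ?f (a + t)) has_integral 2 / \<epsilon>) UNIV"
    by (auto intro: has_integral_integral_lborel simp: has_bochner_integral_iff
        dest!: has_integral_integral_lborel)
  then show ?thesis by (simp add: add.commute)
qed

lemma exp_dominated_integrable:
  fixes G :: "real \<Rightarrow> 'a::banach"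
  assumes "continuous_on UNIV G" "\<epsilon> > 0" "\<And>t. norm (G t) \<le> C * exp (-\<epsilon> * \<bar>t + a\<bar>)"
  shows "G integrable_on UNIV"
proof (rule integrable_on_all_intervals_integrable_bound)
  show "(\<lambda>t. if t \<in> UNIV then G t else 0) integrable_on cbox x y" for x y
    by (auto intro!: integrable_continuous_interval continuous_on_subset[OF assms(1)])
  show "(\<lambda>t. C * exp (-\<epsilon> * \<bar>t + a\<bar>)) integrable_on UNIV"
    using has_integral_mult_right[OF has_integral_exp_abs[OF assms(2), of a], of C]
    by (auto simp: integrable_on_def)
qed (use assms in auto)

lemma exp_dominated_integral_bound:
  fixes G :: "real \<Rightarrow> 'a::banach"
  assumes "G integrable_on UNIV" "\<epsilon> > 0" "\<And>t. norm (G t) \<le> C * exp (-\<epsilon> * \<bar>t + a\<bar>)"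
  shows "norm (integral UNIV G) \<le> C * (2 / \<epsilon>)"
proof -
  note h = has_integral_mult_right[OF has_integral_exp_abs[OF assms(2), of a], of C]
  have "norm (integral UNIV G) \<le> integral UNIV (\<lambda>t. C * exp (-\<epsilon> * \<bar>t + a\<bar>))"
    using assms h by (intro integral_norm_bound_integral) (auto simp: integrable_on_def)
  then show ?thesis using integral_unique[OF h] by simp
qed

lemma integral_symmetric_tendsto:
  fixes G :: "real \<Rightarrow> 'a::banach"
  assumes "G integrable_on UNIV"
  shows "((\<lambda>T. integral {-T..T} G) \<longlongrightarrow> integral UNIV G) at_top"
proof (rule tendstoI)
  fix e :: real assume "e > 0"
  have "(G has_integral integral UNIV G) UNIV" using assms by auto
  then obtain B where B: "B > 0"
    "\<And>a b. ball 0 B \<subseteq> cbox a b \<Longrightarrow> norm (integral (cbox a b) G - integral UNIV G) < e"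
    using \<open>e > 0\<close> by (subst (asm) has_integral_alt') auto
  have "dist (integral {-T..T} G) (integral UNIV G) < e" if "T \<ge> B" for T
    using B(2)[of "-T" T] that by (force simp: dist_norm)
  then show "\<forall>\<^sub>F T in at_top. dist (integral {-T..T} G) (integral UNIV G) < e"
    by (auto simp: eventually_at_top_linorder)
qed

text \<open>For \<bar>t\<bar> > T half of the decay rate yields the factor exp (-(\<epsilon>/2) T),
  and the other half is kept for integrability.\<close>

lemma integral_tail_bound:
  fixes G :: "real \<Rightarrow> 'a::banach"
  assumes cont: "continuous_on UNIV G" and "\<epsilon> > 0"
    and bd: "\<And>t. norm (G t) \<le> C * exp (-\<epsilon> * \<bar>t\<bar>)"
  shows "norm (integral UNIV G - integral {-T..T} G) \<le> C * (4 / \<epsilon>) * exp (-(\<epsilon>/2) * T)"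
proof -
  have C: "C \<ge> 0" using order_trans[OF norm_ge_zero bd[of 0]] by simp
  let ?H = "\<lambda>t. if t \<in> {-T..T} then G t else 0"
  have iG: "G integrable_on UNIV"
    by (rule exp_dominated_integrable[OF cont, of \<epsilon> C 0]) (use assms in auto)
  have iH: "?H integrable_on UNIV"
    by (subst integrable_restrict_UNIV) (auto intro!: integrable_continuous_interval continuous_on_subset[OF cont])
  have "integral UNIV G - integral {-T..T} G = integral UNIV (\<lambda>t. G t - ?H t)"
    using integral_diff[OF iG iH] by (simp only: integral_restrict_UNIV)
  also have "norm \<dots> \<le> (C * exp (-(\<epsilon>/2) * T)) * (2 / (\<epsilon>/2))"
  proof (rule exp_dominated_integral_bound)
    show "(\<lambda>t. G t - ?H t) integrable_on UNIV" by (rule integrable_diff[OF iG iH])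
    fix t :: real
    have "norm (G t) \<le> C * exp (-(\<epsilon>/2) * T) * exp (- (\<epsilon> / 2) * \<bar>t + 0\<bar>)" if "t \<notin> {-T..T}"
    proof -
      have "exp (-\<epsilon> * \<bar>t\<bar>) \<le> exp (-(\<epsilon>/2) * T + - (\<epsilon> / 2) * \<bar>t\<bar>)"
        using that \<open>\<epsilon> > 0\<close> mult_left_mono[of T "\<bar>t\<bar>" "\<epsilon>/2"] by (auto simp: field_simps)
      then show ?thesis using order_trans[OF bd[of t] mult_left_mono[OF _ C]]
        by (metis add.right_neutral exp_add mult.assoc)
    qed
    then show "norm (G t - ?H t) \<le> C * exp (-(\<epsilon>/2) * T) * exp (- (\<epsilon> / 2) * \<bar>t + 0\<bar>)"
      using C by auto
  qed (use assms in auto)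
  finally show ?thesis by (simp add: mult_ac)
qed

text \<open>Preparation for exchanging two integrals over the whole line: the error made by
  truncating to the square of side 2T is exponentially small, and the exchange is then a matter of
  continuous functions on a square.\<close>

lemma inner_integral_exp_dominated:
  fixes k :: "real \<Rightarrow> real \<Rightarrow> 'a::banach"
  assumes cont: "continuous_on UNIV (\<lambda>(s,t). k s t)" and "\<epsilon> > 0"
    and bd: "\<And>s t. norm (k s t) \<le> C * exp (-\<epsilon> * \<bar>s\<bar>) * exp (-\<epsilon> * \<bar>t\<bar>)"
  shows "continuous_on UNIV (\<lambda>s. integral UNIV (k s))"
    and "norm (integral UNIV (k s)) \<le> C * (2 / \<epsilon>) * exp (-\<epsilon> * \<bar>s\<bar>)"
    and "norm (integral UNIV (\<lambda>s. integral UNIV (k s)) -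
           integral {-T..T} (\<lambda>s. integral {-T..T} (k s))) \<le> 16 * C / \<epsilon>^2 * exp (-(\<epsilon>/2) * T)"
proof -
  have C: "C \<ge> 0" using order_trans[OF norm_ge_zero bd[of 0 0]] by simp
  have ck: "continuous_on UNIV (k s)" for s
  proof -
    have "continuous_on UNIV (\<lambda>t. (s, t))" by (intro continuous_intros)
    from continuous_on_compose2[OF cont this] show ?thesis by simp
  qed
  let ?h = "\<lambda>s. integral UNIV (k s)" and ?hT = "\<lambda>T s. integral {-T..T} (k s)"
  have tail: "norm (?h s - ?hT T s) \<le> C * exp (-\<epsilon> * \<bar>s\<bar>) * (4 / \<epsilon>) * exp (-(\<epsilon>/2) * T)" for s T
    by (rule integral_tail_bound[OF ck \<open>\<epsilon> > 0\<close> bd])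
  have chT: "continuous_on UNIV (?hT T)" for T
    using integral_continuous_on_param[of UNIV "-T" T k] continuous_on_subset[OF cont] by simp
  have lim0: "((\<lambda>T. C * (4 / \<epsilon>) * exp (-(\<epsilon>/2) * T)) \<longlongrightarrow> 0) at_top"
    using \<open>\<epsilon> > 0\<close> by real_asymp
  show ch: "continuous_on UNIV ?h"
  proof (rule uniform_limit_theorem[OF _ _ trivial_limit_at_top_linorder])
    show "\<forall>\<^sub>F T in at_top. continuous_on UNIV (?hT T)" using chT by simp
    show "uniform_limit UNIV ?hT ?h at_top"
    proof (rule uniform_limitI)
      fix e :: real assume "e > 0"
      have "\<forall>\<^sub>F T in at_top. C * (4 / \<epsilon>) * exp (-(\<epsilon>/2) * T) < e"
        using order_tendstoD(2)[OF lim0 \<open>e > 0\<close>] .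
      then show "\<forall>\<^sub>F T in at_top. \<forall>s\<in>UNIV. dist (?hT T s) (?h s) < e"
      proof eventually_elim
        case (elim T)
        have "C * exp (-\<epsilon> * \<bar>s\<bar>) * (4 / \<epsilon>) * exp (-(\<epsilon>/2) * T) \<le> C * 1 * (4 / \<epsilon>) * exp (-(\<epsilon>/2) * T)" for s
          using C \<open>\<epsilon> > 0\<close> by (intro mult_right_mono mult_left_mono) auto
        then show ?case using elim tail[of _ T]
          by (auto simp: dist_norm norm_minus_commute intro: le_less_trans order_trans)
      qed
    qed
  qed
  have "norm (integral UNIV (k s)) \<le> C * exp (-\<epsilon> * \<bar>s\<bar>) * (2 / \<epsilon>)" for s
    using exp_dominated_integral_bound[OF exp_dominated_integrable[OF ck], of \<epsilon> s "C * exp (-\<epsilon> * \<bar>s\<bar>)" 0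
        \<epsilon> "C * exp (-\<epsilon> * \<bar>s\<bar>)" 0] bd \<open>\<epsilon> > 0\<close> by simp
  then show bh: "norm (integral UNIV (k s)) \<le> C * (2 / \<epsilon>) * exp (-\<epsilon> * \<bar>s\<bar>)" for s
    by (simp add: mult_ac)
  \<comment> \<open>The outer tail, and the inner tail integrated over the outer variable,
    contribute 8 C / \<epsilon>^2 each.\<close>
  have "norm (integral UNIV ?h - integral {-T..T} ?h) \<le> C * (2/\<epsilon>) * (4 / \<epsilon>) * exp (-(\<epsilon>/2) * T)"
    by (rule integral_tail_bound[OF ch \<open>\<epsilon> > 0\<close> bh])
  moreover have "norm (integral {-T..T} ?h - integral {-T..T} (?hT T)) \<le> C * (4 / \<epsilon>) * exp (-(\<epsilon>/2) * T) * (2/\<epsilon>)"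
  proof -
    let ?g = "\<lambda>s. if s \<in> {-T..T} then ?h s - ?hT T s else 0"
    have i: "?h integrable_on {-T..T}" "?hT T integrable_on {-T..T}"
      using ch chT by (auto intro!: integrable_continuous_interval intro: continuous_on_subset)
    have "integral {-T..T} ?h - integral {-T..T} (?hT T) = integral UNIV ?g"
      using integral_diff[OF i] by (simp only: integral_restrict_UNIV)
    also have "norm \<dots> \<le> C * (4 / \<epsilon>) * exp (-(\<epsilon>/2) * T) * (2/\<epsilon>)"
    proof (rule exp_dominated_integral_bound)
      show "?g integrable_on UNIV" using integrable_diff[OF i] by (simp only: integrable_restrict_UNIV)
      show "norm (?g s) \<le> C * (4 / \<epsilon>) * exp (-(\<epsilon>/2) * T) * exp (-\<epsilon> * \<bar>s + 0\<bar>)" for s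
        using tail[of s T] C \<open>\<epsilon> > 0\<close> by (auto simp: mult_ac)
    qed (use \<open>\<epsilon> > 0\<close> in auto)
    finally show ?thesis .
  qed
  ultimately have "norm (integral UNIV ?h - integral {-T..T} (?hT T))
      \<le> C * (2/\<epsilon>) * (4 / \<epsilon>) * exp (-(\<epsilon>/2) * T) + C * (4 / \<epsilon>) * exp (-(\<epsilon>/2) * T) * (2/\<epsilon>)"
    by (rule norm_diff_triangle_le)
  also have "\<dots> = 16 * C / \<epsilon>^2 * exp (-(\<epsilon>/2) * T)" by (simp add: power2_eq_square field_simps)
  finally show "norm (integral UNIV ?h - integral {-T..T} (?hT T)) \<le> 16 * C / \<epsilon>^2 * exp (-(\<epsilon>/2) * T)" .
qed

text \<open>Both iterated integrals are limits of integrals over squares, on which the order of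
  integration of a continuous function is immaterial.\<close>

lemma exp_dominated_integral_swap:
  fixes k :: "real \<Rightarrow> real \<Rightarrow> 'a::banach"
  assumes cont: "continuous_on UNIV (\<lambda>(s,t). k s t)" and "\<epsilon> > 0"
    and bd: "\<And>s t. norm (k s t) \<le> C * exp (-\<epsilon> * \<bar>s\<bar>) * exp (-\<epsilon> * \<bar>t\<bar>)"
  shows "integral UNIV (\<lambda>s. integral UNIV (k s)) = integral UNIV (\<lambda>t. integral UNIV (\<lambda>s. k s t))"
proof -
  have cont': "continuous_on UNIV (\<lambda>(t,s). k s t)"
    using continuous_on_compose2[OF cont continuous_on_swap[of UNIV]]
    by (simp add: split_beta prod.swap_def)
  have bd': "norm (k s t) \<le> C * exp (-\<epsilon> * \<bar>t\<bar>) * exp (-\<epsilon> * \<bar>s\<bar>)" for s t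
    using bd[of s t] by (simp add: mult_ac)
  have lim0: "((\<lambda>T. 16 * C / \<epsilon>^2 * exp (-(\<epsilon>/2) * T)) \<longlongrightarrow> 0) at_top"
    using \<open>\<epsilon> > 0\<close> by real_asymp
  have 1: "((\<lambda>T. integral {-T..T} (\<lambda>s. integral {-T..T} (k s))) \<longlongrightarrow> integral UNIV (\<lambda>s. integral UNIV (k s))) at_top"
    using inner_integral_exp_dominated(3)[OF assms] by (intro Lim_null[THEN iffD2, OF Lim_null_comparison[OF always_eventually lim0]] allI)
      (simp add: norm_minus_commute)

  have 2: "((\<lambda>T. integral {-T..T} (\<lambda>t. integral {-T..T} (\<lambda>s. k s t))) \<longlongrightarrow>
      integral UNIV (\<lambda>t. integral UNIV (\<lambda>s. k s t))) at_top"
    using inner_integral_exp_dominated(3)[OF cont' \<open>\<epsilon> > 0\<close> bd']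
    by (intro Lim_null[THEN iffD2, OF Lim_null_comparison[OF always_eventually lim0]] allI)
      (simp add: norm_minus_commute)
  have "integral {-T..T} (\<lambda>s. integral {-T..T} (k s)) = integral {-T..T} (\<lambda>t. integral {-T..T} (\<lambda>s. k s t))" for T
    using integral_swap_continuous[of "-T" "-T" T T k] continuous_on_subset[OF cont] by simp
  then show ?thesis
    using tendsto_unique[OF _ 1] 2 by simp
qed

section \<open>Shifting lines of integration in a strip\<close>

text \<open>Cauchy's theorem for a strip, with values in X. Differentiating the integral over a
  horizontal segment with respect to its height gives \<i> times the integral of \<open>G'\<close>,
  that is \<i> times the difference of the end values of \<open>G\<close>. These tend to
  \<open>y1 - y0\<close>, so a shift by \<beta> - \<alpha> contributes \<i> (\<beta> - \<alpha>)(y1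
  - y0). Nonzero end values are allowed because resolvent integrands such as \<lambda> R(\<lambda>)
  y have them.\<close>

lemma strip_shift:
  fixes G G' :: "complex \<Rightarrow> 'a::complex_banach"
  assumes "\<alpha> \<le> \<beta>"
    and der: "\<And>w. Im w \<in> {\<alpha>..\<beta>} \<Longrightarrow>
      (G has_derivative (\<lambda>h. h *\<^sub>C G' w)) (at w within {w. Im w \<in> {\<alpha>..\<beta>}})"
    and cont: "continuous_on {w. Im w \<in> {\<alpha>..\<beta>}} G'"
    and top: "\<And>e. e > 0 \<Longrightarrow> \<exists>T0. \<forall>t\<ge>T0. \<forall>a\<in>{\<alpha>..\<beta>}. norm (G (Complex t a) - y1) \<le> e"
    and bot: "\<And>e. e > 0 \<Longrightarrow> \<exists>T0. \<forall>t\<ge>T0. \<forall>a\<in>{\<alpha>..\<beta>}. norm (G (Complex (-t) a) - y0) \<le> e"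
  shows "((\<lambda>T. integral {-T..T} (\<lambda>t. G (Complex t \<beta>)) - integral {-T..T} (\<lambda>t. G (Complex t \<alpha>)))
     \<longlongrightarrow> (\<i> * complex_of_real (\<beta> - \<alpha>)) *\<^sub>C (y1 - y0)) at_top"
proof (rule tendstoI)
  fix e :: real assume "e > 0"
  define S where "S = {w. Im w \<in> {\<alpha>..\<beta>}}"
  \<comment> \<open>The summand 1 keeps the denominator positive when \<alpha> = \<beta>.\<close>
  define e' where "e' = e / (4 * (\<beta> - \<alpha> + 1))"
  have e': "e' > 0" "2 * e' * (\<beta> - \<alpha>) < e"
  proof -
    show "e' > 0" using \<open>e > 0\<close> \<open>\<alpha> \<le> \<beta>\<close> by (simp add: e'_def)
    have "2 * e' * (\<beta> - \<alpha>) = e * ((\<beta> - \<alpha>) / (2 * (\<beta> - \<alpha> + 1)))"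
      using \<open>\<alpha> \<le> \<beta>\<close> by (simp add: e'_def field_simps)
    also have "\<dots> < e * 1" using \<open>e > 0\<close> \<open>\<alpha> \<le> \<beta>\<close> by (intro mult_strict_left_mono) auto
    finally show "2 * e' * (\<beta> - \<alpha>) < e" by simp
  qed
  obtain T1 where T1: "\<And>t a. t \<ge> T1 \<Longrightarrow> a \<in> {\<alpha>..\<beta>} \<Longrightarrow> norm (G (Complex t a) - y1) \<le> e'"
    using top[OF e'(1)] by blast
  obtain T2 where T2: "\<And>t a. t \<ge> T2 \<Longrightarrow> a \<in> {\<alpha>..\<beta>} \<Longrightarrow> norm (G (Complex (-t) a) - y0) \<le> e'"
    using bot[OF e'(1)] by blast
  have mem_S: "w \<in> S \<longleftrightarrow> Im w \<in> {\<alpha>..\<beta>}" for w by (simp add: S_def)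
  have dt: "((\<lambda>t. G (Complex t a)) has_vector_derivative G' (Complex t a)) (at t within X)"
    if "a \<in> {\<alpha>..\<beta>}" "t \<in> X" for t a X
  proof -
    have "((\<lambda>t. G (Complex t a)) has_derivative (\<lambda>h. Complex h 0 *\<^sub>C G' (Complex t a))) (at t within X)"
      using that
      by (intro has_derivative_in_compose2[where t=S and g=G and f="\<lambda>t. Complex t a" and
            g'="\<lambda>w h. h *\<^sub>C G' w", folded o_def])
         (auto simp: mem_S Complex_eq intro!: derivative_eq_intros der[folded S_def])
    then show ?thesis
      by (simp add: has_vector_derivative_def Complex_eq flip: scaleC_of_real)
  qed
  have da: "((\<lambda>a. G (Complex t a)) has_vector_derivative \<i> *\<^sub>C G' (Complex t a)) (at a within {\<alpha>..\<beta>})"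
    if "a \<in> {\<alpha>..\<beta>}" for t a
  proof -
    have "((\<lambda>a. G (Complex t a)) has_derivative (\<lambda>h. Complex 0 h *\<^sub>C G' (Complex t a))) (at a within {\<alpha>..\<beta>})"
      using that
      by (intro has_derivative_in_compose2[where t=S and g=G and f="\<lambda>a. Complex t a" and
            f'="\<lambda>h. Complex 0 h" and g'="\<lambda>w h. h *\<^sub>C G' w"])
         (auto simp: mem_S Complex_eq intro!: derivative_eq_intros der[folded S_def])
    then show ?thesis
      by (simp add: has_vector_derivative_def Complex_eq scaleC_scaleC mult.commute flip: scaleC_of_real)
  qed
  have cG': "continuous_on ({\<alpha>..\<beta>} \<times> X) (\<lambda>(a, t). \<i> *\<^sub>C G' (Complex t a))" for X
    unfolding split_beta using cont
    by (intro continuous_intros continuous_on_compose2[OF cont]) (auto simp: Complex_eq intro!: continuous_intros)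
  have main: "norm ((integral {-T..T} (\<lambda>t. G (Complex t \<beta>)) - integral {-T..T} (\<lambda>t. G (Complex t \<alpha>))) -
      (\<i> * complex_of_real (\<beta> - \<alpha>)) *\<^sub>C (y1 - y0)) < e" if T: "T \<ge> T1" "T \<ge> T2" "T \<ge> 0" for T
  proof -
    \<comment> \<open>Subtracting the expected linear term leaves a function of the height whose
      derivative is at most 2 e', so that the mean value inequality finishes the estimate.\<close>
    define J where "J a = integral {-T..T} (\<lambda>t. G (Complex t a)) - (\<i> * complex_of_real a) *\<^sub>C (y1 - y0)" for a
    define J' where "J' a = \<i> *\<^sub>C ((G (Complex T a) - y1) - (G (Complex (-T) a) - y0))" for a
    have FTC: "integral {-T..T} (\<lambda>t. \<i> *\<^sub>C G' (Complex t a)) = \<i> *\<^sub>C (G (Complex T a) - G (Complex (-T) a))"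
      if "a \<in> {\<alpha>..\<beta>}" for a
    proof (rule integral_unique)
      have "((\<lambda>t. G' (Complex t a)) has_integral G (Complex T a) - G (Complex (-T) a)) {-T..T}"
        using T that by (intro fundamental_theorem_of_calculus dt) auto
      from has_integral_linear[OF this scaleC.bounded_linear_right[of \<i>]]
      show "((\<lambda>t. \<i> *\<^sub>C G' (Complex t a)) has_integral \<i> *\<^sub>C (G (Complex T a) - G (Complex (-T) a))) {-T..T}"
        by (simp add: o_def)
    qed
    have dJ: "(J has_vector_derivative J' a) (at a within {\<alpha>..\<beta>})" if a: "a \<in> {\<alpha>..\<beta>}" for a
    proof -
      have "((\<lambda>a. integral (cbox (-T) T) (\<lambda>t. G (Complex t a))) has_vector_derivative
          integral (cbox (-T) T) (\<lambda>t. \<i> *\<^sub>C G' (Complex t a))) (at a within {\<alpha>..\<beta>})"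
        by (rule leibniz_rule_vector_derivative)
           (use a cG' in \<open>auto intro!: da integrable_continuous_interval continuous_on_vector_derivative dt\<close>)
      moreover have "((\<lambda>a. (\<i> * complex_of_real a) *\<^sub>C (y1 - y0)) has_vector_derivative \<i> *\<^sub>C (y1 - y0)) (at a within {\<alpha>..\<beta>})"
      proof -
        have "((\<lambda>a. \<i> * complex_of_real a) has_vector_derivative \<i>) (at a within {\<alpha>..\<beta>})"
          by (auto intro!: derivative_eq_intros)
        from bounded_linear.has_vector_derivative[OF scaleC.bounded_linear_left this]
        show ?thesis .
      qed
      ultimately have "(J has_vector_derivative integral (cbox (-T) T) (\<lambda>t. \<i> *\<^sub>C G' (Complex t a)) - \<i> *\<^sub>C (y1 - y0))
          (at a within {\<alpha>..\<beta>})"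
        unfolding J_def cbox_interval by (rule has_vector_derivative_diff)
      then show ?thesis
        using FTC[OF a] by (simp add: J'_def scaleC_simps algebra_simps)
    qed
    have "norm (J' a) \<le> 2 * e'" if "a \<in> {\<alpha>..\<beta>}" for a
      using T1[OF T(1) that] T2[OF T(2) that]
      by (auto simp: J'_def norm_scaleC intro: order_trans[OF norm_triangle_ineq4])
    then have "norm (J \<beta> - J \<alpha>) \<le> (2 * e') * norm (\<beta> - \<alpha>)"
      using dJ \<open>\<alpha> \<le> \<beta>\<close> e'
      by (intro differentiable_bound[where S="{\<alpha>..\<beta>}" and f'="\<lambda>a h. h *\<^sub>R J' a"])
         (auto simp: has_vector_derivative_def intro!: onorm_le simp: mult.commute mult_left_mono)
    also have "\<dots> < e" using e' \<open>\<alpha> \<le> \<beta>\<close> by simp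
    finally show ?thesis by (simp add: J_def scaleC_simps algebra_simps)
  qed
  then show "\<forall>\<^sub>F T in at_top. dist (integral {-T..T} (\<lambda>t. G (Complex t \<beta>)) - integral {-T..T} (\<lambda>t. G (Complex t \<alpha>)))
      ((\<i> * complex_of_real (\<beta> - \<alpha>)) *\<^sub>C (y1 - y0)) < e"
    using eventually_ge_at_top[of "max (max T1 T2) 0"] by (auto simp: dist_norm elim!: eventually_mono)
qed

lemma strip_shift_exp:
  fixes G G' :: "complex \<Rightarrow> 'a::complex_banach"
  assumes "\<alpha> \<le> \<beta>"
    and der: "\<And>w. Im w \<in> {\<alpha>..\<beta>} \<Longrightarrow>
      (G has_derivative (\<lambda>h. h *\<^sub>C G' w)) (at w within {w. Im w \<in> {\<alpha>..\<beta>}})"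
    and cont: "continuous_on {w. Im w \<in> {\<alpha>..\<beta>}} G'"
    and "\<epsilon> > 0"
    and top: "\<And>w. Im w \<in> {\<alpha>..\<beta>} \<Longrightarrow> Re w \<ge> T0 \<Longrightarrow> norm (G w - y1) \<le> C * exp (-\<epsilon> * Re w)"
    and bot: "\<And>w. Im w \<in> {\<alpha>..\<beta>} \<Longrightarrow> Re w \<le> - T0 \<Longrightarrow> norm (G w - y0) \<le> C * exp (\<epsilon> * Re w)"
  shows "((\<lambda>T. integral {-T..T} (\<lambda>t. G (Complex t \<beta>)) - integral {-T..T} (\<lambda>t. G (Complex t \<alpha>)))
     \<longlongrightarrow> (\<i> * complex_of_real (\<beta> - \<alpha>)) *\<^sub>C (y1 - y0)) at_top"
proof -
  have lim0: "((\<lambda>t. C * exp (-\<epsilon> * t)) \<longlongrightarrow> 0) at_top"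
    using \<open>\<epsilon> > 0\<close> by real_asymp
  have small: "\<exists>T1\<ge>T0. \<forall>t\<ge>T1. C * exp (-\<epsilon> * t) \<le> e" if "e > 0" for e
  proof -
    obtain T1 where "\<forall>t\<ge>T1. C * exp (-\<epsilon> * t) < e"
      using order_tendstoD(2)[OF lim0 \<open>0 < e\<close>] by (auto simp: eventually_at_top_linorder)
    then show ?thesis by (intro exI[of _ "max T0 T1"]) (auto simp: less_imp_le)
  qed
  show ?thesis
  proof (rule strip_shift[OF \<open>\<alpha> \<le> \<beta>\<close> der cont])
    fix e :: real assume "e > 0"
    then obtain T1 where T1: "T1 \<ge> T0" "\<forall>t\<ge>T1. C * exp (-\<epsilon> * t) \<le> e" using small by blast
    show "\<exists>T0. \<forall>t\<ge>T0. \<forall>a\<in>{\<alpha>..\<beta>}. norm (G (Complex t a) - y1) \<le> e"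
    proof (intro exI[of _ T1] allI impI ballI)
      fix t a assume "T1 \<le> t" "a \<in> {\<alpha>..\<beta>}"
      then show "norm (G (Complex t a) - y1) \<le> e"
        using T1 order_trans[OF top[of "Complex t a"], of e] by simp
    qed
    show "\<exists>T0. \<forall>t\<ge>T0. \<forall>a\<in>{\<alpha>..\<beta>}. norm (G (Complex (-t) a) - y0) \<le> e"
    proof (intro exI[of _ T1] allI impI ballI)
      fix t a assume "T1 \<le> t" "a \<in> {\<alpha>..\<beta>}"
      then show "norm (G (Complex (-t) a) - y0) \<le> e"
        using T1 order_trans[OF bot[of "Complex (-t) a"], of e] by simp
    qed
  qed
qed

lemma strip_shift_holomorphic:
  fixes G :: "complex \<Rightarrow> complex"
  assumes "\<alpha> \<le> \<beta>" "G holomorphic_on U" "open U" "{w. Im w \<in> {\<alpha>..\<beta>}} \<subseteq> U" "\<epsilon> > 0"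
    and top: "\<And>w. Im w \<in> {\<alpha>..\<beta>} \<Longrightarrow> Re w \<ge> T0 \<Longrightarrow> norm (G w - y1) \<le> C * exp (-\<epsilon> * Re w)"
    and bot: "\<And>w. Im w \<in> {\<alpha>..\<beta>} \<Longrightarrow> Re w \<le> - T0 \<Longrightarrow> norm (G w - y0) \<le> C * exp (\<epsilon> * Re w)"
  shows "((\<lambda>T. integral {-T..T} (\<lambda>t. G (Complex t \<beta>)) - integral {-T..T} (\<lambda>t. G (Complex t \<alpha>)))
     \<longlongrightarrow> \<i> * complex_of_real (\<beta> - \<alpha>) * (y1 - y0)) at_top"
  unfolding scaleC_mult_complex[symmetric, of _ "y1 - y0"]
proof (rule strip_shift_exp[where G' = "deriv G"])
  fix w assume "Im w \<in> {\<alpha>..\<beta>}"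
  then have "(G has_field_derivative deriv G w) (at w)"
    using assms by (intro holomorphic_derivI) auto
  moreover have "(\<lambda>h. h *\<^sub>C deriv G w) = (*) (deriv G w)" by (simp add: fun_eq_iff)
  ultimately show "(G has_derivative (\<lambda>h. h *\<^sub>C deriv G w)) (at w within {w. Im w \<in> {\<alpha>..\<beta>}})"
    unfolding has_field_derivative_def by (metis has_derivative_at_withinI)
next
  show "continuous_on {w. Im w \<in> {\<alpha>..\<beta>}} (deriv G)"
    using assms by (meson continuous_on_subset holomorphic_deriv holomorphic_on_imp_continuous_on)
qed (use assms in auto)

section \<open>Sectors\<close>

lemma exp_in_sector:
  assumes "\<sigma> \<le> pi" "\<bar>Im w\<bar> < \<sigma>"
  shows "exp w \<in> sector \<sigma>"
proof -
  have Ln: "Ln (exp w) = w" using assms by (intro Ln_exp) auto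
  have "Re (exp w) \<noteq> 0 \<or> Im (exp w) \<noteq> 0" using exp_not_eq_zero[of w] complex_eq_iff by fastforce
  then have "exp w \<notin> \<real>\<^sub>\<le>\<^sub>0"
    using Im_Ln_eq_pi[of "exp w"] assms Ln unfolding complex_nonpos_Reals_iff by force
  moreover have "Arg (exp w) = Im w" using Arg_eq_Im_Ln[of "exp w"] Ln by simp
  ultimately show ?thesis using assms by (simp add: sector_def)
qed

lemma sector_Ln:
  assumes "0 < \<sigma>" "z \<in> sector \<sigma>"
  shows "z \<noteq> 0" "exp (Ln z) = z" "\<bar>Im (Ln z)\<bar> < \<sigma>"
proof -
  show "z \<noteq> 0" using assms by (auto simp: sector_def)
  then show "exp (Ln z) = z" "\<bar>Im (Ln z)\<bar> < \<sigma>" using assms by (auto simp: sector_def Arg_eq_Im_Ln)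
qed

lemma sector_eq_exp_image: "0 < \<sigma> \<Longrightarrow> \<sigma> \<le> pi \<Longrightarrow> sector \<sigma> = exp ` {w. \<bar>Im w\<bar> < \<sigma>}"
proof (intro equalityI subsetI)
  fix z assume "0 < \<sigma>" "z \<in> sector \<sigma>"
  from sector_Ln[OF this] show "z \<in> exp ` {w. \<bar>Im w\<bar> < \<sigma>}"
    by (intro image_eqI[of _ _ "Ln z"]) auto
next
  fix z :: complex assume "\<sigma> \<le> pi" "z \<in> exp ` {w. \<bar>Im w\<bar> < \<sigma>}"
  then show "z \<in> sector \<sigma>" using exp_in_sector by blast
qed

lemma open_sector:
  assumes "0 < \<sigma>"
  shows "open (sector \<sigma>)"
proof -
  have "sector \<sigma> = - \<real>\<^sub>\<le>\<^sub>0 \<inter> (\<lambda>z. \<bar>Im (Ln z)\<bar>) -` {..<\<sigma>}"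
  proof -
    have "Arg z = Im (Ln z)" if "z \<notin> \<real>\<^sub>\<le>\<^sub>0" for z
      using that by (intro Arg_eq_Im_Ln) auto
    then show ?thesis using assms by (auto simp: sector_def)
  qed
  moreover have "open \<dots>"
    by (intro continuous_open_preimage continuous_intros) (auto simp: closed_nonpos_Reals_complex open_Compl)
  ultimately show ?thesis by simp
qed

lemma sector_mono: "0 < \<sigma> \<Longrightarrow> \<sigma> \<le> \<sigma>' \<Longrightarrow> sector \<sigma> \<subseteq> sector \<sigma>'"
  by (auto simp: sector_def)

lemma open_strip: "open {w. \<bar>Im w\<bar> < \<sigma>}"
  by (intro open_Collect_less continuous_intros)

lemma mult_in_sector:
  assumes "0 < \<sigma>" "\<sigma> \<le> pi" "z \<in> sector \<sigma>" "c > 0"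
  shows "complex_of_real c * z \<in> sector \<sigma>"
proof -
  have "complex_of_real c * z = exp (Ln z + complex_of_real (ln c))"
    using sector_Ln[OF assms(1,3)] assms(4) by (simp add: exp_add exp_of_real)
  then show ?thesis using exp_in_sector[of \<sigma> "Ln z + complex_of_real (ln c)"] sector_Ln[OF assms(1,3)] assms by simp
qed

lemma one_plus_sector_nonzero:
  assumes "0 < \<sigma>" "z \<in> sector \<sigma>" "c > 0"
  shows "1 + complex_of_real c * z \<noteq> 0"
proof
  assume "1 + complex_of_real c * z = 0"
  then have "z = complex_of_real (- 1 / c)" using assms(3) by (simp add: field_simps add_eq_0_iff)
  then have "z \<in> \<real>\<^sub>\<le>\<^sub>0" using assms(3) by (simp only: complex_nonpos_Reals_iff) simp
  then show False using assms by (auto simp: sector_def)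
qed

text \<open>In polar form, \<open>|p e^{ia} - q e^{ib}|^2 = p^2 + q^2 - 2 p q cos (a - b)\<close>.\<close>

lemma norm_exp_diff_ge:
  assumes "cos (Im w - Im v) \<le> k" "0 \<le> k" "k < 1"
  shows "sqrt ((1 - k) / 2) * (exp (Re w) + exp (Re v)) \<le> cmod (exp w - exp v)"
proof -
  let ?p = "exp (Re w)" and ?q = "exp (Re v)"
  have "(cmod (exp w - exp v))\<^sup>2 = (?p * cos (Im w) - ?q * cos (Im v))\<^sup>2 + (?p * sin (Im w) - ?q * sin (Im v))\<^sup>2"
    by (simp add: cmod_power2 Re_exp Im_exp)
  also have "\<dots> = ?p\<^sup>2 * ((cos (Im w))\<^sup>2 + (sin (Im w))\<^sup>2) + ?q\<^sup>2 * ((cos (Im v))\<^sup>2 + (sin (Im v))\<^sup>2)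
      - 2 * ?p * ?q * cos (Im w - Im v)"
    unfolding cos_diff by algebra
  also have "\<dots> = ?p\<^sup>2 + ?q\<^sup>2 - 2 * ?p * ?q * cos (Im w - Im v)" by simp
  also have "\<dots> \<ge> ?p\<^sup>2 + ?q\<^sup>2 - 2 * ?p * ?q * k"
    using assms(1) by (intro diff_left_mono mult_left_mono) auto
  also have "?p\<^sup>2 + ?q\<^sup>2 - 2 * ?p * ?q * k = (1 - k) / 2 * (?p + ?q)\<^sup>2 + (1 + k) / 2 * (?p - ?q)\<^sup>2"
    by (simp add: power2_eq_square field_simps)
  also have "\<dots> \<ge> (1 - k) / 2 * (?p + ?q)\<^sup>2" using assms by simp
  finally have "sqrt ((1 - k) / 2 * (?p + ?q)\<^sup>2) \<le> cmod (exp w - exp v)"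
    by (intro real_le_lsqrt) auto
  moreover have "sqrt ((?p + ?q)\<^sup>2) = ?p + ?q" by (intro real_sqrt_unique) auto
  ultimately show ?thesis unfolding real_sqrt_mult by (simp only:)
qed

text \<open>Here -c is the point exp (ln c + \<i> pi), whose angular distance from
  \<open>exp w\<close> is at least pi - \<nu>. The constant is the same for all c.\<close>

lemma norm_exp_add_ge:
  assumes "0 \<le> \<nu>" "\<nu> < pi"
  obtains \<kappa> where "\<kappa> > 0" "\<And>w c. \<bar>Im w\<bar> \<le> \<nu> \<Longrightarrow> c > 0 \<Longrightarrow> \<kappa> * (exp (Re w) + c) \<le> cmod (exp w + complex_of_real c)"
proof -
  define k where "k = max 0 (- cos \<nu>)"
  have k: "0 \<le> k" "k < 1"
    using cos_monotone_0_pi[of \<nu> pi] assms by (auto simp: k_def)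
  show ?thesis
  proof
    show "sqrt ((1 - k) / 2) > 0" using k by simp
    fix w :: complex and c :: real assume w: "\<bar>Im w\<bar> \<le> \<nu>" and c: "c > 0"
    have e: "exp (Complex (ln c) pi) = - complex_of_real c"
      using c by (simp add: exp_eq_polar flip: cis_conv_exp)
    have "cos \<nu> \<le> cos \<bar>Im w\<bar>" using w assms by (intro cos_monotone_0_pi_le) auto
    then have "cos (Im w - pi) \<le> k" by (auto simp: cos_diff k_def)
    from norm_exp_diff_ge[of w "Complex (ln c) pi" k, simplified e] this k c
    show "sqrt ((1 - k) / 2) * (exp (Re w) + c) \<le> cmod (exp w + complex_of_real c)" by simp
  qed
qed

section \<open>Functions decaying at both ends of a sector\<close>

lemma max_powr_exp: "max (exp x powr \<epsilon>) (exp x powr - \<epsilon>) = exp (\<epsilon> * \<bar>x\<bar>)" if "\<epsilon> > 0" for x \<epsilon> :: real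
  using that by (auto simp: powr_def max_def abs_if mult_le_0_iff zero_le_mult_iff)

text \<open>In the coordinate w = Ln z the sector is a strip, dilations are translations and the
  two-sided weight is exp (\<epsilon> \<bar>Re w\<bar>). All later decay estimates are stated in
  this form.\<close>

lemma H0_inf_iff:
  assumes "0 < \<sigma>" "\<sigma> \<le> pi"
  shows "f \<in> H0_inf \<sigma> \<longleftrightarrow> f holomorphic_on sector \<sigma> \<and>
    (\<exists>\<epsilon>>0. \<exists>C. \<forall>w. \<bar>Im w\<bar> < \<sigma> \<longrightarrow> cmod (f (exp w)) \<le> C * exp (-\<epsilon> * \<bar>Re w\<bar>))"
proof -
  have "bdd_above ((\<lambda>z. max (cmod z powr \<epsilon>) (cmod z powr (-\<epsilon>)) * cmod (f z)) ` sector \<sigma>) \<longleftrightarrow>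
      (\<exists>C. \<forall>w. \<bar>Im w\<bar> < \<sigma> \<longrightarrow> cmod (f (exp w)) \<le> C * exp (-\<epsilon> * \<bar>Re w\<bar>))" if "\<epsilon> > 0" for \<epsilon>
    unfolding sector_eq_exp_image[OF assms] using that
    by (auto simp: bdd_above_def max_powr_exp exp_minus field_simps)
  then show ?thesis unfolding H0_inf_def mem_Collect_eq by meson
qed

lemma H0_infE:
  assumes "0 < \<sigma>" "\<sigma> \<le> pi" "f \<in> H0_inf \<sigma>"
  obtains \<epsilon> C where "\<epsilon> > 0" "C \<ge> 0" "\<And>w. \<bar>Im w\<bar> < \<sigma> \<Longrightarrow> cmod (f (exp w)) \<le> C * exp (-\<epsilon> * \<bar>Re w\<bar>)"
proof -
  obtain \<epsilon> C where e: "\<epsilon> > 0" "\<And>w. \<bar>Im w\<bar> < \<sigma> \<Longrightarrow> cmod (f (exp w)) \<le> C * exp (-\<epsilon> * \<bar>Re w\<bar>)"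
    using assms(3) unfolding H0_inf_iff[OF assms(1,2)] by blast
  moreover have "C \<ge> 0" using order_trans[OF norm_ge_zero e(2)[of 0]] assms by simp
  ultimately show ?thesis using that by blast
qed

lemma H0_infI:
  assumes "0 < \<sigma>" "\<sigma> \<le> pi" "f holomorphic_on sector \<sigma>" "\<epsilon> > 0"
    "\<And>w. \<bar>Im w\<bar> < \<sigma> \<Longrightarrow> cmod (f (exp w)) \<le> C * exp (-\<epsilon> * \<bar>Re w\<bar>)"
  shows "f \<in> H0_inf \<sigma>"
  unfolding H0_inf_iff[OF assms(1,2)] using assms by blast

lemma H0_inf_holomorphic: "f \<in> H0_inf \<sigma> \<Longrightarrow> f holomorphic_on sector \<sigma>"
  by (simp add: H0_inf_def)

lemma H0_inf_mono:
  assumes "0 < \<sigma>" "\<sigma> \<le> \<sigma>'" "f \<in> H0_inf \<sigma>'"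
  shows "f \<in> H0_inf \<sigma>"
proof -
  have "bdd_above (F ` sector \<sigma>)" if "bdd_above (F ` sector \<sigma>')" for F :: "complex \<Rightarrow> real"
    by (rule bdd_above_mono[OF that image_mono[OF sector_mono[OF assms(1,2)]]])
  then show ?thesis using assms(3) sector_mono[OF assms(1,2)] unfolding H0_inf_def mem_Collect_eq
    by (meson holomorphic_on_subset)
qed

lemma H0_inf_mult_bounded:
  assumes "0 < \<sigma>" "\<sigma> \<le> pi" "f \<in> H0_inf \<sigma>" "h holomorphic_on sector \<sigma>"
    and B: "\<And>w. \<bar>Im w\<bar> < \<sigma> \<Longrightarrow> cmod (h (exp w)) \<le> B"
  shows "(\<lambda>z. f z * h z) \<in> H0_inf \<sigma>"
proof -
  obtain \<epsilon> C where e: "\<epsilon> > 0" "C \<ge> 0" "\<And>w. \<bar>Im w\<bar> < \<sigma> \<Longrightarrow> cmod (f (exp w)) \<le> C * exp (-\<epsilon> * \<bar>Re w\<bar>)"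
    using H0_infE[OF assms(1-3)] by blast
  show ?thesis
  proof (rule H0_infI[OF assms(1,2) _ e(1)])
    fix w :: complex assume w: "\<bar>Im w\<bar> < \<sigma>"
    have "cmod (f (exp w) * h (exp w)) \<le> (C * exp (-\<epsilon> * \<bar>Re w\<bar>)) * B"
      unfolding norm_mult using e w B by (intro mult_mono) auto
    then show "cmod (f (exp w) * h (exp w)) \<le> (C * B) * exp (-\<epsilon> * \<bar>Re w\<bar>)" by (simp add: mult_ac)
  qed (use assms H0_inf_holomorphic in \<open>auto intro!: holomorphic_intros\<close>)
qed

lemma H0_inf_bounded:
  assumes "0 < \<sigma>" "\<sigma> \<le> pi" "f \<in> H0_inf \<sigma>"
  obtains B where "B \<ge> 0" "\<And>w. \<bar>Im w\<bar> < \<sigma> \<Longrightarrow> cmod (f (exp w)) \<le> B"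
proof -
  obtain \<epsilon> C where e: "\<epsilon> > 0" "C \<ge> 0" "\<And>w. \<bar>Im w\<bar> < \<sigma> \<Longrightarrow> cmod (f (exp w)) \<le> C * exp (-\<epsilon> * \<bar>Re w\<bar>)"
    using H0_infE[OF assms(1-3)] by blast
  have "cmod (f (exp w)) \<le> C" if "\<bar>Im w\<bar> < \<sigma>" for w
    using e(3)[OF that] mult_left_mono[OF _ e(2), of "exp (-\<epsilon> * \<bar>Re w\<bar>)" 1] e(1)
    by auto
  then show ?thesis using that e(2) by blast
qed

lemma H0_inf_mult:
  assumes "0 < \<sigma>" "\<sigma> \<le> pi" "f \<in> H0_inf \<sigma>" "g \<in> H0_inf \<sigma>"
  shows "(\<lambda>z. f z * g z) \<in> H0_inf \<sigma>"
  by (metis H0_inf_mult_bounded[OF assms(1-3)] H0_inf_bounded[OF assms(1,2,4)] H0_inf_holomorphic assms(4))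

lemma H0_inf_cmult:
  assumes "0 < \<sigma>" "\<sigma> \<le> pi" "f \<in> H0_inf \<sigma>"
  shows "(\<lambda>z. c * f z) \<in> H0_inf \<sigma>"
  using H0_inf_mult_bounded[OF assms, of "\<lambda>_. c" "cmod c"] by (simp add: mult.commute)

lemma H0_inf_add:
  assumes "0 < \<sigma>" "\<sigma> \<le> pi" "f \<in> H0_inf \<sigma>" "g \<in> H0_inf \<sigma>"
  shows "(\<lambda>z. f z + g z) \<in> H0_inf \<sigma>"
proof -
  obtain \<epsilon> C where e: "\<epsilon> > 0" "C \<ge> 0" "\<And>w. \<bar>Im w\<bar> < \<sigma> \<Longrightarrow> cmod (f (exp w)) \<le> C * exp (-\<epsilon> * \<bar>Re w\<bar>)"
    using H0_infE[OF assms(1-3)] by blast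
  obtain \<epsilon>' C' where e': "\<epsilon>' > 0" "C' \<ge> 0" "\<And>w. \<bar>Im w\<bar> < \<sigma> \<Longrightarrow> cmod (g (exp w)) \<le> C' * exp (-\<epsilon>' * \<bar>Re w\<bar>)"
    using H0_infE[OF assms(1,2,4)] by blast
  show ?thesis
  proof (rule H0_infI[OF assms(1,2)])
    show "min \<epsilon> \<epsilon>' > 0" using e e' by simp
    fix w :: complex assume w: "\<bar>Im w\<bar> < \<sigma>"
    have "exp (-\<epsilon> * \<bar>Re w\<bar>) \<le> exp (- min \<epsilon> \<epsilon>' * \<bar>Re w\<bar>)" "exp (-\<epsilon>' * \<bar>Re w\<bar>) \<le> exp (- min \<epsilon> \<epsilon>' * \<bar>Re w\<bar>)"
      by (auto intro!: mult_right_mono)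
    then have "C * exp (-\<epsilon> * \<bar>Re w\<bar>) + C' * exp (-\<epsilon>' * \<bar>Re w\<bar>) \<le> (C + C') * exp (- min \<epsilon> \<epsilon>' * \<bar>Re w\<bar>)"
      unfolding distrib_right by (intro add_mono mult_left_mono e(2) e'(2))
    then show "cmod (f (exp w) + g (exp w)) \<le> (C + C') * exp (- min \<epsilon> \<epsilon>' * \<bar>Re w\<bar>)"
      using e(3)[OF w] e'(3)[OF w] norm_triangle_ineq[of "f (exp w)" "g (exp w)"] by linarith
  qed (use assms H0_inf_holomorphic in \<open>auto intro!: holomorphic_intros\<close>)
qed

lemma exp_of_real_ln_mult: "c > 0 \<Longrightarrow> complex_of_real c * exp w = exp (w + complex_of_real (ln c))"
  by (simp add: exp_add exp_of_real)

lemma H0_inf_scale: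
  assumes "0 < \<sigma>" "\<sigma> \<le> pi" "f \<in> H0_inf \<sigma>" "c > 0"
  shows "(\<lambda>z. f (complex_of_real c * z)) \<in> H0_inf \<sigma>"
proof -
  obtain \<epsilon> C where e: "\<epsilon> > 0" "C \<ge> 0" "\<And>w. \<bar>Im w\<bar> < \<sigma> \<Longrightarrow> cmod (f (exp w)) \<le> C * exp (-\<epsilon> * \<bar>Re w\<bar>)"
    using H0_infE[OF assms(1-3)] by blast
  show ?thesis
  proof (rule H0_infI[OF assms(1,2) _ e(1)])
    show "(\<lambda>z. f (complex_of_real c * z)) holomorphic_on sector \<sigma>"
      using holomorphic_on_compose_gen[OF _ H0_inf_holomorphic[OF assms(3)], of "\<lambda>z. complex_of_real c * z" "sector \<sigma>"]
        mult_in_sector assms by (auto simp: o_def intro!: holomorphic_intros)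
    fix w :: complex assume w: "\<bar>Im w\<bar> < \<sigma>"
    have "- \<epsilon> * \<bar>Re w + ln c\<bar> \<le> \<epsilon> * \<bar>ln c\<bar> + - \<epsilon> * \<bar>Re w\<bar>"
      using mult_left_mono[of "\<bar>Re w\<bar>" "\<bar>Re w + ln c\<bar> + \<bar>ln c\<bar>" \<epsilon>] e(1) by (simp add: algebra_simps)
    then have "C * exp (- \<epsilon> * \<bar>Re w + ln c\<bar>) \<le> C * exp (\<epsilon> * \<bar>ln c\<bar>) * exp (- \<epsilon> * \<bar>Re w\<bar>)"
      using e(2) by (simp add: mult.assoc flip: exp_add) (auto intro!: mult_left_mono)
    then show "cmod (f (complex_of_real c * exp w)) \<le> C * exp (\<epsilon> * \<bar>ln c\<bar>) * exp (-\<epsilon> * \<bar>Re w\<bar>)"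
      using e(3)[of "w + complex_of_real (ln c)"] w exp_of_real_ln_mult[OF assms(4)] by (auto intro: order_trans)
  qed
qed

section \<open>Cauchy's theorem and formula on the boundary of a sector\<close>

lemma continuous_on_exp_ray [continuous_intros]: "continuous_on A (\<lambda>t. exp (Complex t a))"
  unfolding Complex_eq by (intro continuous_intros)

lemma continuous_on_ray:
  assumes "0 < \<sigma>" "\<sigma> \<le> pi" "continuous_on (sector \<sigma>) F" "\<bar>a\<bar> < \<sigma>"
  shows "continuous_on A (\<lambda>t. F (exp (Complex t a)))"
  using assms exp_in_sector[of \<sigma>] by (intro continuous_on_compose2[OF assms(3)] continuous_intros) auto

text \<open>Cauchy's theorem for F(\<lambda>) d\<lambda>/\<lambda> on the boundary of a sector:
  \<open>F\<close> tends to 0 at both ends, so shifting the line of integration costs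
  nothing.\<close>

lemma ray_integrals_eq:
  assumes "0 < \<nu>" "\<nu> < \<sigma>" "\<sigma> \<le> pi" "F holomorphic_on sector \<sigma>" "\<epsilon> > 0"
    and bd: "\<And>w. \<bar>Im w\<bar> \<le> \<nu> \<Longrightarrow> cmod (F (exp w)) \<le> C * exp (-\<epsilon> * \<bar>Re w\<bar>)"
  shows "integral UNIV (\<lambda>t. F (exp (Complex t (-\<nu>)))) = integral UNIV (\<lambda>t. F (exp (Complex t \<nu>)))"
proof -
  have C: "C \<ge> 0" using order_trans[OF norm_ge_zero bd[of 0]] assms by simp
  have lim: "((\<lambda>T. integral {-T..T} (\<lambda>t. F (exp (Complex t a)))) \<longlongrightarrow> integral UNIV (\<lambda>t. F (exp (Complex t a)))) at_top"
    if "\<bar>a\<bar> \<le> \<nu>" for a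
    using assms that bd[of "Complex t a" for t]
    by (intro integral_symmetric_tendsto exp_dominated_integrable[of _ \<epsilon> C 0] continuous_on_ray[of \<sigma>]
        holomorphic_on_imp_continuous_on) auto
  have "((\<lambda>T. integral {-T..T} (\<lambda>t. (F \<circ> exp) (Complex t \<nu>)) - integral {-T..T} (\<lambda>t. (F \<circ> exp) (Complex t (-\<nu>))))
     \<longlongrightarrow> \<i> * complex_of_real (\<nu> - (-\<nu>)) * (0 - 0)) at_top"
  proof (rule strip_shift_holomorphic[OF _ _ open_strip])
    show "(F \<circ> exp) holomorphic_on {w. \<bar>Im w\<bar> < \<sigma>}"
      using assms exp_in_sector by (intro holomorphic_on_compose_gen[where t="sector \<sigma>"] holomorphic_intros) auto
    fix w assume w: "Im w \<in> {-\<nu>..\<nu>}"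
    show "norm ((F \<circ> exp) w - 0) \<le> C * exp (- \<epsilon> * Re w)" if "0 \<le> Re w"
      using bd[of w] w that by auto
    show "norm ((F \<circ> exp) w - 0) \<le> C * exp (\<epsilon> * Re w)" if "Re w \<le> - 0"
      using bd[of w] w that by auto
  qed (use assms in auto)
  then have "integral UNIV (\<lambda>t. F (exp (Complex t \<nu>))) - integral UNIV (\<lambda>t. F (exp (Complex t (-\<nu>)))) = 0"
    using tendsto_diff[OF lim[of \<nu>] lim[of "-\<nu>"]] assms by (intro tendsto_unique[OF trivial_limit_at_top_linorder]) auto
  then show ?thesis by simp
qed

text \<open>With p = exp v, g(l) is written as (g(l) - g(p)) + g(p). The first part has a removable
  singularity at p and is shifted across the sector. The second is g(p) times the kernel l/(l - p),
  which is shifted the other way round, through the angles from \<nu> to 2 pi - \<nu>, and so never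
  meets p. Neither part decays at infinity: their limits there contribute 2\<nu> \<i> g(p) and (2 pi
  - 2\<nu>) \<i> g(p), which add up to the result.\<close>

lemma ray_Cauchy_formula:
  assumes "0 < \<nu>" "\<nu> < \<sigma>" "\<sigma> \<le> pi" "g \<in> H0_inf \<sigma>" "\<bar>Im v\<bar> < \<nu>"
  defines "H \<equiv> \<lambda>l. g l * l / (l - exp v)"
  shows "integral UNIV (\<lambda>t. H (exp (Complex t (-\<nu>)))) - integral UNIV (\<lambda>t. H (exp (Complex t \<nu>)))
    = 2 * pi * \<i> * g (exp v)"
proof -
  define p where "p = exp v"
  have ne: "exp w \<noteq> p" if "Im w \<in> {\<nu>..2*pi-\<nu>} \<or> Im w = -\<nu>" for w
  proof
    assume eq: "exp w = p"
    have "\<bar>Im w - Im v\<bar> < 2 * pi" using that assms(1,2,3,5) pi_gt_zero by (simp add: abs_less_iff) linarith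
    then have "w = v" using eq unfolding p_def by (rule exp_complex_eqI)
    then show False using that assms(1,2,3,5) by (auto simp: abs_less_iff)
  qed
  obtain \<epsilon>' C' where e': "\<epsilon>' > 0" "C' \<ge> 0" "\<And>w. \<bar>Im w\<bar> < \<sigma> \<Longrightarrow> cmod (g (exp w)) \<le> C' * exp (-\<epsilon>' * \<bar>Re w\<bar>)"
    using H0_infE[OF _ assms(3,4)] assms by auto
  \<comment> \<open>The kernel l/(l - p) approaches its end values only at rate 1, which caps the
    usable rate.\<close>
  define \<epsilon> where "\<epsilon> = min \<epsilon>' 1"
  have \<epsilon>: "0 < \<epsilon>" "\<epsilon> \<le> 1" using e' by (auto simp: \<epsilon>_def)
  have g: "cmod (g (exp w)) \<le> C' * exp (-\<epsilon> * \<bar>Re w\<bar>)" if "\<bar>Im w\<bar> < \<sigma>" for w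
  proof -
    have "exp (-\<epsilon>' * \<bar>Re w\<bar>) \<le> exp (-\<epsilon> * \<bar>Re w\<bar>)" by (auto simp: \<epsilon>_def intro!: mult_right_mono)
    then show ?thesis using e'(3)[OF that] e'(2) by (meson mult_left_mono order_trans)
  qed
  \<comment> \<open>Beyond T0 the moduli of exp w and p differ at least by a factor 2, so their
    distance is at least half of the larger one.\<close>
  define T0 where "T0 = \<bar>Re v\<bar> + ln 2"
  have T0: "0 \<le> T0" by (simp add: T0_def)
  have half: "exp (Re v) \<le> exp (Re w) / 2" if "Re w \<ge> T0" for w
  proof -
    have "exp (Re v + ln 2) \<le> exp (Re w)" using that by (simp add: T0_def)
    then show ?thesis by (simp add: exp_add)
  qed
  have half': "exp (Re w) \<le> exp (Re v) / 2" if "Re w \<le> - T0" for w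
  proof -
    have "exp (Re w + ln 2) \<le> exp (Re v)" using that by (simp add: T0_def)
    then show ?thesis by (simp add: exp_add)
  qed
  have top: "cmod (exp w - p) \<ge> exp (Re w) / 2" if "Re w \<ge> T0" for w
    using half[OF that] norm_triangle_ineq2[of "exp w" p] by (simp add: p_def)
  have bot: "cmod (exp w - p) \<ge> exp (Re v) / 2" if "Re w \<le> - T0" for w
    using half'[OF that] norm_triangle_ineq2[of p "exp w"] by (simp add: p_def norm_minus_commute)
  have quot_top: "cmod (exp w / (exp w - p)) \<le> 2" if "Re w \<ge> T0" for w
    using top[OF that] by (simp add: norm_divide divide_le_eq)
  have quot_bot: "cmod (exp w / (exp w - p)) \<le> 2 / exp (Re v) * exp (Re w)" if "Re w \<le> - T0" for w
  proof -
    have "cmod (exp w / (exp w - p)) \<le> exp (Re w) / (exp (Re v) / 2)"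
      unfolding norm_divide norm_exp_eq_Re using bot[OF that] by (intro divide_left_mono) (auto simp: zero_less_mult_iff intro: less_le_trans)
    then show ?thesis by (simp add: field_simps)
  qed
  have quot_top': "cmod (exp w / (exp w - p) - 1) \<le> 2 * exp (Re v) * exp (- Re w)" if "Re w \<ge> T0" for w
  proof -
    have nz: "exp w - p \<noteq> 0" using top[OF that] by (metis exp_gt_zero half_gt_zero norm_zero not_le)
    have "cmod (exp w / (exp w - p) - 1) = exp (Re v) / cmod (exp w - p)"
      using nz by (simp add: norm_divide field_simps p_def flip: norm_exp_eq_Re)
    also have "\<dots> \<le> exp (Re v) / (exp (Re w) / 2)"
      using top[OF that] by (intro divide_left_mono) (auto simp: zero_less_mult_iff intro: less_le_trans)
    finally show ?thesis by (simp add: exp_minus field_simps)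
  qed
  define h where "h l = (if l = p then deriv g p else (g l - g p) / (l - p))" for l
  have p: "p \<in> sector \<sigma>" using assms by (auto simp: p_def intro!: exp_in_sector)
  have h_holo: "h holomorphic_on sector \<sigma>"
    unfolding h_def[abs_def] using assms p open_sector[of \<sigma>]
    by (intro pole_lemma H0_inf_holomorphic) (auto simp: interior_open)
  have h_eq: "h l * l = (g l - g p) * (l / (l - p))" if "l \<noteq> p" for l
    using that by (simp add: h_def)
  have ne_top: "exp w \<noteq> p" if "Re w \<ge> T0" for w
    using top[OF that] exp_gt_zero[of "Re w"] by auto
  have ne_bot: "exp w \<noteq> p" if "Re w \<le> - T0" for w
    using bot[OF that] exp_gt_zero[of "Re v"] by auto
  define G where "G w = h (exp w) * exp w" for w
  define E where "E w = exp w / (exp w - p)" for w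
  have exp_le: "exp (- Re w) \<le> exp (- \<epsilon> * Re w)" if "Re w \<ge> 0" for w
    using \<epsilon> that by (simp add: mult_left_le_one_le)
  have exp_le': "exp (Re w) \<le> exp (\<epsilon> * Re w)" if "Re w \<le> 0" for w
    using \<epsilon> that mult_right_mono_neg[of \<epsilon> 1 "Re w"] by simp
  \<comment> \<open>At infinity g(l) tends to 0 and l/(l - p) to 1, which leaves the end value -
    g(p); at 0 the factor l/(l - p) vanishes.\<close>
  have 1: "((\<lambda>T. integral {-T..T} (\<lambda>t. G (Complex t \<nu>)) - integral {-T..T} (\<lambda>t. G (Complex t (-\<nu>))))
     \<longlongrightarrow> \<i> * complex_of_real (\<nu> - (-\<nu>)) * (- g p - 0)) at_top"
  proof (rule strip_shift_holomorphic[OF _ _ open_strip])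
    show "G holomorphic_on {w. \<bar>Im w\<bar> < \<sigma>}"
      unfolding G_def using assms exp_in_sector h_holo
      by (intro holomorphic_intros holomorphic_on_compose_gen[where t="sector \<sigma>" and g=h and f=exp, unfolded o_def]) auto
    let ?C = "2 * C' + 2 * exp (Re v) * cmod (g p) + (C' + cmod (g p)) * (2 / exp (Re v))"
    fix w assume w: "Im w \<in> {-\<nu>..\<nu>}"
    then have gw: "cmod (g (exp w)) \<le> C' * exp (-\<epsilon> * \<bar>Re w\<bar>)" using g assms by auto
    show "norm (G w - (- g p)) \<le> ?C * exp (- \<epsilon> * Re w)" if t: "T0 \<le> Re w"
    proof -
      have "G w - (- g p) = g (exp w) * (exp w / (exp w - p)) - g p * (exp w / (exp w - p) - 1)"
        unfolding G_def h_eq[OF ne_top[OF t]] by (simp only: left_diff_distrib right_diff_distrib mult_1_right) simp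
      also have "norm \<dots> \<le> C' * exp (-\<epsilon> * \<bar>Re w\<bar>) * 2 + cmod (g p) * (2 * exp (Re v) * exp (- Re w))"
        using quot_top[OF t] quot_top'[OF t] gw
        by (intro order_trans[OF norm_triangle_ineq4] add_mono) (auto simp only: norm_mult intro!: mult_mono norm_ge_zero mult_nonneg_nonneg e'(2) exp_ge_zero)
      also have "\<dots> \<le> C' * exp (-\<epsilon> * Re w) * 2 + cmod (g p) * (2 * exp (Re v) * exp (- \<epsilon> * Re w))"
        using exp_le[of w] t T0 by (intro add_mono mult_left_mono) auto
      also have "\<dots> \<le> ?C * exp (- \<epsilon> * Re w)"
        using e'(2) by (simp add: algebra_simps)
      finally show ?thesis .
    qed
    show "norm (G w - 0) \<le> ?C * exp (\<epsilon> * Re w)" if t: "Re w \<le> - T0"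
    proof -
      have "cmod (g (exp w) - g p) \<le> C' + cmod (g p)"
        using order_trans[OF gw mult_left_mono[OF _ e'(2), of _ 1]] \<epsilon>
        by (intro order_trans[OF norm_triangle_ineq4] add_mono) auto
      then have "norm (G w - 0) \<le> (C' + cmod (g p)) * (2 / exp (Re v) * exp (Re w))"
        unfolding G_def h_eq[OF ne_bot[OF t]] diff_zero norm_mult[of "_ - _"] using quot_bot[OF t] e'(2)
        by (intro mult_mono) auto
      also have "\<dots> \<le> (C' + cmod (g p)) * (2 / exp (Re v) * exp (\<epsilon> * Re w))"
        using exp_le'[of w] t T0 e'(2) by (intro mult_left_mono) auto
      also have "\<dots> \<le> ?C * exp (\<epsilon> * Re w)"
        using e'(2) by (simp add: algebra_simps)
      finally show ?thesis .
    qed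
  qed (use assms \<epsilon> in auto)
  \<comment> \<open>The upper edge 2 pi - \<nu> of this strip is the same ray as -\<nu>, by
    periodicity of exp.\<close>
  have 2: "((\<lambda>T. integral {-T..T} (\<lambda>t. E (Complex t (2*pi-\<nu>))) - integral {-T..T} (\<lambda>t. E (Complex t \<nu>)))
     \<longlongrightarrow> \<i> * complex_of_real ((2*pi-\<nu>) - \<nu>) * (1 - 0)) at_top"
  proof (rule strip_shift_holomorphic[where U="{w. exp w \<noteq> p}" and ?T0.0=T0 and \<epsilon>=1 and
        C="2 * exp (Re v) + 2 / exp (Re v)"])
    show "open {w. exp w \<noteq> p}" by (intro open_Collect_neq continuous_intros)
    show "E holomorphic_on {w. exp w \<noteq> p}" unfolding E_def by (intro holomorphic_intros) auto
    fix w
    show "norm (E w - 1) \<le> (2 * exp (Re v) + 2 / exp (Re v)) * exp (- 1 * Re w)" if "T0 \<le> Re w"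
      using quot_top'[OF that] by (simp add: E_def algebra_simps add_increasing2)
    show "norm (E w - 0) \<le> (2 * exp (Re v) + 2 / exp (Re v)) * exp (1 * Re w)" if "Re w \<le> - T0"
      using quot_bot[OF that] by (simp add: E_def algebra_simps add_increasing)
  qed (use assms ne in auto)
  have per: "exp (Complex t (2*pi-\<nu>)) = exp (Complex t (-\<nu>))" for t
    by (intro complex_eqI) (simp_all add: Re_exp Im_exp)
  have sec: "exp (Complex t a) \<in> sector \<sigma>" if "\<bar>a\<bar> < \<sigma>" for t a
    using exp_in_sector[of \<sigma> "Complex t a"] assms(3) that by simp
  have 3: "integral {-T..T} (\<lambda>t. H (exp (Complex t (-\<nu>)))) - integral {-T..T} (\<lambda>t. H (exp (Complex t \<nu>)))
     = g p * (integral {-T..T} (\<lambda>t. E (Complex t (2*pi-\<nu>))) - integral {-T..T} (\<lambda>t. E (Complex t \<nu>)))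
       - (integral {-T..T} (\<lambda>t. G (Complex t \<nu>)) - integral {-T..T} (\<lambda>t. G (Complex t (-\<nu>))))" for T
  proof -
    have cE: "continuous_on {-T..T} (\<lambda>t. E (Complex t a))" if "a \<in> {\<nu>..2*pi-\<nu>} \<or> a = -\<nu>" for a
      unfolding E_def using ne[of "Complex t a" for t] that by (intro continuous_intros) auto
    have cG: "continuous_on {-T..T} (\<lambda>t. G (Complex t a))" if "\<bar>a\<bar> < \<sigma>" for a
      unfolding G_def using assms(1-3) that
      by (intro continuous_intros continuous_on_ray[of \<sigma>] holomorphic_on_imp_continuous_on h_holo) auto
    have "integral {-T..T} (\<lambda>t. H (exp (Complex t a))) =
        integral {-T..T} (\<lambda>t. G (Complex t a)) + g p * integral {-T..T} (\<lambda>t. E (Complex t a))"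
      if a: "a = \<nu> \<or> a = - \<nu>" for a
    proof -
      have n: "exp (Complex t a) \<noteq> p" for t using ne[of "Complex t a"] a assms(1-3) by auto
      have "H (exp (Complex t a)) = G (Complex t a) + g p * E (Complex t a)" for t
        unfolding G_def E_def h_eq[OF n] H_def p_def[symmetric] by (simp only: left_diff_distrib) simp
      then have "integral {-T..T} (\<lambda>t. H (exp (Complex t a))) =
        integral {-T..T} (\<lambda>t. G (Complex t a) + g p * E (Complex t a))" by simp
      also have "\<dots> = integral {-T..T} (\<lambda>t. G (Complex t a)) + integral {-T..T} (\<lambda>t. g p * E (Complex t a))"
        using a assms(1-3) by (intro integral_add integrable_continuous_interval continuous_intros cG cE) auto
      finally show ?thesis by simp
    qed
    note eqs = this[of \<nu>, simplified] this[of "-\<nu>", simplified]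
    have E2: "E (Complex t (2*pi-\<nu>)) = E (Complex t (-\<nu>))" for t by (simp only: E_def per)
    show ?thesis unfolding eqs E2 by (simp only: right_diff_distrib) simp
  qed
  have g_cont: "continuous_on (sector \<sigma>) g"
    using assms(4) by (intro holomorphic_on_imp_continuous_on H0_inf_holomorphic)
  have lim: "((\<lambda>T. integral {-T..T} (\<lambda>t. H (exp (Complex t a)))) \<longlongrightarrow> integral UNIV (\<lambda>t. H (exp (Complex t a)))) at_top"
    if a: "a = \<nu> \<or> a = - \<nu>" for a
  proof -
    have n: "exp (Complex t a) \<noteq> p" for t using ne[of "Complex t a"] a assms(1-3) by auto
    \<comment> \<open>Modulo 2 pi, the arguments of the ray and of p differ by at least \<nu> -
      \<bar>Im v\<bar> > 0, so the distance from p dominates the sum of the moduli.\<close>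
    define k where "k = max 0 (cos (\<nu> - \<bar>Im v\<bar>))"
    have "cos (a - Im v) \<le> k"
    proof -
      have "cos \<bar>a - Im v\<bar> \<le> cos (\<nu> - \<bar>Im v\<bar>)"
      proof (cases "\<bar>a - Im v\<bar> \<le> pi")
        case True
        then show ?thesis using a assms(1,2,3,5) by (intro cos_monotone_0_pi_le) auto
      next
        case False
        have "cos \<bar>a - Im v\<bar> = cos (2 * pi - \<bar>a - Im v\<bar>)" by (simp add: cos_diff)
        also have "\<dots> \<le> cos (\<nu> - \<bar>Im v\<bar>)" using False a assms(1,2,3,5) by (intro cos_monotone_0_pi_le) auto
        finally show ?thesis .
      qed
      then show ?thesis by (simp add: k_def)
    qed
    moreover have "k < 1" using cos_monotone_0_pi[of 0 "\<nu> - \<bar>Im v\<bar>"] assms(1,2,3,5) by (auto simp: k_def)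
    ultimately have lb: "sqrt ((1 - k) / 2) * (exp t + exp (Re v)) \<le> cmod (exp (Complex t a) - p)" for t
      using norm_exp_diff_ge[of "Complex t a" v k] by (simp add: p_def k_def)
    define \<kappa> where "\<kappa> = sqrt ((1 - k) / 2)"
    have \<kappa>: "\<kappa> > 0" using \<open>k < 1\<close> by (simp add: \<kappa>_def)
    show ?thesis
    proof (intro integral_symmetric_tendsto exp_dominated_integrable[of _ \<epsilon> "C' / \<kappa>" 0] \<epsilon>)
      show "continuous_on UNIV (\<lambda>t. H (exp (Complex t a)))"
        unfolding H_def p_def[symmetric] using n a assms(1-3)
        by (intro continuous_intros continuous_on_ray[of \<sigma>] g_cont) auto
      fix t
      have "cmod (exp (Complex t a)) / cmod (exp (Complex t a) - p) \<le> 1 / \<kappa>"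
      proof -
        have "\<kappa> * exp t \<le> \<kappa> * (exp t + exp (Re v))" using \<kappa> by simp
        also note lb[of t, folded \<kappa>_def]
        finally have "exp t \<le> cmod (exp (Complex t a) - p) / \<kappa>"
          using \<kappa> by (subst pos_le_divide_eq) (simp_all add: mult.commute)
        then show ?thesis using n[of t] by (subst pos_divide_le_eq) simp_all
      qed
      then have "cmod (g (exp (Complex t a))) * (cmod (exp (Complex t a)) / cmod (exp (Complex t a) - p)) \<le> C' * exp (-\<epsilon> * \<bar>t\<bar>) * (1 / \<kappa>)"
        using g[of "Complex t a"] a assms(1-3) e'(2) by (intro mult_mono) auto
      then show "norm (H (exp (Complex t a))) \<le> C' / \<kappa> * exp (-\<epsilon> * \<bar>t + 0\<bar>)"
        by (simp add: H_def norm_mult norm_divide p_def[symmetric])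
    qed
  qed
  have "((\<lambda>T. integral {-T..T} (\<lambda>t. H (exp (Complex t (-\<nu>)))) - integral {-T..T} (\<lambda>t. H (exp (Complex t \<nu>))))
     \<longlongrightarrow> g p * (\<i> * complex_of_real ((2*pi-\<nu>) - \<nu>) * (1 - 0)) - \<i> * complex_of_real (\<nu> - (-\<nu>)) * (- g p - 0)) at_top"
    unfolding 3 by (intro tendsto_diff tendsto_mult tendsto_const 1 2)
  moreover have "((\<lambda>T. integral {-T..T} (\<lambda>t. H (exp (Complex t (-\<nu>)))) - integral {-T..T} (\<lambda>t. H (exp (Complex t \<nu>))))
     \<longlongrightarrow> integral UNIV (\<lambda>t. H (exp (Complex t (-\<nu>)))) - integral UNIV (\<lambda>t. H (exp (Complex t \<nu>)))) at_top"
    by (intro tendsto_diff lim) auto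
  ultimately have "integral UNIV (\<lambda>t. H (exp (Complex t (-\<nu>)))) - integral UNIV (\<lambda>t. H (exp (Complex t \<nu>))) =
      g p * (\<i> * complex_of_real ((2*pi-\<nu>) - \<nu>) * (1 - 0)) - \<i> * complex_of_real (\<nu> - (-\<nu>)) * (- g p - 0)"
    using tendsto_unique[OF trivial_limit_at_top_linorder] by blast
  also have "\<dots> = 2 * pi * \<i> * g p" by (simp add: algebra_simps)
  finally show ?thesis by (simp add: p_def)
qed

section \<open>Resolvents outside a sector\<close>

text \<open>The inequality \<open>Re z < cos \<delta> * cmod z\<close> describes the points strictly
  off the closed sector of angle \<delta>, without using an argument function; it excludes 0
  automatically. Sectoriality enters through one fixed angle \<delta> and one constant M.\<close>

locale sectorial_operator =
  fixes D :: "'a::complex_banach set" and A :: "'a \<Rightarrow> 'a" and \<delta> M :: real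
  assumes linear: "linear_operator D A"
    and inj: "inj_on A D"
    and \<delta>: "0 < \<delta>" "\<delta> < pi"
    and resolvent_set: "Re z < cos \<delta> * cmod z \<Longrightarrow> z \<in> resolvent_set D A"
    and resolvent_bound: "Re z < cos \<delta> * cmod z \<Longrightarrow> norm (z *\<^sub>C resolvent D A z x) \<le> M * norm x"
begin

abbreviation "R \<equiv> resolvent D A"

definition Out :: "complex set" where "Out = {z. Re z < cos \<delta> * cmod z}"

lemma D_add: "x \<in> D \<Longrightarrow> y \<in> D \<Longrightarrow> x + y \<in> D" and A_add: "x \<in> D \<Longrightarrow> y \<in> D \<Longrightarrow> A (x + y) = A x + A y"
  using linear by (auto simp: linear_operator_def)

lemma D_scale: "x \<in> D \<Longrightarrow> c *\<^sub>C x \<in> D" and A_scale: "x \<in> D \<Longrightarrow> A (c *\<^sub>C x) = c *\<^sub>C A x"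
  using linear by (auto simp: linear_operator_def)

lemma D_minus: "x \<in> D \<Longrightarrow> - x \<in> D" and A_minus: "x \<in> D \<Longrightarrow> A (- x) = - A x"
  using D_scale[of x "-1"] A_scale[of x "-1"] by auto

lemma D_diff: "x \<in> D \<Longrightarrow> y \<in> D \<Longrightarrow> x - y \<in> D" and A_diff: "x \<in> D \<Longrightarrow> y \<in> D \<Longrightarrow> A (x - y) = A x - A y"
  using D_add[of x "-y"] A_add[of x "-y"] D_minus A_minus by auto

lemma D_zero: "0 \<in> D" and A_zero [simp]: "A 0 = 0"
  using linear A_diff[of 0 0] by (auto simp: linear_operator_def)

lemma Out_bij: "z \<in> Out \<Longrightarrow> bij_betw (\<lambda>x. z *\<^sub>C x - A x) D UNIV"
  and Out_bounded_linear: "z \<in> Out \<Longrightarrow> bounded_linear (R z)"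
  using resolvent_set by (auto simp: Out_def resolvent_set_def)

lemma R_in_D: "z \<in> Out \<Longrightarrow> R z x \<in> D"
  unfolding resolvent_def by (rule inv_into_into) (use Out_bij[of z] in \<open>auto simp: bij_betw_def\<close>)

lemma R_right: "z \<in> Out \<Longrightarrow> z *\<^sub>C R z x - A (R z x) = x"
  unfolding resolvent_def using f_inv_into_f[of x "\<lambda>x. z *\<^sub>C x - A x" D] Out_bij[of z]
  by (auto simp: bij_betw_def)

lemma R_eqI: "z \<in> Out \<Longrightarrow> u \<in> D \<Longrightarrow> z *\<^sub>C u - A u = x \<Longrightarrow> R z x = u"
  unfolding resolvent_def using Out_bij[of z] by (auto simp: bij_betw_def intro: inv_into_f_f)

lemma A_R: "z \<in> Out \<Longrightarrow> A (R z x) = z *\<^sub>C R z x - x"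
  using R_right[of z x] by (simp add: algebra_simps)

lemma R_A: "z \<in> Out \<Longrightarrow> x \<in> D \<Longrightarrow> R z (A x) = z *\<^sub>C R z x - x"
  by (intro R_eqI) (auto simp: R_in_D D_diff D_scale A_diff A_scale A_R scaleC_simps)

lemma R_add: "z \<in> Out \<Longrightarrow> R z (x + y) = R z x + R z y"
  and R_diff: "z \<in> Out \<Longrightarrow> R z (x - y) = R z x - R z y"
  and R_minus: "z \<in> Out \<Longrightarrow> R z (- x) = - R z x"
  and R_zero: "z \<in> Out \<Longrightarrow> R z 0 = 0"
  using Out_bounded_linear[of z] bounded_linear.linear linear_add linear_diff linear_neg linear_0 by blast+

lemma R_scale: "z \<in> Out \<Longrightarrow> R z (c *\<^sub>C x) = c *\<^sub>C R z x"
  by (intro R_eqI) (auto simp: R_in_D D_scale A_scale A_R scaleC_simps scaleC_scaleC mult.commute)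

lemma Out_nonzero: "z \<in> Out \<Longrightarrow> z \<noteq> 0"
  by (auto simp: Out_def)

lemma R_bound: "z \<in> Out \<Longrightarrow> norm (R z x) \<le> M / cmod z * norm x"
  using resolvent_bound[of z x] Out_nonzero[of z] by (auto simp: Out_def norm_scaleC field_simps)

lemma R_bound': "z \<in> Out \<Longrightarrow> cmod z * norm (R z x) \<le> M * norm x"
  using resolvent_bound[of z x] by (auto simp: Out_def norm_scaleC)

lemma resolvent_identity:
  assumes "z \<in> Out" "w \<in> Out"
  shows "(w - z) *\<^sub>C R z (R w x) = R z x - R w x"
proof -
  have "R z ((w - z) *\<^sub>C R w x) = R z x - R w x"
    using assms by (intro R_eqI) (auto simp: R_in_D D_diff A_diff A_R scaleC_simps)
  then show ?thesis using assms R_scale by simp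
qed

lemma R_commute:
  assumes "z \<in> Out" "w \<in> Out"
  shows "R z (R w x) = R w (R z x)"
proof (cases "z = w")
  case False
  have "(w - z) *\<^sub>C R w (R z x) = - ((z - w) *\<^sub>C R w (R z x))" by (simp add: scaleC_simps)
  also have "\<dots> = (w - z) *\<^sub>C R z (R w x)" by (simp only: resolvent_identity assms minus_diff_eq)
  finally have "(w - z) *\<^sub>C R z (R w x) = (w - z) *\<^sub>C R w (R z x)" by (rule sym)
  then show ?thesis using False by (subst (asm) scaleC_eq_iff) auto
qed simp

lemma exp_in_Out:
  assumes "\<delta> < \<bar>Im w\<bar>" "\<bar>Im w\<bar> < 2 * pi - \<delta>"
  shows "exp w \<in> Out"
proof -
  have "cos \<bar>Im w\<bar> < cos \<delta>"
  proof (cases "\<bar>Im w\<bar> \<le> pi")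
    case True
    then show ?thesis using assms \<delta> by (intro cos_monotone_0_pi) auto
  next
    case False
    have "cos \<bar>Im w\<bar> = cos (2 * pi - \<bar>Im w\<bar>)" by (simp add: cos_diff)
    also have "\<dots> < cos \<delta>" using False assms \<delta> by (intro cos_monotone_0_pi) auto
    finally show ?thesis .
  qed
  then show ?thesis by (simp add: Out_def Re_exp mult.commute[of _ "cos _"])
qed

lemma neg_in_Out: "c > 0 \<Longrightarrow> - complex_of_real c \<in> Out"
  using cos_monotone_0_pi[of \<delta> pi] \<delta> mult_strict_right_mono[of "-1" "cos \<delta>" c] by (simp add: Out_def)

text \<open>On the trivial space the resolvent bound says nothing about the sign of M, hence the
  form with the factor \<open>norm x\<close>.\<close>

lemma M_nonneg: "M * norm (x::'a) \<ge> 0"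
  using order_trans[OF mult_nonneg_nonneg R_bound'[OF neg_in_Out[of 1], of x]] by simp

lemma R_continuous:
  "continuous_on Out (\<lambda>z. R z x)"
  unfolding continuous_on_def
proof
  fix z assume z: "z \<in> Out"
  have "((\<lambda>w. M / cmod w * norm ((w - z) *\<^sub>C R z x)) \<longlongrightarrow> M / cmod z * norm ((z - z) *\<^sub>C R z x)) (at z within Out)"
    using Out_nonzero[OF z] by (intro tendsto_intros scaleC.tendsto) auto
  then have lim: "((\<lambda>w. M / cmod w * norm ((w - z) *\<^sub>C R z x)) \<longlongrightarrow> 0) (at z within Out)" by simp
  have "\<forall>\<^sub>F w in at z within Out. norm (R w x - R z x) \<le> M / cmod w * norm ((w - z) *\<^sub>C R z x)"
  proof (unfold eventually_at_filter, intro always_eventually allI impI)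
    fix w assume w: "w \<in> Out"
    have "R w x - R z x = - R w ((w - z) *\<^sub>C R z x)"
      using resolvent_identity[OF w z, of x] w by (simp add: R_scale scaleC_simps R_diff)
    then show "norm (R w x - R z x) \<le> M / cmod w * norm ((w - z) *\<^sub>C R z x)"
      using R_bound[OF w, of "(w - z) *\<^sub>C R z x"] by simp
  qed
  from Lim_null_comparison[OF this lim] show "((\<lambda>w. R w x) \<longlongrightarrow> R z x) (at z within Out)"
    by (rule Lim_null[THEN iffD2])
qed

lemma R_continuous_compose [continuous_intros]:
  assumes "continuous_on X h" "h ` X \<subseteq> Out"
  shows "continuous_on X (\<lambda>t. R (h t) x)"
  using continuous_on_compose2[OF R_continuous assms] .

text \<open>Up to sign this is the derivative of the resolvent, whose continuity is required for
  shifting contours.\<close>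

lemma R_R_continuous: "continuous_on Out (\<lambda>z. R z (R z x))"
  unfolding continuous_on_def
proof
  fix z assume z: "z \<in> Out"
  have c: "((\<lambda>w. norm (R w y - R z y)) \<longlongrightarrow> 0) (at z within Out)" for y
    using R_continuous[of y] z by (auto simp: continuous_on_def intro!: tendsto_norm_zero LIM_zero)
  have "((\<lambda>w. M / cmod w * norm (R w x - R z x) + norm (R w (R z x) - R z (R z x))) \<longlongrightarrow> M / cmod z * 0 + 0) (at z within Out)"
    using Out_nonzero[OF z] by (intro tendsto_intros c) auto
  then have lim: "((\<lambda>w. M / cmod w * norm (R w x - R z x) + norm (R w (R z x) - R z (R z x))) \<longlongrightarrow> 0) (at z within Out)"
    by simp
  have "\<forall>\<^sub>F w in at z within Out. norm (R w (R w x) - R z (R z x)) \<le>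
      M / cmod w * norm (R w x - R z x) + norm (R w (R z x) - R z (R z x))"
  proof (unfold eventually_at_filter, intro always_eventually allI impI)
    fix w assume w: "w \<in> Out"
    have "R w (R w x) - R z (R z x) = R w (R w x - R z x) + (R w (R z x) - R z (R z x))"
      using w by (simp add: R_diff)
    then show "norm (R w (R w x) - R z (R z x)) \<le> M / cmod w * norm (R w x - R z x) + norm (R w (R z x) - R z (R z x))"
      by (simp only:) (rule order_trans[OF norm_triangle_ineq add_right_mono[OF R_bound[OF w]]])
  qed
  from Lim_null_comparison[OF this lim] show "((\<lambda>w. R w (R w x)) \<longlongrightarrow> R z (R z x)) (at z within Out)"
    by (rule Lim_null[THEN iffD2])
qed

lemma R_has_derivative:
  assumes z: "z \<in> Out"
  shows "((\<lambda>w. R w x) has_derivative (\<lambda>h. h *\<^sub>C (- R z (R z x)))) (at z within Out)"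
proof (rule has_derivativeI)
  show "bounded_linear (\<lambda>h. h *\<^sub>C (- R z (R z x)))" by (rule scaleC.bounded_linear_left)
  have "((\<lambda>w. norm (R w (R z x) - R z (R z x))) \<longlongrightarrow> 0) (at z within Out)"
    using R_continuous[of "R z x"] z by (auto simp: continuous_on_def intro!: tendsto_norm_zero LIM_zero)
  moreover have "\<forall>\<^sub>F w in at z within Out. norm ((R w x - R z x - (w - z) *\<^sub>C (- R z (R z x))) /\<^sub>R norm (w - z))
     \<le> norm (R w (R z x) - R z (R z x))"
  proof (unfold eventually_at_filter, intro always_eventually allI impI)
    fix w assume w: "w \<in> Out" "w \<noteq> z"
    have "R w x - R z x - (w - z) *\<^sub>C (- R z (R z x)) = (z - w) *\<^sub>C (R w (R z x) - R z (R z x))"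
      using resolvent_identity[OF w(1) z, of x] by (simp add: scaleC_simps algebra_simps)
    then show "norm ((R w x - R z x - (w - z) *\<^sub>C (- R z (R z x))) /\<^sub>R norm (w - z)) \<le> norm (R w (R z x) - R z (R z x))"
      using w by (simp add: norm_scaleC norm_minus_commute flip: mult.assoc)
  qed
  ultimately show "((\<lambda>w. (R w x - R z x - (w - z) *\<^sub>C (- R z (R z x))) /\<^sub>R norm (w - z)) \<longlongrightarrow> 0) (at z within Out)"
    by (rule Lim_null_comparison[rotated])
qed

text \<open>\<open>J c = (1 + c A)\<^sup>-\<^sup>1\<close>.\<close>

definition J :: "real \<Rightarrow> 'a \<Rightarrow> 'a" where
  "J c x = - ((1 / complex_of_real c) *\<^sub>C R (- complex_of_real (1 / c)) x)"

lemma J_in_D: "c > 0 \<Longrightarrow> J c x \<in> D"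
  unfolding J_def by (intro D_minus D_scale R_in_D neg_in_Out) auto

lemma J_right:
  assumes "c > 0"
  shows "J c x + complex_of_real c *\<^sub>C A (J c x) = x"
proof -
  let ?u = "R (- complex_of_real (1 / c)) x"
  have o: "- complex_of_real (1 / c) \<in> Out" using assms by (intro neg_in_Out) auto
  have "A (J c x) = - ((1 / complex_of_real c) *\<^sub>C A ?u)"
    unfolding J_def using o by (simp add: A_minus A_scale D_scale R_in_D)
  then have "complex_of_real c *\<^sub>C A (J c x) = - A ?u" using assms by (simp add: scaleC_simps scaleC_scaleC)
  then show ?thesis using A_R[OF o, of x] by (simp add: J_def scaleC_simps)
qed

lemma J_eqI:
  assumes "c > 0" "u \<in> D" "u + complex_of_real c *\<^sub>C A u = x"
  shows "J c x = u"
proof -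
  have "R (- complex_of_real (1 / c)) x = - (complex_of_real c *\<^sub>C u)"
    using assms(1,2) by (intro R_eqI neg_in_Out)
      (auto simp: D_minus D_scale A_minus A_scale scaleC_simps scaleC_scaleC assms(3)[symmetric])
  then show ?thesis using assms(1) by (simp add: J_def scaleC_simps scaleC_scaleC)
qed

lemma J_linear:
  assumes "c > 0"
  shows "J c (x + y) = J c x + J c y" "J c (x - y) = J c x - J c y" "J c (a *\<^sub>C x) = a *\<^sub>C J c x" "J c 0 = 0"
  using neg_in_Out[of "1/c"] assms
  by (auto simp: J_def R_add R_diff R_scale R_zero scaleC_simps scaleC_scaleC mult.commute)

lemma J_bounded_linear: "c > 0 \<Longrightarrow> bounded_linear (J c)"
  unfolding J_def using Out_bounded_linear[OF neg_in_Out[of "1/c"]]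
  by (intro bounded_linear_minus bounded_linear_compose[OF scaleC.bounded_linear_right]) auto

lemma J_bound: "c > 0 \<Longrightarrow> norm (J c x) \<le> M * norm x"
  using R_bound'[OF neg_in_Out[of "1/c"], of x] by (simp add: J_def norm_scaleC norm_divide)

lemma J_R_commute: "c > 0 \<Longrightarrow> z \<in> Out \<Longrightarrow> J c (R z x) = R z (J c x)"
  using neg_in_Out[of "1/c"] by (simp add: J_def R_minus R_scale R_commute[of z])

lemma A_J:
  assumes "c > 0"
  shows "A (J c x) = (1 / complex_of_real c) *\<^sub>C (x - J c x)"
proof -
  have "complex_of_real c *\<^sub>C A (J c x) = x - J c x" using J_right[OF assms, of x] by (simp add: algebra_simps)
  from this[symmetric] show ?thesis using assms by (simp add: scaleC_scaleC)
qed

lemma inv_into_one_plus_A: "inv_into D (\<lambda>u. u + A u) x = J 1 x"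
proof -
  have "inj_on (\<lambda>u. u + A u) D"
    by (rule inj_onI) (metis J_eqI zero_less_one of_real_1 scaleC_one)
  from inv_into_f_f[OF this J_in_D[of 1 x]] J_right[of 1 x] show ?thesis by simp
qed

end

section \<open>The functional calculus on decaying functions\<close>

text \<open>The angle \<sigma> stays strictly below pi, so that 1/(1 + cz) is bounded on the sector
  uniformly in c > 0. Sectors of angle pi are reached at the end by shrinking them.\<close>

locale sectorial_calculus = sectorial_operator D A \<delta> M
  for D :: "'a::complex_banach set" and A :: "'a \<Rightarrow> 'a" and \<delta> M :: real +
  fixes \<sigma> :: real
  assumes \<sigma>_bounds: "\<delta> < \<sigma>" "\<sigma> < pi"
begin

lemma \<sigma>: "\<delta> < \<sigma>" "\<sigma> \<le> pi" "0 < \<sigma>" "\<sigma> < pi"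
  using \<sigma>_bounds \<delta> by auto

definition ray_integrand :: "real \<Rightarrow> (complex \<Rightarrow> complex) \<Rightarrow> 'a \<Rightarrow> real \<Rightarrow> 'a" where
  "ray_integrand a f x t = (exp (Complex t a) * f (exp (Complex t a))) *\<^sub>C R (exp (Complex t a)) x"

lemma ray_integral_eq: "ray_integral D A a f x = integral UNIV (ray_integrand a f x)"
  by (simp add: ray_integral_def ray_integrand_def[abs_def] Let_def)

lemma ray_Out: "\<delta> < \<bar>a\<bar> \<Longrightarrow> \<bar>a\<bar> < \<sigma> \<Longrightarrow> exp (Complex t a) \<in> Out"
  using \<sigma> \<delta> by (intro exp_in_Out) auto

lemma ray_integrand_continuous:
  assumes "continuous_on (sector \<sigma>) f" "\<delta> < \<bar>a\<bar>" "\<bar>a\<bar> < \<sigma>"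
  shows "continuous_on X (ray_integrand a f x)"
  unfolding ray_integrand_def using assms ray_Out \<sigma> \<delta>
  by (intro continuous_intros continuous_on_ray[of \<sigma>]) auto

lemma ray_integrand_bound:
  assumes "\<delta> < \<bar>a\<bar>" "\<bar>a\<bar> < \<sigma>"
  shows "norm (ray_integrand a f x t) \<le> cmod (f (exp (Complex t a))) * (M * norm x)"
proof -
  have "norm (ray_integrand a f x t) = cmod (f (exp (Complex t a))) * (cmod (exp (Complex t a)) * norm (R (exp (Complex t a)) x))"
    by (simp add: ray_integrand_def norm_scaleC norm_mult mult_ac)
  also have "\<dots> \<le> cmod (f (exp (Complex t a))) * (M * norm x)"
    using ray_Out assms by (intro mult_left_mono R_bound') auto
  finally show ?thesis .
qed

lemma ray_integrand_integrable:
  assumes "f \<in> H0_inf \<sigma>" "\<delta> < \<bar>a\<bar>" "\<bar>a\<bar> < \<sigma>"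
  shows "ray_integrand a f x integrable_on UNIV"
proof -
  obtain \<epsilon> C where e: "\<epsilon> > 0" "C \<ge> 0" "\<And>w. \<bar>Im w\<bar> < \<sigma> \<Longrightarrow> cmod (f (exp w)) \<le> C * exp (-\<epsilon> * \<bar>Re w\<bar>)"
    using H0_infE[OF _ \<sigma>(2) assms(1)] \<sigma> \<delta> by auto
  have c: "continuous_on (sector \<sigma>) f"
    by (rule holomorphic_on_imp_continuous_on[OF H0_inf_holomorphic[OF assms(1)]])
  show ?thesis
  proof (rule exp_dominated_integrable[OF ray_integrand_continuous[OF c assms(2,3)] e(1), of _ "C * (M * norm x)" 0])
    fix t
    have "norm (ray_integrand a f x t) \<le> (C * exp (-\<epsilon> * \<bar>t\<bar>)) * (M * norm x)"
      using order_trans[OF ray_integrand_bound[OF assms(2,3), of f x t]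
          mult_right_mono[OF e(3)[of "Complex t a"] M_nonneg[of x]]] assms by simp
    then show "norm (ray_integrand a f x t) \<le> C * (M * norm x) * exp (- \<epsilon> * \<bar>t + 0\<bar>)" by (simp add: mult_ac)
  qed
qed

lemma ray_integral_bound:
  assumes "f \<in> H0_inf \<sigma>" "\<delta> < \<bar>a\<bar>" "\<bar>a\<bar> < \<sigma>" "\<epsilon> > 0"
    "\<And>t. cmod (f (exp (Complex t a))) \<le> C * exp (-\<epsilon> * \<bar>t + b\<bar>)"
  shows "norm (ray_integral D A a f x) \<le> C * (2 / \<epsilon>) * (M * norm x)"
proof -
  have "norm (ray_integral D A a f x) \<le> C * (M * norm x) * (2 / \<epsilon>)"
    unfolding ray_integral_eq
  proof (rule exp_dominated_integral_bound[OF ray_integrand_integrable[OF assms(1-3)] assms(4)])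
    fix t
    have "norm (ray_integrand a f x t) \<le> (C * exp (-\<epsilon> * \<bar>t + b\<bar>)) * (M * norm x)"
      using ray_integrand_bound[OF assms(2,3), of f x t] mult_right_mono[OF assms(5) M_nonneg, of t x]
      by (rule order_trans)
    then show "norm (ray_integrand a f x t) \<le> C * (M * norm x) * exp (- \<epsilon> * \<bar>t + b\<bar>)" by (simp add: mult_ac)
  qed
  then show ?thesis by (simp add: mult_ac)
qed

lemma ray_integral_bound_integral:
  assumes "f \<in> H0_inf \<sigma>" "\<delta> < \<bar>a\<bar>" "\<bar>a\<bar> < \<sigma>" "(\<lambda>t. cmod (f (exp (Complex t a)))) integrable_on UNIV"
  shows "norm (ray_integral D A a f x) \<le> integral UNIV (\<lambda>t. cmod (f (exp (Complex t a)))) * (M * norm x)"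
proof -
  have "norm (ray_integral D A a f x) \<le> integral UNIV (\<lambda>t. cmod (f (exp (Complex t a))) * (M * norm x))"
    unfolding ray_integral_eq
    by (rule integral_norm_bound_integral[OF ray_integrand_integrable[OF assms(1-3)]
          integrable_on_mult_left[OF assms(4)] ray_integrand_bound[OF assms(2,3)]])
  then show ?thesis by simp
qed

lemma ray_integral_add_left:
  assumes "f \<in> H0_inf \<sigma>" "g \<in> H0_inf \<sigma>" "\<delta> < \<bar>a\<bar>" "\<bar>a\<bar> < \<sigma>"
  shows "ray_integral D A a (\<lambda>z. f z + g z) x = ray_integral D A a f x + ray_integral D A a g x"
proof -
  have "ray_integrand a (\<lambda>z. f z + g z) x = (\<lambda>t. ray_integrand a f x t + ray_integrand a g x t)"
    by (simp add: fun_eq_iff ray_integrand_def distrib_left scaleC.add_left)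
  then show ?thesis
    using integral_add[OF ray_integrand_integrable[OF assms(1,3,4)] ray_integrand_integrable[OF assms(2-4)]]
    by (simp add: ray_integral_eq)
qed

lemma ray_integral_cmult_left:
  assumes "f \<in> H0_inf \<sigma>" "\<delta> < \<bar>a\<bar>" "\<bar>a\<bar> < \<sigma>"
  shows "ray_integral D A a (\<lambda>z. c * f z) x = c *\<^sub>C ray_integral D A a f x"
proof -
  have "ray_integrand a (\<lambda>z. c * f z) x = (\<lambda>t. c *\<^sub>C ray_integrand a f x t)"
    by (simp add: fun_eq_iff ray_integrand_def scaleC_scaleC mult_ac)
  then show ?thesis
    using integral_linear[OF ray_integrand_integrable[OF assms] scaleC.bounded_linear_right[of c]]
    by (simp add: ray_integral_eq o_def)
qed

lemma ray_integral_commute: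
  assumes "f \<in> H0_inf \<sigma>" "\<delta> < \<bar>a\<bar>" "\<bar>a\<bar> < \<sigma>"
    and B: "bounded_linear B" "\<And>c x. B (c *\<^sub>C x) = c *\<^sub>C B x" "\<And>z x. z \<in> Out \<Longrightarrow> B (R z x) = R z (B x)"
  shows "B (ray_integral D A a f x) = ray_integral D A a f (B x)"
proof -
  have "ray_integrand a f (B x) = (\<lambda>t. B (ray_integrand a f x t))"
    by (simp add: fun_eq_iff ray_integrand_def B(2,3) ray_Out[OF assms(2,3)])
  then show ?thesis
    using integral_linear[OF ray_integrand_integrable[OF assms(1-3)] B(1), of x]
    by (simp add: ray_integral_eq o_def)
qed

lemma ray_integral_cong:
  assumes "\<And>z. z \<in> sector \<sigma> \<Longrightarrow> f z = g z" "\<bar>a\<bar> < \<sigma>"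
  shows "ray_integral D A a f x = ray_integral D A a g x"
proof -
  have "ray_integrand a f x = ray_integrand a g x"
    using assms(1)[OF exp_in_sector, of "Complex t a" for t] \<sigma> assms(2)
    by (simp add: fun_eq_iff ray_integrand_def)
  then show ?thesis by (simp add: ray_integral_eq)
qed

end

section \<open>Resolvents of A inside the calculus\<close>

lemma exp_Complex_2pi_minus: "exp (Complex t (2*pi-a)) = exp (Complex t (-a))"
  by (intro complex_eqI) (simp_all add: Re_exp Im_exp)

lemma norm_one_plus_exp_ge:
  assumes "0 \<le> \<nu>" "\<nu> < pi"
  obtains \<kappa> where "\<kappa> > 0"
    "\<And>w c. \<bar>Im w\<bar> \<le> \<nu> \<Longrightarrow> c > 0 \<Longrightarrow> \<kappa> * (1 + c * exp (Re w)) \<le> cmod (1 + complex_of_real c * exp w)"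
proof -
  obtain \<kappa> where k: "\<kappa> > 0" "\<And>w c. \<bar>Im w\<bar> \<le> \<nu> \<Longrightarrow> c > 0 \<Longrightarrow> \<kappa> * (exp (Re w) + c) \<le> cmod (exp w + complex_of_real c)"
    using norm_exp_add_ge[OF assms] by metis
  have "\<kappa> * (1 + c * exp (Re w)) \<le> cmod (1 + complex_of_real c * exp w)" if "\<bar>Im w\<bar> \<le> \<nu>" "c > 0" for w c
  proof -
    have "c * (\<kappa> * (exp (Re w) + 1 / c)) \<le> c * cmod (exp w + complex_of_real (1 / c))"
      using k(2)[OF that(1), of "1 / c"] that by (intro mult_left_mono) auto
    moreover have "c * cmod (exp w + complex_of_real (1 / c)) = cmod (complex_of_real c * (exp w + complex_of_real (1 / c)))"
      using that by (simp only: norm_mult norm_of_real abs_of_pos)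
    moreover have "complex_of_real c * (exp w + complex_of_real (1 / c)) = 1 + complex_of_real c * exp w"
      using that by (simp add: distrib_left)
    moreover have "c * (\<kappa> * (exp (Re w) + 1 / c)) = \<kappa> * (1 + c * exp (Re w))"
      using that by (simp add: field_simps)
    ultimately show ?thesis by simp
  qed
  with k(1) show ?thesis using that by blast
qed

text \<open>The difference is (c - 1) z / ((1 + z)(1 + cz)) and vanishes to first order at 0 and at
  infinity. It serves to rewrite a dilated 1/(1 + cz) in terms of 1/(1 + z) and, for c = 2, as a
  regularizing factor.\<close>

lemma resolvent_difference_in_H0:
  assumes "0 < \<sigma>" "\<sigma> < pi" "c > 0"
  shows "(\<lambda>z. 1 / (1 + z) - 1 / (1 + complex_of_real c * z)) \<in> H0_inf \<sigma>"
proof -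
  obtain \<kappa> where k: "\<kappa> > 0"
    "\<And>w c. \<bar>Im w\<bar> \<le> \<sigma> \<Longrightarrow> c > 0 \<Longrightarrow> \<kappa> * (1 + c * exp (Re w)) \<le> cmod (1 + complex_of_real c * exp w)"
    using norm_one_plus_exp_ge[of \<sigma>] assms by auto
  have nz: "1 + complex_of_real a * z \<noteq> 0" if "z \<in> sector \<sigma>" "a > 0" for a z
    using one_plus_sector_nonzero[of \<sigma> z a] that assms by auto
  define B where "B = \<bar>c - 1\<bar> / \<kappa>\<^sup>2 * max 1 (1 / c)"
  show ?thesis
  proof (rule H0_infI)
    show "(\<lambda>z. 1 / (1 + z) - 1 / (1 + complex_of_real c * z)) holomorphic_on sector \<sigma>"
      using nz[of _ 1] nz[of _ c] assms by (auto intro!: holomorphic_intros)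
    fix w :: complex assume w: "\<bar>Im w\<bar> < \<sigma>"
    let ?r = "exp (Re w)"
    have s: "exp w \<in> sector \<sigma>" using w assms by (intro exp_in_sector) auto
    have k1: "\<kappa> * (1 + ?r) \<le> cmod (1 + exp w)" using k(2)[of w 1] w by simp
    have kc: "\<kappa> * (1 + c * ?r) \<le> cmod (1 + complex_of_real c * exp w)" using k(2)[of w c] w assms by simp
    have pos: "0 < \<kappa> * (1 + ?r)" "0 < \<kappa> * (1 + c * ?r)" using k(1) assms by (auto intro!: mult_pos_pos add_pos_pos)
    have "1 / (1 + exp w) - 1 / (1 + complex_of_real c * exp w) =
        complex_of_real (c - 1) * exp w / ((1 + exp w) * (1 + complex_of_real c * exp w))"
      using nz[OF s, of 1] nz[OF s, of c] assms by (simp add: divide_simps) (simp add: algebra_simps)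
    then have "cmod (1 / (1 + exp w) - 1 / (1 + complex_of_real c * exp w)) =
        \<bar>c - 1\<bar> * ?r / (cmod (1 + exp w) * cmod (1 + complex_of_real c * exp w))"
      by (simp only: norm_mult norm_divide norm_of_real norm_exp_eq_Re)
    also have "\<dots> \<le> \<bar>c - 1\<bar> * ?r / ((\<kappa> * (1 + ?r)) * (\<kappa> * (1 + c * ?r)))"
    proof (rule divide_left_mono)
      show le: "(\<kappa> * (1 + ?r)) * (\<kappa> * (1 + c * ?r)) \<le> cmod (1 + exp w) * cmod (1 + complex_of_real c * exp w)"
        by (rule mult_mono[OF k1 kc norm_ge_zero less_imp_le[OF pos(2)]])
      show "0 < cmod (1 + exp w) * cmod (1 + complex_of_real c * exp w) * ((\<kappa> * (1 + ?r)) * (\<kappa> * (1 + c * ?r)))"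
        using mult_pos_pos[OF pos] le by (metis mult_pos_pos order_less_le_trans)
    qed simp
    also have "\<dots> = \<bar>c - 1\<bar> / \<kappa>\<^sup>2 * (?r / ((1 + ?r) * (1 + c * ?r)))"
      by (simp add: power2_eq_square field_simps)
    also have "\<dots> \<le> \<bar>c - 1\<bar> / \<kappa>\<^sup>2 * (max 1 (1 / c) * exp (- \<bar>Re w\<bar>))"
    proof (intro mult_left_mono)
      have p: "?r > 0" "c * ?r > 0" using assms by auto
      show "?r / ((1 + ?r) * (1 + c * ?r)) \<le> max 1 (1 / c) * exp (- \<bar>Re w\<bar>)"
      proof (cases "Re w \<ge> 0")
        case True
        have "?r * (c * ?r) \<le> (1 + ?r) * (1 + c * ?r)" using p by (intro mult_mono) auto
        then have "?r / ((1 + ?r) * (1 + c * ?r)) \<le> ?r / (?r * (c * ?r))"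
          using p by (intro divide_left_mono) (auto intro!: mult_pos_pos add_pos_pos)
        also have "\<dots> = 1 / c * exp (- \<bar>Re w\<bar>)" using True by (simp add: exp_minus field_simps)
        also have "\<dots> \<le> max 1 (1 / c) * exp (- \<bar>Re w\<bar>)" by (intro mult_right_mono) auto
        finally show ?thesis .
      next
        case False
        have "1 * 1 \<le> (1 + ?r) * (1 + c * ?r)" using p by (intro mult_mono) auto
        then have "?r / ((1 + ?r) * (1 + c * ?r)) \<le> ?r / 1"
          using p by (intro divide_left_mono) (auto intro!: mult_pos_pos add_pos_pos)
        also have "\<dots> = 1 * exp (- \<bar>Re w\<bar>)" using False by simp
        also have "\<dots> \<le> max 1 (1 / c) * exp (- \<bar>Re w\<bar>)" by (intro mult_right_mono) auto
        finally show ?thesis .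
      qed
    qed auto
    finally show "cmod (1 / (1 + exp w) - 1 / (1 + complex_of_real c * exp w)) \<le> B * exp (- 1 * \<bar>Re w\<bar>)"
      by (simp add: B_def mult.assoc)
  qed (use assms in auto)
qed

lemma one_plus_quotient_bounded:
  assumes "0 < \<sigma>" "\<sigma> < pi"
  obtains B where "B > 0" "\<And>w c. \<bar>Im w\<bar> \<le> \<sigma> \<Longrightarrow> c > 0 \<Longrightarrow> cmod (1 / (1 + complex_of_real c * exp w)) \<le> B / (1 + c * exp (Re w))"
proof -
  obtain \<kappa> where k: "\<kappa> > 0"
    "\<And>w c. \<bar>Im w\<bar> \<le> \<sigma> \<Longrightarrow> c > 0 \<Longrightarrow> \<kappa> * (1 + c * exp (Re w)) \<le> cmod (1 + complex_of_real c * exp w)"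
    using norm_one_plus_exp_ge[of \<sigma>] assms by auto
  have "cmod (1 / (1 + complex_of_real c * exp w)) \<le> (1 / \<kappa>) / (1 + c * exp (Re w))" if "\<bar>Im w\<bar> \<le> \<sigma>" "c > 0" for w c
  proof -
    have "0 < \<kappa> * (1 + c * exp (Re w))" using k(1) that by (auto intro!: mult_pos_pos add_pos_pos)
    then have "1 / cmod (1 + complex_of_real c * exp w) \<le> 1 / (\<kappa> * (1 + c * exp (Re w)))"
      using k(2)[OF that] by (intro divide_left_mono) (assumption, simp, metis mult_pos_pos order_less_le_trans)
    then show ?thesis by (simp add: norm_divide)
  qed
  then show ?thesis using that[of "1 / \<kappa>"] k(1) by simp
qed

context sectorial_calculus
begin

abbreviation hc :: "real \<Rightarrow> (complex \<Rightarrow> complex) \<Rightarrow> 'a \<Rightarrow> 'a" where "hc \<equiv> H0_calculus D A"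

lemma hc_eqI:
  "ray_integral D A (-\<nu>) f x - ray_integral D A \<nu> f x = (2 * pi * \<i>) *\<^sub>C y \<Longrightarrow> hc \<nu> f x = y"
  by (simp add: H0_calculus_def scaleC_scaleC)

lemma hc_two_pi_i:
  "ray_integral D A (-\<nu>) f x - ray_integral D A \<nu> f x = (2 * pi * \<i>) *\<^sub>C hc \<nu> f x"
  by (simp add: H0_calculus_def scaleC_scaleC)

lemma hc_cong: "(\<And>z. z \<in> sector \<sigma> \<Longrightarrow> f z = g z) \<Longrightarrow> \<bar>\<nu>\<bar> < \<sigma> \<Longrightarrow> hc \<nu> f x = hc \<nu> g x"
  using ray_integral_cong[of f g \<nu> x] ray_integral_cong[of f g "-\<nu>" x] by (simp add: H0_calculus_def)

lemma hc_add_left: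
  assumes "f \<in> H0_inf \<sigma>" "g \<in> H0_inf \<sigma>" "\<delta> < \<nu>" "\<nu> < \<sigma>"
  shows "hc \<nu> (\<lambda>z. f z + g z) x = hc \<nu> f x + hc \<nu> g x"
  using assms \<delta> by (simp add: H0_calculus_def ray_integral_add_left[OF assms(1,2)] scaleC_simps)

lemma hc_cmult_left:
  assumes "f \<in> H0_inf \<sigma>" "\<delta> < \<nu>" "\<nu> < \<sigma>"
  shows "hc \<nu> (\<lambda>z. c * f z) x = c *\<^sub>C hc \<nu> f x"
  using assms \<delta> by (simp add: H0_calculus_def ray_integral_cmult_left[OF assms(1)] scaleC_simps scaleC_scaleC mult_ac)

lemma hc_commute:
  assumes "f \<in> H0_inf \<sigma>" "\<delta> < \<nu>" "\<nu> < \<sigma>"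
    and B: "bounded_linear B" "\<And>c x. B (c *\<^sub>C x) = c *\<^sub>C B x" "\<And>z x. z \<in> Out \<Longrightarrow> B (R z x) = R z (B x)"
  shows "B (hc \<nu> f x) = hc \<nu> f (B x)"
  using assms(2,3) \<delta> ray_integral_commute[OF assms(1) _ _ B, of \<nu>] ray_integral_commute[OF assms(1) _ _ B, of "-\<nu>"]
    bounded_linear.linear[OF B(1)]
  by (simp add: H0_calculus_def B(2) linear_diff)

lemma ray_integrand_linear:
  assumes "\<delta> < \<bar>a\<bar>" "\<bar>a\<bar> < \<sigma>"
  shows "ray_integrand a f (x + y) = (\<lambda>t. ray_integrand a f x t + ray_integrand a f y t)"
    "ray_integrand a f (c *\<^sub>C x) = (\<lambda>t. c *\<^sub>C ray_integrand a f x t)"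
  using ray_Out[OF assms]
  by (simp_all add: fun_eq_iff ray_integrand_def R_add R_scale scaleC.add_right scaleC_scaleC mult_ac)

lemma hc_add_right:
  assumes "f \<in> H0_inf \<sigma>" "\<delta> < \<nu>" "\<nu> < \<sigma>"
  shows "hc \<nu> f (x + y) = hc \<nu> f x + hc \<nu> f y"
proof -
  have "ray_integral D A a f (x + y) = ray_integral D A a f x + ray_integral D A a f y" if "a = \<nu> \<or> a = -\<nu>" for a
  proof -
    have a: "\<delta> < \<bar>a\<bar>" "\<bar>a\<bar> < \<sigma>" using that assms \<delta> by auto
    show ?thesis unfolding ray_integral_eq ray_integrand_linear[OF a]
      using a assms(1) by (intro integral_add ray_integrand_integrable)
  qed
  then show ?thesis by (simp add: H0_calculus_def scaleC_simps)
qed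

lemma hc_scale_right:
  assumes "f \<in> H0_inf \<sigma>" "\<delta> < \<nu>" "\<nu> < \<sigma>"
  shows "hc \<nu> f (c *\<^sub>C x) = c *\<^sub>C hc \<nu> f x"
proof -
  have "ray_integral D A a f (c *\<^sub>C x) = c *\<^sub>C ray_integral D A a f x" if "a = \<nu> \<or> a = -\<nu>" for a
  proof -
    have a: "\<delta> < \<bar>a\<bar>" "\<bar>a\<bar> < \<sigma>" using that assms \<delta> by auto
    show ?thesis unfolding ray_integral_eq ray_integrand_linear[OF a]
      using integral_linear[OF ray_integrand_integrable[OF assms(1) a] scaleC.bounded_linear_right[of c], of x]
      by (simp add: o_def)
  qed
  then show ?thesis by (simp add: H0_calculus_def scaleC_simps scaleC_scaleC mult_ac)
qed

lemma hc_diff_right: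
  assumes "f \<in> H0_inf \<sigma>" "\<delta> < \<nu>" "\<nu> < \<sigma>"
  shows "hc \<nu> f (x - y) = hc \<nu> f x - hc \<nu> f y"
  using hc_add_right[OF assms, of x "-1 *\<^sub>C y"] hc_scale_right[OF assms, of "-1" y] by simp

lemma hc_bound:
  assumes "f \<in> H0_inf \<sigma>" "\<delta> < \<nu>" "\<nu> < \<sigma>" "\<epsilon> > 0"
    "\<And>w. \<bar>Im w\<bar> < \<sigma> \<Longrightarrow> cmod (f (exp w)) \<le> C * exp (-\<epsilon> * \<bar>Re w + b\<bar>)"
  shows "norm (hc \<nu> f x) \<le> C * (2 / \<epsilon>) * (M * norm x)"
proof -
  have C: "C * (2 / \<epsilon>) * (M * norm x) \<ge> 0"
  proof -
    have "0 \<le> C * exp (-\<epsilon> * \<bar>Re 0 + b\<bar>)" using assms(5)[of 0] \<sigma> by (intro order_trans[OF norm_ge_zero]) auto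
    then have "C \<ge> 0" by (simp add: zero_le_mult_iff)
    then show ?thesis using assms(4) by (intro mult_nonneg_nonneg M_nonneg) auto
  qed
  have "norm (ray_integral D A a f x) \<le> C * (2 / \<epsilon>) * (M * norm x)" if "a = \<nu> \<or> a = -\<nu>" for a
    using that assms(2,3) \<delta> assms(5)[of "Complex t a" for t]
    by (intro ray_integral_bound[OF assms(1) _ _ assms(4)]) auto
  from this[of "-\<nu>"] this[of \<nu>] have "norm (ray_integral D A (-\<nu>) f x - ray_integral D A \<nu> f x) \<le> 2 * (C * (2 / \<epsilon>) * (M * norm x))"
    using norm_triangle_ineq4[of "ray_integral D A (-\<nu>) f x" "ray_integral D A \<nu> f x"] by linarith
  then have "norm (hc \<nu> f x) \<le> 1 / (2 * pi) * (2 * (C * (2 / \<epsilon>) * (M * norm x)))"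
    unfolding H0_calculus_def norm_scaleC by (intro mult_mono) (auto simp: norm_divide norm_mult)
  also have "\<dots> \<le> 1 * (C * (2 / \<epsilon>) * (M * norm x))"
    using C pi_gt3 mult_right_mono[of "1 / pi" 1 "C * (2 / \<epsilon>) * (M * norm x)"] by (simp add: mult_ac)
  finally show ?thesis by simp
qed

text \<open>The operator form of the partial fraction decomposition of 1/((l - z)(1 + bz)): the
  resolvent identity at the points l and -1/b.\<close>

lemma R_J:
  assumes b: "b > 0" and o: "l \<in> Out" and nz: "1 + complex_of_real b * l \<noteq> 0"
  shows "R l (J b x) = (1 / (1 + complex_of_real b * l)) *\<^sub>C R l x + (complex_of_real b / (1 + complex_of_real b * l)) *\<^sub>C J b x"
proof -
  have m: "- complex_of_real (1 / b) \<in> Out" using b by (intro neg_in_Out) auto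
  have r: "R (- complex_of_real (1 / b)) x = - (complex_of_real b *\<^sub>C J b x)"
    using b by (simp add: J_def scaleC_simps scaleC_scaleC)
  have "(- complex_of_real (1 / b) - l) *\<^sub>C R l (- (complex_of_real b *\<^sub>C J b x)) = R l x + complex_of_real b *\<^sub>C J b x"
    using resolvent_identity[OF o m, of x] unfolding r by simp
  then have "((- complex_of_real (1 / b) - l) * (- complex_of_real b)) *\<^sub>C R l (J b x) = R l x + complex_of_real b *\<^sub>C J b x"
    using o by (simp add: R_minus R_scale scaleC_simps scaleC_scaleC)
  moreover have "(- complex_of_real (1 / b) - l) * (- complex_of_real b) = 1 + complex_of_real b * l"
    using b by (simp add: field_simps)
  ultimately have "(1 + complex_of_real b * l) *\<^sub>C R l (J b x) = R l x + complex_of_real b *\<^sub>C J b x" by simp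
  then have "(1 / (1 + complex_of_real b * l)) *\<^sub>C ((1 + complex_of_real b * l) *\<^sub>C R l (J b x)) =
      (1 / (1 + complex_of_real b * l)) *\<^sub>C (R l x + complex_of_real b *\<^sub>C J b x)" by (rule arg_cong)
  then show ?thesis using nz by (simp add: scaleC.add_right scaleC_scaleC)
qed

text \<open>By \<open>R_J\<close> the integrand on each ray is \<lambda> R(\<lambda>) y, with y = J
  1 x - J c x, minus scalar multiples of J 1 x and J c x. The resolvent term is shifted through the
  complement of the sector, the scalar terms across the sector. Their end values contribute 2 pi -
  2\<nu> and 2\<nu>, together 2 pi \<i> y.\<close>

lemma hc_resolvent_difference:
  assumes c: "c > 0" and \<nu>: "\<delta> < \<nu>" "\<nu> < \<sigma>"
  shows "hc \<nu> (\<lambda>z. 1 / (1 + z) - 1 / (1 + complex_of_real c * z)) x = J 1 x - J c x"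
proof -
  let ?u = "\<lambda>z. 1 / (1 + z) - 1 / (1 + complex_of_real c * z)"
  define y where "y = J 1 x - J c x"
  \<comment> \<open>A preimage of y under A. It shows that y lies in the domain and in the range of
    A.\<close>
  define v where "v = complex_of_real c *\<^sub>C J c x - J 1 x"
  have yD: "y \<in> D" and vD: "v \<in> D" using c by (auto simp: y_def v_def J_in_D D_diff D_scale)
  have Av: "A v = y"
    using c by (simp add: y_def v_def A_diff D_scale J_in_D A_scale A_J scaleC_simps scaleC_scaleC)
  have \<nu>': "0 < \<nu>" "\<nu> < pi" using \<nu> \<delta> \<sigma> by auto
  define G where "G w = exp w *\<^sub>C R (exp w) y" for w
  define G' where "G' w = exp w *\<^sub>C R (exp w) y - (exp w * exp w) *\<^sub>C R (exp w) (R (exp w) y)" for w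
  define E where "E a w = complex_of_real a * exp w / (1 + complex_of_real a * exp w)" for a w
  \<comment> \<open>Membership of y in the domain gives convergence of \<lambda> R(\<lambda>) y to y
    at infinity, at the rate 1/\<bar>\<lambda>\<bar>; y = A v gives convergence to 0 at the origin,
    at the rate \<bar>\<lambda>\<bar>.\<close>
  have 1: "((\<lambda>T. integral {-T..T} (\<lambda>t. G (Complex t (2*pi-\<nu>))) - integral {-T..T} (\<lambda>t. G (Complex t \<nu>)))
     \<longlongrightarrow> (\<i> * complex_of_real ((2*pi-\<nu>) - \<nu>)) *\<^sub>C (y - 0)) at_top"
  proof (rule strip_shift_exp[where G'=G' and \<epsilon>=1 and C="M * norm (A y) + (M * norm v + norm v)"])
    let ?S = "{w. Im w \<in> {\<nu>..2*pi-\<nu>}}"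
    have out: "exp w \<in> Out" if "w \<in> ?S" for w using that \<nu> \<nu>' \<delta> by (intro exp_in_Out) auto
    fix w assume "Im w \<in> {\<nu>..2*pi-\<nu>}"
    then have w: "w \<in> ?S" by simp
    have e: "(exp has_derivative (\<lambda>h. exp w * h)) (at w within ?S)"
      using has_derivative_at_withinI[OF DERIV_exp[THEN has_field_derivative_imp_has_derivative]] .
    have "((\<lambda>w. R (exp w) y) has_derivative (\<lambda>h. (exp w * h) *\<^sub>C (- R (exp w) (R (exp w) y)))) (at w within ?S)"
      by (rule has_derivative_in_compose2[OF R_has_derivative _ _ e]) (use out w in auto)
    from scaleC.FDERIV[OF e this]
    show "(G has_derivative (\<lambda>h. h *\<^sub>C G' w)) (at w within ?S)"
      unfolding G_def[abs_def] G'_def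
      by (rule has_derivative_eq_rhs) (simp add: fun_eq_iff scaleC_simps scaleC_scaleC mult_ac)
    have n: "exp w \<in> Out" using out w .
    have "G w - y = R (exp w) (A y)" unfolding G_def using R_A[OF n yD] by simp
    then have "norm (G w - y) \<le> M / exp (Re w) * norm (A y)" using R_bound[OF n, of "A y"] by simp
    also have "\<dots> = M * norm (A y) * exp (- 1 * Re w)" by (simp add: exp_minus field_simps)
    also have "\<dots> \<le> (M * norm (A y) + (M * norm v + norm v)) * exp (- 1 * Re w)"
      using M_nonneg[of v] by (intro mult_right_mono) auto
    finally show "norm (G w - y) \<le> (M * norm (A y) + (M * norm v + norm v)) * exp (- 1 * Re w)" .
    have "G w = exp w *\<^sub>C (exp w *\<^sub>C R (exp w) v - v)" unfolding G_def using R_A[OF n vD] Av by simp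
    then have "norm (G w - 0) = exp (Re w) * norm (exp w *\<^sub>C R (exp w) v - v)" by (simp add: norm_scaleC)
    also have "\<dots> \<le> exp (Re w) * (M * norm v + norm v)"
      using R_bound'[OF n, of v] by (intro mult_left_mono order_trans[OF norm_triangle_ineq4]) (auto simp: norm_scaleC)
    also have "\<dots> \<le> (M * norm (A y) + (M * norm v + norm v)) * exp (1 * Re w)"
      using mult_nonneg_nonneg[OF M_nonneg[of "A y"], of "exp (Re w)"] by (simp add: distrib_left distrib_right mult_ac)
    finally show "norm (G w - 0) \<le> (M * norm (A y) + (M * norm v + norm v)) * exp (1 * Re w)" .
  next
    show "continuous_on {w. Im w \<in> {\<nu>..2*pi-\<nu>}} G'"
    proof -
      have out: "exp w \<in> Out" if "Im w \<in> {\<nu>..2*pi-\<nu>}" for w using that \<nu> \<nu>' \<delta> by (intro exp_in_Out) auto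
      show ?thesis unfolding G'_def
        using out by (intro continuous_intros R_continuous_compose continuous_on_compose2[OF R_R_continuous]) auto
    qed
  qed (use \<nu>' in auto)
  have 2: "((\<lambda>T. integral {-T..T} (\<lambda>t. E a (Complex t \<nu>)) - integral {-T..T} (\<lambda>t. E a (Complex t (-\<nu>))))
     \<longlongrightarrow> \<i> * complex_of_real (\<nu> - (-\<nu>)) * (1 - 0)) at_top" if a: "a > 0" for a
  proof -
    obtain B where B: "B > 0" "\<And>w c. \<bar>Im w\<bar> \<le> \<nu> \<Longrightarrow> c > 0 \<Longrightarrow> cmod (1 / (1 + complex_of_real c * exp w)) \<le> B / (1 + c * exp (Re w))"
      using one_plus_quotient_bounded[OF \<nu>'] by blast
    show ?thesis
    proof (rule strip_shift_holomorphic[where U="{w. \<bar>Im w\<bar> < \<sigma>}" and \<epsilon>=1 and C="B / a + a * B", OF _ _ open_strip])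
      have nz: "1 + complex_of_real a * exp w \<noteq> 0" if "\<bar>Im w\<bar> < \<sigma>" for w
        using one_plus_sector_nonzero[OF \<sigma>(3) exp_in_sector[OF \<sigma>(2) that] a] .
      then show "E a holomorphic_on {w. \<bar>Im w\<bar> < \<sigma>}"
        unfolding E_def[abs_def] by (auto intro!: holomorphic_intros)
      fix w assume w: "Im w \<in> {-\<nu>..\<nu>}"
      then have w': "\<bar>Im w\<bar> \<le> \<nu>" by auto
      have p: "exp (Re w) > 0" "a * exp (Re w) > 0" using a by auto
      have "E a w - 1 = - (1 / (1 + complex_of_real a * exp w))"
        using nz[of w] w' \<nu> by (simp add: E_def field_simps)
      then have "norm (E a w - 1) \<le> B / (1 + a * exp (Re w))" using B(2)[OF w' a] by simp
      also have "\<dots> \<le> B / (a * exp (Re w))" using p B(1) by (intro divide_left_mono) (auto intro!: mult_pos_pos add_pos_pos)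
      also have "\<dots> = B / a * exp (- 1 * Re w)" by (simp add: exp_minus field_simps)
      also have "\<dots> \<le> (B / a + a * B) * exp (- 1 * Re w)" using a B(1) by (intro mult_right_mono) auto
      finally show "norm (E a w - 1) \<le> (B / a + a * B) * exp (- 1 * Re w)" .
      have "norm (E a w - 0) = a * exp (Re w) * cmod (1 / (1 + complex_of_real a * exp w))"
        using a by (simp add: E_def norm_mult norm_divide)
      also have "\<dots> \<le> a * exp (Re w) * (B / (1 + a * exp (Re w)))"
        using p B(2)[OF w' a] by (intro mult_left_mono) auto
      also have "\<dots> \<le> a * exp (Re w) * (B / 1)" using p B(1) by (intro mult_left_mono divide_left_mono) auto
      also have "\<dots> \<le> (B / a + a * B) * exp (1 * Re w)" using a B(1) by (simp add: algebra_simps)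
      finally show "norm (E a w - 0) \<le> (B / a + a * B) * exp (1 * Re w)" .
    qed (use \<nu> \<nu>' in auto)
  qed
  have rc: "ray_integrand a ?u x t = G (Complex t a) - (E 1 (Complex t a) *\<^sub>C J 1 x - E c (Complex t a) *\<^sub>C J c x)"
    if a: "a = \<nu> \<or> a = -\<nu>" for a t
  proof -
    define l where "l = exp (Complex t a)"
    have o: "l \<in> Out" and s: "l \<in> sector \<sigma>"
      unfolding l_def using a \<nu> \<delta> \<sigma> by (auto intro!: ray_Out exp_in_sector)
    have key: "(1 / (1 + complex_of_real b * l)) *\<^sub>C R l x = R l (J b x) - (complex_of_real b / (1 + complex_of_real b * l)) *\<^sub>C J b x"
      if b: "b > 0" for b
      using R_J[OF b o one_plus_sector_nonzero[OF \<sigma>(3) s b], of x] by (simp add: algebra_simps)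
    have "ray_integrand a ?u x t = l *\<^sub>C ((1 / (1 + complex_of_real 1 * l)) *\<^sub>C R l x - (1 / (1 + complex_of_real c * l)) *\<^sub>C R l x)"
      unfolding ray_integrand_def l_def[symmetric] scaleC.diff_left[symmetric] scaleC_scaleC by simp
    also have "\<dots> = G (Complex t a) - (E 1 (Complex t a) *\<^sub>C J 1 x - E c (Complex t a) *\<^sub>C J c x)"
      unfolding key[OF zero_less_one] key[OF c] G_def E_def l_def[symmetric] y_def R_diff[OF o]
      by (simp add: scaleC.diff_right scaleC_scaleC mult_ac)
    finally show ?thesis .
  qed
  have E_cont: "continuous_on X (\<lambda>t. E b (Complex t a))" if "\<bar>a\<bar> < \<sigma>" "b > 0" for X a b
  proof -
    have "1 + complex_of_real b * exp (Complex t a) \<noteq> 0" for t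
      using that by (intro one_plus_sector_nonzero[OF \<sigma>(3) exp_in_sector[OF \<sigma>(2)]]) auto
    then show ?thesis unfolding E_def by (intro continuous_intros) auto
  qed
  have G_cont: "continuous_on X (\<lambda>t. G (Complex t a))" if "\<delta> < \<bar>a\<bar>" "\<bar>a\<bar> < \<sigma>" for X a
    unfolding G_def using ray_Out that by (intro continuous_intros R_continuous_compose) auto
  have int: "integral {-T..T} (ray_integrand a ?u x) = integral {-T..T} (\<lambda>t. G (Complex t a)) -
      (integral {-T..T} (\<lambda>t. E 1 (Complex t a)) *\<^sub>C J 1 x - integral {-T..T} (\<lambda>t. E c (Complex t a)) *\<^sub>C J c x)"
    if a: "a = \<nu> \<or> a = -\<nu>" for a T
  proof -
    have a': "\<delta> < \<bar>a\<bar>" "\<bar>a\<bar> < \<sigma>" using a \<nu> \<delta> by auto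
    have I: "((\<lambda>t. E b (Complex t a) *\<^sub>C z) has_integral integral {-T..T} (\<lambda>t. E b (Complex t a)) *\<^sub>C z) {-T..T}" if "b > 0" for b and z :: 'a
      using has_integral_linear[OF integrable_integral[OF integrable_continuous_interval[OF E_cont[OF a'(2) that]]]
          scaleC.bounded_linear_left[of z]] by (simp add: o_def)
    show ?thesis unfolding rc[OF a, THEN ext]
      by (intro integral_unique has_integral_diff I integrable_integral integrable_continuous_interval G_cont a' c zero_less_one)
  qed
  have u: "?u \<in> H0_inf \<sigma>" using resolvent_difference_in_H0[OF \<sigma>(3,4) c] .
  have "((\<lambda>T. integral {-T..T} (ray_integrand (-\<nu>) ?u x) - integral {-T..T} (ray_integrand \<nu> ?u x))
     \<longlongrightarrow> ray_integral D A (-\<nu>) ?u x - ray_integral D A \<nu> ?u x) at_top"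
    unfolding ray_integral_eq using \<nu> \<nu>'
    by (intro tendsto_diff integral_symmetric_tendsto ray_integrand_integrable[OF u]) auto
  moreover have "((\<lambda>T. integral {-T..T} (ray_integrand (-\<nu>) ?u x) - integral {-T..T} (ray_integrand \<nu> ?u x))
     \<longlongrightarrow> (\<i> * complex_of_real ((2*pi-\<nu>) - \<nu>)) *\<^sub>C (y - 0) +
        ((\<i> * complex_of_real (\<nu> - (-\<nu>)) * (1 - 0)) *\<^sub>C J 1 x - (\<i> * complex_of_real (\<nu> - (-\<nu>)) * (1 - 0)) *\<^sub>C J c x)) at_top"
  proof (rule Lim_transform_eventually[OF tendsto_add[OF 1 tendsto_diff[OF
          scaleC.tendsto[OF 2[OF zero_less_one] tendsto_const] scaleC.tendsto[OF 2[OF c] tendsto_const]]]], intro always_eventually allI)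
    fix T :: real
    have G2: "G (Complex t (2*pi-\<nu>)) = G (Complex t (-\<nu>))" for t by (simp only: G_def exp_Complex_2pi_minus)
    show "integral {-T..T} (\<lambda>t. G (Complex t (2*pi-\<nu>))) - integral {-T..T} (\<lambda>t. G (Complex t \<nu>)) +
        ((integral {-T..T} (\<lambda>t. E 1 (Complex t \<nu>)) - integral {-T..T} (\<lambda>t. E 1 (Complex t (-\<nu>)))) *\<^sub>C J 1 x -
         (integral {-T..T} (\<lambda>t. E c (Complex t \<nu>)) - integral {-T..T} (\<lambda>t. E c (Complex t (-\<nu>)))) *\<^sub>C J c x) =
        integral {-T..T} (ray_integrand (-\<nu>) ?u x) - integral {-T..T} (ray_integrand \<nu> ?u x)"
      unfolding G2 int[of \<nu>, simplified] int[of "-\<nu>", simplified] by (simp add: scaleC.diff_left)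
  qed
  ultimately have "ray_integral D A (-\<nu>) ?u x - ray_integral D A \<nu> ?u x =
      (\<i> * complex_of_real ((2*pi-\<nu>) - \<nu>)) *\<^sub>C (y - 0) +
        ((\<i> * complex_of_real (\<nu> - (-\<nu>)) * (1 - 0)) *\<^sub>C J 1 x - (\<i> * complex_of_real (\<nu> - (-\<nu>)) * (1 - 0)) *\<^sub>C J c x)"
    using tendsto_unique[OF trivial_limit_at_top_linorder] by blast
  also have "\<dots> = (\<i> * complex_of_real ((2*pi-\<nu>) - \<nu>) + \<i> * complex_of_real (\<nu> - (-\<nu>))) *\<^sub>C y"
    by (simp only: y_def scaleC.add_left scaleC.diff_right diff_zero mult_1_right add_diff_add)
  also have "\<i> * complex_of_real ((2*pi-\<nu>) - \<nu>) + \<i> * complex_of_real (\<nu> - (-\<nu>)) = 2 * pi * \<i>"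
    by (simp add: algebra_simps)
  finally show ?thesis unfolding y_def by (rule hc_eqI)
qed

end

lemma H0_ray_integrable:
  assumes "0 < \<sigma>" "\<sigma> \<le> pi" "F \<in> H0_inf \<sigma>" "\<bar>a\<bar> < \<sigma>"
  shows "(\<lambda>t. F (exp (Complex t a))) integrable_on UNIV"
proof -
  obtain \<epsilon> C where e: "\<epsilon> > 0" "C \<ge> 0" "\<And>w. \<bar>Im w\<bar> < \<sigma> \<Longrightarrow> cmod (F (exp w)) \<le> C * exp (-\<epsilon> * \<bar>Re w\<bar>)"
    using H0_infE[OF assms(1-3)] by blast
  have c: "continuous_on (sector \<sigma>) F"
    by (rule holomorphic_on_imp_continuous_on[OF H0_inf_holomorphic[OF assms(3)]])
  show ?thesis
    using e(3)[of "Complex t a" for t] assms(4)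
    by (intro exp_dominated_integrable[OF continuous_on_ray[OF assms(1,2) c assms(4)] e(1), of C 0]) simp
qed

lemma H0_ray_integrals_eq:
  assumes "0 < \<nu>" "\<nu> < \<sigma>" "\<sigma> \<le> pi" "F \<in> H0_inf \<sigma>"
  shows "integral UNIV (\<lambda>t. F (exp (Complex t (-\<nu>)))) = integral UNIV (\<lambda>t. F (exp (Complex t \<nu>)))"
proof -
  obtain \<epsilon> C where e: "\<epsilon> > 0" "C \<ge> 0" "\<And>w. \<bar>Im w\<bar> < \<sigma> \<Longrightarrow> cmod (F (exp w)) \<le> C * exp (-\<epsilon> * \<bar>Re w\<bar>)"
    using H0_infE[of \<sigma> F] assms by auto
  show ?thesis
    by (rule ray_integrals_eq[OF assms(1-3) H0_inf_holomorphic[OF assms(4)] e(1), of C]) (use e(3) assms in auto)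
qed

lemma exp_dominated_kernel_integrable:
  fixes k :: "real \<Rightarrow> real \<Rightarrow> 'a::banach"
  assumes cont: "continuous_on UNIV (\<lambda>(s,t). k s t)" and "\<epsilon> > 0"
    and bd: "\<And>s t. norm (k s t) \<le> C * exp (-\<epsilon> * \<bar>s\<bar>) * exp (-\<epsilon> * \<bar>t\<bar>)"
  shows "k s integrable_on UNIV" and "(\<lambda>s. integral UNIV (k s)) integrable_on UNIV"
proof -
  have "continuous_on UNIV (\<lambda>t. (s, t))" by (intro continuous_intros)
  from continuous_on_compose2[OF cont this] have "continuous_on UNIV (k s)" by simp
  then show "k s integrable_on UNIV"
    by (rule exp_dominated_integrable[OF _ \<open>\<epsilon> > 0\<close>, of _ "C * exp (-\<epsilon> * \<bar>s\<bar>)" 0]) (use bd in simp)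
  show "(\<lambda>s. integral UNIV (k s)) integrable_on UNIV"
    using inner_integral_exp_dominated(1,2)[OF assms]
    by (intro exp_dominated_integrable[OF _ \<open>\<epsilon> > 0\<close>, of _ "C * (2 / \<epsilon>)" 0]) auto
qed

lemma one_plus_holomorphic:
  assumes "0 < \<sigma>" "c > 0" "h holomorphic_on sector \<sigma>"
  shows "(\<lambda>z. h z / (1 + complex_of_real c * z)) holomorphic_on sector \<sigma>"
  using one_plus_sector_nonzero[OF assms(1) _ assms(2)] assms(3) by (auto intro!: holomorphic_intros)

lemma H0_inf_div_one_plus:
  assumes "0 < \<sigma>" "\<sigma> < pi" "c > 0" "f \<in> H0_inf \<sigma>"
  shows "(\<lambda>z. f z * (1 / (1 + complex_of_real c * z))) \<in> H0_inf \<sigma>"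
    and "(\<lambda>z. f z * (complex_of_real c * z / (1 + complex_of_real c * z))) \<in> H0_inf \<sigma>"
proof -
  obtain B where B: "B > 0" "\<And>w c. \<bar>Im w\<bar> \<le> \<sigma> \<Longrightarrow> c > 0 \<Longrightarrow> cmod (1 / (1 + complex_of_real c * exp w)) \<le> B / (1 + c * exp (Re w))"
    using one_plus_quotient_bounded[OF assms(1,2)] by blast
  have b: "cmod (1 / (1 + complex_of_real c * exp w)) \<le> B" "cmod (complex_of_real c * exp w / (1 + complex_of_real c * exp w)) \<le> B"
    if w: "\<bar>Im w\<bar> < \<sigma>" for w
  proof -
    have p: "0 < c * exp (Re w)" using assms by simp
    have 1: "cmod (1 / (1 + complex_of_real c * exp w)) \<le> B / (1 + c * exp (Re w))" using B(2) w assms by simp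
    also have "\<dots> \<le> B / 1" using p B(1) by (intro divide_left_mono) auto
    finally show "cmod (1 / (1 + complex_of_real c * exp w)) \<le> B" by simp
    have "cmod (complex_of_real c * exp w / (1 + complex_of_real c * exp w)) =
        c * exp (Re w) * cmod (1 / (1 + complex_of_real c * exp w))" using assms by (simp add: norm_mult norm_divide)
    also have "\<dots> \<le> c * exp (Re w) * (B / (1 + c * exp (Re w)))" using 1 p by (intro mult_left_mono) auto
    also have "\<dots> \<le> B" using p B(1) by (simp add: divide_le_eq add_pos_pos)
    finally show "cmod (complex_of_real c * exp w / (1 + complex_of_real c * exp w)) \<le> B" .
  qed
  show "(\<lambda>z. f z * (1 / (1 + complex_of_real c * z))) \<in> H0_inf \<sigma>"
    by (rule H0_inf_mult_bounded[OF assms(1) _ assms(4) one_plus_holomorphic b(1)])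
       (use assms in \<open>auto intro!: holomorphic_intros\<close>)
  show "(\<lambda>z. f z * (complex_of_real c * z / (1 + complex_of_real c * z))) \<in> H0_inf \<sigma>"
    by (rule H0_inf_mult_bounded[OF assms(1) _ assms(4) one_plus_holomorphic b(2)])
       (use assms in \<open>auto intro!: holomorphic_intros\<close>)
qed

text \<open>The difference of the arguments lies between \<nu>' - \<nu> and \<nu> + \<nu>', a
  compact part of (0, 2 pi), on which the cosine is bounded away from 1.\<close>

lemma norm_exp_diff_ge_separated:
  assumes "0 \<le> \<nu>" "\<nu> < \<nu>'" "\<nu> + \<nu>' < 2 * pi"
  obtains \<kappa> where "\<kappa> > 0"
    "\<And>w m. \<bar>Im w\<bar> \<le> \<nu> \<Longrightarrow> \<bar>Im m\<bar> = \<nu>' \<Longrightarrow> \<kappa> * (exp (Re m) + exp (Re w)) \<le> cmod (exp m - exp w)"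
proof -
  have c1: "cos d < 1" if "0 < d" "d < 2 * pi" for d
  proof (cases "d \<le> pi")
    case True
    then show ?thesis using cos_monotone_0_pi[of 0 d] that by auto
  next
    case False
    have "cos d = cos (2 * pi - d)" by (simp add: cos_diff)
    also have "\<dots> < 1" using cos_monotone_0_pi[of 0 "2 * pi - d"] that False by auto
    finally show ?thesis .
  qed
  define k where "k = max 0 (max (cos (\<nu>' - \<nu>)) (cos (\<nu> + \<nu>')))"
  have k: "0 \<le> k" "k < 1" using c1[of "\<nu>' - \<nu>"] c1[of "\<nu> + \<nu>'"] assms by (auto simp: k_def)
  show ?thesis
  proof
    show "sqrt ((1 - k) / 2) > 0" using k by simp
    fix w m :: complex assume w: "\<bar>Im w\<bar> \<le> \<nu>" and m: "\<bar>Im m\<bar> = \<nu>'"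
    define d where "d = \<bar>Im m - Im w\<bar>"
    have d: "\<nu>' - \<nu> \<le> d" "d \<le> \<nu> + \<nu>'" using w m by (auto simp: d_def)
    have "cos d \<le> k"
    proof (cases "d \<le> pi")
      case True
      have "cos d \<le> cos (\<nu>' - \<nu>)" using d True assms by (intro cos_monotone_0_pi_le) auto
      then show ?thesis by (simp add: k_def)
    next
      case False
      have "cos d = cos (2 * pi - d)" by (simp add: cos_diff)
      also have "\<dots> \<le> cos (2 * pi - (\<nu> + \<nu>'))" using d False assms by (intro cos_monotone_0_pi_le) auto
      also have "\<dots> = cos (\<nu> + \<nu>')" by (simp add: cos_diff)
      finally show ?thesis by (simp add: k_def)
    qed
    then have "cos (Im m - Im w) \<le> k" by (simp add: d_def)
    from norm_exp_diff_ge[OF this k]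
    show "sqrt ((1 - k) / 2) * (exp (Re m) + exp (Re w)) \<le> cmod (exp m - exp w)" .
  qed
qed

section \<open>Products in the calculus and independence of the angle\<close>

context sectorial_calculus
begin

text \<open>\<open>R_J\<close> produces the desired integrand plus a scalar integrand times
  \<open>J c x\<close>; the scalar integrals over the two rays are equal by Cauchy's theorem and
  cancel.\<close>

lemma hc_J:
  assumes c: "c > 0" and f: "f \<in> H0_inf \<sigma>" and \<nu>: "\<delta> < \<nu>" "\<nu> < \<sigma>"
  shows "hc \<nu> f (J c x) = hc \<nu> (\<lambda>z. f z * (1 / (1 + complex_of_real c * z))) x"
proof -
  let ?g = "\<lambda>z. f z * (1 / (1 + complex_of_real c * z))"
  let ?F = "\<lambda>z. f z * (complex_of_real c * z / (1 + complex_of_real c * z))"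
  have g: "?g \<in> H0_inf \<sigma>" and F: "?F \<in> H0_inf \<sigma>"
    using H0_inf_div_one_plus[OF \<sigma>(3,4) c f] by auto
  have "ray_integral D A a f (J c x) = ray_integral D A a ?g x + integral UNIV (\<lambda>t. ?F (exp (Complex t a))) *\<^sub>C J c x"
    if a: "\<delta> < \<bar>a\<bar>" "\<bar>a\<bar> < \<sigma>" for a
  proof -
    have rr: "ray_integrand a f (J c x) t = ray_integrand a ?g x t + ?F (exp (Complex t a)) *\<^sub>C J c x" for t
    proof -
      have s: "exp (Complex t a) \<in> sector \<sigma>" using a \<sigma> by (intro exp_in_sector) auto
      show ?thesis
        unfolding ray_integrand_def R_J[OF c ray_Out[OF a] one_plus_sector_nonzero[OF \<sigma>(3) s c]]
        by (simp add: scaleC.add_right scaleC_scaleC mult_ac)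
    qed
    have I: "((\<lambda>t. ?F (exp (Complex t a)) *\<^sub>C J c x) has_integral integral UNIV (\<lambda>t. ?F (exp (Complex t a))) *\<^sub>C J c x) UNIV"
      using has_integral_linear[OF integrable_integral[OF H0_ray_integrable[OF \<sigma>(3,2) F a(2)]] scaleC.bounded_linear_left[of "J c x"]]
      by (simp add: o_def)
    have eqf: "ray_integrand a f (J c x) = (\<lambda>t. ray_integrand a ?g x t + ?F (exp (Complex t a)) *\<^sub>C J c x)"
      by (rule ext) (rule rr)
    show ?thesis unfolding ray_integral_eq eqf
      by (rule integral_unique[OF has_integral_add[OF integrable_integral[OF ray_integrand_integrable[OF g a]] I]])
  qed
  from this[of \<nu>] this[of "-\<nu>"] show ?thesis
    using H0_ray_integrals_eq[OF _ \<nu>(2) \<sigma>(2) F] \<nu> \<delta> by (simp add: H0_calculus_def)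
qed

lemma J_hc_commute:
  assumes "c > 0" "f \<in> H0_inf \<sigma>" "\<delta> < \<nu>" "\<nu> < \<sigma>"
  shows "J c (hc \<nu> f x) = hc \<nu> f (J c x)"
  using assms by (intro hc_commute J_bounded_linear J_linear J_R_commute)

text \<open>For h = (1 + z) f, \<open>hc_J\<close> turns h(A) into f(A) after composition with J 1 =
  (1 + A)^-1. Thus f(A)x is a value of J 1, and A J 1 = 1 - J 1 gives the formula.\<close>

lemma hc_A:
  assumes f: "f \<in> H0_inf \<sigma>" and zf: "(\<lambda>z. z * f z) \<in> H0_inf \<sigma>" and \<nu>: "\<delta> < \<nu>" "\<nu> < \<sigma>"
  shows "hc \<nu> f x \<in> D" "A (hc \<nu> f x) = hc \<nu> (\<lambda>z. z * f z) x"
proof -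
  let ?h = "\<lambda>z. f z + z * f z"
  have h: "?h \<in> H0_inf \<sigma>" using H0_inf_add[OF \<sigma>(3,2) f zf] .
  have "J 1 (hc \<nu> ?h x) = hc \<nu> (\<lambda>z. ?h z * (1 / (1 + complex_of_real 1 * z))) x"
    using J_hc_commute[OF zero_less_one h \<nu>] hc_J[OF zero_less_one h \<nu>] by simp
  also have "\<dots> = hc \<nu> f x"
  proof (rule hc_cong)
    fix z assume z: "z \<in> sector \<sigma>"
    have "1 + z \<noteq> 0" using one_plus_sector_nonzero[OF \<sigma>(3) z zero_less_one] by simp
    then show "?h z * (1 / (1 + complex_of_real 1 * z)) = f z" by (simp add: field_simps)
  qed (use \<nu> \<delta> in auto)
  finally have eq: "J 1 (hc \<nu> ?h x) = hc \<nu> f x" .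
  show "hc \<nu> f x \<in> D" unfolding eq[symmetric] by (rule J_in_D) simp
  have "A (hc \<nu> f x) = hc \<nu> ?h x - hc \<nu> f x" using A_J[OF zero_less_one, of "hc \<nu> ?h x"] unfolding eq by simp
  then show "A (hc \<nu> f x) = hc \<nu> (\<lambda>z. z * f z) x" using hc_add_left[OF f zf \<nu>, of x] by simp
qed

lemma ray_integral_diff_right:
  assumes "f \<in> H0_inf \<sigma>" "\<delta> < \<bar>a\<bar>" "\<bar>a\<bar> < \<sigma>"
  shows "ray_integral D A a f (x - y) = ray_integral D A a f x - ray_integral D A a f y"
proof -
  have "ray_integrand a f (x - y) = (\<lambda>t. ray_integrand a f x t - ray_integrand a f y t)"
    using ray_Out[OF assms(2,3)] by (simp add: fun_eq_iff ray_integrand_def R_diff scaleC_simps)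
  then show ?thesis unfolding ray_integral_eq
    by (simp add: integral_diff[OF ray_integrand_integrable[OF assms] ray_integrand_integrable[OF assms]])
qed

text \<open>With \<open>\<lambda>\<close> on the inner and \<open>\<mu>\<close> on the outer contour, the resolvent identity splits the
  double integral into two; the inner integration gives Cauchy's formula for \<open>g\<close> in the first
  one and zero in the second one.\<close>

lemma hc_product_two_angles:
  assumes f: "f \<in> H0_inf \<sigma>" and g: "g \<in> H0_inf \<sigma>" and \<nu>: "\<delta> < \<nu>" "\<nu> < \<nu>'" "\<nu>' < \<sigma>"
  shows "hc \<nu> f (hc \<nu>' g x) = hc \<nu> (\<lambda>z. f z * g z) x"
proof -
  have \<nu>0: "0 < \<nu>" "\<nu> + \<nu>' < 2 * pi" using \<nu> \<delta> \<sigma> by auto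
  obtain \<kappa> where \<kappa>: "\<kappa> > 0"
    "\<And>w m. \<bar>Im w\<bar> \<le> \<nu> \<Longrightarrow> \<bar>Im m\<bar> = \<nu>' \<Longrightarrow> \<kappa> * (exp (Re m) + exp (Re w)) \<le> cmod (exp m - exp w)"
    using norm_exp_diff_ge_separated[of \<nu> \<nu>'] \<nu> \<nu>0 by auto
  obtain \<epsilon>1 C1 where e1: "\<epsilon>1 > 0" "C1 \<ge> 0" "\<And>w. \<bar>Im w\<bar> < \<sigma> \<Longrightarrow> cmod (f (exp w)) \<le> C1 * exp (-\<epsilon>1 * \<bar>Re w\<bar>)"
    using H0_infE[OF \<sigma>(3,2) f] by blast
  obtain \<epsilon>2 C2 where e2: "\<epsilon>2 > 0" "C2 \<ge> 0" "\<And>w. \<bar>Im w\<bar> < \<sigma> \<Longrightarrow> cmod (g (exp w)) \<le> C2 * exp (-\<epsilon>2 * \<bar>Re w\<bar>)"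
    using H0_infE[OF \<sigma>(3,2) g] by blast
  define \<epsilon> where "\<epsilon> = min \<epsilon>1 \<epsilon>2"
  have \<epsilon>: "\<epsilon> > 0" using e1 e2 by (simp add: \<epsilon>_def)
  have bf: "cmod (f (exp w)) \<le> C1 * exp (-\<epsilon> * \<bar>Re w\<bar>)" if "\<bar>Im w\<bar> < \<sigma>" for w
  proof -
    have "exp (-\<epsilon>1 * \<bar>Re w\<bar>) \<le> exp (-\<epsilon> * \<bar>Re w\<bar>)" by (auto simp: \<epsilon>_def intro!: mult_right_mono)
    then show ?thesis using e1(3)[OF that] e1(2) by (meson mult_left_mono order_trans)
  qed
  have bg: "cmod (g (exp w)) \<le> C2 * exp (-\<epsilon> * \<bar>Re w\<bar>)" if "\<bar>Im w\<bar> < \<sigma>" for w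
  proof -
    have "exp (-\<epsilon>2 * \<bar>Re w\<bar>) \<le> exp (-\<epsilon> * \<bar>Re w\<bar>)" by (auto simp: \<epsilon>_def intro!: mult_right_mono)
    then show ?thesis using e2(3)[OF that] e2(2) by (meson mult_left_mono order_trans)
  qed
  have fc: "continuous_on (sector \<sigma>) f" and gc: "continuous_on (sector \<sigma>) g"
    using f g by (auto intro: holomorphic_on_imp_continuous_on H0_inf_holomorphic)
  define l where "l a s = exp (Complex s a)" for a s
  define q where "q a b s t = f (l a s) * g (l b t) / (l b t - l a s) * l a s * l b t" for a b s t
  define k1 where "k1 a b s t = q a b s t *\<^sub>C R (l a s) x" for a b s t
  define k2 where "k2 a b s t = q a b s t *\<^sub>C R (l b t) x" for a b s t
  define C where "C = C1 * C2 / \<kappa> * (M * norm x)"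
  have in1: "\<delta> < \<bar>a\<bar>" "\<bar>a\<bar> < \<sigma>" "\<bar>a\<bar> \<le> \<nu>" if "a = \<nu> \<or> a = -\<nu>" for a using that \<nu> \<nu>0 by auto
  have in2: "\<delta> < \<bar>b\<bar>" "\<bar>b\<bar> < \<sigma>" "\<bar>b\<bar> = \<nu>'" if "b = \<nu>' \<or> b = -\<nu>'" for b using that \<nu> \<nu>0 by auto
  {
    fix a b assume a: "a = \<nu> \<or> a = -\<nu>" and b: "b = \<nu>' \<or> b = -\<nu>'"
    note a' = in1[OF a] and b' = in2[OF b]
    have sep: "\<kappa> * (exp t + exp s) \<le> cmod (l b t - l a s)" for s t
      using \<kappa>(2)[of "Complex s a" "Complex t b"] a' b' by (simp add: l_def)
    have sep_pos: "0 < cmod (l b t - l a s)" for s t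
      by (rule less_le_trans[OF _ sep]) (use \<kappa>(1) in \<open>auto intro!: mult_pos_pos add_pos_pos\<close>)
    have nz: "l b t - l a s \<noteq> 0" for s t using sep_pos[of t s] by auto
    \<comment> \<open>The separation of the contours absorbs one of the factors
      \<bar>\<lambda>\<bar> and \<bar>\<mu>\<bar> that come from the logarithmic parametrization;
      the resolvent bound absorbs the other one.\<close>
    have qbd: "exp t / cmod (l b t - l a s) \<le> 1 / \<kappa>" "exp s / cmod (l b t - l a s) \<le> 1 / \<kappa>" for s t
    proof -
      have "\<kappa> * exp t \<le> cmod (l b t - l a s)" "\<kappa> * exp s \<le> cmod (l b t - l a s)"
        using \<kappa>(1) by (auto intro!: order_trans[OF mult_left_mono sep[of t s]])
      then show "exp t / cmod (l b t - l a s) \<le> 1 / \<kappa>" "exp s / cmod (l b t - l a s) \<le> 1 / \<kappa>"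
        using sep_pos[of t s] \<kappa>(1) by (auto simp: pos_divide_le_eq pos_le_divide_eq mult.commute)
    qed
    have bfl: "cmod (f (l a s)) \<le> C1 * exp (-\<epsilon> * \<bar>s\<bar>)" for s using bf[of "Complex s a"] a' by (simp add: l_def)
    have bgl: "cmod (g (l b t)) \<le> C2 * exp (-\<epsilon> * \<bar>t\<bar>)" for t using bg[of "Complex t b"] b' by (simp add: l_def)
    have nl: "cmod (l c t) = exp t" for c t by (simp add: l_def)
    have oa: "l a s \<in> Out" and ob: "l b t \<in> Out" for s t using ray_Out a' b' by (auto simp: l_def)
    have fg: "cmod (f (l a s)) * cmod (g (l b t)) \<le> (C1 * exp (-\<epsilon> * \<bar>s\<bar>)) * (C2 * exp (-\<epsilon> * \<bar>t\<bar>))" for s t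
      using bfl bgl e1(2) by (intro mult_mono) auto
    have k1_bd: "norm (k1 a b s t) \<le> C * exp (-\<epsilon> * \<bar>s\<bar>) * exp (-\<epsilon> * \<bar>t\<bar>)" for s t
    proof -
      have "norm (k1 a b s t) = (cmod (f (l a s)) * cmod (g (l b t))) * ((exp t / cmod (l b t - l a s)) * (cmod (l a s) * norm (R (l a s) x)))"
        by (simp add: k1_def q_def norm_scaleC norm_mult norm_divide nl)
      also have "\<dots> \<le> ((C1 * exp (-\<epsilon> * \<bar>s\<bar>)) * (C2 * exp (-\<epsilon> * \<bar>t\<bar>))) * ((1 / \<kappa>) * (M * norm x))"
        using \<kappa>(1) e1(2) e2(2) by (intro mult_mono fg qbd R_bound' oa) (auto intro!: mult_nonneg_nonneg)
      finally show ?thesis by (simp add: C_def mult_ac)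
    qed
    have k2_bd: "norm (k2 a b s t) \<le> C * exp (-\<epsilon> * \<bar>s\<bar>) * exp (-\<epsilon> * \<bar>t\<bar>)" for s t
    proof -
      have "norm (k2 a b s t) = (cmod (f (l a s)) * cmod (g (l b t))) * ((exp s / cmod (l b t - l a s)) * (cmod (l b t) * norm (R (l b t) x)))"
        by (simp add: k2_def q_def norm_scaleC norm_mult norm_divide nl)
      also have "\<dots> \<le> ((C1 * exp (-\<epsilon> * \<bar>s\<bar>)) * (C2 * exp (-\<epsilon> * \<bar>t\<bar>))) * ((1 / \<kappa>) * (M * norm x))"
        using \<kappa>(1) e1(2) e2(2) by (intro mult_mono fg qbd R_bound' ob) (auto intro!: mult_nonneg_nonneg)
      finally show ?thesis by (simp add: C_def mult_ac)
    qed
    have lc: "continuous_on X (\<lambda>p. l c (h p))" if "continuous_on X h" for X :: "(real \<times> real) set" and h c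
      unfolding l_def Complex_eq using that by (intro continuous_intros)
    have flc: "continuous_on X (\<lambda>p. F (l c (h p)))" if "continuous_on X h" "continuous_on (sector \<sigma>) F" "\<bar>c\<bar> < \<sigma>"
      for X :: "(real \<times> real) set" and h c and F :: "complex \<Rightarrow> complex"
      using exp_in_sector[OF \<sigma>(2), of "Complex t c" for t] that(3)
      by (intro continuous_on_compose2[OF that(2) lc[OF that(1)]]) (auto simp: l_def)
    have qc: "continuous_on UNIV (\<lambda>p. q a b (fst p) (snd p))"
      unfolding q_def using nz a' b' fc gc
      by (intro continuous_intros flc lc) auto
    have k1_c: "continuous_on UNIV (\<lambda>(s, t). k1 a b s t)"
      unfolding k1_def split_beta using oa
      by (intro continuous_intros qc R_continuous_compose lc) auto
    have k2_c: "continuous_on UNIV (\<lambda>(s, t). k2 a b s t)"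
      unfolding k2_def split_beta using ob
      by (intro continuous_intros qc R_continuous_compose lc) auto
    have Q: "ray_integral D A a f (ray_integral D A b g x) =
        integral UNIV (\<lambda>s. integral UNIV (k1 a b s)) - integral UNIV (\<lambda>s. integral UNIV (k2 a b s))"
    proof -
      have rs: "ray_integrand a f (ray_integrand b g x t) s = k1 a b s t - k2 a b s t" for s t
      proof -
        have "k1 a b s t - k2 a b s t = (q a b s t * (l b t - l a s)) *\<^sub>C R (l a s) (R (l b t) x)"
          unfolding k1_def k2_def scaleC.diff_right[symmetric] resolvent_identity[OF oa ob, symmetric] scaleC_scaleC ..
        also have "q a b s t * (l b t - l a s) = l a s * f (l a s) * (l b t * g (l b t))"
          using nz[of t s] by (simp add: q_def)
        finally show ?thesis using R_scale[OF oa]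
          by (simp add: ray_integrand_def l_def[symmetric] scaleC_scaleC)
      qed
      have bl: "bounded_linear (\<lambda>y. ray_integrand a f y s)" for s
        unfolding ray_integrand_def l_def[symmetric]
        by (rule bounded_linear_compose[OF scaleC.bounded_linear_right Out_bounded_linear[OF oa]])
      have "ray_integrand a f (ray_integral D A b g x) s = integral UNIV (k1 a b s) - integral UNIV (k2 a b s)" for s
      proof -
        have "ray_integrand a f (ray_integral D A b g x) s = integral UNIV (\<lambda>t. ray_integrand a f (ray_integrand b g x t) s)"
          unfolding ray_integral_eq using integral_linear[OF ray_integrand_integrable[OF g b'(1,2)] bl] by (simp add: o_def)
        also have "\<dots> = integral UNIV (k1 a b s) - integral UNIV (k2 a b s)"
          unfolding rs
          by (rule integral_diff exp_dominated_kernel_integrable(1)[OF k1_c \<epsilon> k1_bd]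
              exp_dominated_kernel_integrable(1)[OF k2_c \<epsilon> k2_bd])+
        finally show ?thesis .
      qed
      then have "ray_integrand a f (ray_integral D A b g x) = (\<lambda>s. integral UNIV (k1 a b s) - integral UNIV (k2 a b s))"
        by (rule ext)
      then show ?thesis unfolding ray_integral_eq[of a]
        using integral_diff[OF exp_dominated_kernel_integrable(2)[OF k1_c \<epsilon> k1_bd]
              exp_dominated_kernel_integrable(2)[OF k2_c \<epsilon> k2_bd]] by simp
    qed
    have inner1: "integral UNIV (k1 a b s) = (f (l a s) * l a s * integral UNIV (\<lambda>t. g (l b t) * l b t / (l b t - l a s))) *\<^sub>C R (l a s) x" for s
    proof -
      have "(\<lambda>t. g (l b t) * l b t / (l b t - l a s)) integrable_on UNIV"
      proof (rule exp_dominated_integrable[OF _ \<epsilon>, of _ "C2 / \<kappa>" 0])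
        show "continuous_on UNIV (\<lambda>t. g (l b t) * l b t / (l b t - l a s))"
          using nz continuous_on_ray[OF \<sigma>(3,2) gc b'(2)]
          by (intro continuous_intros) (auto simp: l_def intro: continuous_intros)
        fix t
        have "norm (g (l b t) * l b t / (l b t - l a s)) = cmod (g (l b t)) * (exp t / cmod (l b t - l a s))"
          by (simp add: norm_mult norm_divide nl)
        also have "\<dots> \<le> (C2 * exp (-\<epsilon> * \<bar>t\<bar>)) * (1 / \<kappa>)" using e2(2) by (intro mult_mono bgl qbd) auto
        finally show "norm (g (l b t) * l b t / (l b t - l a s)) \<le> C2 / \<kappa> * exp (-\<epsilon> * \<bar>t + 0\<bar>)" by simp
      qed
      from integral_linear[OF this scaleC.bounded_linear_left[of "(f (l a s) * l a s) *\<^sub>C R (l a s) x"]]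
      show ?thesis by (simp add: o_def k1_def[abs_def] q_def scaleC_scaleC mult_ac)
    qed
    have inner2: "integral UNIV (\<lambda>s. k2 a b s t) = integral UNIV (\<lambda>s. f (l a s) * l a s / (l b t - l a s)) *\<^sub>C ((g (l b t) * l b t) *\<^sub>C R (l b t) x)" for t
    proof -
      have "(\<lambda>s. f (l a s) * l a s / (l b t - l a s)) integrable_on UNIV"
      proof (rule exp_dominated_integrable[OF _ \<epsilon>, of _ "C1 / \<kappa>" 0])
        show "continuous_on UNIV (\<lambda>s. f (l a s) * l a s / (l b t - l a s))"
          using nz continuous_on_ray[OF \<sigma>(3,2) fc a'(2)]
          by (intro continuous_intros) (auto simp: l_def intro: continuous_intros)
        fix s
        have "norm (f (l a s) * l a s / (l b t - l a s)) = cmod (f (l a s)) * (exp s / cmod (l b t - l a s))"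
          by (simp add: norm_mult norm_divide nl)
        also have "\<dots> \<le> (C1 * exp (-\<epsilon> * \<bar>s\<bar>)) * (1 / \<kappa>)" using e1(2) by (intro mult_mono bfl qbd) auto
        finally show "norm (f (l a s) * l a s / (l b t - l a s)) \<le> C1 / \<kappa> * exp (-\<epsilon> * \<bar>s + 0\<bar>)" by simp
      qed
      from integral_linear[OF this scaleC.bounded_linear_left[of "(g (l b t) * l b t) *\<^sub>C R (l b t) x"]]
      show ?thesis by (simp add: o_def k2_def[abs_def] q_def scaleC_scaleC mult_ac)
    qed
    \<comment> \<open>In the part with R(\<mu>) the scalar integration is the one over \<lambda>,
      which is the outer one, so the order must be exchanged. In the part with R(\<lambda>) the
      scalar integration is already inside.\<close>
    have swap: "integral UNIV (\<lambda>s. integral UNIV (k2 a b s)) = integral UNIV (\<lambda>t. integral UNIV (\<lambda>s. k2 a b s t))"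
      by (rule exp_dominated_integral_swap[OF k2_c \<epsilon> k2_bd])
    note Q inner1 inner2 swap exp_dominated_kernel_integrable(2)[OF k1_c \<epsilon> k1_bd]
  } note facts = this
  define I1 where "I1 a b = integral UNIV (\<lambda>s. integral UNIV (k1 a b s))" for a b
  define I2 where "I2 a b = integral UNIV (\<lambda>s. integral UNIV (k2 a b s))" for a b
  have I1: "I1 a (-\<nu>') - I1 a \<nu>' = (2 * pi * \<i>) *\<^sub>C ray_integral D A a (\<lambda>z. f z * g z) x" if a: "a = \<nu> \<or> a = -\<nu>" for a
  proof -
    have Cf: "integral UNIV (\<lambda>t. g (l (-\<nu>') t) * l (-\<nu>') t / (l (-\<nu>') t - l a s)) -
        integral UNIV (\<lambda>t. g (l \<nu>' t) * l \<nu>' t / (l \<nu>' t - l a s)) = 2 * pi * \<i> * g (l a s)" for s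
      using ray_Cauchy_formula[of \<nu>' \<sigma> g "Complex s a"] \<nu> \<nu>0 \<sigma> g in1[OF a] by (simp add: l_def)
    have "I1 a (-\<nu>') - I1 a \<nu>' = integral UNIV (\<lambda>s. integral UNIV (k1 a (-\<nu>') s) - integral UNIV (k1 a \<nu>' s))"
      unfolding I1_def by (rule integral_diff[symmetric]) (use facts(5)[OF a] in auto)
    also have "\<dots> = integral UNIV (\<lambda>s. (2 * pi * \<i>) *\<^sub>C ray_integrand a (\<lambda>z. f z * g z) x s)"
    proof (rule arg_cong[of _ _ "integral UNIV"], rule ext)
      fix s
      have "integral UNIV (k1 a (-\<nu>') s) - integral UNIV (k1 a \<nu>' s) = (f (l a s) * l a s * (2 * pi * \<i> * g (l a s))) *\<^sub>C R (l a s) x"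
        unfolding Cf[symmetric] facts(2)[OF a disjI1[OF refl]] facts(2)[OF a disjI2[OF refl]]
        by (simp only: right_diff_distrib scaleC.diff_left)
      then show "integral UNIV (k1 a (-\<nu>') s) - integral UNIV (k1 a \<nu>' s) = (2 * pi * \<i>) *\<^sub>C ray_integrand a (\<lambda>z. f z * g z) x s"
        by (simp add: ray_integrand_def l_def[symmetric] scaleC_scaleC mult_ac)
    qed
    also have "\<dots> = (2 * pi * \<i>) *\<^sub>C ray_integral D A a (\<lambda>z. f z * g z) x"
      unfolding ray_integral_eq
      using integral_linear[OF ray_integrand_integrable[OF H0_inf_mult[OF \<sigma>(3,2) f g] in1(1,2)[OF a]] scaleC.bounded_linear_right[of "2 * pi * \<i>"]]
      by (simp add: o_def)
    finally show ?thesis .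
  qed
  have I2: "I2 (-\<nu>) b = I2 \<nu> b" if b: "b = \<nu>' \<or> b = -\<nu>'" for b
  proof -
    \<comment> \<open>The pole \<mu> lies on a ray of angle \<nu>', so the integrand is holomorphic
      on the open sector of angle \<nu>', which still contains the inner contour.\<close>
    have "integral UNIV (\<lambda>s. f (l (-\<nu>) s) * l (-\<nu>) s / (l b t - l (-\<nu>) s)) = integral UNIV (\<lambda>s. f (l \<nu> s) * l \<nu> s / (l b t - l \<nu> s))" for t
      unfolding l_def[of "-\<nu>"] l_def[of \<nu>]
    proof (rule ray_integrals_eq[where \<sigma>=\<nu>' and \<epsilon>=\<epsilon> and C="C1 / \<kappa>" and F="\<lambda>z. f z * z / (l b t - z)"])
      have "l b t - z \<noteq> 0" if z: "z \<in> sector \<nu>'" for z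
      proof
        assume "l b t - z = 0"
        moreover have n: "\<nu>' > 0" using \<nu> \<nu>0 by simp
        note L = sector_Ln[OF n z]
        ultimately have eq: "exp (Ln z) = exp (Complex t b)" by (simp add: l_def)
        have "\<bar>Im (Ln z)\<bar> < pi" "\<bar>b\<bar> < pi" using L(3) in2[OF b] \<nu> \<sigma> by linarith+
        then have "\<bar>Im (Ln z) - Im (Complex t b)\<bar> < 2 * pi"
          using abs_triangle_ineq4[of "Im (Ln z)" b] by (simp only: complex.sel)
        from exp_complex_eqI[OF this eq] have "Ln z = Complex t b" .
        then show False using L(3) in2[OF b] by simp
      qed
      then show "(\<lambda>z. f z * z / (l b t - z)) holomorphic_on sector \<nu>'"
        using holomorphic_on_subset[OF H0_inf_holomorphic[OF f] sector_mono[of \<nu>' \<sigma>]] \<nu> \<nu>0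
        by (intro holomorphic_intros) auto
      fix w assume w: "\<bar>Im w\<bar> \<le> \<nu>"
      have sep: "\<kappa> * (exp t + exp (Re w)) \<le> cmod (l b t - exp w)"
        using \<kappa>(2)[OF w, of "Complex t b"] in2[OF b] by (simp add: l_def)
      have sep_pos: "0 < cmod (l b t - exp w)"
        by (rule less_le_trans[OF _ sep]) (use \<kappa>(1) in \<open>auto intro!: mult_pos_pos add_pos_pos\<close>)
      have "\<kappa> * exp (Re w) \<le> cmod (l b t - exp w)"
        using sep mult_pos_pos[OF \<kappa>(1) exp_gt_zero[of t]] by (simp add: distrib_left)
      then have "exp (Re w) / cmod (l b t - exp w) \<le> 1 / \<kappa>"
        using sep_pos \<kappa>(1) by (auto simp: pos_divide_le_eq pos_le_divide_eq mult.commute)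
      then have "cmod (f (exp w)) * (exp (Re w) / cmod (l b t - exp w)) \<le> (C1 * exp (-\<epsilon> * \<bar>Re w\<bar>)) * (1 / \<kappa>)"
        using e1(2) w \<nu> by (intro mult_mono bf) auto
      then show "cmod (f (exp w) * exp w / (l b t - exp w)) \<le> C1 / \<kappa> * exp (-\<epsilon> * \<bar>Re w\<bar>)"
        by (simp add: norm_mult norm_divide)
    qed (use \<nu> \<nu>0 \<sigma> \<epsilon> in auto)
    then show ?thesis
      unfolding I2_def facts(4)[OF disjI1[OF refl] b] facts(4)[OF disjI2[OF refl] b]
        facts(3)[OF disjI1[OF refl] b] facts(3)[OF disjI2[OF refl] b] by simp
  qed
  have Q: "ray_integral D A a f (ray_integral D A b g x) = I1 a b - I2 a b"
    if "a = \<nu> \<or> a = -\<nu>" "b = \<nu>' \<or> b = -\<nu>'" for a b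
    unfolding I1_def I2_def by (rule facts(1)[OF that])
  let ?c = "2 * pi * \<i>"
  let ?fg = "\<lambda>z. f z * g z"
  have \<nu>\<sigma>: "\<nu> < \<sigma>" using \<nu> by simp
  have ray: "ray_integral D A a f (?c *\<^sub>C hc \<nu>' g x) = ?c *\<^sub>C ray_integral D A a ?fg x - (I2 a (-\<nu>') - I2 a \<nu>')"
    if a: "a = \<nu> \<or> a = -\<nu>" for a
    unfolding hc_two_pi_i[symmetric] ray_integral_diff_right[OF f in1(1,2)[OF a]] Q[OF a disjI1[OF refl]] Q[OF a disjI2[OF refl]]
      I1[OF a, symmetric] by simp
  have "hc \<nu> f (?c *\<^sub>C hc \<nu>' g x) = ?c *\<^sub>C hc \<nu> ?fg x"
  proof (rule hc_eqI)
    have "ray_integral D A (-\<nu>) f (?c *\<^sub>C hc \<nu>' g x) - ray_integral D A \<nu> f (?c *\<^sub>C hc \<nu>' g x) =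
        ?c *\<^sub>C (ray_integral D A (-\<nu>) ?fg x - ray_integral D A \<nu> ?fg x)"
      unfolding ray[OF disjI1[OF refl]] ray[OF disjI2[OF refl]] I2[OF disjI1[OF refl]] I2[OF disjI2[OF refl]]
      by (simp add: scaleC.diff_right)
    then show "ray_integral D A (-\<nu>) f (?c *\<^sub>C hc \<nu>' g x) - ray_integral D A \<nu> f (?c *\<^sub>C hc \<nu>' g x) =
        ?c *\<^sub>C (?c *\<^sub>C hc \<nu> ?fg x)"
      unfolding hc_two_pi_i[of \<nu> ?fg] .
  qed
  then have "?c *\<^sub>C hc \<nu> f (hc \<nu>' g x) = ?c *\<^sub>C hc \<nu> ?fg x"
    by (simp only: hc_scale_right[OF f \<nu>(1) \<nu>\<sigma>])
  then show ?thesis by (subst (asm) scaleC_eq_iff) auto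
qed

text \<open>Injectivity of A enters here. If u is the common value, then A u = x - u and 2 A u = x -
  u, so A u = A (2u) and u = 0. Accordingly J 1 - J 2 is an injective operator in the
  calculus.\<close>

lemma J_difference_injective:
  assumes "J 1 x = J 2 x"
  shows "x = 0"
proof -
  have "2 *\<^sub>C A (J 2 x) = x - J 2 x" "A (J 1 x) = x - J 1 x" by (simp_all add: A_J scaleC_scaleC)
  then have "A (J 1 x) = 2 *\<^sub>C A (J 2 x)" using assms by simp
  then have "A (J 1 x) = A (2 *\<^sub>C J 2 x)" by (simp add: A_scale J_in_D)
  from inj_onD[OF inj this] have "J 1 x = 2 *\<^sub>C J 2 x" by (simp add: J_in_D D_scale)
  then have "J 2 x = 0" using assms scaleC.add_left[of 1 1 "J 2 x"] by simp
  then show ?thesis using J_right[of 2 x] by simp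
qed

text \<open>Since the product formula needs two different angles, independence of the angle is obtained
  by comparing the two products with the injective operator \<open>e(A)\<close>, \<open>e(z) = 1/(1+z) - 1/(1+2z)\<close>.\<close>

lemma hc_angle_independent:
  assumes f: "f \<in> H0_inf \<sigma>" and \<nu>: "\<delta> < \<nu>" "\<nu> < \<nu>'" "\<nu>' < \<sigma>"
  shows "hc \<nu> f x = hc \<nu>' f x"
proof -
  let ?e = "\<lambda>z. 1 / (1 + z) - 1 / (1 + complex_of_real 2 * z)"
  define B where "B y = J 1 y - J 2 y" for y
  have \<nu>\<sigma>: "\<nu> < \<sigma>" "\<delta> < \<nu>'" using \<nu> by auto
  have e: "?e \<in> H0_inf \<sigma>" using resolvent_difference_in_H0[OF \<sigma>(3,4), of 2] by simp
  have eB: "hc a ?e y = B y" if "\<delta> < a" "a < \<sigma>" for a y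
    unfolding B_def using hc_resolvent_difference[OF _ that, of 2] by simp
  have "B (hc \<nu>' f x) = hc \<nu> (\<lambda>z. ?e z * f z) x"
    using hc_product_two_angles[OF e f \<nu>] eB[OF \<nu>(1) \<nu>\<sigma>(1)] by simp
  also have "\<dots> = hc \<nu> (\<lambda>z. f z * ?e z) x" by (simp add: mult.commute)
  also have "\<dots> = hc \<nu> f (B x)"
    using hc_product_two_angles[OF f e \<nu>] eB[OF \<nu>\<sigma>(2) \<nu>(3)] by simp
  also have "\<dots> = B (hc \<nu> f x)"
    unfolding B_def hc_diff_right[OF f \<nu>(1) \<nu>\<sigma>(1)] by (simp add: J_hc_commute[OF _ f \<nu>(1) \<nu>\<sigma>(1)])
  finally have "J 1 (hc \<nu> f x - hc \<nu>' f x) = J 2 (hc \<nu> f x - hc \<nu>' f x)"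
    unfolding B_def by (simp add: J_linear algebra_simps)
  from J_difference_injective[OF this] show ?thesis by simp
qed

lemma hc_product:
  assumes f: "f \<in> H0_inf \<sigma>" and g: "g \<in> H0_inf \<sigma>" and \<nu>: "\<delta> < \<nu>" "\<nu> < \<sigma>"
  shows "hc \<nu> f (hc \<nu> g x) = hc \<nu> (\<lambda>z. f z * g z) x"
proof -
  obtain \<nu>' where \<nu>': "\<nu> < \<nu>'" "\<nu>' < \<sigma>" using dense[OF \<nu>(2)] by blast
  show ?thesis
    using hc_product_two_angles[OF f g \<nu>(1) \<nu>'] hc_angle_independent[OF g \<nu>(1) \<nu>'] by simp
qed

end

section \<open>Sequence norms\<close>

text \<open>The definition of \<open>lseq_norm\<close> uses unordered sums; as integrals against
  counting measure they become accessible to monotonicity and Tonelli.\<close>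

lemma infsum_int_eq_nn_integral:
  fixes f :: "int \<Rightarrow> ennreal"
  shows "(\<Sum>\<^sub>\<infinity>j. f j) = (\<integral>\<^sup>+j. f j \<partial>count_space UNIV)"
proof (rule antisym)
  show "(\<Sum>\<^sub>\<infinity>j. f j) \<le> (\<integral>\<^sup>+j. f j \<partial>count_space UNIV)"
  proof (subst nonneg_infsum_complete, simp, rule SUP_least)
    fix F :: "int set" assume "F \<in> {F. finite F \<and> F \<subseteq> UNIV}"
    then have F: "finite F" by simp
    have "sum f F = (\<integral>\<^sup>+j. (if j \<in> F then f j else 0) \<partial>count_space UNIV)"
      by (subst nn_integral_count_space'[OF F]) auto
    also have "\<dots> \<le> (\<integral>\<^sup>+j. f j \<partial>count_space UNIV)" by (rule nn_integral_mono) auto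
    finally show "sum f F \<le> (\<integral>\<^sup>+j. f j \<partial>count_space UNIV)" .
  qed
  have "(\<integral>\<^sup>+j. f j \<partial>count_space UNIV) = (\<integral>\<^sup>+n. f (int_decode n) \<partial>count_space UNIV)"
    by (rule nn_integral_bij_count_space[OF bij_int_decode, symmetric])
  also have "\<dots> = (SUP n. \<Sum>i<n. f (int_decode i))"
    by (simp add: nn_integral_count_space_nat suminf_eq_SUP)
  also have "\<dots> \<le> (\<Sum>\<^sub>\<infinity>j. f j)"
  proof (rule SUP_least)
    fix n
    have "(\<Sum>i<n. f (int_decode i)) = sum f (int_decode ` {..<n})"
      using bij_int_decode by (subst sum.reindex) (auto simp: bij_def inj_on_def)
    also have "\<dots> \<le> (\<Sum>\<^sub>\<infinity>j. f j)"
      by (subst nonneg_infsum_complete) (auto intro!: SUP_upper)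
    finally show "(\<Sum>i<n. f (int_decode i)) \<le> (\<Sum>\<^sub>\<infinity>j. f j)" .
  qed
  finally show "(\<integral>\<^sup>+j. f j \<partial>count_space UNIV) \<le> (\<Sum>\<^sub>\<infinity>j. f j)" .
qed

lemma ennreal_powr_le_iff:
  assumes "p > 0" "L \<ge> 0"
  shows "ennreal_powr x (1 / p) \<le> ennreal L \<longleftrightarrow> x \<le> ennreal (L powr p)"
proof (cases x)
  case (real q)
  have "q powr (1 / p) \<le> L \<longleftrightarrow> q \<le> L powr p"
  proof
    assume "q powr (1 / p) \<le> L"
    then have "(q powr (1 / p)) powr p \<le> L powr p" using assms by (intro powr_mono2) auto
    then show "q \<le> L powr p" using real assms by (simp add: powr_powr)
  next
    assume "q \<le> L powr p"
    then have "q powr (1 / p) \<le> (L powr p) powr (1 / p)" using assms real by (intro powr_mono2) auto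
    then show "q powr (1 / p) \<le> L" using assms by (simp add: powr_powr)
  qed
  then show ?thesis using real assms by (simp add: ennreal_powr_def)
qed (simp add: ennreal_powr_def top_unique)

lemma ennreal_powr_mult_le:
  assumes "p > 0" "C > 0" "x \<le> ennreal (C powr p) * y"
  shows "ennreal_powr x (1 / p) \<le> ennreal C * ennreal_powr y (1 / p)"
proof (cases y)
  case (real q)
  have "x \<le> ennreal ((C * q powr (1 / p)) powr p)"
    using assms real by (simp add: powr_mult powr_powr ennreal_mult)
  then have "ennreal_powr x (1 / p) \<le> ennreal (C * q powr (1 / p))"
    using assms real by (subst ennreal_powr_le_iff) auto
  then show ?thesis using real assms by (simp add: ennreal_powr_def ennreal_mult)
qed (use assms in \<open>simp add: ennreal_powr_def ennreal_mult_top\<close>)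

lemma enn2real_ge_1: "1 \<le> s \<Longrightarrow> s \<noteq> \<infinity> \<Longrightarrow> 1 \<le> enn2real s"
  by (cases s) (auto simp: ennreal_1[symmetric] simp del: ennreal_1)

lemma lseq_norm_finite:
  assumes "s \<noteq> \<infinity>"
  shows "lseq_norm s a = ennreal_powr (\<integral>\<^sup>+j. ennreal (\<bar>a j\<bar> powr enn2real s) \<partial>count_space UNIV) (1 / enn2real s)"
  using assms by (simp add: lseq_norm_def infsum_int_eq_nn_integral)

lemma lseq_norm_scale:
  assumes "1 \<le> s" "c \<noteq> 0"
  shows "lseq_norm s (\<lambda>j. c * a j) \<le> ennreal \<bar>c\<bar> * lseq_norm s a"
proof (cases "s = \<infinity>")
  case True
  then show ?thesis
    by (auto simp: lseq_norm_def abs_mult ennreal_mult intro!: SUP_least mult_left_mono SUP_upper)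
next
  case False
  have "(\<integral>\<^sup>+j. ennreal (\<bar>c * a j\<bar> powr enn2real s) \<partial>count_space UNIV) =
      ennreal (\<bar>c\<bar> powr enn2real s) * (\<integral>\<^sup>+j. ennreal (\<bar>a j\<bar> powr enn2real s) \<partial>count_space UNIV)"
    by (simp add: abs_mult powr_mult ennreal_mult nn_integral_cmult)
  then show ?thesis
    unfolding lseq_norm_finite[OF False] using assms enn2real_ge_1[OF assms(1) False]
    by (intro ennreal_powr_mult_le) auto
qed

lemma ennreal_le_linear_combination:
  assumes "x \<le> a * y + b * z" "a \<ge> 0" "b \<ge> 0" "y \<ge> 0" "z \<ge> 0"
  shows "ennreal x \<le> ennreal a * ennreal y + ennreal b * ennreal z"
  using ennreal_leI[OF assms(1)] assms(2-) by (simp add: ennreal_mult)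

lemma ennreal_linear_combination:
  assumes "a \<ge> 0" "b \<ge> 0" "y \<ge> 0" "z \<ge> 0"
  shows "ennreal a * ennreal y + ennreal b * ennreal z = ennreal (a * y + b * z)"
  using assms by (simp add: ennreal_mult)

text \<open>Convexity of the power on the positive axis covers u, v > 0. If one of them is zero, the
  claim reduces to m^p \<le> m for m in [0, 1].\<close>

lemma powr_convex_combination:
  assumes "p \<ge> 1" "0 \<le> l" "l \<le> 1" "u \<ge> 0" "v \<ge> (0::real)"
  shows "(l * u + (1 - l) * v) powr p \<le> l * u powr p + (1 - l) * v powr p"
proof -
  have scaled: "(m * w) powr p \<le> m * w powr p" if "0 \<le> m" "m \<le> 1" "w \<ge> 0" for m w :: real
  proof -
    have "m powr p \<le> m" using powr_mono'[of 1 p m] that assms(1) by (cases "m = 0") auto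
    then have "m powr p * w powr p \<le> m * w powr p" by (intro mult_right_mono) auto
    then show ?thesis using that by (simp add: powr_mult)
  qed
  consider "u = 0" | "v = 0" | "u > 0" "v > 0" using assms by linarith
  then show ?thesis
  proof cases
    case 1 then show ?thesis using scaled[of "1 - l" v] assms by simp
  next
    case 2 then show ?thesis using scaled[of l u] assms by simp
  next
    case 3
    then show ?thesis using powr_convex[OF assms(1)] assms
      by (auto simp: convex_on_def dest!: bspec[of _ _ u] bspec[of _ _ v] spec[of _ l] spec[of _ "1 - l"])
  qed
qed

lemma lseq_norm_triangle:
  assumes s: "1 \<le> s" and le: "\<And>j. \<bar>x j\<bar> \<le> \<bar>a j\<bar> + \<bar>b j\<bar>"
  shows "lseq_norm s x \<le> lseq_norm s a + lseq_norm s b"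
proof (cases "s = \<infinity>")
  case True
  have "ennreal \<bar>x j\<bar> \<le> (SUP j. ennreal \<bar>a j\<bar>) + (SUP j. ennreal \<bar>b j\<bar>)" for j
  proof -
    have "ennreal \<bar>x j\<bar> \<le> ennreal \<bar>a j\<bar> + ennreal \<bar>b j\<bar>" using le[of j] by (simp flip: ennreal_plus)
    also have "\<dots> \<le> (SUP j. ennreal \<bar>a j\<bar>) + (SUP j. ennreal \<bar>b j\<bar>)"
      by (intro add_mono SUP_upper) auto
    finally show ?thesis .
  qed
  then show ?thesis using True by (simp add: lseq_norm_def SUP_le_iff)
next
  case False
  define p where "p = enn2real s"
  have p: "p \<ge> 1" using enn2real_ge_1[OF s False] by (simp add: p_def)
  note L = lseq_norm_finite[OF False, folded p_def]
  show ?thesis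
  proof (cases "lseq_norm s a = \<infinity> \<or> lseq_norm s b = \<infinity>")
    case False
    then obtain \<alpha> \<beta> where ab: "lseq_norm s a = ennreal \<alpha>" "\<alpha> \<ge> 0" "lseq_norm s b = ennreal \<beta>" "\<beta> \<ge> 0"
      by (cases "lseq_norm s a"; cases "lseq_norm s b") auto
    have "lseq_norm s x \<le> ennreal (\<alpha> + \<beta>) + ennreal e" if "e > 0" for e
    proof -
      \<comment> \<open>The two norms are enlarged by e/2 so that division by them is possible even
        if a sequence vanishes. Minkowski's inequality is then convexity applied to the normalized
        entries, with weights \<alpha>'/(\<alpha>' + \<beta>') and \<beta>'/(\<alpha>' +
        \<beta>').\<close>
      define \<alpha>' \<beta>' where "\<alpha>' = \<alpha> + e / 2" and "\<beta>' = \<beta> + e / 2"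
      have pos: "\<alpha>' > 0" "\<beta>' > 0" using ab that by (auto simp: \<alpha>'_def \<beta>'_def)
      define l where "l = \<alpha>' / (\<alpha>' + \<beta>')"
      have l: "0 \<le> l" "l \<le> 1" "1 - l = \<beta>' / (\<alpha>' + \<beta>')" using pos by (auto simp: l_def field_simps)
      have A: "(\<integral>\<^sup>+j. ennreal (\<bar>a j\<bar> powr p) \<partial>count_space UNIV) \<le> ennreal (\<alpha>' powr p)"
        using ab pos p that unfolding L by (subst ennreal_powr_le_iff[symmetric]) (auto simp: \<alpha>'_def)
      have B: "(\<integral>\<^sup>+j. ennreal (\<bar>b j\<bar> powr p) \<partial>count_space UNIV) \<le> ennreal (\<beta>' powr p)"
        using ab pos p that unfolding L by (subst ennreal_powr_le_iff[symmetric]) (auto simp: \<beta>'_def)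
      define P where "P = (\<alpha>' + \<beta>') powr p"
      have pt: "\<bar>x j\<bar> powr p \<le> P * l / \<alpha>' powr p * \<bar>a j\<bar> powr p + P * (1 - l) / \<beta>' powr p * \<bar>b j\<bar> powr p" for j
      proof -
        have "\<bar>x j\<bar> powr p \<le> (\<bar>a j\<bar> + \<bar>b j\<bar>) powr p" using le[of j] p by (intro powr_mono2) auto
        also have "\<bar>a j\<bar> + \<bar>b j\<bar> = (\<alpha>' + \<beta>') * (l * (\<bar>a j\<bar> / \<alpha>') + (1 - l) * (\<bar>b j\<bar> / \<beta>'))"
        proof -
          have "(\<alpha>' + \<beta>') * (l * (\<bar>a j\<bar> / \<alpha>') + (1 - l) * (\<bar>b j\<bar> / \<beta>')) =
              ((\<alpha>' + \<beta>') * l) / \<alpha>' * \<bar>a j\<bar> + ((\<alpha>' + \<beta>') * (1 - l)) / \<beta>' * \<bar>b j\<bar>"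
            by (simp add: algebra_simps)
          moreover have "(\<alpha>' + \<beta>') * l = \<alpha>'" "(\<alpha>' + \<beta>') * (1 - l) = \<beta>'"
            unfolding l(3) using pos by (auto simp: l_def)
          ultimately show ?thesis using pos by simp
        qed
        also have "\<dots> powr p = P * (l * (\<bar>a j\<bar> / \<alpha>') + (1 - l) * (\<bar>b j\<bar> / \<beta>')) powr p"
          unfolding P_def by (rule powr_mult)
        also have "\<dots> \<le> P * (l * (\<bar>a j\<bar> / \<alpha>') powr p + (1 - l) * (\<bar>b j\<bar> / \<beta>') powr p)"
          using pos l p by (intro mult_left_mono powr_convex_combination) (auto simp: P_def)
        also have "\<dots> = P * l / \<alpha>' powr p * \<bar>a j\<bar> powr p + P * (1 - l) / \<beta>' powr p * \<bar>b j\<bar> powr p"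
          using pos by (simp add: powr_divide algebra_simps)
        finally show ?thesis .
      qed
      have c: "P * l / \<alpha>' powr p \<ge> 0" "P * (1 - l) / \<beta>' powr p \<ge> 0" using l pos by (auto simp: P_def)
      have "(\<integral>\<^sup>+j. ennreal (\<bar>x j\<bar> powr p) \<partial>count_space UNIV) \<le>
          (\<integral>\<^sup>+j. ennreal (P * l / \<alpha>' powr p) * ennreal (\<bar>a j\<bar> powr p) + ennreal (P * (1 - l) / \<beta>' powr p) * ennreal (\<bar>b j\<bar> powr p) \<partial>count_space UNIV)"
        using pt c by (intro nn_integral_mono ennreal_le_linear_combination) auto
      also have "\<dots> = ennreal (P * l / \<alpha>' powr p) * (\<integral>\<^sup>+j. ennreal (\<bar>a j\<bar> powr p) \<partial>count_space UNIV) +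
          ennreal (P * (1 - l) / \<beta>' powr p) * (\<integral>\<^sup>+j. ennreal (\<bar>b j\<bar> powr p) \<partial>count_space UNIV)"
        by (simp add: nn_integral_add nn_integral_cmult)
      also have "\<dots> \<le> ennreal (P * l / \<alpha>' powr p) * ennreal (\<alpha>' powr p) + ennreal (P * (1 - l) / \<beta>' powr p) * ennreal (\<beta>' powr p)"
        by (intro add_mono mult_left_mono A B) auto
      also have "\<dots> = ennreal (P * l / \<alpha>' powr p * \<alpha>' powr p + P * (1 - l) / \<beta>' powr p * \<beta>' powr p)"
        using c by (intro ennreal_linear_combination) auto
      also have "P * l / \<alpha>' powr p * \<alpha>' powr p + P * (1 - l) / \<beta>' powr p * \<beta>' powr p = P"
      proof -
        have "P * l / \<alpha>' powr p * \<alpha>' powr p = P * l" "P * (1 - l) / \<beta>' powr p * \<beta>' powr p = P * (1 - l)"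
          using pos by simp_all
        then show ?thesis by (simp add: algebra_simps)
      qed
      finally have "lseq_norm s x \<le> ennreal (\<alpha>' + \<beta>')"
        unfolding L P_def using pos p by (subst ennreal_powr_le_iff) auto
      also have "\<alpha>' + \<beta>' = (\<alpha> + \<beta>) + e" by (simp add: \<alpha>'_def \<beta>'_def)
      also have "ennreal \<dots> = ennreal (\<alpha> + \<beta>) + ennreal e" using ab that by (intro ennreal_plus) auto
      finally show ?thesis .
    qed
    then have "lseq_norm s x \<le> ennreal (\<alpha> + \<beta>)"
      by (rule ennreal_le_epsilon)
    then show ?thesis using ab by (simp add: ennreal_plus)
  qed auto
qed

lemma lseq_norm_zero [simp]: "1 \<le> s \<Longrightarrow> lseq_norm s (\<lambda>_. 0) = 0"
  by (cases "s = \<infinity>") (auto simp: lseq_norm_finite ennreal_powr_def lseq_norm_def)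

lemma lseq_norm_point:
  assumes s: "1 \<le> s"
  shows "ennreal \<bar>a j\<bar> \<le> lseq_norm s a"
proof (cases "s = \<infinity>")
  case True
  then show ?thesis by (auto simp: lseq_norm_def intro: SUP_upper)
next
  case False
  define p where "p = enn2real s"
  have p: "p \<ge> 1" using enn2real_ge_1[OF s False] by (simp add: p_def)
  show ?thesis
  proof (cases "lseq_norm s a")
    case (real L)
    then have "(\<integral>\<^sup>+j. ennreal (\<bar>a j\<bar> powr p) \<partial>count_space UNIV) \<le> ennreal (L powr p)"
      using p lseq_norm_finite[OF False, of a, folded p_def]
      by (subst ennreal_powr_le_iff[symmetric]) auto
    then have "ennreal (\<bar>a j\<bar> powr p) \<le> ennreal (L powr p)"
      using nn_integral_ge_point[of j UNIV "\<lambda>j. ennreal (\<bar>a j\<bar> powr p)"] by (meson UNIV_I order_trans)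
    then have "\<bar>a j\<bar> powr p \<le> L powr p" by simp
    then have "\<bar>a j\<bar> \<le> L" using p real powr_less_mono2[of p L "\<bar>a j\<bar>"] by (cases "\<bar>a j\<bar> \<le> L") auto
    then show ?thesis using real by simp
  qed auto
qed

lemma lseq_norm_delta:
  assumes s: "1 \<le> s"
  shows "lseq_norm s (\<lambda>j. if j = i then a else 0) = ennreal \<bar>a\<bar>"
proof (rule antisym)
  show "ennreal \<bar>a\<bar> \<le> lseq_norm s (\<lambda>j. if j = i then a else 0)"
    using lseq_norm_point[OF s, of "\<lambda>j. if j = i then a else 0" i] by simp
  show "lseq_norm s (\<lambda>j. if j = i then a else 0) \<le> ennreal \<bar>a\<bar>"
  proof (cases "s = \<infinity>")
    case True
    then show ?thesis by (auto simp: lseq_norm_def intro!: SUP_least)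
  next
    case False
    have "(\<integral>\<^sup>+j. ennreal (\<bar>if j = i then a else 0\<bar> powr enn2real s) \<partial>count_space UNIV) = ennreal (\<bar>a\<bar> powr enn2real s)"
      by (subst nn_integral_count_space'[of "{i}"]) auto
    then show ?thesis
      unfolding lseq_norm_finite[OF False] using enn2real_ge_1[OF s False] by (subst ennreal_powr_le_iff) auto
  qed
qed

section \<open>Convolution with a geometric kernel\<close>

lemma nn_integral_geometric_int:
  assumes "0 < r" "r < (1::real)"
  shows "(\<integral>\<^sup>+j. ennreal (r ^ nat \<bar>j\<bar>) \<partial>count_space (UNIV::int set)) < \<infinity>"
proof -
  let ?f = "\<lambda>j::int. ennreal (r ^ nat \<bar>j\<bar>)"
  have half: "(\<integral>\<^sup>+n. ennreal (r ^ n) \<partial>count_space UNIV) < \<infinity>"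
    unfolding nn_integral_count_space_nat using assms
    by (subst suminf_ennreal2) (auto intro!: summable_geometric)
  have "bij_betw int UNIV {0..}" by (auto simp: bij_betw_def inj_on_def image_iff intro: nonneg_int_cases)
  from nn_integral_bij_count_space[OF this, of ?f] have 1: "(\<integral>\<^sup>+j. ?f j \<partial>count_space {0..}) < \<infinity>"
    using half by simp
  have "bij_betw (\<lambda>n. - int n) UNIV {..0}"
    by (auto simp: bij_betw_def inj_on_def image_iff) (metis add.inverse_inverse neg_0_le_iff_le nonneg_int_cases)
  from nn_integral_bij_count_space[OF this, of ?f] have 2: "(\<integral>\<^sup>+j. ?f j \<partial>count_space {..0}) < \<infinity>"
    using half by simp
  have "(\<integral>\<^sup>+j. ?f j \<partial>count_space UNIV) \<le> (\<integral>\<^sup>+j. ?f j * indicator {0..} j + ?f j * indicator {..0} j \<partial>count_space UNIV)"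
    by (intro nn_integral_mono) (auto split: split_indicator)
  also have "\<dots> = (\<integral>\<^sup>+j. ?f j \<partial>count_space {0..}) + (\<integral>\<^sup>+j. ?f j \<partial>count_space {..0})"
    by (simp add: nn_integral_add nn_integral_count_space_indicator)
  also have "\<dots> < \<infinity>" using 1 2 by simp
  finally show ?thesis .
qed

lemma nn_integral_int_shift:
  fixes f :: "int \<Rightarrow> ennreal"
  shows "(\<integral>\<^sup>+j. f (i - j) \<partial>count_space UNIV) = (\<integral>\<^sup>+j. f j \<partial>count_space UNIV)"
    and "(\<integral>\<^sup>+j. f (j - i) \<partial>count_space UNIV) = (\<integral>\<^sup>+j. f j \<partial>count_space UNIV)"
proof -
  have "bij_betw (\<lambda>j. i - j) UNIV (UNIV :: int set)"
    by (rule bij_betw_byWitness[where f'="\<lambda>j. i - j"]) auto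
  then show "(\<integral>\<^sup>+j. f (i - j) \<partial>count_space UNIV) = (\<integral>\<^sup>+j. f j \<partial>count_space UNIV)"
    by (rule nn_integral_bij_count_space)
  have "bij_betw (\<lambda>j. j - i) UNIV (UNIV :: int set)"
    by (rule bij_betw_byWitness[where f'="\<lambda>j. j + i"]) auto
  then show "(\<integral>\<^sup>+j. f (j - i) \<partial>count_space UNIV) = (\<integral>\<^sup>+j. f j \<partial>count_space UNIV)"
    by (rule nn_integral_bij_count_space)
qed

text \<open>Young's inequality with a free parameter m and equality at k = m. Summed against weights
  and with m optimized, it yields Jensen's inequality.\<close>

lemma powr_tangent:
  assumes "p \<ge> 1" "m > 0" "k \<ge> (0::real)"
  shows "k \<le> m powr (1 - p) / p * k powr p + (1 - 1 / p) * m"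
proof (cases "k = 0")
  case False
  then have k: "k > 0" using assms by simp
  have "(m powr (1 - p) * k powr p) powr (1 / p) * m powr (1 - 1 / p) \<le>
      1 / p * (m powr (1 - p) * k powr p) + (1 - 1 / p) * m"
    using assms k by (intro Youngs_inequality_0) auto
  moreover have "(m powr (1 - p) * k powr p) powr (1 / p) * m powr (1 - 1 / p) = k"
  proof -
    have "(m powr (1 - p) * k powr p) powr (1 / p) = m powr ((1 - p) / p) * k"
      using assms k by (simp add: powr_mult powr_powr)
    moreover have "m powr ((1 - p) / p) * m powr (1 - 1 / p) = m powr ((1 - p) / p + (1 - 1 / p))"
      by (simp add: powr_add)
    moreover have "(1 - p) / p + (1 - 1 / p) = 0" using assms by (simp add: field_simps)
    ultimately show ?thesis using assms by (simp add: mult_ac)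
  qed
  ultimately show ?thesis by simp
qed (use assms in simp)

text \<open>Young's convolution inequality: K is the sum of the kernel, hence independent of s and
  C. For finite s the pointwise bound (\<rho> * k)^p \<le> K^(p-1) (\<rho> * k^p) is summed with
  Tonelli.\<close>

lemma lseq_norm_convolution:
  assumes r: "0 < r" "r < (1::real)"
  obtains K where "K > 0"
    "\<And>s c k C. 1 \<le> s \<Longrightarrow> C > 0 \<Longrightarrow> (\<And>j. c j \<ge> 0) \<Longrightarrow> (\<And>j. k j \<ge> 0) \<Longrightarrow>
      (\<And>i::int. ennreal (c i) \<le> ennreal C * (\<integral>\<^sup>+j. ennreal (r ^ nat \<bar>i - j\<bar>) * ennreal (k j) \<partial>count_space UNIV)) \<Longrightarrow>
      lseq_norm s c \<le> ennreal (C * K) * lseq_norm s k"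
proof -
  let ?\<rho> = "\<lambda>j::int. ennreal (r ^ nat \<bar>j\<bar>)"
  obtain K where K: "(\<integral>\<^sup>+j. ?\<rho> j \<partial>count_space UNIV) = ennreal K" "K \<ge> 0"
    using nn_integral_geometric_int[OF r] by (cases "\<integral>\<^sup>+j. ?\<rho> j \<partial>count_space UNIV") auto
  have "?\<rho> 0 \<le> (\<integral>\<^sup>+j. ?\<rho> j \<partial>count_space UNIV)" by (rule nn_integral_ge_point) simp
  then have K1: "K \<ge> 1" using K by (simp flip: ennreal_1)
  have rowsum: "(\<integral>\<^sup>+j. ?\<rho> (i - j) \<partial>count_space UNIV) = ennreal K" "(\<integral>\<^sup>+j. ?\<rho> (j - i) \<partial>count_space UNIV) = ennreal K" for i
    using nn_integral_int_shift[of ?\<rho> i] K by auto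
  show ?thesis
  proof
    show "K > 0" using K1 by simp
    fix s :: ennreal and c k :: "int \<Rightarrow> real" and C :: real
    assume s: "1 \<le> s" and C: "C > 0" and c: "\<And>j. c j \<ge> 0" and k: "\<And>j. k j \<ge> 0"
      and le: "\<And>i. ennreal (c i) \<le> ennreal C * (\<integral>\<^sup>+j. ?\<rho> (i - j) * ennreal (k j) \<partial>count_space UNIV)"
    show "lseq_norm s c \<le> ennreal (C * K) * lseq_norm s k"
    proof (cases "s = \<infinity>")
      case True
      have "ennreal (c i) \<le> ennreal (C * K) * lseq_norm s k" for i
      proof -
        have "(\<integral>\<^sup>+j. ?\<rho> (i - j) * ennreal (k j) \<partial>count_space UNIV) \<le> (\<integral>\<^sup>+j. ?\<rho> (i - j) * lseq_norm s k \<partial>count_space UNIV)"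
          using lseq_norm_point[OF s, of k] k by (intro nn_integral_mono mult_left_mono) auto
        also have "\<dots> = ennreal K * lseq_norm s k" by (simp add: nn_integral_multc rowsum)
        finally show ?thesis
          using le[of i] C K(2) by (simp add: ennreal_mult mult.assoc) (meson mult_left_mono order_trans zero_le)
      qed
      then show ?thesis using c True by (subst lseq_norm_def) (auto intro!: SUP_least)
    next
      case False
      define p where "p = enn2real s"
      have p: "p \<ge> 1" using enn2real_ge_1[OF s False] by (simp add: p_def)
      define E where "E = (\<integral>\<^sup>+j. ennreal (k j powr p) \<partial>count_space UNIV)"
      have main: "ennreal (c i powr p) \<le> ennreal (C powr p * K powr (p - 1)) * (\<integral>\<^sup>+j. ?\<rho> (i - j) * ennreal (k j powr p) \<partial>count_space UNIV)" for i
      proof (cases "\<integral>\<^sup>+j. ?\<rho> (i - j) * ennreal (k j powr p) \<partial>count_space UNIV")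
        case top
        then show ?thesis using C K1 by (simp add: ennreal_mult_top)
      next
        case (real S)
        show ?thesis
        proof (cases "S = 0")
          case True
          have "?\<rho> (i - j) * ennreal (k j powr p) = 0" for j
            using nn_integral_ge_point[of j UNIV "\<lambda>j. ?\<rho> (i - j) * ennreal (k j powr p)"] real True by simp
          then have "k j = 0" for j
            using zero_less_power[OF r(1)] k[of j] by (simp add: ennreal_eq_0_iff) (metis not_le)
          then have "c i = 0" using le[of i] c[of i] by (simp add: ennreal_eq_0_iff)
          then show ?thesis by simp
        next
          case False
          then have S: "S > 0" using real by simp
          \<comment> \<open>The p-mean of k with respect to the weights \<rho>/K. For this m the
            summed tangent bound is exactly m K; it must be positive, which is why S = 0 was treated
            apart.\<close>
          define m where "m = (S / K) powr (1 / p)"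
          have m: "m > 0" using S K1 by (simp add: m_def)
          have mp: "m powr p = S / K" using S K1 p by (simp add: m_def powr_powr)
          have c1: "m powr (1 - p) / p \<ge> 0" "(1 - 1 / p) * m \<ge> 0" using p m by auto
          have "(\<integral>\<^sup>+j. ?\<rho> (i - j) * ennreal (k j) \<partial>count_space UNIV) \<le>
              (\<integral>\<^sup>+j. ennreal (m powr (1 - p) / p) * (?\<rho> (i - j) * ennreal (k j powr p)) + ennreal ((1 - 1 / p) * m) * ?\<rho> (i - j) \<partial>count_space UNIV)"
          proof (rule nn_integral_mono)
            fix j
            have "ennreal (k j) \<le> ennreal (m powr (1 - p) / p) * ennreal (k j powr p) + ennreal ((1 - 1 / p) * m)"
              using ennreal_le_linear_combination[of "k j" _ "k j powr p" "(1 - 1 / p) * m" 1] powr_tangent[OF p m k[of j]] c1 by simp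
            then have "?\<rho> (i - j) * ennreal (k j) \<le> ?\<rho> (i - j) * (ennreal (m powr (1 - p) / p) * ennreal (k j powr p) + ennreal ((1 - 1 / p) * m))"
              by (rule mult_left_mono) simp
            then show "?\<rho> (i - j) * ennreal (k j) \<le> ennreal (m powr (1 - p) / p) * (?\<rho> (i - j) * ennreal (k j powr p)) + ennreal ((1 - 1 / p) * m) * ?\<rho> (i - j)"
              by (simp add: distrib_left mult_ac)
          qed
          also have "\<dots> = ennreal (m powr (1 - p) / p) * ennreal S + ennreal ((1 - 1 / p) * m) * ennreal K"
            using real by (simp add: nn_integral_add nn_integral_cmult rowsum)
          also have "\<dots> = ennreal (m powr (1 - p) / p * S + (1 - 1 / p) * m * K)"
            using c1 S K1 by (intro ennreal_linear_combination) auto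
          also have "m powr (1 - p) / p * S + (1 - 1 / p) * m * K = m * K"
          proof -
            have "m powr (1 - p) * S = m * K"
            proof -
              have "m powr (1 - p) * (S / K) = m powr (1 - p + p)" unfolding mp[symmetric] by (rule powr_add[symmetric])
              then show ?thesis using m K1 by (simp add: field_simps)
            qed
            then show ?thesis using p by (simp add: field_simps)
          qed
          finally have "ennreal (c i) \<le> ennreal C * ennreal (m * K)"
            using le[of i] by (meson mult_left_mono order_trans zero_le)
          then have "c i \<le> C * (m * K)" using C m K1 by (simp flip: ennreal_mult)
          then have "c i powr p \<le> (C * (m * K)) powr p" using c p by (intro powr_mono2) auto
          also have "\<dots> = C powr p * K powr (p - 1) * S"
            using C m K1 mp by (simp add: powr_mult powr_diff)
          finally show ?thesis using real C K1 S by (simp flip: ennreal_mult)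
        qed
      qed
      have "(\<integral>\<^sup>+i. ennreal (c i powr p) \<partial>count_space UNIV) \<le>
          (\<integral>\<^sup>+i. ennreal (C powr p * K powr (p - 1)) * (\<integral>\<^sup>+j. ?\<rho> (i - j) * ennreal (k j powr p) \<partial>count_space UNIV) \<partial>count_space UNIV)"
        by (intro nn_integral_mono main)
      also have "\<dots> = ennreal (C powr p * K powr (p - 1)) * (\<integral>\<^sup>+i. (\<integral>\<^sup>+j. ?\<rho> (i - j) * ennreal (k j powr p) \<partial>count_space UNIV) \<partial>count_space UNIV)"
        by (simp add: nn_integral_cmult)
      also have "(\<integral>\<^sup>+i. (\<integral>\<^sup>+j. ?\<rho> (i - j) * ennreal (k j powr p) \<partial>count_space UNIV) \<partial>count_space UNIV) =
          (\<integral>\<^sup>+j. (\<integral>\<^sup>+i. ?\<rho> (i - j) * ennreal (k j powr p) \<partial>count_space UNIV) \<partial>count_space UNIV)"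
        by (rule nn_integral_count_space_nn_integral) auto
      also have "\<dots> = ennreal K * E" by (simp add: nn_integral_multc rowsum nn_integral_cmult E_def)
      also have "ennreal (C powr p * K powr (p - 1)) * (ennreal K * E) = ennreal ((C * K) powr p) * E"
        using C K1 by (simp add: powr_mult powr_diff flip: ennreal_mult mult.assoc)
      finally show ?thesis
        using c k p C K1 unfolding lseq_norm_finite[OF False] p_def[symmetric]
        by (intro ennreal_powr_mult_le) (auto simp: E_def)
    qed
  qed
qed

section \<open>Dyadic discretization of the interpolation norm\<close>

definition dyadic :: "int \<Rightarrow> real set" where "dyadic i = {2 powr i..<2 powr (i + 1)}"

lemma dyadic_exists:
  assumes "t > 0"
  shows "t \<in> dyadic \<lfloor>log 2 t\<rfloor>"
proof -
  have "2 powr (of_int \<lfloor>log 2 t\<rfloor>) \<le> 2 powr (log 2 t)" by simp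
  moreover have "2 powr (log 2 t) < 2 powr (of_int \<lfloor>log 2 t\<rfloor> + 1)" by simp
  ultimately show ?thesis using assms by (simp add: dyadic_def)
qed

lemma dyadic_pos: "t \<in> dyadic i \<Longrightarrow> t > 0"
  by (auto simp: dyadic_def intro: less_le_trans[of 0 "2 powr i"])

lemma dyadic_unique:
  assumes "t \<in> dyadic i" "t \<in> dyadic j"
  shows "i = j"
proof -
  have "2 powr real_of_int i < 2 powr (real_of_int j + 1)" "2 powr real_of_int j < 2 powr (real_of_int i + 1)"
    using assms unfolding dyadic_def by (meson atLeastLessThan_iff le_less_trans)+
  then show ?thesis by simp
qed

lemma emeasure_dyadic: "emeasure lborel (dyadic i) = ennreal (2 powr i)"
  by (simp add: dyadic_def powr_add)

lemma dyadic_measurable [measurable]: "dyadic i \<in> sets lborel" "dyadic i \<in> sets borel"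
  by (simp_all add: dyadic_def)

text \<open>The integrand is compared with the step function taking the value \<open>u i\<close> on
  \<open>dyadic i\<close>, for which Tonelli applies; regularity of \<open>f\<close> does not come
  into play.\<close>

lemma nn_integral_dyadic_le:
  fixes u :: "int \<Rightarrow> ennreal"
  assumes "\<And>i t. t \<in> dyadic i \<Longrightarrow> f t \<le> u i"
  shows "(\<integral>\<^sup>+t\<in>{0<..}. f t \<partial>lborel) \<le> (\<integral>\<^sup>+i. u i * ennreal (2 powr i) \<partial>count_space UNIV)"
proof -
  have "(\<integral>\<^sup>+t\<in>{0<..}. f t \<partial>lborel) \<le> (\<integral>\<^sup>+t. (\<integral>\<^sup>+i. u i * indicator (dyadic i) t \<partial>count_space UNIV) \<partial>lborel)"
  proof (rule nn_integral_mono)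
    fix t :: real
    show "f t * indicator {0<..} t \<le> (\<integral>\<^sup>+i. u i * indicator (dyadic i) t \<partial>count_space UNIV)"
    proof (cases "t > 0")
      case True
      let ?i = "\<lfloor>log 2 t\<rfloor>"
      have "f t \<le> u ?i * indicator (dyadic ?i) t" using assms dyadic_exists[OF True] by simp
      also have "\<dots> \<le> (\<integral>\<^sup>+i. u i * indicator (dyadic i) t \<partial>count_space UNIV)"
        by (rule nn_integral_ge_point) simp
      finally show ?thesis using True by simp
    qed simp
  qed
  also have "\<dots> = (\<integral>\<^sup>+i. (\<integral>\<^sup>+t. u i * indicator (dyadic i) t \<partial>lborel) \<partial>count_space UNIV)"
    by (rule nn_integral_count_space_nn_integral) auto
  also have "\<dots> = (\<integral>\<^sup>+i. u i * ennreal (2 powr i) \<partial>count_space UNIV)"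
    by (simp add: nn_integral_cmult_indicator emeasure_dyadic)
  finally show ?thesis .
qed

lemma nn_integral_dyadic_ge:
  fixes u :: "int \<Rightarrow> ennreal"
  assumes "\<And>i t. t \<in> dyadic i \<Longrightarrow> u i \<le> f t"
  shows "(\<integral>\<^sup>+i. u i * ennreal (2 powr i) \<partial>count_space UNIV) \<le> (\<integral>\<^sup>+t\<in>{0<..}. f t \<partial>lborel)"
proof -
  have "(\<integral>\<^sup>+i. u i * ennreal (2 powr i) \<partial>count_space UNIV) =
      (\<integral>\<^sup>+i. (\<integral>\<^sup>+t. u i * indicator (dyadic i) t \<partial>lborel) \<partial>count_space UNIV)"
    by (simp add: nn_integral_cmult_indicator emeasure_dyadic)
  also have "\<dots> = (\<integral>\<^sup>+t. (\<integral>\<^sup>+i. u i * indicator (dyadic i) t \<partial>count_space UNIV) \<partial>lborel)"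
    by (rule nn_integral_count_space_nn_integral[symmetric]) auto
  also have "\<dots> \<le> (\<integral>\<^sup>+t\<in>{0<..}. f t \<partial>lborel)"
  proof (rule nn_integral_mono)
    fix t :: real
    show "(\<integral>\<^sup>+i. u i * indicator (dyadic i) t \<partial>count_space UNIV) \<le> f t * indicator {0<..} t"
    proof (cases "t > 0")
      case True
      let ?i = "\<lfloor>log 2 t\<rfloor>"
      have "(\<integral>\<^sup>+i. u i * indicator (dyadic i) t \<partial>count_space UNIV) = (\<Sum>i\<in>{?i}. u i * indicator (dyadic i) t)"
        using dyadic_exists[OF True] dyadic_unique by (intro nn_integral_count_space') (auto simp: indicator_def)
      also have "\<dots> \<le> f t" using dyadic_exists[OF True] assms by simp
      finally show ?thesis using True by simp
    next
      case False
      then have "t \<notin> dyadic i" for i using dyadic_pos by blast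
      then show ?thesis by simp
    qed
  qed
  finally show ?thesis .
qed

text \<open>\<kappa> stands for t -> K(t, x). Monotonicity and doubling confine its variation on a
  dyadic interval to a factor 2.\<close>

locale dyadic_comparison =
  fixes \<kappa> :: "real \<Rightarrow> real" and \<theta> :: real and s :: ennreal
  assumes \<kappa>_nonneg: "t > 0 \<Longrightarrow> \<kappa> t \<ge> 0"
    and \<kappa>_mono: "0 < t \<Longrightarrow> t \<le> u \<Longrightarrow> \<kappa> t \<le> \<kappa> u"
    and \<kappa>_double: "t > 0 \<Longrightarrow> \<kappa> (2 * t) \<le> 2 * \<kappa> t"
    and \<theta>: "0 < \<theta>" "\<theta> < 1"
    and s: "1 \<le> s"
begin

definition k :: "int \<Rightarrow> real" where "k i = 2 powr (- (i * \<theta>)) * \<kappa> (2 powr i)"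

lemma k_nonneg: "k i \<ge> 0"
  by (simp add: k_def \<kappa>_nonneg)

lemma dyadic_bounds:
  assumes t: "t \<in> dyadic i"
  shows "t powr (-\<theta>) * \<kappa> t \<le> 2 * k i" "k i / 2 \<le> t powr (-\<theta>) * \<kappa> t"
proof -
  have t2: "2 powr i \<le> t" "t \<le> 2 * 2 powr i" "t > 0"
    using t dyadic_pos by (auto simp: dyadic_def powr_add)
  have pw: "2 powr (- (i * \<theta>)) = (2 powr i) powr (-\<theta>)" by (simp add: powr_powr)
  have "t powr (-\<theta>) \<le> (2 powr i) powr (-\<theta>)" using t2 \<theta> by (intro powr_mono2') auto
  moreover have "\<kappa> t \<le> 2 * \<kappa> (2 powr i)"
    using order_trans[OF \<kappa>_mono[OF t2(3,2)] \<kappa>_double] by simp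
  ultimately have "t powr (-\<theta>) * \<kappa> t \<le> (2 powr i) powr (-\<theta>) * (2 * \<kappa> (2 powr i))"
    using \<kappa>_nonneg[OF t2(3)] by (intro mult_mono) auto
  then show "t powr (-\<theta>) * \<kappa> t \<le> 2 * k i" by (simp add: k_def pw)
  have "(1/2) * (2 powr i) powr (-\<theta>) \<le> 2 powr (-\<theta>) * (2 powr i) powr (-\<theta>)"
  proof (rule mult_right_mono)
    have "2 powr (-1) \<le> 2 powr (-\<theta>)" using \<theta> by (intro powr_mono) auto
    then show "1 / 2 \<le> 2 powr (-\<theta>)" by (simp add: powr_minus_divide)
  qed simp
  also have "\<dots> = (2 * 2 powr i) powr (-\<theta>)" by (simp add: powr_mult)
  also have "\<dots> \<le> t powr (-\<theta>)" using t2 \<theta> by (intro powr_mono2') auto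
  finally have "(1/2) * (2 powr i) powr (-\<theta>) * \<kappa> (2 powr i) \<le> t powr (-\<theta>) * \<kappa> t"
    using \<kappa>_mono[OF _ t2(1)] \<kappa>_nonneg by (intro mult_mono) auto
  then show "k i / 2 \<le> t powr (-\<theta>) * \<kappa> t" by (simp add: k_def pw)
qed

definition N :: ennreal where
  "N = (if s = \<infinity> then (SUP t\<in>{0<..}. ennreal (t powr (-\<theta>) * \<kappa> t))
      else ennreal_powr
        (\<integral>\<^sup>+t\<in>{0<..}. ennreal ((t powr (-\<theta>) * \<kappa> t) powr enn2real s / t) \<partial>lborel)
        (1 / enn2real s))"

lemma N_le: "N \<le> ennreal 2 * lseq_norm s k"
proof (cases "s = \<infinity>")
  case True
  have "ennreal (t powr (-\<theta>) * \<kappa> t) \<le> ennreal 2 * lseq_norm s k" if "t > 0" for t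
  proof -
    have "ennreal (t powr (-\<theta>) * \<kappa> t) \<le> ennreal (2 * k \<lfloor>log 2 t\<rfloor>)"
      using dyadic_bounds(1)[OF dyadic_exists[OF that]] by (rule ennreal_leI)
    also have "\<dots> = ennreal 2 * ennreal \<bar>k \<lfloor>log 2 t\<rfloor>\<bar>" using k_nonneg by (simp add: ennreal_mult)
    also have "\<dots> \<le> ennreal 2 * lseq_norm s k" by (intro mult_left_mono lseq_norm_point s) simp
    finally show ?thesis .
  qed
  then show ?thesis unfolding N_def if_P[OF True] by (intro SUP_least) simp
next
  case False
  define p where "p = enn2real s"
  have p: "p \<ge> 1" using enn2real_ge_1[OF s False] by (simp add: p_def)
  have "(\<integral>\<^sup>+t\<in>{0<..}. ennreal ((t powr (-\<theta>) * \<kappa> t) powr p / t) \<partial>lborel) \<le>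
      (\<integral>\<^sup>+i. ennreal ((2 * k i) powr p / 2 powr i) * ennreal (2 powr i) \<partial>count_space UNIV)"
  proof (rule nn_integral_dyadic_le, rule ennreal_leI)
    fix i t assume t: "t \<in> dyadic i"
    show "(t powr (-\<theta>) * \<kappa> t) powr p / t \<le> (2 * k i) powr p / 2 powr i"
      using t dyadic_pos[OF t] dyadic_bounds[OF t] \<kappa>_nonneg p
      by (intro frac_le powr_mono2) (auto simp: dyadic_def)
  qed
  also have "\<dots> = ennreal (2 powr p) * (\<integral>\<^sup>+i. ennreal (\<bar>k i\<bar> powr p) \<partial>count_space UNIV)"
    using k_nonneg by (subst nn_integral_cmult[symmetric]) (auto simp: powr_mult simp flip: ennreal_mult intro!: nn_integral_cong)
  finally show ?thesis
    unfolding N_def if_not_P[OF False] lseq_norm_finite[OF False] p_def[symmetric]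
    using p by (intro ennreal_powr_mult_le) auto
qed

lemma le_N: "lseq_norm s k \<le> ennreal 4 * N"
proof (cases "s = \<infinity>")
  case True
  have "ennreal \<bar>k i\<bar> \<le> ennreal 4 * N" for i
  proof -
    have m: "2 powr i \<in> dyadic i" by (simp add: dyadic_def)
    have "\<bar>k i\<bar> \<le> 4 * ((2 powr i) powr (-\<theta>) * \<kappa> (2 powr i))"
      using dyadic_bounds(2)[OF m] k_nonneg[of i] by linarith
    then have "ennreal \<bar>k i\<bar> \<le> ennreal (4 * ((2 powr i) powr (-\<theta>) * \<kappa> (2 powr i)))" by (rule ennreal_leI)
    also have "\<dots> = ennreal 4 * ennreal ((2 powr i) powr (-\<theta>) * \<kappa> (2 powr i))" by (rule ennreal_mult) (auto simp: \<kappa>_nonneg)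
    also have "\<dots> \<le> ennreal 4 * N" unfolding N_def if_P[OF True] by (intro mult_left_mono SUP_upper) auto
    finally show ?thesis .
  qed
  then show ?thesis unfolding lseq_norm_def if_P[OF True] by (intro SUP_least)
next
  case False
  define p where "p = enn2real s"
  have p: "p \<ge> 1" using enn2real_ge_1[OF s False] by (simp add: p_def)
  \<comment> \<open>One factor 2^p undoes the halving in \<open>k i / 2\<close>; the other one
    absorbs the loss from t < 2 * 2^i in dt/t, because 2 \<le> 2^p.\<close>
  have pt: "\<bar>k i\<bar> powr p \<le> 4 powr p * ((k i / 2) powr p / (2 * 2 powr i) * 2 powr i)" for i
  proof -
    have "2 \<le> 2 powr p" using powr_mono[of 1 p 2] p by simp
    then have "2 * (k i powr p) \<le> 2 powr p * k i powr p" by (intro mult_right_mono) auto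
    moreover have "(4::real) powr p = 2 powr p * 2 powr p" by (simp flip: powr_mult)
    ultimately show ?thesis using k_nonneg[of i] by (simp add: powr_divide field_simps)
  qed
  have "(\<integral>\<^sup>+i. ennreal (\<bar>k i\<bar> powr p) \<partial>count_space UNIV) \<le>
      (\<integral>\<^sup>+i. ennreal (4 powr p) * (ennreal ((k i / 2) powr p / (2 * 2 powr i)) * ennreal (2 powr i)) \<partial>count_space UNIV)"
    using pt by (intro nn_integral_mono) (simp flip: ennreal_mult)
  also have "\<dots> = ennreal (4 powr p) * (\<integral>\<^sup>+i. ennreal ((k i / 2) powr p / (2 * 2 powr i)) * ennreal (2 powr i) \<partial>count_space UNIV)"
    by (rule nn_integral_cmult) simp
  also have "\<dots> \<le> ennreal (4 powr p) * (\<integral>\<^sup>+t\<in>{0<..}. ennreal ((t powr (-\<theta>) * \<kappa> t) powr p / t) \<partial>lborel)"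
  proof (intro mult_left_mono nn_integral_dyadic_ge ennreal_leI)
    fix i t assume t: "t \<in> dyadic i"
    show "(k i / 2) powr p / (2 * 2 powr i) \<le> (t powr (-\<theta>) * \<kappa> t) powr p / t"
      using t dyadic_pos[OF t] dyadic_bounds[OF t] k_nonneg[of i] p
      by (intro frac_le powr_mono2) (auto simp: dyadic_def powr_add)
  qed simp
  finally show ?thesis
    unfolding N_def if_not_P[OF False] lseq_norm_finite[OF False] p_def[symmetric]
    using p by (intro ennreal_powr_mult_le) auto
qed

end

section \<open>Elementary functions and their calculus\<close>

lemma sector_pos_real: "0 < \<sigma> \<Longrightarrow> t > 0 \<Longrightarrow> complex_of_real t \<in> sector \<sigma>"
  by (auto simp: sector_def complex_nonpos_Reals_iff)

lemma H0_inf_tendsto_zero: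
  assumes "0 < \<sigma>" "\<sigma> \<le> pi" "f \<in> H0_inf \<sigma>"
  shows "((\<lambda>t. f (exp (complex_of_real t))) \<longlongrightarrow> 0) at_top" "((\<lambda>t. f (exp (complex_of_real t))) \<longlongrightarrow> 0) at_bot"
proof -
  obtain \<epsilon> C where e: "\<epsilon> > 0" "C \<ge> 0" "\<And>w. \<bar>Im w\<bar> < \<sigma> \<Longrightarrow> cmod (f (exp w)) \<le> C * exp (-\<epsilon> * \<bar>Re w\<bar>)"
    using H0_infE[OF assms] by blast
  have b: "norm (f (exp (complex_of_real t))) \<le> C * exp (-\<epsilon> * \<bar>t\<bar>)" for t
    using e(3)[of "complex_of_real t"] assms by simp
  have 1: "((\<lambda>t. C * exp (-\<epsilon> * \<bar>t\<bar>)) \<longlongrightarrow> 0) at_top" using e(1) by real_asymp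
  have 2: "((\<lambda>t. C * exp (-\<epsilon> * \<bar>t\<bar>)) \<longlongrightarrow> 0) at_bot" using e(1) by real_asymp
  show "((\<lambda>t. f (exp (complex_of_real t))) \<longlongrightarrow> 0) at_top"
    by (rule Lim_null_comparison[OF _ 1]) (use b in \<open>auto intro: always_eventually\<close>)
  show "((\<lambda>t. f (exp (complex_of_real t))) \<longlongrightarrow> 0) at_bot"
    by (rule Lim_null_comparison[OF _ 2]) (use b in \<open>auto intro: always_eventually\<close>)
qed

lemma inverse_one_plus_exp_tendsto:
  "((\<lambda>t. a / (1 + exp (complex_of_real t)) + b) \<longlongrightarrow> b) at_top"
  "((\<lambda>t. a / (1 + exp (complex_of_real t)) + b) \<longlongrightarrow> a + b) at_bot"
proof -
  have eq: "a / (1 + exp (complex_of_real t)) + b = a * complex_of_real (1 / (1 + exp t)) + b" for t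
    by (simp add: exp_of_real)
  have 1: "((\<lambda>t::real. 1 / (1 + exp t)) \<longlongrightarrow> 0) at_top" by real_asymp
  have 2: "((\<lambda>t::real. 1 / (1 + exp t)) \<longlongrightarrow> 1) at_bot" by real_asymp
  show "((\<lambda>t. a / (1 + exp (complex_of_real t)) + b) \<longlongrightarrow> b) at_top"
    unfolding eq using tendsto_add[OF tendsto_mult[OF tendsto_const[of a] tendsto_of_real[OF 1]] tendsto_const[of b]] by simp
  show "((\<lambda>t. a / (1 + exp (complex_of_real t)) + b) \<longlongrightarrow> a + b) at_bot"
    unfolding eq using tendsto_add[OF tendsto_mult[OF tendsto_const[of a] tendsto_of_real[OF 2]] tendsto_const[of b]] by simp
qed

text \<open>The limits along the positive axis determine the coefficients: b at infinity and a + b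
  at 0. This makes the definite description in \<open>elementary_calculus\<close>
  meaningful.\<close>

lemma elementary_decomposition_unique:
  assumes \<sigma>: "0 < \<sigma>" "\<sigma> \<le> pi" and f: "f \<in> H0_inf \<sigma>" and g: "g \<in> H0_inf \<sigma>"
    and eq: "\<And>z. z \<in> sector \<sigma> \<Longrightarrow> f z + a / (1 + z) + b = g z + c / (1 + z) + d"
  shows "a = c" "b = d" "\<And>z. z \<in> sector \<sigma> \<Longrightarrow> f z = g z"
proof -
  have s: "exp (complex_of_real t) \<in> sector \<sigma>" for t
    using sector_pos_real[OF \<sigma>(1), of "exp t"] by (simp add: exp_of_real)
  have "f (exp (complex_of_real t)) - g (exp (complex_of_real t)) = (c - a) / (1 + exp (complex_of_real t)) + (d - b)" for t
    using eq[OF s[of t]] by (simp add: diff_divide_distrib algebra_simps)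
  then have fg: "(\<lambda>t. f (exp (complex_of_real t)) - g (exp (complex_of_real t))) = (\<lambda>t. (c - a) / (1 + exp (complex_of_real t)) + (d - b))"
    by (rule ext)
  have "((\<lambda>t. f (exp (complex_of_real t)) - g (exp (complex_of_real t))) \<longlongrightarrow> 0 - 0) at_top"
    by (intro tendsto_diff H0_inf_tendsto_zero[OF \<sigma> f] H0_inf_tendsto_zero[OF \<sigma> g])
  from tendsto_unique[OF trivial_limit_at_top_linorder inverse_one_plus_exp_tendsto(1) this[unfolded fg]]
  have db: "d - b = 0" by simp
  have "((\<lambda>t. f (exp (complex_of_real t)) - g (exp (complex_of_real t))) \<longlongrightarrow> 0 - 0) at_bot"
    by (intro tendsto_diff H0_inf_tendsto_zero[OF \<sigma> f] H0_inf_tendsto_zero[OF \<sigma> g])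
  from tendsto_unique[OF trivial_limit_at_bot_linorder inverse_one_plus_exp_tendsto(2) this[unfolded fg]]
  have "(c - a) + (d - b) = 0" by simp
  then show ac: "a = c" and bd: "b = d" using db by auto
  show "f z = g z" if "z \<in> sector \<sigma>" for z using eq[OF that] ac bd by simp
qed

text \<open>Decompositions are taken on the sector of angle \<Sigma>, which may be pi, while the
  calculus lives on the smaller sector of angle \<sigma>, which contains the contour.\<close>

lemma (in sectorial_calculus) elementary_calculus_eq:
  assumes \<Sigma>: "\<sigma> \<le> \<Sigma>" "\<Sigma> \<le> pi" and \<nu>: "\<delta> < \<nu>" "\<nu> < \<sigma>" and g: "g \<in> H0_inf \<Sigma>"
    and eq: "\<And>z. z \<in> sector \<Sigma> \<Longrightarrow> f z = g z + a / (1 + z) + b"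
  shows "elementary_calculus D A \<Sigma> \<nu> f x = hc \<nu> g x + a *\<^sub>C J 1 x + b *\<^sub>C x"
  unfolding elementary_calculus_def inv_into_one_plus_A
proof (rule the_equality)
  show "\<exists>\<phi>\<in>H0_inf \<Sigma>. \<exists>a' b'. (\<forall>z\<in>sector \<Sigma>. f z = \<phi> z + a' / (1 + z) + b') \<and>
      hc \<nu> g x + a *\<^sub>C J 1 x + b *\<^sub>C x = hc \<nu> \<phi> x + a' *\<^sub>C J 1 x + b' *\<^sub>C x"
    using g eq by blast
next
  fix y assume "\<exists>\<phi>\<in>H0_inf \<Sigma>. \<exists>a b. (\<forall>z\<in>sector \<Sigma>. f z = \<phi> z + a / (1 + z) + b) \<and>
      y = hc \<nu> \<phi> x + a *\<^sub>C J 1 x + b *\<^sub>C x"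
  then obtain \<phi> a' b' where \<phi>: "\<phi> \<in> H0_inf \<Sigma>" "\<And>z. z \<in> sector \<Sigma> \<Longrightarrow> f z = \<phi> z + a' / (1 + z) + b'"
    and y: "y = hc \<nu> \<phi> x + a' *\<^sub>C J 1 x + b' *\<^sub>C x" by blast
  have \<Sigma>0: "0 < \<Sigma>" using \<Sigma> \<sigma> by simp
  note u = elementary_decomposition_unique[OF \<Sigma>0 \<Sigma>(2) \<phi>(1) g, of a' b' a b]
  have e: "\<phi> z + a' / (1 + z) + b' = g z + a / (1 + z) + b" if "z \<in> sector \<Sigma>" for z
    using \<phi>(2)[OF that] eq[OF that] by simp
  have "hc \<nu> \<phi> x = hc \<nu> g x"
    by (rule hc_cong) (use u(3)[OF e] sector_mono[OF \<sigma>(3) \<Sigma>(1)] \<nu> \<delta> in auto)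
  then show "y = hc \<nu> g x + a *\<^sub>C J 1 x + b *\<^sub>C x" using y u(1,2)[OF e] by simp
qed

section \<open>The K-functional of the domain\<close>

context sectorial_operator
begin

abbreviation K :: "real \<Rightarrow> 'a \<Rightarrow> real" where "K \<equiv> K_functional D (graph_norm A)"

lemma graph_norm_nonneg: "graph_norm A y \<ge> 0"
  by (simp add: graph_norm_def)

lemma K_bdd_below: "t \<ge> 0 \<Longrightarrow> bdd_below {norm a + t * graph_norm A b | a b. b \<in> D \<and> x = a + b}"
  by (rule bdd_belowI[of _ 0]) (auto simp: graph_norm_nonneg)

lemma K_le: "t \<ge> 0 \<Longrightarrow> b \<in> D \<Longrightarrow> K t x \<le> norm (x - b) + t * graph_norm A b"
  unfolding K_functional_def
  by (intro cInf_lower K_bdd_below) (rule CollectI, rule exI[of _ "x - b"], rule exI[of _ b], auto)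

lemma K_greatest:
  assumes "\<And>b. b \<in> D \<Longrightarrow> L \<le> norm (x - b) + t * graph_norm A b"
  shows "L \<le> K t x"
  unfolding K_functional_def
proof (rule cInf_greatest)
  show "{norm a + t * graph_norm A b |a b. b \<in> D \<and> x = a + b} \<noteq> {}"
  proof -
    have "norm x + t * graph_norm A 0 \<in> {norm a + t * graph_norm A b |a b. b \<in> D \<and> x = a + b}"
      using D_zero by (intro CollectI exI[of _ x] exI[of _ "0::'a"]) auto
    then show ?thesis by blast
  qed
  show "L \<le> y" if y: "y \<in> {norm a + t * graph_norm A b |a b. b \<in> D \<and> x = a + b}" for y
  proof -
    obtain a b where ab: "y = norm a + t * graph_norm A b" "b \<in> D" "x = a + b" using y by blast
    then have "x - b = a" by simp
    then show ?thesis using assms[OF ab(2)] ab(1) by simp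
  qed
qed

lemma K_nonneg: "t \<ge> 0 \<Longrightarrow> K t x \<ge> 0"
  by (rule K_greatest) (simp add: graph_norm_nonneg)

lemma K_le_norm: "t \<ge> 0 \<Longrightarrow> K t x \<le> norm x"
  using K_le[of t 0 x] D_zero by (simp add: graph_norm_def)

lemma K_mono:
  assumes "0 \<le> t" "t \<le> u"
  shows "K t x \<le> K u x"
proof (rule K_greatest)
  fix b assume "b \<in> D"
  then have "K t x \<le> norm (x - b) + t * graph_norm A b" using assms by (intro K_le)
  also have "\<dots> \<le> norm (x - b) + u * graph_norm A b"
    using assms graph_norm_nonneg by (intro add_left_mono mult_right_mono)
  finally show "K t x \<le> norm (x - b) + u * graph_norm A b" .
qed

lemma K_double:
  assumes "0 \<le> t"
  shows "K (2 * t) x \<le> 2 * K t x"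
proof -
  have "K (2 * t) x / 2 \<le> K t x"
  proof (rule K_greatest)
    fix b assume "b \<in> D"
    then have "K (2 * t) x \<le> norm (x - b) + 2 * t * graph_norm A b" using assms by (intro K_le) auto
    also have "\<dots> \<le> 2 * norm (x - b) + 2 * t * graph_norm A b" by simp
    finally show "K (2 * t) x / 2 \<le> norm (x - b) + t * graph_norm A b" by simp
  qed
  then show ?thesis by simp
qed

text \<open>The graph norm dominates the norm, so at t = 1 splitting x gains nothing.\<close>

lemma norm_le_K_one: "norm x \<le> K 1 x"
proof (rule K_greatest)
  fix b assume "b \<in> D"
  show "norm x \<le> norm (x - b) + 1 * graph_norm A b"
    using norm_triangle_sub[of x b] norm_ge_zero[of "A b"] unfolding graph_norm_def mult_1_left by linarith
qed

text \<open>A R(z) = z R(z) - 1 has norm at most M + 1, and on the domain A R(z) b = R(z) A b is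
  bounded by M/\<bar>z\<bar> times the norm of A b. Both are applied to x = (x - b) + b before
  taking the infimum over b.\<close>

lemma norm_A_R_le_K:
  assumes "z \<in> Out" "M \<ge> 0"
  shows "norm (A (R z x)) \<le> (M + 1) * K (1 / cmod z) x"
proof -
  have "norm (A (R z x)) / (M + 1) \<le> K (1 / cmod z) x"
  proof (rule K_greatest)
    fix b assume b: "b \<in> D"
    have "A (R z x) = (z *\<^sub>C R z (x - b) - (x - b)) + R z (A b)"
      using assms by (simp add: A_R R_A[OF _ b] R_diff scaleC_simps)
    also have "norm \<dots> \<le> (M * norm (x - b) + norm (x - b)) + M / cmod z * norm (A b)"
    proof (rule order_trans[OF norm_triangle_ineq add_mono[OF order_trans[OF norm_triangle_ineq4] R_bound[OF assms(1)]]])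
      show "norm (z *\<^sub>C R z (x - b)) + norm (x - b) \<le> M * norm (x - b) + norm (x - b)"
        using R_bound'[OF assms(1), of "x - b"] by (simp only: norm_scaleC add_le_cancel_right)
    qed
    also have "\<dots> \<le> (M + 1) * (norm (x - b) + 1 / cmod z * graph_norm A b)"
    proof -
      have "M / cmod z * norm (A b) \<le> (M + 1) / cmod z * graph_norm A b"
        using assms(2) by (intro mult_mono divide_right_mono) (auto simp: graph_norm_def)
      then show ?thesis by (simp add: algebra_simps add_divide_distrib)
    qed
    finally show "norm (A (R z x)) / (M + 1) \<le> norm (x - b) + 1 / cmod z * graph_norm A b"
      using assms(2) by (simp add: divide_le_eq mult.commute)
  qed
  then show ?thesis using assms(2) by (simp add: divide_le_eq mult.commute)
qed

lemma norm_diff_J_le_K: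
  assumes "c > 0" "M \<ge> 0"
  shows "norm (x - J c x) \<le> (M + 1) * K c x"
proof -
  have o: "- complex_of_real (1 / c) \<in> Out" using assms by (intro neg_in_Out) auto
  have "x - J c x = - A (R (- complex_of_real (1 / c)) x)"
    using A_R[OF o, of x] assms by (simp add: J_def scaleC_simps)
  then show ?thesis using norm_A_R_le_K[OF o assms(2), of x] assms(1) by (simp add: norm_divide)
qed

text \<open>\<open>J c x\<close> serves as the competitor in the infimum; c A (J c x) = x - J c x
  accounts for the factor 2.\<close>

lemma K_le_J:
  assumes "0 < c" "M \<ge> 0"
  shows "K c x \<le> 2 * norm (x - J c x) + c * M * norm x"
proof -
  have "K c x \<le> norm (x - J c x) + c * (norm (J c x) + norm (A (J c x)))"
    using K_le[OF _ J_in_D[OF assms(1), of x], of c x] assms by (simp add: graph_norm_def)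
  also have "c * norm (A (J c x)) = norm (x - J c x)"
    unfolding A_J[OF assms(1)] norm_scaleC using assms by (simp add: norm_divide)
  then have "norm (x - J c x) + c * (norm (J c x) + norm (A (J c x))) = 2 * norm (x - J c x) + c * norm (J c x)"
    by (simp add: distrib_left)
  also have "\<dots> \<le> 2 * norm (x - J c x) + c * M * norm x"
    using mult_left_mono[OF J_bound[OF assms(1), of x], of c] assms by simp
  finally show ?thesis .
qed

end

section \<open>Bounding the discrete norm by the interpolation norm\<close>

lemma norm_integral_le_nn_integral:
  fixes G :: "real \<Rightarrow> 'a::banach"
  assumes cont: "continuous_on UNIV G" and "\<epsilon> > 0" and bd: "\<And>t. norm (G t) \<le> C * exp (-\<epsilon> * \<bar>t\<bar>)"
  shows "ennreal (norm (integral UNIV G)) \<le> (\<integral>\<^sup>+t. ennreal (norm (G t)) \<partial>lborel)"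
proof -
  have n: "continuous_on UNIV (\<lambda>t. norm (G t))" using cont by (intro continuous_intros)
  have iG: "G integrable_on UNIV" and ih: "(\<lambda>t. norm (G t)) integrable_on UNIV"
    using exp_dominated_integrable[OF cont \<open>\<epsilon> > 0\<close>, of C 0] exp_dominated_integrable[OF n \<open>\<epsilon> > 0\<close>, of C 0] bd by auto
  have "(\<integral>\<^sup>+t. ennreal (norm (G t)) \<partial>lborel) = ennreal (integral UNIV (\<lambda>t. norm (G t)))"
    using ih by (intro nn_integral_has_integral_lborel) (auto intro!: borel_measurable_continuous_onI n)
  moreover have "norm (integral UNIV G) \<le> integral UNIV (\<lambda>t. norm (G t))"
    by (rule integral_norm_bound_integral[OF iG ih]) simp
  ultimately show ?thesis by (simp add: ennreal_leI)
qed

text \<open>For \<bar>\<lambda>\<bar> = exp t the K-functional is taken at exp (-t). The t with exp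
  (-t) in \<open>dyadic i\<close> lie in an interval of length ln 2 \<le> 1, so integrating over it
  costs no more than the bound \<open>u i\<close>.\<close>

lemma nn_integral_exp_dyadic_le:
  fixes u :: "int \<Rightarrow> ennreal"
  assumes "\<And>i t. exp (-t) \<in> dyadic i \<Longrightarrow> f t \<le> u i"
  shows "(\<integral>\<^sup>+t. f t \<partial>lborel) \<le> (\<integral>\<^sup>+i. u i \<partial>count_space UNIV)"
proof -
  define S where "S i = {- (of_int i + 1) * ln 2 .. - of_int i * ln (2::real)}" for i :: int
  have [measurable]: "S i \<in> sets lborel" for i by (simp add: S_def)
  have S: "t \<in> S i" if "exp (-t) \<in> dyadic i" for t i
  proof -
    have "2 powr i \<le> exp (-t)" "exp (-t) < 2 powr (i + 1)" using that by (auto simp: dyadic_def)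
    then have "i * ln 2 \<le> -t" "-t < (i + 1) * ln 2" by (simp_all add: powr_def)
    then show ?thesis by (simp add: S_def distrib_right left_diff_distrib)
  qed
  have eS: "emeasure lborel (S i) \<le> 1" for i
  proof -
    have "emeasure lborel (S i) = ennreal (ln 2)" by (simp add: S_def algebra_simps)
    also have "\<dots> \<le> ennreal 1" using ln_le_minus_one[of 2] by (intro ennreal_leI) simp
    finally show ?thesis by simp
  qed
  have "(\<integral>\<^sup>+t. f t \<partial>lborel) \<le> (\<integral>\<^sup>+t. (\<integral>\<^sup>+i. u i * indicator (S i) t \<partial>count_space UNIV) \<partial>lborel)"
  proof (rule nn_integral_mono)
    fix t :: real
    let ?i = "\<lfloor>log 2 (exp (-t))\<rfloor>"
    have d: "exp (-t) \<in> dyadic ?i" by (rule dyadic_exists) simp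
    have "f t \<le> u ?i * indicator (S ?i) t" using assms[OF d] S[OF d] by simp
    also have "\<dots> \<le> (\<integral>\<^sup>+i. u i * indicator (S i) t \<partial>count_space UNIV)"
      by (rule nn_integral_ge_point) simp
    finally show "f t \<le> (\<integral>\<^sup>+i. u i * indicator (S i) t \<partial>count_space UNIV)" .
  qed
  also have "\<dots> = (\<integral>\<^sup>+i. (\<integral>\<^sup>+t. u i * indicator (S i) t \<partial>lborel) \<partial>count_space UNIV)"
    by (rule nn_integral_count_space_nn_integral) auto
  also have "\<dots> = (\<integral>\<^sup>+i. u i * emeasure lborel (S i) \<partial>count_space UNIV)"
    by (intro nn_integral_cong nn_integral_cmult_indicator) measurable
  also have "\<dots> \<le> (\<integral>\<^sup>+i. u i \<partial>count_space UNIV)"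
  proof (rule nn_integral_mono)
    show "u i * emeasure lborel (S i) \<le> u i" for i
      using mult_left_mono[OF eS[of i], of "u i"] by simp
  qed
  finally show ?thesis .
qed

lemma powr_two_le_geometric:
  fixes \<gamma> x :: real and m :: int
  assumes "\<gamma> > 0" "m \<ge> 0 \<Longrightarrow> x \<le> - (of_int m * \<gamma>)" "m \<le> 0 \<Longrightarrow> x \<le> of_int m * \<gamma>"
  shows "2 powr x \<le> (2 powr (-\<gamma>)) ^ nat \<bar>m\<bar>"
proof -
  have "(2 powr (-\<gamma>)) ^ nat \<bar>m\<bar> = 2 powr (- (of_int \<bar>m\<bar> * \<gamma>))"
    by (simp add: powr_realpow[symmetric] powr_powr mult.commute)
  moreover have "x \<le> - (of_int \<bar>m\<bar> * \<gamma>)" using assms by (cases "m \<ge> 0") auto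
  ultimately show ?thesis by simp
qed

text \<open>What is kept of \<phi>: the decomposition with limit b at infinity, the order above
  \<theta> at 0, the absence of zeros, and \<open>harnack\<close>, which is the uniform bound on the
  quotients \<phi>(tz)/\<phi>(2^-d z) from the definition of the class, taken at j = 0 and freed
  from the factor z^(-\<theta>).\<close>

locale interpolation_data = sectorial_calculus D A \<delta> M \<sigma>
  for D :: "'a::complex_banach set" and A :: "'a \<Rightarrow> 'a" and \<delta> M \<sigma> :: real +
  fixes \<nu> \<theta> \<epsilon>0 C0 H :: real and \<phi> \<phi>0 :: "complex \<Rightarrow> complex" and b :: complex and d :: int
  assumes M: "0 \<le> M"
    and \<nu>: "\<delta> < \<nu>" "\<nu> < \<sigma>"
    and \<theta>: "0 < \<theta>" "\<theta> < 1"
    and \<phi>0: "\<phi>0 \<in> H0_inf \<sigma>"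
    and \<phi>_eq: "z \<in> sector \<sigma> \<Longrightarrow> \<phi> z = \<phi>0 z + b * (z / (1 + z))"
    and \<phi>_nonzero: "z \<in> sector \<sigma> \<Longrightarrow> \<phi> z \<noteq> 0"
    and \<epsilon>0: "\<epsilon>0 > 0"
    and \<phi>_zero: "\<bar>Im w\<bar> < \<sigma> \<Longrightarrow> Re w \<le> 0 \<Longrightarrow> cmod (\<phi> (exp w)) \<le> C0 * exp ((\<theta> + \<epsilon>0) * Re w)"
    and harnack: "z \<in> sector \<sigma> \<Longrightarrow> t \<in> {1..2} \<Longrightarrow>
      cmod (\<phi> (complex_of_real t * z)) \<le> H * cmod (\<phi> (complex_of_real (2 powr (- d)) * z))"
begin

text \<open>This is \<phi>(cA), with the part cz/(1 + cz) interpreted directly as 1 - J c; agreement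
  with the elementary calculus is shown in \<open>elementary_calculus_scaled\<close>.\<close>

definition T :: "real \<Rightarrow> 'a \<Rightarrow> 'a" where
  "T c x = hc \<nu> (\<lambda>z. \<phi>0 (complex_of_real c * z)) x + b *\<^sub>C (x - J c x)"

lemma \<phi>0_scale: "c > 0 \<Longrightarrow> (\<lambda>z. \<phi>0 (complex_of_real c * z)) \<in> H0_inf \<sigma>"
  using H0_inf_scale[OF \<sigma>(3,2) \<phi>0] .

text \<open>Removing b z/(1 + z) from \<phi> leaves at 0 only the order p = min (\<theta> +
  \<epsilon>0) 1, which still exceeds \<theta> because \<theta> < 1.\<close>

lemma \<phi>0_decay:
  obtains p \<epsilon> C where "\<theta> < p" "0 < \<epsilon>" "0 \<le> C"
    "\<And>w. \<bar>Im w\<bar> < \<sigma> \<Longrightarrow> cmod (\<phi>0 (exp w)) \<le> C * exp (p * Re w)"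
    "\<And>w. \<bar>Im w\<bar> < \<sigma> \<Longrightarrow> cmod (\<phi>0 (exp w)) \<le> C * exp (- \<epsilon> * Re w)"
proof -
  obtain \<epsilon> C1 where e: "\<epsilon> > 0" "C1 \<ge> 0" "\<And>w. \<bar>Im w\<bar> < \<sigma> \<Longrightarrow> cmod (\<phi>0 (exp w)) \<le> C1 * exp (-\<epsilon> * \<bar>Re w\<bar>)"
    using H0_infE[OF \<sigma>(3,2) \<phi>0] by blast
  obtain B where B: "B > 0" "\<And>w c. \<bar>Im w\<bar> \<le> \<sigma> \<Longrightarrow> c > 0 \<Longrightarrow> cmod (1 / (1 + complex_of_real c * exp w)) \<le> B / (1 + c * exp (Re w))"
    using one_plus_quotient_bounded[OF \<sigma>(3,4)] by blast
  define p where "p = min (\<theta> + \<epsilon>0) 1"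
  have p: "\<theta> < p" "0 < p" using \<theta> \<epsilon>0 by (auto simp: p_def)
  have C0: "C0 \<ge> 0" using order_trans[OF norm_ge_zero \<phi>_zero[of 0]] \<sigma> by simp
  define C where "C = C1 + C0 + cmod b * B"
  have C: "C1 \<le> C" "0 \<le> C" using C0 e(2) B(1) by (auto simp: C_def)
  show ?thesis
  proof
    show "\<theta> < p" "0 < \<epsilon>" "0 \<le> C" using p e C by auto
    fix w :: complex assume w: "\<bar>Im w\<bar> < \<sigma>"
    have "- \<epsilon> * \<bar>Re w\<bar> \<le> - \<epsilon> * Re w" using e(1) by simp
    then have "C1 * exp (-\<epsilon> * \<bar>Re w\<bar>) \<le> C * exp (- \<epsilon> * Re w)" using C e(2) by (intro mult_mono) auto
    then show "cmod (\<phi>0 (exp w)) \<le> C * exp (- \<epsilon> * Re w)" using e(3)[OF w] by (rule order_trans[rotated])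
    show "cmod (\<phi>0 (exp w)) \<le> C * exp (p * Re w)"
    proof (cases "Re w \<le> 0")
      case False
      have "- \<epsilon> * \<bar>Re w\<bar> \<le> 0" "0 \<le> p * Re w" using e(1) p False by auto
      then have "- \<epsilon> * \<bar>Re w\<bar> \<le> p * Re w" by linarith
      then have "C1 * exp (-\<epsilon> * \<bar>Re w\<bar>) \<le> C * exp (p * Re w)" using C e(2) by (intro mult_mono) auto
      then show ?thesis using e(3)[OF w] by (rule order_trans[rotated])
    next
      case True
      have le1: "(\<theta> + \<epsilon>0) * Re w \<le> p * Re w" "Re w \<le> p * Re w"
        using mult_right_mono_neg[OF _ True, of p "\<theta> + \<epsilon>0"] mult_right_mono_neg[OF _ True, of p 1] by (auto simp: p_def)
      have s: "exp w \<in> sector \<sigma>" using exp_in_sector[OF \<sigma>(2) w] .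
      have "cmod (exp w / (1 + exp w)) = exp (Re w) * cmod (1 / (1 + complex_of_real 1 * exp w))" by (simp add: norm_divide)
      also have "\<dots> \<le> exp (Re w) * (B / (1 + 1 * exp (Re w)))" using B(2)[of w 1] w by (intro mult_left_mono) auto
      also have "\<dots> \<le> exp (Re w) * (B / 1)" using B(1) by (intro mult_left_mono divide_left_mono) (auto simp: add_pos_pos)
      finally have q: "cmod (exp w / (1 + exp w)) \<le> B * exp (Re w)" by (simp add: mult.commute)
      have "\<phi>0 (exp w) = \<phi> (exp w) - b * (exp w / (1 + exp w))" using \<phi>_eq[OF s] by simp
      then have "cmod (\<phi>0 (exp w)) \<le> cmod (\<phi> (exp w)) + cmod b * cmod (exp w / (1 + exp w))"
        by (metis norm_mult norm_triangle_ineq4)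
      also have "\<dots> \<le> C0 * exp ((\<theta> + \<epsilon>0) * Re w) + cmod b * (B * exp (Re w))"
        using \<phi>_zero[OF w True] q by (intro add_mono mult_left_mono) auto
      also have "\<dots> \<le> C0 * exp (p * Re w) + cmod b * (B * exp (p * Re w))"
        using le1 C0 B(1) by (intro add_mono mult_left_mono) auto
      also have "\<dots> = (C0 + cmod b * B) * exp (p * Re w)" by (simp add: algebra_simps)
      also have "\<dots> \<le> C * exp (p * Re w)" using e(2) by (intro mult_right_mono) (auto simp: C_def)
      finally show ?thesis .
    qed
  qed
qed

definition cj :: "'a \<Rightarrow> int \<Rightarrow> real" where "cj x j = 2 powr (- (j * \<theta>)) * norm (T (2 powr j) x)"
definition kj :: "'a \<Rightarrow> int \<Rightarrow> real" where "kj x j = 2 powr (- (j * \<theta>)) * K (2 powr j) x"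

text \<open>Since \<open>\<lambda> R(\<lambda>) x = x + A R(\<lambda>) x\<close> and the contribution of the constant vector \<open>x\<close> vanishes by Cauchy's
  theorem, the functional calculus only sees \<open>A R(\<lambda>) x\<close>, which the K-functional controls.\<close>

lemma norm_hc_le:
  assumes f: "f \<in> H0_inf \<sigma>"
  shows "ennreal (norm (hc \<nu> f x)) \<le>
    (\<integral>\<^sup>+t. ennreal (cmod (f (exp (Complex t (-\<nu>)))) * ((M + 1) * K (exp (-t)) x)) \<partial>lborel) +
    (\<integral>\<^sup>+t. ennreal (cmod (f (exp (Complex t \<nu>))) * ((M + 1) * K (exp (-t)) x)) \<partial>lborel)"
proof -
  obtain \<epsilon> C where e: "\<epsilon> > 0" "C \<ge> 0" "\<And>w. \<bar>Im w\<bar> < \<sigma> \<Longrightarrow> cmod (f (exp w)) \<le> C * exp (-\<epsilon> * \<bar>Re w\<bar>)"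
    using H0_infE[OF \<sigma>(3,2) f] by blast
  have fc: "continuous_on (sector \<sigma>) f"
    by (rule holomorphic_on_imp_continuous_on[OF H0_inf_holomorphic[OF f]])
  define G where "G a t = f (exp (Complex t a)) *\<^sub>C A (R (exp (Complex t a)) x)" for a t
  define I where "I a = integral UNIV (G a)" for a
  {
    fix a assume a: "a = \<nu> \<or> a = -\<nu>"
    have a': "\<delta> < \<bar>a\<bar>" "\<bar>a\<bar> < \<sigma>" using a \<nu> \<delta> by auto
    have G: "G a t = ray_integrand a f x t - f (exp (Complex t a)) *\<^sub>C x" for t
      using A_R[OF ray_Out[OF a']] by (simp add: G_def ray_integrand_def scaleC.diff_right scaleC_scaleC mult.commute)
    have Gc: "continuous_on UNIV (G a)" unfolding G
      by (intro continuous_intros ray_integrand_continuous[OF fc a'] continuous_on_ray[OF \<sigma>(3,2) fc a'(2)])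
    have K: "norm (A (R (exp (Complex t a)) x)) \<le> (M + 1) * K (exp (-t)) x" for t
      using norm_A_R_le_K[OF ray_Out[OF a', of t] M, of x] by (simp add: exp_minus inverse_eq_divide)
    have Gn: "norm (G a t) \<le> cmod (f (exp (Complex t a))) * ((M + 1) * K (exp (-t)) x)" for t
      unfolding G_def norm_scaleC using K by (intro mult_left_mono) auto
    have Gb: "norm (G a t) \<le> C * ((M + 1) * norm x) * exp (-\<epsilon> * \<bar>t\<bar>)" for t
    proof -
      have "norm (G a t) \<le> (C * exp (-\<epsilon> * \<bar>t\<bar>)) * ((M + 1) * norm x)"
        using e(2) e(3)[of "Complex t a"] a' M K_le_norm[of "exp (-t)" x] K_nonneg[of "exp (-t)" x]
        by (intro order_trans[OF Gn] mult_mono) auto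
      then show ?thesis by (simp add: mult_ac)
    qed
    have "ray_integral D A a f x = I a + integral UNIV (\<lambda>t. f (exp (Complex t a))) *\<^sub>C x"
    proof -
      have "((\<lambda>t. f (exp (Complex t a)) *\<^sub>C x) has_integral integral UNIV (\<lambda>t. f (exp (Complex t a))) *\<^sub>C x) UNIV"
        using has_integral_linear[OF integrable_integral[OF H0_ray_integrable[OF \<sigma>(3,2) f a'(2)]] scaleC.bounded_linear_left[of x]]
        by (simp add: o_def)
      from has_integral_diff[OF integrable_integral[OF ray_integrand_integrable[OF f a']] this]
      have "(G a has_integral (ray_integral D A a f x - integral UNIV (\<lambda>t. f (exp (Complex t a))) *\<^sub>C x)) UNIV"
        unfolding ray_integral_eq G[abs_def] .
      from integral_unique[OF this] show ?thesis by (simp add: I_def)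
    qed
    moreover have "ennreal (norm (I a)) \<le> (\<integral>\<^sup>+t. ennreal (cmod (f (exp (Complex t a))) * ((M + 1) * K (exp (-t)) x)) \<partial>lborel)"
      unfolding I_def
      by (rule order_trans[OF norm_integral_le_nn_integral[OF Gc e(1) Gb]]) (intro nn_integral_mono ennreal_leI Gn)
    ultimately have "ray_integral D A a f x = I a + integral UNIV (\<lambda>t. f (exp (Complex t a))) *\<^sub>C x \<and>
      ennreal (norm (I a)) \<le> (\<integral>\<^sup>+t. ennreal (cmod (f (exp (Complex t a))) * ((M + 1) * K (exp (-t)) x)) \<partial>lborel)" by blast
  } note I = this
  have "hc \<nu> f x = (1 / (2 * pi * \<i>)) *\<^sub>C (I (-\<nu>) - I \<nu>)"
    using I[of \<nu>] I[of "-\<nu>"] H0_ray_integrals_eq[OF _ \<nu>(2) \<sigma>(2) f] \<nu> \<delta> by (simp add: H0_calculus_def)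
  then have "norm (hc \<nu> f x) = 1 / (2 * pi) * norm (I (-\<nu>) - I \<nu>)" by (simp add: norm_scaleC norm_divide norm_mult)
  also have "\<dots> \<le> 1 * (norm (I (-\<nu>)) + norm (I \<nu>))"
    using pi_gt3 by (intro mult_mono norm_triangle_ineq4) auto
  finally have "ennreal (norm (hc \<nu> f x)) \<le> ennreal (norm (I (-\<nu>))) + ennreal (norm (I \<nu>))"
    by (simp add: ennreal_leI flip: ennreal_plus)
  also have "\<dots> \<le> (\<integral>\<^sup>+t. ennreal (cmod (f (exp (Complex t (-\<nu>)))) * ((M + 1) * K (exp (-t)) x)) \<partial>lborel) +
    (\<integral>\<^sup>+t. ennreal (cmod (f (exp (Complex t \<nu>))) * ((M + 1) * K (exp (-t)) x)) \<partial>lborel)"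
    using I[of \<nu>] I[of "-\<nu>"] by (intro add_mono) auto
  finally show ?thesis .
qed

text \<open>\<open>norm_hc_le\<close> is applied to the dilate of \<phi>0 by 2^j and cut into the
  pieces with 1/\<bar>\<lambda>\<bar> in \<open>dyadic i\<close>, where \<bar>2^j \<lambda>\<bar> is
  about 2^(j-i). The part b (x - J c x) contributes only the diagonal term i = j.\<close>

lemma cj_le_convolution:
  obtains r C where "0 < r" "r < 1" "C > 0"
    "\<And>x j. ennreal (cj x j) \<le> ennreal C * (\<integral>\<^sup>+i. ennreal (r ^ nat \<bar>j - i\<bar>) * ennreal (kj x i) \<partial>count_space UNIV)"
proof -
  obtain p \<epsilon> C where C: "\<theta> < p" "0 < \<epsilon>" "0 \<le> C"
    "\<And>w. \<bar>Im w\<bar> < \<sigma> \<Longrightarrow> cmod (\<phi>0 (exp w)) \<le> C * exp (p * Re w)"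
    "\<And>w. \<bar>Im w\<bar> < \<sigma> \<Longrightarrow> cmod (\<phi>0 (exp w)) \<le> C * exp (- \<epsilon> * Re w)"
    using \<phi>0_decay by blast
  \<comment> \<open>The decay of \<phi>0 combined with the weight 2^(-(j-i)\<theta>): the rate is p
    - \<theta> for j < i and \<epsilon> + \<theta> for j > i.\<close>
  define \<gamma> where "\<gamma> = min (p - \<theta>) (\<epsilon> + \<theta>)"
  have \<gamma>: "\<gamma> > 0" using C \<theta> by (simp add: \<gamma>_def)
  define r where "r = 2 powr (- \<gamma>)"
  have r: "0 < r" "r < 1" using \<gamma> powr_less_mono[of "-\<gamma>" 0 2] by (auto simp: r_def)
  \<comment> \<open>The factor 2 in front counts the two rays, the middle summand belongs to b (x -
    J c x), and the 1 secures positivity.\<close>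
  define C' where "C' = 2 * (C * 2 powr \<epsilon> * ((M + 1) * 2)) + cmod b * (M + 1) + 1"
  have C': "C' > 0" using C(3) M by (simp add: C'_def add_nonneg_pos)
  have point: "2 powr (- (j * \<theta>)) * (cmod (\<phi>0 (complex_of_real (2 powr j) * exp (Complex t a))) * ((M + 1) * K (exp (-t)) x))
      \<le> C * 2 powr \<epsilon> * ((M + 1) * 2) * (r ^ nat \<bar>j - i\<bar> * kj x i)"
    if a: "\<bar>a\<bar> < \<sigma>" and t: "exp (-t) \<in> dyadic i" for x t a and i j :: int
  proof -
    have t2: "2 powr i \<le> exp (-t)" "exp (-t) \<le> 2 powr (i + 1)" using t by (auto simp: dyadic_def)
    then have tl: "i * ln 2 \<le> - t" "- t \<le> (i + 1) * ln 2" by (simp_all add: powr_def)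
    have arg: "complex_of_real (2 powr j) * exp (Complex t a) = exp (Complex (t + j * ln 2) a)"
      by (simp add: exp_of_real_ln_mult ln_powr complex_eq_iff Complex_eq algebra_simps)
    have Kb: "K (exp (-t)) x \<le> 2 * K (2 powr i) x"
      using order_trans[OF K_mono[OF _ t2(2)] ] K_double[of "2 powr i" x] by (simp add: powr_add mult.commute)
    have f1: "cmod (\<phi>0 (exp (Complex (t + j * ln 2) a))) \<le> C * 2 powr \<epsilon> * 2 powr ((j - i) * p)"
    proof -
      have "p * (t + j * ln 2) \<le> p * ((j - i) * ln 2)" using tl C(1) \<theta> by (intro mult_left_mono) (auto simp: algebra_simps)
      then have "exp (p * (t + j * ln 2)) \<le> 2 powr ((j - i) * p)" by (simp add: powr_def mult_ac)
      then have "C * exp (p * (t + j * ln 2)) \<le> C * (2 powr \<epsilon> * 2 powr ((j - i) * p))"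
        using C(2,3) ge_one_powr_ge_zero[of 2 \<epsilon>]
        by (intro mult_left_mono) (auto intro: order_trans[OF _ mult_right_mono[of 1 "2 powr \<epsilon>"]])
      then show ?thesis using C(4)[of "Complex (t + j * ln 2) a"] a by (simp add: mult.assoc)
    qed
    have f2: "cmod (\<phi>0 (exp (Complex (t + j * ln 2) a))) \<le> C * 2 powr \<epsilon> * 2 powr (- ((j - i) * \<epsilon>))"
    proof -
      have "\<epsilon> * (- (t + j * ln 2)) \<le> \<epsilon> * ((1 - (j - i)) * ln 2)" using tl C(2) by (intro mult_left_mono) (auto simp: algebra_simps)
      then have "exp (- \<epsilon> * (t + j * ln 2)) \<le> 2 powr (\<epsilon> + - ((j - i) * \<epsilon>))" by (simp add: powr_def algebra_simps)
      then have "C * exp (- \<epsilon> * (t + j * ln 2)) \<le> C * (2 powr \<epsilon> * 2 powr (- ((j - i) * \<epsilon>)))"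
        unfolding powr_add using C(3) by (intro mult_left_mono) auto
      then show ?thesis using C(5)[of "Complex (t + j * ln 2) a"] a by (simp add: mult.assoc)
    qed
    define y where "y = (if j - i \<ge> 0 then - ((j - i) * \<epsilon>) else (j - i) * p)"
    have f: "cmod (\<phi>0 (exp (Complex (t + j * ln 2) a))) \<le> C * 2 powr \<epsilon> * 2 powr y" using f1 f2 by (simp add: y_def)
    have y: "2 powr (y - (j - i) * \<theta>) \<le> r ^ nat \<bar>j - i\<bar>"
      unfolding r_def
    proof (rule powr_two_le_geometric[OF \<gamma>])
      show "y - (j - i) * \<theta> \<le> - ((j - i) * \<gamma>)" if "j - i \<ge> 0"
      proof -
        have "(j - i) * \<gamma> \<le> (j - i) * (\<epsilon> + \<theta>)" using that by (intro mult_left_mono) (auto simp: \<gamma>_def)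
        then show ?thesis using that by (simp add: y_def algebra_simps)
      qed
      show "y - (j - i) * \<theta> \<le> (j - i) * \<gamma>" if "j - i \<le> 0"
      proof (cases "j = i")
        case False
        have "(j - i) * (p - \<theta>) \<le> (j - i) * \<gamma>" using that by (intro mult_left_mono_neg) (auto simp: \<gamma>_def)
        then show ?thesis using that False by (simp add: y_def algebra_simps)
      qed (simp add: y_def)
    qed
    have "2 powr (- (j * \<theta>)) * (cmod (\<phi>0 (complex_of_real (2 powr j) * exp (Complex t a))) * ((M + 1) * K (exp (-t)) x))
      \<le> 2 powr (- (j * \<theta>)) * ((C * 2 powr \<epsilon> * 2 powr y) * ((M + 1) * (2 * K (2 powr i) x)))"
      unfolding arg using f Kb M C(3) K_nonneg[of "exp (-t)" x] by (intro mult_left_mono mult_mono) auto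
    also have "\<dots> = C * 2 powr \<epsilon> * ((M + 1) * 2) * (2 powr (y - (j - i) * \<theta>) * kj x i)"
    proof -
      have "2 powr (y - (j - i) * \<theta>) * 2 powr (- (i * \<theta>)) = 2 powr y * 2 powr (- (j * \<theta>))"
        by (simp add: algebra_simps flip: powr_add)
      then show ?thesis by (simp add: kj_def mult_ac)
    qed
    also have "\<dots> \<le> C * 2 powr \<epsilon> * ((M + 1) * 2) * (r ^ nat \<bar>j - i\<bar> * kj x i)"
      using y C(3) M K_nonneg[of "2 powr i" x] by (intro mult_left_mono mult_right_mono) (auto simp: kj_def)
    finally show ?thesis .
  qed
  show ?thesis
  proof
    fix x :: 'a and j :: int
    let ?W = "\<integral>\<^sup>+i. ennreal (r ^ nat \<bar>j - i\<bar>) * ennreal (kj x i) \<partial>count_space UNIV"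
    let ?f = "\<lambda>z. \<phi>0 (complex_of_real (2 powr j) * z)"
    let ?C1 = "C * 2 powr \<epsilon> * ((M + 1) * 2)"
    have kj0: "kj x i \<ge> 0" for i by (simp add: kj_def K_nonneg)
    have ray: "ennreal (2 powr (- (j * \<theta>))) * (\<integral>\<^sup>+t. ennreal (cmod (?f (exp (Complex t a))) * ((M + 1) * K (exp (-t)) x)) \<partial>lborel) \<le> ennreal ?C1 * ?W"
      if "\<bar>a\<bar> < \<sigma>" for a
    proof -
      have "(\<integral>\<^sup>+t. ennreal (cmod (?f (exp (Complex t a))) * ((M + 1) * K (exp (-t)) x)) \<partial>lborel) \<le>
          (\<integral>\<^sup>+i. ennreal (2 powr (j * \<theta>)) * (ennreal ?C1 * (ennreal (r ^ nat \<bar>j - i\<bar>) * ennreal (kj x i))) \<partial>count_space UNIV)"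
      proof (rule nn_integral_exp_dyadic_le)
        fix i t assume t: "exp (-t) \<in> dyadic i"
        have "cmod (?f (exp (Complex t a))) * ((M + 1) * K (exp (-t)) x) =
            2 powr (j * \<theta>) * (2 powr (- (j * \<theta>)) * (cmod (?f (exp (Complex t a))) * ((M + 1) * K (exp (-t)) x)))"
          by (simp add: powr_minus)
        also have "\<dots> \<le> 2 powr (j * \<theta>) * (?C1 * (r ^ nat \<bar>j - i\<bar> * kj x i))"
          by (intro mult_left_mono point[OF that t]) simp
        finally show "ennreal (cmod (?f (exp (Complex t a))) * ((M + 1) * K (exp (-t)) x)) \<le>
            ennreal (2 powr (j * \<theta>)) * (ennreal ?C1 * (ennreal (r ^ nat \<bar>j - i\<bar>) * ennreal (kj x i)))"
          using kj0[of i] r C(3) M by (simp add: ennreal_leI flip: ennreal_mult)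
      qed
      also have "\<dots> = ennreal (2 powr (j * \<theta>)) * (ennreal ?C1 * ?W)" by (simp add: nn_integral_cmult)
      finally have "ennreal (2 powr (- (j * \<theta>))) * (\<integral>\<^sup>+t. ennreal (cmod (?f (exp (Complex t a))) * ((M + 1) * K (exp (-t)) x)) \<partial>lborel)
          \<le> ennreal (2 powr (- (j * \<theta>))) * (ennreal (2 powr (j * \<theta>)) * (ennreal ?C1 * ?W))" by (rule mult_left_mono) simp
      also have "\<dots> = ennreal ?C1 * ?W"
      proof -
        have "ennreal (2 powr (- (j * \<theta>))) * ennreal (2 powr (j * \<theta>)) = 1"
          by (simp flip: ennreal_mult powr_add)
        then show ?thesis by (simp add: mult.assoc[symmetric])
      qed
      finally show ?thesis .
    qed
    have h: "ennreal (2 powr (- (j * \<theta>)) * norm (hc \<nu> ?f x)) \<le> ennreal (2 * ?C1) * ?W"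
    proof -
      have "ennreal (2 powr (- (j * \<theta>)) * norm (hc \<nu> ?f x)) = ennreal (2 powr (- (j * \<theta>))) * ennreal (norm (hc \<nu> ?f x))"
        by (simp add: ennreal_mult)
      also have "\<dots> \<le> ennreal ?C1 * ?W + ennreal ?C1 * ?W"
        using ray[of \<nu>] ray[of "-\<nu>"] \<nu> \<delta>
        by (intro order_trans[OF mult_left_mono[OF norm_hc_le[OF \<phi>0_scale]]]) (auto simp: distrib_left intro!: add_mono)
      also have "\<dots> = ennreal (2 * ?C1) * ?W"
      proof -
        have "ennreal (2 * ?C1) = ennreal ?C1 + ennreal ?C1"
          using C(3) M by (subst ennreal_plus[symmetric]) auto
        then show ?thesis by (simp only: distrib_right)
      qed
      finally show ?thesis .
    qed
    have kW: "ennreal (kj x j) \<le> ?W"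
      using nn_integral_ge_point[of j UNIV "\<lambda>i. ennreal (r ^ nat \<bar>j - i\<bar>) * ennreal (kj x i)"] by simp
    have "cj x j \<le> 2 powr (- (j * \<theta>)) * norm (hc \<nu> ?f x) + cmod b * (M + 1) * kj x j"
    proof -
      have "norm (T (2 powr j) x) \<le> norm (hc \<nu> ?f x) + cmod b * ((M + 1) * K (2 powr j) x)"
        unfolding T_def using norm_diff_J_le_K[of "2 powr j" x] M
        by (intro order_trans[OF norm_triangle_ineq] add_mono) (auto simp: norm_scaleC intro!: mult_left_mono)
      from mult_left_mono[OF this, of "2 powr (- (j * \<theta>))"] show ?thesis
        by (simp add: cj_def kj_def algebra_simps)
    qed
    then have "ennreal (cj x j) \<le> ennreal (2 powr (- (j * \<theta>)) * norm (hc \<nu> ?f x)) + ennreal (cmod b * (M + 1)) * ennreal (kj x j)"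
      using kj0[of j] M by (simp add: ennreal_leI flip: ennreal_mult ennreal_plus)
    also have "\<dots> \<le> ennreal (2 * ?C1) * ?W + ennreal (cmod b * (M + 1)) * ?W"
      by (intro add_mono h mult_left_mono kW) simp
    also have "\<dots> = ennreal (2 * ?C1 + cmod b * (M + 1)) * ?W"
      using C(3) M by (simp add: ennreal_plus distrib_right)
    also have "\<dots> \<le> ennreal C' * ?W" by (intro mult_right_mono ennreal_leI) (auto simp: C'_def)
    finally show "ennreal (cj x j) \<le> ennreal C' * ?W" .
  qed (use r C' in auto)
qed

end

section \<open>A discrete reproducing formula\<close>

lemma sum_int_telescope:
  fixes F :: "int \<Rightarrow> 'a::ab_group_add"
  shows "(\<Sum>j\<in>{- int n..int n}. F (j + 1) - F j) = F (int n + 1) - F (- int n)"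
proof (induction n)
  case (Suc n)
  have "{- int (Suc n)..int (Suc n)} = insert (- int (Suc n)) (insert (int (Suc n)) {- int n..int n})" by auto
  then have "(\<Sum>j\<in>{- int (Suc n)..int (Suc n)}. F (j + 1) - F j) =
      (F (- int (Suc n) + 1) - F (- int (Suc n))) + ((F (int (Suc n) + 1) - F (int (Suc n))) + (\<Sum>j\<in>{- int n..int n}. F (j + 1) - F j))"
    by simp
  also have "\<dots> = F (int (Suc n) + 1) - F (- int (Suc n))"
    unfolding Suc.IH by (simp add: algebra_simps)
  finally show ?case .
qed simp

lemma convex_strip: "convex {w. \<bar>Im w\<bar> < \<sigma>}"
proof -
  have "{w. \<bar>Im w\<bar> < \<sigma>} = {w. Im w < \<sigma>} \<inter> {w. Im w > - \<sigma>}" by auto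
  then show ?thesis by (simp add: convex_Int convex_halfspace_Im_lt convex_halfspace_Im_gt)
qed

text \<open>The lopsided intervals come from telescoping over j = -n, ..., n, which ends at n +
  1.\<close>

lemma has_integral_symmetric_intervals_limit:
  fixes f :: "real \<Rightarrow> 'a::banach"
  assumes "(f has_integral I) UNIV" "c > 0"
  shows "(\<lambda>n. integral {- (real n * c)..(real n + 1) * c} f) \<longlonglongrightarrow> I"
proof (rule tendstoI)
  fix e :: real assume "e > 0"
  then obtain B where B: "B > 0" "\<And>a b. ball 0 B \<subseteq> cbox a b \<Longrightarrow> norm (integral (cbox a b) f - I) < e"
    using assms(1) by (subst (asm) has_integral_alt') auto
  have "dist (integral {- (real n * c)..(real n + 1) * c} f) I < e" if "n \<ge> nat \<lceil>B / c\<rceil>" for n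
  proof -
    have "B / c \<le> real n" using that by linarith
    then have "B \<le> real n * c" using assms(2) by (simp add: divide_le_eq)
    then have "ball 0 B \<subseteq> cbox (- (real n * c)) ((real n + 1) * c)"
      using assms(2) by (auto simp: abs_less_iff distrib_right)
    from B(2)[OF this] show ?thesis by (simp add: dist_norm)
  qed
  then show "\<forall>\<^sub>F n in sequentially. dist (integral {- (real n * c)..(real n + 1) * c} f) I < e"
    using eventually_sequentially by blast
qed

context interpolation_data
begin

lemma \<phi>_holomorphic: "\<phi> holomorphic_on sector \<sigma>"
proof -
  have "(\<lambda>z. \<phi>0 z + b * (z / (1 + complex_of_real 1 * z))) holomorphic_on sector \<sigma>"
    by (intro holomorphic_intros H0_inf_holomorphic[OF \<phi>0] one_plus_holomorphic[OF \<sigma>(3)]) auto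
  then show ?thesis by (rule holomorphic_transform) (use \<phi>_eq in simp)
qed

lemma \<phi>_bounded:
  obtains B where "B \<ge> 0" "\<And>w. \<bar>Im w\<bar> < \<sigma> \<Longrightarrow> cmod (\<phi> (exp w)) \<le> B"
proof -
  obtain B0 where B0: "B0 \<ge> 0" "\<And>w. \<bar>Im w\<bar> < \<sigma> \<Longrightarrow> cmod (\<phi>0 (exp w)) \<le> B0"
    using H0_inf_bounded[OF \<sigma>(3,2) \<phi>0] by blast
  obtain B where B: "B > 0" "\<And>w c. \<bar>Im w\<bar> \<le> \<sigma> \<Longrightarrow> c > 0 \<Longrightarrow> cmod (1 / (1 + complex_of_real c * exp w)) \<le> B / (1 + c * exp (Re w))"
    using one_plus_quotient_bounded[OF \<sigma>(3,4)] by blast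
  have "cmod (\<phi> (exp w)) \<le> B0 + cmod b * B" if w: "\<bar>Im w\<bar> < \<sigma>" for w
  proof -
    have "cmod (exp w / (1 + exp w)) = exp (Re w) * cmod (1 / (1 + complex_of_real 1 * exp w))" by (simp add: norm_divide)
    also have "\<dots> \<le> exp (Re w) * (B / (1 + 1 * exp (Re w)))" using B(2)[of w 1] w by (intro mult_left_mono) auto
    also have "\<dots> \<le> B" using B(1) by (simp add: divide_le_eq add_pos_pos algebra_simps)
    finally have q: "cmod (exp w / (1 + exp w)) \<le> B" .
    have "cmod (\<phi> (exp w)) \<le> cmod (\<phi>0 (exp w)) + cmod b * cmod (exp w / (1 + exp w))"
      unfolding \<phi>_eq[OF exp_in_sector[OF \<sigma>(2) w]] by (metis norm_mult norm_triangle_ineq)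
    also have "\<dots> \<le> B0 + cmod b * B" using B0(2)[OF w] q by (intro add_mono mult_left_mono) auto
    finally show ?thesis .
  qed
  moreover have "B0 + cmod b * B \<ge> 0" using B0 B by simp
  ultimately show ?thesis using that by blast
qed

text \<open>The function \<open>g\<close> below is \<open>\<integral>\<^sub>1\<^sup>2 \<eta>(tz) \<phi>(tz) dt/t\<close> divided by \<open>\<phi>(2\<^sup>-\<^sup>d z)\<close>, where
  \<open>\<eta>(z)\<close> is a multiple of \<open>\<phi>\<^sup>*(z) z / (1 + z)\<^sup>3\<close> with \<open>\<phi>\<^sup>*(z) = cnj (\<phi> (cnj z))\<close>, so that \<open>\<integral> \<eta>(t) \<phi>(t) dt/t\<close>
  over \<open>(0, \<infinity>)\<close> is \<open>1\<close>. In the variable \<open>w = Ln z\<close> the numerator is a difference of values of a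
  primitive, so that the sums over dyadic scales telescope.\<close>

lemma reproducing_function:
  obtains g C Q where "g \<in> H0_inf \<sigma>" "(\<lambda>z. z * g z) \<in> H0_inf \<sigma>" "C \<ge> 0"
    "\<And>w. \<bar>Im w\<bar> < \<sigma> \<Longrightarrow> cmod (g (exp w)) \<le> C * exp (- 1 * \<bar>Re w\<bar>)"
    "\<And>w. \<bar>Im w\<bar> < \<sigma> \<Longrightarrow> cmod (exp w * g (exp w)) \<le> C * exp (- 1 * \<bar>Re w\<bar>)"
    "\<And>n w. \<bar>Im w\<bar> < \<sigma> \<Longrightarrow> cmod (\<Sum>j\<in>{- int n..int n}. g (complex_of_real (2 powr j) * exp w) *
       \<phi> (complex_of_real (2 powr (j - d)) * exp w)) \<le> Q"
    "\<And>w. \<bar>Im w\<bar> < \<sigma> \<Longrightarrow> (\<lambda>n. \<Sum>j\<in>{- int n..int n}. g (complex_of_real (2 powr j) * exp w) *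
       \<phi> (complex_of_real (2 powr (j - d)) * exp w)) \<longlonglongrightarrow> 1"
proof -
  let ?S = "{w. \<bar>Im w\<bar> < \<sigma>}"
  obtain B\<phi> where B\<phi>: "B\<phi> \<ge> 0" "\<And>w. \<bar>Im w\<bar> < \<sigma> \<Longrightarrow> cmod (\<phi> (exp w)) \<le> B\<phi>" using \<phi>_bounded by blast
  obtain B where B: "B > 0" "\<And>w c. \<bar>Im w\<bar> \<le> \<sigma> \<Longrightarrow> c > 0 \<Longrightarrow> cmod (1 / (1 + complex_of_real c * exp w)) \<le> B / (1 + c * exp (Re w))"
    using one_plus_quotient_bounded[OF \<sigma>(3,4)] by blast
  \<comment> \<open>The factor z/(1 + z)^3 is of order 1 at 0 and of order -2 at infinity, so that
    both E and z E decay at rate 1. The reflected \<phi> makes the product with \<phi> equal to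
    \<bar>\<phi>\<bar>^2 z/(1 + z)^3 on the positive axis, hence nonnegative there.\<close>
  define E where "E w = cnj (\<phi> (exp (cnj w))) * (exp w * (1 / (1 + exp w)) ^ 3)" for w
  define k where "k w = E w * \<phi> (exp w)" for w
  define C1 where "C1 = B\<phi> * B ^ 3"
  have C1: "C1 \<ge> 0" using B\<phi> B by (simp add: C1_def)
  have E_bd: "cmod (E w) \<le> C1 * exp (- \<bar>Re w\<bar>)" "cmod (exp w * E w) \<le> C1 * exp (- \<bar>Re w\<bar>)" if w: "\<bar>Im w\<bar> < \<sigma>" for w
  proof -
    define e where "e = exp (Re w)"
    have e: "e > 0" by (simp add: e_def)
    have "cmod (1 / (1 + exp w)) \<le> B / (1 + e)" using B(2)[of w 1] w by (simp add: e_def)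
    then have "cmod (1 / (1 + exp w)) ^ 3 \<le> (B / (1 + e)) ^ 3" by (intro power_mono) auto
    then have "cmod (E w) \<le> B\<phi> * (e * (B / (1 + e)) ^ 3)"
      unfolding E_def norm_mult norm_power complex_mod_cnj using B\<phi>(2)[of "cnj w"] B\<phi>(1) w
      by (intro mult_mono) (auto simp: e_def)
    also have "\<dots> = C1 * (e / (1 + e) ^ 3)" by (simp add: C1_def power_divide)
    finally have E1: "cmod (E w) \<le> C1 * (e / (1 + e) ^ 3)" .
    have p1: "1 \<le> (1 + e) ^ 3" "e ^ 3 \<le> (1 + e) ^ 3" using e by (auto intro: one_le_power power_mono)
    have ab: "e / (1 + e) ^ 3 \<le> exp (- \<bar>Re w\<bar>) \<and> e * (e / (1 + e) ^ 3) \<le> exp (- \<bar>Re w\<bar>)"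
    proof (cases "Re w \<ge> 0")
      case True
      have e1: "e \<ge> 1" using True by (simp add: e_def)
      have "e / (1 + e) ^ 3 \<le> e / e ^ 3" using p1 e by (intro divide_left_mono) auto
      moreover have "e * (e / (1 + e) ^ 3) \<le> e * (e / e ^ 3)" using p1 e by (intro mult_left_mono divide_left_mono) auto
      moreover have "e * (e / e ^ 3) = 1 / e" using e by (simp add: power3_eq_cube)
      moreover have "e / e ^ 3 \<le> e * (e / e ^ 3)" using e e1 by (intro mult_left_mono[of 1 e "e / e ^ 3", simplified mult.commute mult_1_left mult_1_right] ) (auto simp: mult.commute)
      moreover have "1 / e = exp (- \<bar>Re w\<bar>)" using True by (simp add: e_def exp_minus inverse_eq_divide)
      ultimately show ?thesis by linarith
    next
      case False
      have e1: "e \<le> 1" using False by (simp add: e_def)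
      have "e / (1 + e) ^ 3 \<le> e / 1" using p1 e by (intro divide_left_mono) auto
      moreover have "e * (e / (1 + e) ^ 3) \<le> 1 * (e / 1)" using p1 e e1 by (intro mult_mono divide_left_mono) auto
      ultimately show ?thesis using False by (simp add: e_def)
    qed
    show "cmod (E w) \<le> C1 * exp (- \<bar>Re w\<bar>)" using order_trans[OF E1 mult_left_mono[OF conjunct1[OF ab] C1]] .
    have "cmod (exp w * E w) = e * cmod (E w)" by (simp add: norm_mult e_def)
    also have "\<dots> \<le> e * (C1 * (e / (1 + e) ^ 3))" using E1 e by (intro mult_left_mono) auto
    also have "\<dots> = C1 * (e * (e / (1 + e) ^ 3))" by simp
    also have "\<dots> \<le> C1 * exp (- \<bar>Re w\<bar>)" by (rule mult_left_mono[OF conjunct2[OF ab] C1])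
    finally show "cmod (exp w * E w) \<le> C1 * exp (- \<bar>Re w\<bar>)" .
  qed
  define C3 where "C3 = C1 * B\<phi>"
  have C3: "C3 \<ge> 0" using C1 B\<phi> by (simp add: C3_def)
  have k_bd: "cmod (k w) \<le> C3 * exp (- \<bar>Re w\<bar>)" if w: "\<bar>Im w\<bar> < \<sigma>" for w
  proof -
    have "cmod (k w) \<le> (C1 * exp (- \<bar>Re w\<bar>)) * B\<phi>"
      unfolding k_def norm_mult using E_bd(1)[OF w] B\<phi>(2)[OF w] C1 by (intro mult_mono) auto
    then show ?thesis by (simp add: C3_def mult_ac)
  qed
  have \<phi>e: "(\<phi> \<circ> exp) holomorphic_on ?S"
    by (rule holomorphic_on_compose_gen[OF _ \<phi>_holomorphic]) (auto intro!: holomorphic_intros exp_in_sector \<sigma>(2))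
  have "cnj ` ?S = ?S" by (auto simp: image_iff) (metis complex_cnj_cnj abs_minus_cancel complex.sel(2) cnj.simps(2))
  then have "(cnj \<circ> (\<phi> \<circ> exp) \<circ> cnj) holomorphic_on ?S"
    using \<phi>e by (intro holomorphic_on_compose_cnj_cnj open_strip) simp
  moreover have nz1: "1 + exp w \<noteq> 0" if "\<bar>Im w\<bar> < \<sigma>" for w
    using one_plus_sector_nonzero[OF \<sigma>(3) exp_in_sector[OF \<sigma>(2) that] zero_less_one] by simp
  ultimately have E_holo: "E holomorphic_on ?S"
    unfolding E_def[abs_def] by (intro holomorphic_intros) (auto simp: o_def)
  have k_holo: "k holomorphic_on ?S"
    unfolding k_def[abs_def] using E_holo \<phi>e by (auto intro!: holomorphic_intros simp: o_def)
  obtain P where P: "\<And>w. w \<in> ?S \<Longrightarrow> (P has_field_derivative k w) (at w within ?S)"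
    using holomorphic_convex_primitive'[OF convex_strip open_strip k_holo] by blast
  have P': "(P has_field_derivative k w) (at w)" if "w \<in> ?S" for w
    using P[OF that] at_within_open[OF that open_strip] by simp
  have P_holo: "P holomorphic_on ?S" using P by (auto simp: holomorphic_on_def field_differentiable_def)
  have P_seg: "cmod (P u - P w) \<le> c * cmod (u - w)"
    if "w \<in> ?S" "u \<in> ?S" "\<And>v. v \<in> closed_segment w u \<Longrightarrow> cmod (k v) \<le> c" for u w c
  proof (rule field_differentiable_bound[of "closed_segment w u"])
    show "(P has_field_derivative k z) (at z within closed_segment w u)" if "z \<in> closed_segment w u" for z
    proof -
      have "z \<in> ?S" using closed_segment_subset[OF \<open>w \<in> ?S\<close> \<open>u \<in> ?S\<close> convex_strip] that by blast
      then show ?thesis using P' by (meson has_field_derivative_at_within)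
    qed
  qed (use that in auto)
  have FTC: "((\<lambda>t. k (w + complex_of_real t)) has_integral P (w + complex_of_real c) - P (w + complex_of_real a)) {a..c}"
    if w: "w \<in> ?S" and "a \<le> c" for w a c
  proof (rule fundamental_theorem_of_calculus[OF \<open>a \<le> c\<close>])
    fix t assume "t \<in> {a..c}"
    have "((\<lambda>u. P (w + u)) has_field_derivative k (w + complex_of_real t)) (at (complex_of_real t))"
      using P'[of "w + complex_of_real t"] w by (simp add: DERIV_shift[symmetric] add.commute)
    then show "((\<lambda>t. P (w + complex_of_real t)) has_vector_derivative k (w + complex_of_real t)) (at t within {a..c})"
      by (rule has_vector_derivative_real_field)
  qed
  define \<rho> where "\<rho> t = (cmod (\<phi> (complex_of_real (exp t))))\<^sup>2 * (exp t * (1 / (1 + exp t)) ^ 3)" for t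
  have k_real: "k (complex_of_real t) = complex_of_real (\<rho> t)" for t
    unfolding k_def E_def \<rho>_def of_real_mult complex_norm_square
    by (simp add: exp_of_real)
  have k_cont: "continuous_on UNIV (\<lambda>t. k (w + complex_of_real t))" if "w \<in> ?S" for w
    using that by (intro continuous_on_compose2[OF holomorphic_on_imp_continuous_on[OF k_holo]] continuous_intros) auto
  have k_int: "(\<lambda>t. k (w + complex_of_real t)) integrable_on UNIV" if "w \<in> ?S" for w
    using k_bd[of "w + complex_of_real t" for t] that
    by (intro exp_dominated_integrable[OF k_cont[OF that], of 1 C3 "Re w"]) (auto simp: add.commute)
  have \<rho>_int: "\<rho> integrable_on UNIV"
    using integrable_linear[OF k_int[of 0] bounded_linear_Re] \<sigma> by (simp add: o_def k_real)
  have \<rho>_nonneg: "\<rho> t \<ge> 0" for t by (simp add: \<rho>_def)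
  have \<rho>_cont: "continuous_on X \<rho>" for X
    using continuous_on_subset[OF continuous_on_Re[OF k_cont[of 0]], of X] \<sigma> by (simp add: k_real)
  \<comment> \<open>The normalizing constant. It is positive because the integrand is continuous,
    nonnegative and nonzero at t = 0, that is at z = 1, where \<phi> does not vanish.\<close>
  define \<kappa> where "\<kappa> = integral UNIV \<rho>"
  have \<kappa>: "\<kappa> > 0"
  proof -
    have "\<rho> 0 \<noteq> 0" using \<phi>_nonzero[OF sector_pos_real[OF \<sigma>(3) zero_less_one]] by (simp add: \<rho>_def)
    then have "integral {0..1} \<rho> \<noteq> 0" using integral_eq_0_iff[OF \<rho>_cont, of 0 1] \<rho>_nonneg by auto
    moreover have "integral {0..1} \<rho> \<ge> 0" by (rule integral_nonneg) (auto intro: integrable_continuous_interval \<rho>_cont \<rho>_nonneg)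
    moreover have "integral {0..1} \<rho> \<le> \<kappa>" unfolding \<kappa>_def
      by (rule integral_subset_le) (auto intro: integrable_continuous_interval \<rho>_cont \<rho>_int \<rho>_nonneg)
    ultimately show ?thesis by linarith
  qed
  define z0 where "z0 = complex_of_real (2 powr (- d))"
  define g where "g z = (P (Ln z + complex_of_real (ln 2)) - P (Ln z)) / (complex_of_real \<kappa> * \<phi> (z0 * z))" for z
  have z0: "z0 * z \<in> sector \<sigma>" if "z \<in> sector \<sigma>" for z unfolding z0_def by (rule mult_in_sector[OF \<sigma>(3,2) that]) simp
  have H: "H \<ge> 0"
  proof -
    have s: "1 \<in> sector \<sigma>" using sector_pos_real[OF \<sigma>(3) zero_less_one] by simp
    have "0 \<le> H * cmod (\<phi> (z0 * 1))" using harnack[OF s, of 1] by (simp add: z0_def) (meson norm_ge_zero order_trans)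
    then show ?thesis using \<phi>_nonzero[OF z0[OF s]] by (simp add: zero_le_mult_iff)
  qed
  have g_exp: "g (exp w) = (P (w + complex_of_real (ln 2)) - P w) / (complex_of_real \<kappa> * \<phi> (z0 * exp w))" if "\<bar>Im w\<bar> < \<sigma>" for w
    using that \<sigma> by (simp add: g_def Ln_exp)
  define C where "C = 2 * C1 * H * ln 2 / \<kappa>"
  have C: "C \<ge> 0" using C1 H \<kappa> by (simp add: C_def)
  have diff_bd: "cmod (g (exp w)) \<le> C * exp (- 1 * \<bar>Re w\<bar>) \<and> cmod (exp w * g (exp w)) \<le> C * exp (- 1 * \<bar>Re w\<bar>)" if w: "\<bar>Im w\<bar> < \<sigma>" for w
  proof -
    have nz: "\<phi> (z0 * exp w) \<noteq> 0" by (intro \<phi>_nonzero z0 exp_in_sector \<sigma>(2) w)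
    \<comment> \<open>On the segment from w to w + ln 2 the points are t exp w with t in [1, 2], so
      \<open>harnack\<close> bounds \<phi> there by the denominator of g, which then
      cancels.\<close>
    have seg: "cmod (k v) \<le> 2 * C1 * exp (- \<bar>Re w\<bar>) * H * cmod (\<phi> (z0 * exp w)) \<and>
        cmod (exp w) * cmod (k v) \<le> 2 * C1 * exp (- \<bar>Re w\<bar>) * H * cmod (\<phi> (z0 * exp w))"
      if v: "v \<in> closed_segment w (w + complex_of_real (ln 2))" for v
    proof -
      obtain u where u: "0 \<le> u" "u \<le> 1" "v = (1 - u) *\<^sub>R w + u *\<^sub>R (w + complex_of_real (ln 2))"
        using v by (auto simp: closed_segment_def)
      define a where "a = u * ln 2"
      have a: "0 \<le> a" "a \<le> ln 2" using u(1,2) by (auto simp: a_def intro: mult_left_le_one_le)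
      have va: "v = w + complex_of_real a" unfolding u(3) a_def by (simp add: algebra_simps scaleR_conv_of_real)
      have Iv: "\<bar>Im v\<bar> < \<sigma>" using w by (simp add: va)
      have ev: "exp v = complex_of_real (exp a) * exp w" by (simp add: va exp_add exp_of_real)
      have "exp a \<in> {1..2}" using a by (auto simp: ln_ge_iff[symmetric])
      then have h: "cmod (\<phi> (exp v)) \<le> H * cmod (\<phi> (z0 * exp w))"
        unfolding ev z0_def by (intro harnack exp_in_sector[OF \<sigma>(2) w])
      have "exp (- \<bar>Re v\<bar>) \<le> exp (- \<bar>Re w\<bar> + ln 2)" using a by (simp add: va)
      then have ex: "exp (- \<bar>Re v\<bar>) \<le> 2 * exp (- \<bar>Re w\<bar>)" unfolding exp_add by simp
      have "C1 * exp (- \<bar>Re v\<bar>) \<le> 2 * C1 * exp (- \<bar>Re w\<bar>)" using mult_left_mono[OF ex C1] by (simp add: mult_ac)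
      then have E1: "cmod (E v) \<le> 2 * C1 * exp (- \<bar>Re w\<bar>)" "cmod (exp v * E v) \<le> 2 * C1 * exp (- \<bar>Re w\<bar>)"
        using E_bd[OF Iv] by linarith+
      have "cmod (exp w) \<le> cmod (exp v)" using a by (simp add: va)
      then have E2: "cmod (exp w) * cmod (E v) \<le> 2 * C1 * exp (- \<bar>Re w\<bar>)"
        using E1(2) mult_right_mono[of "cmod (exp w)" "cmod (exp v)" "cmod (E v)"] by (simp add: norm_mult)
      have "cmod (E v) * cmod (\<phi> (exp v)) \<le> (2 * C1 * exp (- \<bar>Re w\<bar>)) * (H * cmod (\<phi> (z0 * exp w)))"
        by (rule mult_mono[OF E1(1) h]) (use C1 in auto)
      moreover have "(cmod (exp w) * cmod (E v)) * cmod (\<phi> (exp v)) \<le> (2 * C1 * exp (- \<bar>Re w\<bar>)) * (H * cmod (\<phi> (z0 * exp w)))"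
        by (rule mult_mono[OF E2 h]) (use C1 in auto)
      ultimately show ?thesis by (simp add: k_def norm_mult mult_ac)
    qed
    let ?b = "2 * C1 * exp (- \<bar>Re w\<bar>) * H * cmod (\<phi> (z0 * exp w))"
    have wS: "w \<in> ?S" "w + complex_of_real (ln 2) \<in> ?S" using w by auto
    have fin: "?b * ln 2 / (\<kappa> * cmod (\<phi> (z0 * exp w))) = C * exp (- 1 * \<bar>Re w\<bar>)"
      using nz by (simp add: C_def)
    have ge: "cmod (g (exp w)) = cmod (P (w + complex_of_real (ln 2)) - P w) / (\<kappa> * cmod (\<phi> (z0 * exp w)))"
      using \<kappa> by (simp add: g_exp[OF w] norm_divide norm_mult)
    have "cmod (P (w + complex_of_real (ln 2)) - P w) \<le> ?b * cmod (w + complex_of_real (ln 2) - w)"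
      by (rule P_seg[OF wS]) (use seg in blast)
    then have p1: "cmod (P (w + complex_of_real (ln 2)) - P w) \<le> ?b * ln 2" by simp
    have "cmod (P (w + complex_of_real (ln 2)) - P w) \<le> (?b / cmod (exp w)) * cmod (w + complex_of_real (ln 2) - w)"
      by (rule P_seg[OF wS]) (use seg in \<open>simp add: pos_le_divide_eq mult.commute\<close>)
    then have p2: "cmod (exp w) * cmod (P (w + complex_of_real (ln 2)) - P w) \<le> ?b * ln 2"
      by (simp add: pos_le_divide_eq mult.commute)
    have kp: "0 < \<kappa> * cmod (\<phi> (z0 * exp w))" using \<kappa> nz by simp
    have "cmod (g (exp w)) \<le> C * exp (- 1 * \<bar>Re w\<bar>)"
      unfolding ge fin[symmetric] using p1 kp by (intro divide_right_mono) auto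
    moreover have "cmod (exp w * g (exp w)) \<le> C * exp (- 1 * \<bar>Re w\<bar>)"
      unfolding norm_mult ge fin[symmetric] times_divide_eq_right using p2 kp by (intro divide_right_mono) auto
    ultimately show ?thesis by blast
  qed
  have g_holo: "g holomorphic_on sector \<sigma>"
  proof -
    have Ln_S: "Ln z \<in> ?S" if "z \<in> sector \<sigma>" for z using sector_Ln[OF \<sigma>(3) that] by simp
    have np: "z \<notin> \<real>\<^sub>\<le>\<^sub>0" if "z \<in> sector \<sigma>" for z using that \<sigma> by (auto simp: sector_def)
    have Ph: "(\<lambda>z. P (h z)) holomorphic_on sector \<sigma>" if "h holomorphic_on sector \<sigma>" "\<And>z. z \<in> sector \<sigma> \<Longrightarrow> h z \<in> ?S" for h
      using holomorphic_on_compose_gen[OF that(1) P_holo] that(2) by (auto simp: o_def)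
    have Fh: "(\<lambda>z. \<phi> (z0 * z)) holomorphic_on sector \<sigma>"
      using holomorphic_on_compose_gen[OF _ \<phi>_holomorphic, of "\<lambda>z. z0 * z" "sector \<sigma>"] z0
      by (auto simp: o_def intro!: holomorphic_intros)
    have L: "Ln holomorphic_on sector \<sigma>" by (rule holomorphic_on_Ln) (use np in auto)
    have P1: "(\<lambda>z. P (Ln z + complex_of_real (ln 2))) holomorphic_on sector \<sigma>"
      by (rule Ph) (use Ln_S in \<open>auto intro!: holomorphic_intros L\<close>)
    have P2: "(\<lambda>z. P (Ln z)) holomorphic_on sector \<sigma>" by (rule Ph[OF L Ln_S])
    have nz: "complex_of_real \<kappa> * \<phi> (z0 * z) \<noteq> 0" if "z \<in> sector \<sigma>" for z
      using \<kappa> \<phi>_nonzero[OF z0[OF that]] by simp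
    show ?thesis unfolding g_def[abs_def]
      by (intro holomorphic_on_divide holomorphic_on_diff P1 P2 holomorphic_on_mult holomorphic_on_const Fh nz)
  qed
  let ?s = "\<lambda>n w. \<Sum>j\<in>{- int n..int n}. g (complex_of_real (2 powr j) * exp w) * \<phi> (complex_of_real (2 powr (j - d)) * exp w)"
  have S_eq: "?s n w = (P (w + complex_of_real ((real n + 1) * ln 2)) - P (w + complex_of_real (- (real n * ln 2)))) / \<kappa>"
    if w: "\<bar>Im w\<bar> < \<sigma>" for n w
  proof -
    define F where "F j = P (w + complex_of_real (of_int j * ln 2)) / \<kappa>" for j
    have "g (complex_of_real (2 powr j) * exp w) * \<phi> (complex_of_real (2 powr (j - d)) * exp w) = F (j + 1) - F j" for j :: int
    proof -
      have e: "complex_of_real (2 powr j) * exp w = exp (w + complex_of_real (of_int j * ln 2))"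
        by (simp add: exp_of_real_ln_mult ln_powr)
      have I: "\<bar>Im (w + complex_of_real (of_int j * ln 2))\<bar> < \<sigma>" using w by simp
      have ph: "\<phi> (z0 * exp (w + complex_of_real (of_int j * ln 2))) = \<phi> (complex_of_real (2 powr (j - d)) * exp w)"
        unfolding e[symmetric] z0_def by (simp add: powr_add[symmetric] mult.assoc[symmetric] flip: of_real_mult)
      have nz: "\<phi> (z0 * exp (w + complex_of_real (of_int j * ln 2))) \<noteq> 0" by (intro \<phi>_nonzero z0 exp_in_sector \<sigma>(2) I)
      have sh: "w + complex_of_real (of_int j * ln 2) + complex_of_real (ln 2) = w + complex_of_real (of_int (j + 1) * ln 2)"
        by (simp add: algebra_simps)
      have quot: "(p - q) / (c * f) * f = p / c - q / c" if "f \<noteq> 0" for p q c f :: complex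
        using that by (simp add: diff_divide_distrib[symmetric])
      show ?thesis unfolding e g_exp[OF I] ph[symmetric] F_def sh by (rule quot[OF nz])
    qed
    then have "?s n w = (\<Sum>j\<in>{- int n..int n}. F (j + 1) - F j)" by simp
    also have "\<dots> = F (int n + 1) - F (- int n)" by (rule sum_int_telescope)
    finally show ?thesis by (simp add: F_def diff_divide_distrib)
  qed
  have ln2: "ln (2::real) > 0" by simp
  \<comment> \<open>Up to 1/\<kappa> the partial sum is an integral of k over a horizontal segment,
    and the integral of the majorant over the full line does not depend on n or w.\<close>
  have S_bd: "cmod (?s n w) \<le> C3 * (2 / 1) / \<kappa>" if w: "\<bar>Im w\<bar> < \<sigma>" for n w
  proof -
    let ?a = "- (real n * ln 2)" and ?c = "(real n + 1) * ln 2"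
    have ac: "?a \<le> ?c" by (simp add: algebra_simps)
    have wS: "w \<in> ?S" using w by simp
    define h where "h t = C3 * exp (- 1 * \<bar>t + Re w\<bar>)" for t
    have h: "(h has_integral C3 * (2 / 1)) UNIV"
      unfolding h_def by (rule has_integral_mult_right[OF has_integral_exp_abs]) simp
    have h0: "h t \<ge> 0" for t using C3 by (simp add: h_def)
    have hc: "h integrable_on {?a..?c}" unfolding h_def by (intro integrable_continuous_interval continuous_intros)
    have "cmod (P (w + complex_of_real ?c) - P (w + complex_of_real ?a)) = cmod (integral {?a..?c} (\<lambda>t. k (w + complex_of_real t)))"
      by (subst integral_unique[OF FTC[OF wS ac]]) simp
    also have "\<dots> \<le> integral {?a..?c} h"
      using FTC[OF wS ac] hc k_bd[of "w + complex_of_real t" for t] w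
      by (intro integral_norm_bound_integral) (auto simp: h_def integrable_on_def add.commute)
    also have "\<dots> \<le> integral UNIV h"
      using hc h h0 by (intro integral_subset_le) (auto simp: integrable_on_def)
    also have "\<dots> = C3 * (2 / 1)" using h by (rule integral_unique)
    finally show ?thesis unfolding S_eq[OF w] norm_divide using \<kappa> by (simp add: divide_right_mono)
  qed
  have S_lim: "(\<lambda>n. ?s n w) \<longlonglongrightarrow> 1" if w: "\<bar>Im w\<bar> < \<sigma>" for w
  proof -
    have "(\<lambda>n. integral {- (real n * ln 2)..(real n + 1) * ln 2} (\<lambda>t. k (complex_of_real t))) \<longlonglongrightarrow> complex_of_real \<kappa>"
    proof (rule has_integral_symmetric_intervals_limit[OF _ ln2])
      have "(\<rho> has_integral \<kappa>) UNIV" using \<rho>_int by (simp add: \<kappa>_def has_integral_integrable_integral)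
      from has_integral_linear[OF this bounded_linear_of_real] show "((\<lambda>t. k (complex_of_real t)) has_integral complex_of_real \<kappa>) UNIV"
        by (simp add: k_real o_def)
    qed
    moreover have "integral {- (real n * ln 2)..(real n + 1) * ln 2} (\<lambda>t. k (complex_of_real t)) =
        P (complex_of_real ((real n + 1) * ln 2)) - P (complex_of_real (- (real n * ln 2)))" for n
      using integral_unique[OF FTC[of 0 "- (real n * ln 2)" "(real n + 1) * ln 2"]] \<sigma> by (simp add: algebra_simps)
    ultimately have L0: "(\<lambda>n. P (complex_of_real ((real n + 1) * ln 2)) - P (complex_of_real (- (real n * ln 2)))) \<longlonglongrightarrow> complex_of_real \<kappa>"
      by simp
    \<comment> \<open>Far out k is small on the segment between t and w + t, so the end values of P
      at w and on the real axis have the same limiting difference. Hence the limit of the sums is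
      the same for all w.\<close>
    have shift: "cmod (P (w + complex_of_real t) - P (complex_of_real t)) \<le> C3 * exp (cmod w - \<bar>t\<bar>) * cmod w" for t
    proof -
      have "cmod (P (w + complex_of_real t) - P (complex_of_real t)) \<le> C3 * exp (cmod w - \<bar>t\<bar>) * cmod (w + complex_of_real t - complex_of_real t)"
      proof (rule P_seg)
        show "complex_of_real t \<in> ?S" "w + complex_of_real t \<in> ?S" using w \<sigma> by auto
        fix v assume v: "v \<in> closed_segment (complex_of_real t) (w + complex_of_real t)"
        then obtain u where u: "0 \<le> u" "u \<le> 1" "v = (1 - u) *\<^sub>R complex_of_real t + u *\<^sub>R (w + complex_of_real t)"
          by (auto simp: closed_segment_def)
        have vv: "v = complex_of_real t + u *\<^sub>R w" unfolding u(3) by (simp add: algebra_simps)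
        have "\<bar>u * Re w\<bar> \<le> cmod w" using u abs_Re_le_cmod[of w] mult_left_le_one_le[of "\<bar>Re w\<bar>" u] by (simp add: abs_mult)
        then have "\<bar>t\<bar> - cmod w \<le> \<bar>Re v\<bar>" by (simp add: vv)
        moreover have "\<bar>u * Im w\<bar> \<le> \<bar>Im w\<bar>" using u mult_left_le_one_le[of "\<bar>Im w\<bar>" u] by (simp add: abs_mult)
        then have "\<bar>Im v\<bar> < \<sigma>" using w by (simp add: vv)
        ultimately show "cmod (k v) \<le> C3 * exp (cmod w - \<bar>t\<bar>)"
          by (intro order_trans[OF k_bd mult_left_mono[OF _ C3]]) auto
      qed
      then show ?thesis by simp
    qed
    have z1: "(\<lambda>n. P (w + complex_of_real ((real n + 1) * ln 2)) - P (complex_of_real ((real n + 1) * ln 2))) \<longlonglongrightarrow> 0"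
    proof (rule Lim_null_comparison)
      show "\<forall>\<^sub>F n in sequentially. norm (P (w + complex_of_real ((real n + 1) * ln 2)) - P (complex_of_real ((real n + 1) * ln 2)))
          \<le> C3 * exp (cmod w - \<bar>(real n + 1) * ln 2\<bar>) * cmod w" using shift by (intro always_eventually allI)
      show "(\<lambda>n. C3 * exp (cmod w - \<bar>(real n + 1) * ln 2\<bar>) * cmod w) \<longlonglongrightarrow> 0" by real_asymp
    qed
    have z2: "(\<lambda>n. P (w + complex_of_real (- (real n * ln 2))) - P (complex_of_real (- (real n * ln 2)))) \<longlonglongrightarrow> 0"
    proof (rule Lim_null_comparison)
      show "\<forall>\<^sub>F n in sequentially. norm (P (w + complex_of_real (- (real n * ln 2))) - P (complex_of_real (- (real n * ln 2))))
          \<le> C3 * exp (cmod w - \<bar>- (real n * ln 2)\<bar>) * cmod w" using shift by (intro always_eventually allI)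
      show "(\<lambda>n. C3 * exp (cmod w - \<bar>- (real n * ln 2)\<bar>) * cmod w) \<longlonglongrightarrow> 0" by real_asymp
    qed
    have "(\<lambda>n. P (w + complex_of_real ((real n + 1) * ln 2)) - P (w + complex_of_real (- (real n * ln 2)))) \<longlonglongrightarrow> (0 - 0) + complex_of_real \<kappa>"
      by (rule Lim_transform_eventually[OF tendsto_add[OF tendsto_diff[OF z1 z2] L0]]) (intro always_eventually allI, simp)
    from tendsto_divide[OF this tendsto_const[of "complex_of_real \<kappa>"]] show ?thesis
      unfolding S_eq[OF w] using \<kappa> by simp
  qed
  show ?thesis
  proof
    show "g \<in> H0_inf \<sigma>" by (rule H0_infI[OF \<sigma>(3,2) g_holo zero_less_one]) (use diff_bd in blast)
    show "(\<lambda>z. z * g z) \<in> H0_inf \<sigma>"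
      by (rule H0_infI[OF \<sigma>(3,2) _ zero_less_one]) (use diff_bd g_holo in \<open>auto intro!: holomorphic_intros\<close>)
  qed (use diff_bd C S_bd S_lim in blast)+
qed

end

section \<open>Bounding the interpolation norm by the discrete norm\<close>

lemma (in sectorial_operator) diff_J_domain:
  assumes "c > 0" "x \<in> D"
  shows "x - J c x = complex_of_real c *\<^sub>C J c (A x)"
proof -
  have "J c (x + complex_of_real c *\<^sub>C A x) = x" by (rule J_eqI[OF assms refl])
  then show ?thesis using J_linear[OF assms(1)] by (simp add: algebra_simps)
qed

lemma (in sectorial_operator) J_commute:
  assumes "c > 0" "c' > 0"
  shows "J c (J c' x) = J c' (J c x)"
  using J_R_commute[OF assms(1) neg_in_Out[of "1 / c'"], of x] assms(2)
  by (simp add: J_def[of c'] J_linear[OF assms(1)] linear_neg[OF bounded_linear.linear[OF J_bounded_linear[OF assms(1)]]])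

lemma H0_ray_abs_integrable:
  assumes "0 < \<sigma>" "\<sigma> \<le> pi" "F \<in> H0_inf \<sigma>" "\<bar>a\<bar> < \<sigma>"
  shows "(\<lambda>t. cmod (F (exp (Complex t a)))) integrable_on UNIV"
proof -
  obtain \<epsilon> C where e: "\<epsilon> > 0" "C \<ge> 0" "\<And>w. \<bar>Im w\<bar> < \<sigma> \<Longrightarrow> cmod (F (exp w)) \<le> C * exp (-\<epsilon> * \<bar>Re w\<bar>)"
    using H0_infE[OF assms(1-3)] by blast
  have c: "continuous_on (sector \<sigma>) F"
    by (rule holomorphic_on_imp_continuous_on[OF H0_inf_holomorphic[OF assms(3)]])
  show ?thesis
    using e(3)[of "Complex t a" for t] assms(4)
    by (intro exp_dominated_integrable[OF continuous_on_norm[OF continuous_on_ray[OF assms(1,2) c assms(4)]] e(1), of C 0]) simp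
qed

context sectorial_calculus
begin

lemma hc_sum:
  assumes "\<delta> < \<nu>" "\<nu> < \<sigma>" "finite F" "\<And>j. j \<in> F \<Longrightarrow> f j \<in> H0_inf \<sigma>"
  shows "(\<lambda>z. \<Sum>j\<in>F. f j z) \<in> H0_inf \<sigma>" "hc \<nu> (\<lambda>z. \<Sum>j\<in>F. f j z) x = (\<Sum>j\<in>F. hc \<nu> (f j) x)"
proof -
  have u: "(\<lambda>z. 1 / (1 + z) - 1 / (1 + complex_of_real 2 * z)) \<in> H0_inf \<sigma>"
    by (rule resolvent_difference_in_H0[OF \<sigma>(3,4)]) simp
  have z0: "(\<lambda>z. 0) \<in> H0_inf \<sigma>" using H0_inf_cmult[OF \<sigma>(3,2) u, of 0] by simp
  have h0: "hc \<nu> (\<lambda>z. 0) x = 0" using hc_cmult_left[OF u assms(1,2), of 0] by simp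
  have "(\<lambda>z. \<Sum>j\<in>F. f j z) \<in> H0_inf \<sigma> \<and> hc \<nu> (\<lambda>z. \<Sum>j\<in>F. f j z) x = (\<Sum>j\<in>F. hc \<nu> (f j) x)"
    using assms(3,4)
  proof (induction F rule: finite_induct)
    case empty
    then show ?case using z0 h0 by simp
  next
    case (insert i F)
    then have i: "f i \<in> H0_inf \<sigma>" and F: "(\<lambda>z. \<Sum>j\<in>F. f j z) \<in> H0_inf \<sigma>" by auto
    show ?case using insert H0_inf_add[OF \<sigma>(3,2) i F] hc_add_left[OF i F assms(1,2), of x] by simp
  qed
  then show "(\<lambda>z. \<Sum>j\<in>F. f j z) \<in> H0_inf \<sigma>" "hc \<nu> (\<lambda>z. \<Sum>j\<in>F. f j z) x = (\<Sum>j\<in>F. hc \<nu> (f j) x)" by auto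
qed

text \<open>Dominated convergence on the two rays. Uniform boundedness of the functions would not
  suffice; the common factor u supplies an integrable majorant.\<close>

lemma hc_tendsto_zero:
  assumes \<nu>: "\<delta> < \<nu>" "\<nu> < \<sigma>" and u: "u \<in> H0_inf \<sigma>" and f: "\<And>n. f n \<in> H0_inf \<sigma>"
    and le: "\<And>n w. \<bar>Im w\<bar> < \<sigma> \<Longrightarrow> cmod (f n (exp w)) \<le> C * cmod (u (exp w))"
    and lim: "\<And>w. \<bar>Im w\<bar> < \<sigma> \<Longrightarrow> (\<lambda>n. f n (exp w)) \<longlonglongrightarrow> 0"
  shows "(\<lambda>n. hc \<nu> (f n) x) \<longlonglongrightarrow> 0"
proof -
  have ray: "(\<lambda>n. ray_integral D A a (f n) x) \<longlonglongrightarrow> 0" if a: "\<delta> < \<bar>a\<bar>" "\<bar>a\<bar> < \<sigma>" for a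
  proof (rule Lim_null_comparison)
    show "\<forall>\<^sub>F n in sequentially. norm (ray_integral D A a (f n) x) \<le> integral UNIV (\<lambda>t. cmod (f n (exp (Complex t a)))) * (M * norm x)"
      using ray_integral_bound_integral[OF f a H0_ray_abs_integrable[OF \<sigma>(3,2) f a(2)]] by (intro always_eventually allI)
    have "(\<lambda>n. integral UNIV (\<lambda>t. cmod (f n (exp (Complex t a))))) \<longlonglongrightarrow> integral UNIV (\<lambda>t::real. 0::real)"
    proof (rule dominated_convergence(2)[of _ _ "\<lambda>t. C * cmod (u (exp (Complex t a)))"])
      show "(\<lambda>t. cmod (f n (exp (Complex t a)))) integrable_on UNIV" for n
        by (rule H0_ray_abs_integrable[OF \<sigma>(3,2) f a(2)])
      show "(\<lambda>t. C * cmod (u (exp (Complex t a)))) integrable_on UNIV"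
        by (rule integrable_on_mult_right[OF H0_ray_abs_integrable[OF \<sigma>(3,2) u a(2)]])
      show "norm (cmod (f n (exp (Complex t a)))) \<le> C * cmod (u (exp (Complex t a)))" for n t
        using le[of "Complex t a" n] a by simp
      show "(\<lambda>n. cmod (f n (exp (Complex t a)))) \<longlonglongrightarrow> 0" for t
        using tendsto_norm[OF lim[of "Complex t a"]] a by simp
    qed
    from tendsto_mult_right[OF this, of "M * norm x"]
    show "(\<lambda>n. integral UNIV (\<lambda>t. cmod (f n (exp (Complex t a)))) * (M * norm x)) \<longlonglongrightarrow> 0" by simp
  qed
  have "(\<lambda>n. (1 / (2 * pi * \<i>)) *\<^sub>C (ray_integral D A (-\<nu>) (f n) x - ray_integral D A \<nu> (f n) x)) \<longlonglongrightarrow> (1 / (2 * pi * \<i>)) *\<^sub>C (0 - 0)"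
    using \<nu> \<delta> by (intro scaleC.tendsto tendsto_const tendsto_diff ray) auto
  then show ?thesis by (simp add: H0_calculus_def)
qed

end

context interpolation_data
begin

text \<open>The product rule for a second factor that need not decay at infinity: cz/(1 + cz) = 1 -
  1/(1 + cz), and multiplication by 1/(1 + cz) is covered by \<open>hc_J\<close>.\<close>

lemma hc_T:
  assumes f: "f \<in> H0_inf \<sigma>" and c: "c > 0"
  shows "(\<lambda>z. f z * \<phi> (complex_of_real c * z)) \<in> H0_inf \<sigma>"
    and "hc \<nu> f (T c x) = hc \<nu> (\<lambda>z. f z * \<phi> (complex_of_real c * z)) x"
proof -
  let ?p = "\<lambda>z. \<phi>0 (complex_of_real c * z)"
  let ?m = "\<lambda>z. f z * (complex_of_real c * z / (1 + complex_of_real c * z))"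
  let ?i = "\<lambda>z. f z * (1 / (1 + complex_of_real c * z))"
  note p = \<phi>0_scale[OF c]
  have m: "?m \<in> H0_inf \<sigma>" and i: "?i \<in> H0_inf \<sigma>" using H0_inf_div_one_plus[OF \<sigma>(3,4) c f] by auto
  have fp: "(\<lambda>z. f z * ?p z) \<in> H0_inf \<sigma>" by (rule H0_inf_mult[OF \<sigma>(3,2) f p])
  have bm: "(\<lambda>z. b * ?m z) \<in> H0_inf \<sigma>" by (rule H0_inf_cmult[OF \<sigma>(3,2) m])
  have eq: "f z * \<phi> (complex_of_real c * z) = f z * ?p z + b * ?m z" if z: "z \<in> sector \<sigma>" for z
    using \<phi>_eq[OF mult_in_sector[OF \<sigma>(3,2) z c]] by (simp add: algebra_simps)
  have F: "(\<lambda>z. f z * \<phi> (complex_of_real c * z)) \<in> H0_inf \<sigma> \<longleftrightarrow> (\<lambda>z. f z * ?p z + b * ?m z) \<in> H0_inf \<sigma>"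
    unfolding H0_inf_def mem_Collect_eq using eq by (simp cong: holomorphic_cong image_cong)
  then show "(\<lambda>z. f z * \<phi> (complex_of_real c * z)) \<in> H0_inf \<sigma>" using H0_inf_add[OF \<sigma>(3,2) fp bm] by simp
  have "hc \<nu> (\<lambda>z. ?m z + ?i z) x = hc \<nu> f x"
  proof (rule hc_cong)
    fix z assume "z \<in> sector \<sigma>"
    from one_plus_sector_nonzero[OF \<sigma>(3) this c]
    have "complex_of_real c * z / (1 + complex_of_real c * z) + 1 / (1 + complex_of_real c * z) = 1"
      by (simp add: add_divide_distrib[symmetric] add.commute)
    then show "?m z + ?i z = f z" by (metis distrib_left mult_1_right)
  qed (use \<nu> \<delta> in auto)
  then have mi: "hc \<nu> ?m x = hc \<nu> f x - hc \<nu> ?i x" using hc_add_left[OF m i \<nu>, of x] by (simp add: algebra_simps)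
  have "hc \<nu> f (T c x) = hc \<nu> (\<lambda>z. f z * ?p z) x + b *\<^sub>C (hc \<nu> f x - hc \<nu> ?i x)"
    unfolding T_def using f \<nu> c p
    by (simp only: hc_add_right[OF f \<nu>] hc_scale_right[OF f \<nu>] hc_diff_right[OF f \<nu>] hc_product[OF f p \<nu>] hc_J[OF c f \<nu>])
  also have "\<dots> = hc \<nu> (\<lambda>z. f z * ?p z + b * ?m z) x"
    unfolding mi[symmetric] by (simp only: hc_add_left[OF fp bm \<nu>] hc_cmult_left[OF m \<nu>])
  also have "\<dots> = hc \<nu> (\<lambda>z. f z * \<phi> (complex_of_real c * z)) x"
    by (rule hc_cong) (use eq \<nu> \<delta> in auto)
  finally show "hc \<nu> f (T c x) = hc \<nu> (\<lambda>z. f z * \<phi> (complex_of_real c * z)) x" .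
qed

text \<open>The bound 1 in the minimum comes from boundedness of 1 - J \<tau> and of g(2^j A). The
  other one comes from 1 - J \<tau> = \<tau> J \<tau> A on the domain and from A g(2^j A) = 2^-j
  (zg)(2^j A); this is why zg, too, has to decay.\<close>

lemma diff_J_hc_bound:
  fixes j :: int and y :: 'a
  assumes g: "g \<in> H0_inf \<sigma>" "(\<lambda>z. z * g z) \<in> H0_inf \<sigma>" "C \<ge> 0"
    "\<And>w. \<bar>Im w\<bar> < \<sigma> \<Longrightarrow> cmod (g (exp w)) \<le> C * exp (- 1 * \<bar>Re w\<bar>)"
    "\<And>w. \<bar>Im w\<bar> < \<sigma> \<Longrightarrow> cmod (exp w * g (exp w)) \<le> C * exp (- 1 * \<bar>Re w\<bar>)"
    and \<tau>: "\<tau> > 0"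
  defines "y' \<equiv> hc \<nu> (\<lambda>z. g (complex_of_real (2 powr j) * z)) y"
  shows "norm (y' - J \<tau> y') \<le> (1 + M) * (C * 2 * M) * min 1 (\<tau> * 2 powr (- real_of_int j)) * norm y"
proof -
  let ?c = "complex_of_real (2 powr j)"
  let ?g = "\<lambda>z. g (?c * z)"
  have gs: "?g \<in> H0_inf \<sigma>" by (rule H0_inf_scale[OF \<sigma>(3,2) g(1)]) simp
  have czg: "(\<lambda>z. ?c * z * ?g z) \<in> H0_inf \<sigma>" using H0_inf_scale[OF \<sigma>(3,2) g(2), of "2 powr j"] by simp
  have cc: "complex_of_real (2 powr (- real_of_int j)) * ?c = 1" by (simp add: powr_minus flip: of_real_mult)
  have zg: "(\<lambda>z. z * ?g z) \<in> H0_inf \<sigma>"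
    using H0_inf_cmult[OF \<sigma>(3,2) czg, of "complex_of_real (2 powr (- real_of_int j))"] cc
    by (simp add: mult.assoc[symmetric])
  have sh: "?c * exp w = exp (w + complex_of_real (j * ln 2))" for w by (simp add: exp_of_real_ln_mult ln_powr)
  have n1: "norm (hc \<nu> ?g y) \<le> C * (2 / 1) * (M * norm y)"
  proof (rule hc_bound[OF gs \<nu> zero_less_one, of _ "j * ln 2"])
    show "cmod (g (?c * exp w)) \<le> C * exp (- 1 * \<bar>Re w + j * ln 2\<bar>)" if "\<bar>Im w\<bar> < \<sigma>" for w
      unfolding sh using g(4)[of "w + complex_of_real (j * ln 2)"] that by simp
  qed
  have n2: "norm (hc \<nu> (\<lambda>z. z * ?g z) y) \<le> (2 powr (- real_of_int j) * C) * (2 / 1) * (M * norm y)"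
  proof (rule hc_bound[OF zg \<nu> zero_less_one, of _ "j * ln 2"])
    fix w :: complex assume w: "\<bar>Im w\<bar> < \<sigma>"
    have "exp w * g (?c * exp w) = complex_of_real (2 powr (- real_of_int j)) * (?c * exp w * g (?c * exp w))"
      using cc by (simp add: mult.assoc[symmetric])
    then have "cmod (exp w * g (?c * exp w)) = 2 powr (- real_of_int j) * cmod (?c * exp w * g (?c * exp w))"
      by (simp only: norm_mult norm_of_real) simp
    also have "\<dots> \<le> 2 powr (- real_of_int j) * (C * exp (- 1 * \<bar>Re w + j * ln 2\<bar>))"
      unfolding sh using g(5)[of "w + complex_of_real (j * ln 2)"] w by (intro mult_left_mono) auto
    finally show "cmod (exp w * g (?c * exp w)) \<le> 2 powr (- real_of_int j) * C * exp (- 1 * \<bar>Re w + j * ln 2\<bar>)"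
      by (simp add: mult.assoc)
  qed
  have "norm (y' - J \<tau> y') \<le> norm y' + M * norm y'"
    using J_bound[OF \<tau>, of "y'"] by (intro order_trans[OF norm_triangle_ineq4]) simp
  also have "\<dots> = (1 + M) * norm y'" by (simp add: algebra_simps)
  also have "\<dots> \<le> (1 + M) * (C * 2 * M * norm y)" using n1 M unfolding y'_def by (intro mult_left_mono) (auto simp: mult_ac)
  finally have A1: "norm (y' - J \<tau> y') \<le> (1 + M) * (C * 2 * M) * norm y" by (simp add: mult_ac)
  note hA = hc_A[OF gs zg \<nu>, of y]
  have "y' - J \<tau> y' = complex_of_real \<tau> *\<^sub>C J \<tau> (hc \<nu> (\<lambda>z. z * ?g z) y)"
    using diff_J_domain[OF \<tau> hA(1)] unfolding hA(2) y'_def .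
  then have "norm (y' - J \<tau> y') = \<tau> * norm (J \<tau> (hc \<nu> (\<lambda>z. z * ?g z) y))" using \<tau> by (simp add: norm_scaleC)
  also have "\<dots> \<le> \<tau> * (M * ((2 powr (- real_of_int j) * C) * (2 / 1) * (M * norm y)))"
    using \<tau> M n2 by (intro mult_left_mono order_trans[OF J_bound[OF \<tau>]]) auto
  also have "\<dots> = M * (C * 2 * M) * (\<tau> * 2 powr (- real_of_int j)) * norm y" by (simp add: mult_ac)
  also have "\<dots> \<le> (1 + M) * (C * 2 * M) * (\<tau> * 2 powr (- real_of_int j)) * norm y"
    using \<tau> M g(3) by (intro mult_right_mono) auto
  finally have A2: "norm (y' - J \<tau> y') \<le> (1 + M) * (C * 2 * M) * (\<tau> * 2 powr (- real_of_int j)) * norm y" .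
  show ?thesis using A1 A2 by (simp add: min_def)
qed

text \<open>For \<open>q(z) = g(z) \<phi>(2\<^sup>-\<^sup>dz)\<close>, the sum of \<open>q(2\<^sup>jA) x\<close> is identified with \<open>x\<close> after applying the injective operator \<open>B = u(A)\<close>, which
  makes the scalar partial sums converge dominatedly.\<close>

lemma norm_diff_J_le_sum:
  fixes x :: 'a
  assumes g: "g \<in> H0_inf \<sigma>"
    and bd: "\<And>n w. \<bar>Im w\<bar> < \<sigma> \<Longrightarrow> cmod (\<Sum>j\<in>{- int n..int n}. g (complex_of_real (2 powr j) * exp w) *
       \<phi> (complex_of_real (2 powr (j - d)) * exp w)) \<le> Q"
    and lim: "\<And>w. \<bar>Im w\<bar> < \<sigma> \<Longrightarrow> (\<lambda>n. \<Sum>j\<in>{- int n..int n}. g (complex_of_real (2 powr j) * exp w) *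
       \<phi> (complex_of_real (2 powr (j - d)) * exp w)) \<longlonglongrightarrow> 1"
    and \<tau>: "\<tau> > 0"
  defines "y \<equiv> \<lambda>j. hc \<nu> (\<lambda>z. g (complex_of_real (2 powr j) * z)) (T (2 powr (real_of_int j - real_of_int d)) x)"
  shows "ennreal (norm (x - J \<tau> x)) \<le> (\<integral>\<^sup>+j. ennreal (norm (y j - J \<tau> (y j))) \<partial>count_space (UNIV :: int set))"
proof (cases "\<integral>\<^sup>+j. ennreal (norm (y j - J \<tau> (y j))) \<partial>count_space (UNIV :: int set)")
  case (real W)
  \<comment> \<open>After applying 1 - J \<tau> the series converges absolutely, since W is finite,
    whereas nothing is claimed about the series of the \<open>y j\<close>. It remains to identify
    its sum with x - J \<tau> x.\<close>
  define a where "a j = y j - J \<tau> (y j)" for j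
  have fin: "(\<Sum>j\<in>F. norm (a j)) \<le> W" if "finite F" for F
  proof -
    have "ennreal (\<Sum>j\<in>F. norm (a j)) = (\<Sum>j\<in>F. ennreal (norm (a j)))" by simp
    also have "\<dots> = (\<integral>\<^sup>+j. (if j \<in> F then ennreal (norm (a j)) else 0) \<partial>count_space UNIV)"
      by (subst nn_integral_count_space'[OF that]) auto
    also have "\<dots> \<le> ennreal W" unfolding real(2)[symmetric] a_def by (rule nn_integral_mono) auto
    finally show ?thesis using real(1) by simp
  qed
  have "(\<lambda>j. norm (a j)) summable_on UNIV"
    by (rule nonneg_bdd_above_summable_on) (use fin in \<open>auto intro!: bdd_aboveI[of _ W]\<close>)
  then have "a summable_on UNIV" by (rule abs_summable_summable)
  then have "(sum a \<longlongrightarrow> infsum a UNIV) (finite_subsets_at_top UNIV)"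
    using has_sum_infsum has_sum_def by blast
  moreover have "filterlim (\<lambda>n. {- int n..int n}) (finite_subsets_at_top UNIV) sequentially"
    unfolding filterlim_finite_subsets_at_top
  proof (intro allI impI)
    fix X :: "int set" assume "finite X \<and> X \<subseteq> UNIV"
    then have m: "\<bar>j\<bar> \<le> Max (abs ` X)" if "j \<in> X" for j using that by (intro Max_ge) auto
    have "finite {- int n..int n} \<and> X \<subseteq> {- int n..int n} \<and> {- int n..int n} \<subseteq> UNIV" if "n \<ge> nat (Max (abs ` X))" for n
      using m that by (force simp: abs_le_iff)
    then show "\<forall>\<^sub>F n in sequentially. finite {- int n..int n} \<and> X \<subseteq> {- int n..int n} \<and> {- int n..int n} \<subseteq> UNIV"
      using eventually_sequentially by blast
  qed
  ultimately have a_lim: "(\<lambda>n. \<Sum>j\<in>{- int n..int n}. a j) \<longlonglongrightarrow> infsum a UNIV"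
    using filterlim_compose by blast
  define Y where "Y = infsum a UNIV"
  have normY: "norm Y \<le> W"
    using tendsto_norm[OF a_lim] order_trans[OF norm_sum fin]
    by (intro Lim_bounded[of _ _ 0]) (auto simp: Y_def)
  let ?u = "\<lambda>z. 1 / (1 + z) - 1 / (1 + complex_of_real 2 * z)"
  have u: "?u \<in> H0_inf \<sigma>" by (rule resolvent_difference_in_H0[OF \<sigma>(3,4)]) simp
  define B where "B v = J 1 v - J 2 v" for v
  have B_bl: "bounded_linear B" unfolding B_def by (intro bounded_linear_sub J_bounded_linear) auto
  have huB: "hc \<nu> ?u v = B v" for v unfolding B_def using hc_resolvent_difference[OF _ \<nu>, of 2] by simp
  let ?q = "\<lambda>j z. g (complex_of_real (2 powr real_of_int j) * z) * \<phi> (complex_of_real (2 powr (real_of_int j - real_of_int d)) * z)"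
  have gj: "(\<lambda>z. g (complex_of_real (2 powr real_of_int j) * z)) \<in> H0_inf \<sigma>" for j
    by (rule H0_inf_scale[OF \<sigma>(3,2) g]) simp
  have q: "?q j \<in> H0_inf \<sigma>" and yq: "y j = hc \<nu> (?q j) x" for j
    using hc_T[OF gj, of "2 powr (real_of_int j - real_of_int d)"] by (auto simp: y_def)
  have uq: "(\<lambda>z. ?u z * ?q j z) \<in> H0_inf \<sigma>" for j by (rule H0_inf_mult[OF \<sigma>(3,2) u q])
  have By: "B (y j) = hc \<nu> (\<lambda>z. ?u z * ?q j z) x" for j
    unfolding huB[symmetric] yq by (rule hc_product[OF u q \<nu>])
  \<comment> \<open>This is u times (1 - partial sum of the q_j). The second factor alone tends to 1
    at both ends of the sector; multiplied by u it belongs to the calculus, is dominated by (1 + Q)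
    \<bar>u\<bar> and tends to 0 pointwise.\<close>
  define f where "f n z = ?u z + (- 1) * (\<Sum>j\<in>{- int n..int n}. ?u z * ?q j z)" for n z
  note su = hc_sum[OF \<nu> finite_atLeastAtMost_int uq]
  have f: "f n \<in> H0_inf \<sigma>" for n unfolding f_def
    by (rule H0_inf_add[OF \<sigma>(3,2) u H0_inf_cmult[OF \<sigma>(3,2) su(1)]])
  have hf: "hc \<nu> (f n) x = B x - B (\<Sum>j\<in>{- int n..int n}. y j)" for n
  proof -
    have "hc \<nu> (f n) x = hc \<nu> ?u x + (- 1) *\<^sub>C (\<Sum>j\<in>{- int n..int n}. hc \<nu> (\<lambda>z. ?u z * ?q j z) x)"
      unfolding f_def hc_add_left[OF u H0_inf_cmult[OF \<sigma>(3,2) su(1)] \<nu>] hc_cmult_left[OF su(1) \<nu>] su(2) ..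
    then show ?thesis unfolding huB By[symmetric] linear_sum[OF bounded_linear.linear[OF B_bl]] by simp
  qed
  have feq: "f n z = ?u z * (1 - (\<Sum>j\<in>{- int n..int n}. ?q j z))" for n z
    by (simp only: f_def sum_distrib_left[symmetric] right_diff_distrib mult_1_right) simp
  have "(\<lambda>n. hc \<nu> (f n) x) \<longlonglongrightarrow> 0"
  proof (rule hc_tendsto_zero[where C="1 + Q", OF \<nu> u f])
    fix w :: complex assume w: "\<bar>Im w\<bar> < \<sigma>"
    show "cmod (f n (exp w)) \<le> (1 + Q) * cmod (?u (exp w))" for n
    proof -
      have "cmod (1 - (\<Sum>j\<in>{- int n..int n}. ?q j (exp w))) \<le> 1 + Q"
        using bd[OF w, of n] by (intro order_trans[OF norm_triangle_ineq4]) simp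
      then show ?thesis unfolding feq norm_mult by (subst mult.commute) (rule mult_right_mono, auto)
    qed
    have "(\<lambda>n. \<Sum>j\<in>{- int n..int n}. ?q j (exp w)) \<longlonglongrightarrow> 1" using lim[OF w] by simp
    then have "(\<lambda>n. ?u (exp w) * (1 - (\<Sum>j\<in>{- int n..int n}. ?q j (exp w)))) \<longlonglongrightarrow> ?u (exp w) * (1 - 1)"
      by (intro tendsto_mult tendsto_diff tendsto_const)
    then show "(\<lambda>n. f n (exp w)) \<longlonglongrightarrow> 0" by (simp only: feq) simp
  qed
  from tendsto_diff[OF tendsto_const[of "B x"] this]
  have Bv: "(\<lambda>n. B (\<Sum>j\<in>{- int n..int n}. y j)) \<longlonglongrightarrow> B x" unfolding hf by simp
  define \<psi> where "\<psi> v = v - J \<tau> v" for v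
  have \<psi>_bl: "bounded_linear \<psi>" unfolding \<psi>_def by (intro bounded_linear_sub bounded_linear_ident J_bounded_linear \<tau>)
  have comm: "\<psi> (B v) = B (\<psi> v)" for v
    unfolding \<psi>_def B_def using \<tau> by (simp add: J_linear J_commute[of \<tau>])
  have "(\<lambda>n. \<psi> (B (\<Sum>j\<in>{- int n..int n}. y j))) \<longlonglongrightarrow> \<psi> (B x)"
    by (rule bounded_linear.tendsto[OF \<psi>_bl Bv])
  moreover have "\<psi> (\<Sum>j\<in>{- int n..int n}. y j) = (\<Sum>j\<in>{- int n..int n}. a j)" for n
    unfolding linear_sum[OF bounded_linear.linear[OF \<psi>_bl]] by (simp add: a_def \<psi>_def)
  ultimately have "(\<lambda>n. B (\<Sum>j\<in>{- int n..int n}. a j)) \<longlonglongrightarrow> B (\<psi> x)" unfolding comm by simp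
  moreover have "(\<lambda>n. B (\<Sum>j\<in>{- int n..int n}. a j)) \<longlonglongrightarrow> B Y"
    unfolding Y_def by (rule bounded_linear.tendsto[OF B_bl a_lim])
  ultimately have "B (\<psi> x) = B Y" by (rule LIMSEQ_unique)
  then have "J 1 (\<psi> x - Y) = J 2 (\<psi> x - Y)" unfolding B_def by (simp add: J_linear algebra_simps)
  from J_difference_injective[OF this] have "\<psi> x = Y" by simp
  then have "norm (x - J \<tau> x) \<le> W" using normY by (simp add: \<psi>_def)
  then show ?thesis unfolding real(2) by (rule ennreal_leI)
qed simp

text \<open>For i \<ge> 0 the estimate K \<le> norm x is enough, because of the weight
  2^(-i\<theta>). For i < 0, \<open>K_le_J\<close> leaves norm (x - J (2^i) x), treated with the
  reproducing formula, and 2^i M norm x, of size 2^(i(1-\<theta>)) after weighting. In both cases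
  the term with norm x decays in \<bar>i\<bar> and is accounted for by an extra entry at j =
  0.\<close>

lemma kj_le_convolution:
  obtains r C where "0 < r" "r < 1" "C > 0"
    "\<And>x i. ennreal (kj x i) \<le> ennreal C * (\<integral>\<^sup>+j. ennreal (r ^ nat \<bar>i - j\<bar>) *
      ennreal (cj x j + (if j = 0 then norm x else 0)) \<partial>count_space UNIV)"
proof -
  obtain g C Q where g: "g \<in> H0_inf \<sigma>" "(\<lambda>z. z * g z) \<in> H0_inf \<sigma>" "C \<ge> 0"
    "\<And>w. \<bar>Im w\<bar> < \<sigma> \<Longrightarrow> cmod (g (exp w)) \<le> C * exp (- 1 * \<bar>Re w\<bar>)"
    "\<And>w. \<bar>Im w\<bar> < \<sigma> \<Longrightarrow> cmod (exp w * g (exp w)) \<le> C * exp (- 1 * \<bar>Re w\<bar>)"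
    "\<And>n w. \<bar>Im w\<bar> < \<sigma> \<Longrightarrow> cmod (\<Sum>j\<in>{- int n..int n}. g (complex_of_real (2 powr j) * exp w) *
       \<phi> (complex_of_real (2 powr (j - d)) * exp w)) \<le> Q"
    "\<And>w. \<bar>Im w\<bar> < \<sigma> \<Longrightarrow> (\<lambda>n. \<Sum>j\<in>{- int n..int n}. g (complex_of_real (2 powr j) * exp w) *
       \<phi> (complex_of_real (2 powr (j - d)) * exp w)) \<longlonglongrightarrow> 1"
    by (rule reproducing_function) (rule that; assumption)
  define C1 where "C1 = (1 + M) * (C * 2 * M)"
  have C1: "C1 \<ge> 0" using M g(3) by (simp add: C1_def)
  \<comment> \<open>For j \<le> i the operator factor is merely bounded and the weight gives the
    rate \<theta>; for j > i the factor 2^(i-j) competes with the growing weight and leaves 1 -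
    \<theta>.\<close>
  define \<gamma> where "\<gamma> = min \<theta> (1 - \<theta>)"
  have \<gamma>: "\<gamma> > 0" "\<gamma> \<le> \<theta>" "\<gamma> \<le> 1 - \<theta>" using \<theta> by (auto simp: \<gamma>_def)
  define r where "r = 2 powr (- \<gamma>)"
  have r: "0 < r" "r < 1" using \<gamma> powr_less_mono[of "-\<gamma>" 0 2] by (auto simp: r_def)
  define C2 where "C2 = C1 * 2 powr \<bar>real_of_int d\<bar>"
  have C2: "C2 \<ge> 0" using C1 by (simp add: C2_def)
  have ker: "min 1 (2 powr (real_of_int (i - j) - real_of_int d)) * 2 powr (- (of_int (i - j) * \<theta>)) \<le> 2 powr \<bar>real_of_int d\<bar> * r ^ nat \<bar>i - j\<bar>" for i j :: int
  proof -
    define m where "m = i - j"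
    define y where "y = (if m \<ge> 0 then - (of_int m * \<theta>) else of_int m - of_int m * \<theta>)"
    have y: "2 powr y \<le> r ^ nat \<bar>m\<bar>" unfolding r_def
    proof (rule powr_two_le_geometric[OF \<gamma>(1)])
      show "y \<le> - (of_int m * \<gamma>)" if "m \<ge> 0"
        using that mult_left_mono[OF \<gamma>(2), of "of_int m"] by (simp add: y_def)
      show "y \<le> of_int m * \<gamma>" if "m \<le> 0"
        using that mult_left_mono_neg[OF \<gamma>(3), of "of_int m"] by (auto simp: y_def algebra_simps)
    qed
    have "min 1 (2 powr (real_of_int m - real_of_int d)) * 2 powr (- (of_int m * \<theta>)) \<le> 2 powr \<bar>real_of_int d\<bar> * 2 powr y"
    proof (cases "m \<ge> 0")
      case True
      have "1 \<le> 2 powr \<bar>real_of_int d\<bar>" by (simp add: ge_one_powr_ge_zero)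
      then show ?thesis using True by (intro mult_mono) (auto simp: y_def)
    next
      case False
      have "min 1 (2 powr (real_of_int m - real_of_int d)) * 2 powr (- (of_int m * \<theta>)) \<le> 2 powr (real_of_int m - real_of_int d) * 2 powr (- (of_int m * \<theta>))"
        by (intro mult_right_mono) auto
      also have "\<dots> = 2 powr (- real_of_int d + y)" using False by (simp add: y_def flip: powr_add) (simp add: algebra_simps)
      also have "\<dots> \<le> 2 powr (\<bar>real_of_int d\<bar> + y)" by (intro powr_mono) auto
      finally show ?thesis by (simp add: powr_add)
    qed
    also have "\<dots> \<le> 2 powr \<bar>real_of_int d\<bar> * r ^ nat \<bar>m\<bar>" using y by (intro mult_left_mono) auto
    finally show ?thesis by (simp add: m_def)
  qed
  have cj0: "cj x j \<ge> 0" for x j by (simp add: cj_def)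
  show ?thesis
  proof
    show "0 < r" "r < 1" by (rule r)+
    show "0 < 2 * C2 + (M + 1)" using C2 M by simp
    fix x :: 'a and i :: int
    let ?c = "\<lambda>j. cj x j + (if j = 0 then norm x else 0)"
    let ?W = "\<integral>\<^sup>+j. ennreal (r ^ nat \<bar>i - j\<bar>) * ennreal (?c j) \<partial>count_space UNIV"
    let ?t = "\<lambda>j. C1 * min 1 (2 powr real_of_int i * 2 powr (- real_of_int j)) * norm (T (2 powr (real_of_int j - real_of_int d)) x)"
    have "ennreal (norm (x - J (2 powr i) x)) \<le> (\<integral>\<^sup>+j. ennreal (?t j) \<partial>count_space UNIV)"
      by (rule order_trans[OF norm_diff_J_le_sum[OF g(1) g(6) g(7)]])
        (auto intro!: nn_integral_mono ennreal_leI diff_J_hc_bound[OF g(1-5), folded C1_def])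
    \<comment> \<open>Replacing j by j + d brings T to the scale 2^j. The minimum is then shifted by
      d, at the price of the factor 2^\<bar>d\<bar> in \<open>C2\<close>.\<close>
    also have "\<dots> = (\<integral>\<^sup>+j. ennreal (?t (j - (- d))) \<partial>count_space UNIV)"
      by (rule nn_integral_int_shift(2)[symmetric])
    also have "\<dots> \<le> (\<integral>\<^sup>+j. ennreal (2 powr (i * \<theta>) * C2) * (ennreal (r ^ nat \<bar>i - j\<bar>) * ennreal (?c j)) \<partial>count_space UNIV)"
    proof (rule nn_integral_mono)
      fix j :: int
      have e1: "2 powr real_of_int i * 2 powr (- real_of_int (j - (- d))) = 2 powr (real_of_int (i - j) - real_of_int d)"
        by (simp flip: powr_add) (simp add: algebra_simps)
      have e2: "norm (T (2 powr (real_of_int (j - (- d)) - real_of_int d)) x) = 2 powr (i * \<theta>) * 2 powr (- (of_int (i - j) * \<theta>)) * cj x j"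
      proof -
        have "2 powr (i * \<theta>) * 2 powr (- (of_int (i - j) * \<theta>)) * 2 powr (- (j * \<theta>)) = 1"
          by (simp flip: powr_add) (simp add: algebra_simps)
        then show ?thesis by (simp add: cj_def flip: mult.assoc)
      qed
      have "?t (j - (- d)) = C1 * 2 powr (i * \<theta>) * (min 1 (2 powr (real_of_int (i - j) - real_of_int d)) * 2 powr (- (of_int (i - j) * \<theta>))) * cj x j"
        unfolding e1 e2 by (simp add: mult_ac)
      also have "\<dots> \<le> C1 * 2 powr (i * \<theta>) * (2 powr \<bar>real_of_int d\<bar> * r ^ nat \<bar>i - j\<bar>) * ?c j"
        by (rule mult_mono[OF mult_left_mono[OF ker]]) (use C1 cj0[of x j] r in auto)
      also have "\<dots> = 2 powr (i * \<theta>) * C2 * (r ^ nat \<bar>i - j\<bar> * ?c j)" by (simp add: C2_def mult_ac)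
      finally have "ennreal (?t (j - (- d))) \<le> ennreal (2 powr (i * \<theta>) * C2 * (r ^ nat \<bar>i - j\<bar> * ?c j))" by (rule ennreal_leI)
      also have "\<dots> = ennreal (2 powr (i * \<theta>) * C2) * (ennreal (r ^ nat \<bar>i - j\<bar>) * ennreal (?c j))"
        using C2 r cj0[of x j] by (simp add: ennreal_mult)
      finally show "ennreal (?t (j - (- d))) \<le> ennreal (2 powr (i * \<theta>) * C2) * (ennreal (r ^ nat \<bar>i - j\<bar>) * ennreal (?c j))" .
    qed
    also have "\<dots> = ennreal (2 powr (i * \<theta>) * C2) * ?W" by (rule nn_integral_cmult) simp
    finally have X: "ennreal (norm (x - J (2 powr i) x)) \<le> ennreal (2 powr (i * \<theta>) * C2) * ?W" .
    have X2: "ennreal (2 powr (- (i * \<theta>)) * norm (x - J (2 powr i) x)) \<le> ennreal C2 * ?W"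
    proof -
      have "ennreal (2 powr (- (i * \<theta>)) * norm (x - J (2 powr i) x)) = ennreal (2 powr (- (i * \<theta>))) * ennreal (norm (x - J (2 powr i) x))"
        by (rule ennreal_mult) auto
      also have "\<dots> \<le> ennreal (2 powr (- (i * \<theta>))) * (ennreal (2 powr (i * \<theta>) * C2) * ?W)" by (rule mult_left_mono[OF X]) simp
      also have "\<dots> = ennreal (2 powr (- (i * \<theta>)) * (2 powr (i * \<theta>) * C2)) * ?W"
        using C2 by (simp add: ennreal_mult mult.assoc)
      also have "2 powr (- (i * \<theta>)) * (2 powr (i * \<theta>) * C2) = C2" by (simp add: powr_minus)
      finally show ?thesis .
    qed
    have pt: "ennreal (r ^ nat \<bar>i\<bar> * norm x) \<le> ?W"
    proof -
      have "ennreal (r ^ nat \<bar>i\<bar> * norm x) \<le> ennreal (r ^ nat \<bar>i - 0\<bar> * ?c 0)"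
        using r cj0[of x 0] by (intro ennreal_leI) (simp add: mult_left_mono)
      also have "\<dots> = ennreal (r ^ nat \<bar>i - 0\<bar>) * ennreal (?c 0)"
        by (rule ennreal_mult) (use r cj0[of x 0] in auto)
      also have "\<dots> \<le> ?W" by (rule nn_integral_ge_point) simp
      finally show ?thesis .
    qed
    have "kj x i \<le> 2 * (2 powr (- (i * \<theta>)) * norm (x - J (2 powr i) x)) + (M + 1) * (r ^ nat \<bar>i\<bar> * norm x)"
    proof (cases "i \<ge> 0")
      case True
      have "2 powr (- (i * \<theta>)) \<le> r ^ nat \<bar>i\<bar>" unfolding r_def
        using True mult_left_mono[OF \<gamma>(2), of "of_int i"] by (intro powr_two_le_geometric[OF \<gamma>(1)]) auto
      then have "kj x i \<le> r ^ nat \<bar>i\<bar> * norm x"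
        unfolding kj_def using K_le_norm[of "2 powr i" x] K_nonneg[of "2 powr i" x] r by (intro mult_mono) auto
      also have "\<dots> \<le> (M + 1) * (r ^ nat \<bar>i\<bar> * norm x)" using M r by (simp add: distrib_right)
      finally show ?thesis by (rule order_trans) simp
    next
      case False
      have "2 powr (- (i * \<theta>)) * 2 powr i \<le> r ^ nat \<bar>i\<bar>"
      proof -
        have "2 powr (- (i * \<theta>)) * 2 powr i = 2 powr (i * (1 - \<theta>))" by (simp add: algebra_simps flip: powr_add)
        also have "\<dots> \<le> r ^ nat \<bar>i\<bar>" unfolding r_def
          using False mult_left_mono_neg[OF \<gamma>(3), of "of_int i"] by (intro powr_two_le_geometric[OF \<gamma>(1)]) auto
        finally show ?thesis .
      qed
      then have h: "2 powr (- (i * \<theta>)) * (2 powr i * M * norm x) \<le> M * (r ^ nat \<bar>i\<bar> * norm x)"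
        using mult_right_mono[of "2 powr (- (i * \<theta>)) * 2 powr i" "r ^ nat \<bar>i\<bar>" "M * norm x"] M by (simp add: mult_ac)
      have "kj x i \<le> 2 powr (- (i * \<theta>)) * (2 * norm (x - J (2 powr i) x) + 2 powr i * M * norm x)"
        unfolding kj_def by (intro mult_left_mono K_le_J M) auto
      also have "\<dots> \<le> 2 * (2 powr (- (i * \<theta>)) * norm (x - J (2 powr i) x)) + M * (r ^ nat \<bar>i\<bar> * norm x)"
        using h by (simp add: distrib_left)
      also have "\<dots> \<le> 2 * (2 powr (- (i * \<theta>)) * norm (x - J (2 powr i) x)) + (M + 1) * (r ^ nat \<bar>i\<bar> * norm x)"
        using r by (simp add: distrib_right)
      finally show ?thesis .
    qed
    then have "ennreal (kj x i) \<le> ennreal 2 * ennreal (2 powr (- (i * \<theta>)) * norm (x - J (2 powr i) x)) + ennreal (M + 1) * ennreal (r ^ nat \<bar>i\<bar> * norm x)"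
      using M r by (intro ennreal_le_linear_combination) auto
    also have "\<dots> \<le> ennreal 2 * (ennreal C2 * ?W) + ennreal (M + 1) * ?W"
      by (intro add_mono mult_left_mono X2 pt) auto
    also have "\<dots> = ennreal (2 * C2 + (M + 1)) * ?W"
    proof -
      have "ennreal (2 * C2 + (M + 1)) = ennreal 2 * ennreal C2 + ennreal (M + 1)"
        using C2 M by (subst ennreal_plus) (auto simp: ennreal_mult)
      then show ?thesis by (simp only: distrib_right mult.assoc)
    qed
    finally show "ennreal (kj x i) \<le> ennreal (2 * C2 + (M + 1)) * ?W" .
  qed
qed

section \<open>The equivalence of the norms\<close>

lemma T_linear:
  assumes "c > 0"
  shows "T c (x + y) = T c x + T c y" "T c (a *\<^sub>C x) = a *\<^sub>C T c x"
  using hc_add_right[OF \<phi>0_scale[OF assms] \<nu>] hc_scale_right[OF \<phi>0_scale[OF assms] \<nu>]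
  by (simp_all add: T_def J_linear[OF assms] scaleC_simps scaleC_scaleC mult.commute)

lemma cj_add: "\<bar>cj (x + y) j\<bar> \<le> \<bar>cj x j\<bar> + \<bar>cj y j\<bar>"
  unfolding cj_def by (simp add: T_linear abs_mult flip: distrib_left) (rule norm_triangle_ineq)

lemma cj_scale: "cj (a *\<^sub>C x) j = cmod a * cj x j"
  by (simp add: cj_def T_linear norm_scaleC)

lemma equivalent_norms:
  assumes s: "1 \<le> s"
  obtains C where "C > 0"
    "\<And>x. ennreal (norm x) + lseq_norm s (cj x) \<le> ennreal C * real_interp_norm D (graph_norm A) \<theta> s x"
    "\<And>x. real_interp_norm D (graph_norm A) \<theta> s x \<le> ennreal C * (ennreal (norm x) + lseq_norm s (cj x))"
proof -
  obtain r1 C1 where r1: "0 < r1" "r1 < 1" "C1 > 0"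
    "\<And>x j. ennreal (cj x j) \<le> ennreal C1 * (\<integral>\<^sup>+i. ennreal (r1 ^ nat \<bar>j - i\<bar>) * ennreal (kj x i) \<partial>count_space UNIV)"
    using cj_le_convolution by blast
  obtain r2 C2 where r2: "0 < r2" "r2 < 1" "C2 > 0"
    "\<And>x i. ennreal (kj x i) \<le> ennreal C2 * (\<integral>\<^sup>+j. ennreal (r2 ^ nat \<bar>i - j\<bar>) *
      ennreal (cj x j + (if j = 0 then norm x else 0)) \<partial>count_space UNIV)"
    using kj_le_convolution by blast
  obtain K1 where K1: "K1 > 0" "\<And>c k. (\<And>j. c j \<ge> 0) \<Longrightarrow> (\<And>j. k j \<ge> 0) \<Longrightarrow>
      (\<And>i::int. ennreal (c i) \<le> ennreal C1 * (\<integral>\<^sup>+j. ennreal (r1 ^ nat \<bar>i - j\<bar>) * ennreal (k j) \<partial>count_space UNIV)) \<Longrightarrow>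
      lseq_norm s c \<le> ennreal (C1 * K1) * lseq_norm s k"
  proof (rule lseq_norm_convolution[OF r1(1,2)])
    fix K :: real
    assume pos: "K > 0" and conv: "\<And>s c k C. 1 \<le> s \<Longrightarrow> C > 0 \<Longrightarrow> (\<And>j. c j \<ge> 0) \<Longrightarrow> (\<And>j. k j \<ge> 0) \<Longrightarrow>
      (\<And>i::int. ennreal (c i) \<le> ennreal C * (\<integral>\<^sup>+j. ennreal (r1 ^ nat \<bar>i - j\<bar>) * ennreal (k j) \<partial>count_space UNIV)) \<Longrightarrow>
      lseq_norm s c \<le> ennreal (C * K) * lseq_norm s k"
    show thesis by (rule that[OF pos conv[OF s r1(3)]])
  qed
  obtain K2 where K2: "K2 > 0" "\<And>c k. (\<And>j. c j \<ge> 0) \<Longrightarrow> (\<And>j. k j \<ge> 0) \<Longrightarrow>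
      (\<And>i::int. ennreal (c i) \<le> ennreal C2 * (\<integral>\<^sup>+j. ennreal (r2 ^ nat \<bar>i - j\<bar>) * ennreal (k j) \<partial>count_space UNIV)) \<Longrightarrow>
      lseq_norm s c \<le> ennreal (C2 * K2) * lseq_norm s k"
  proof (rule lseq_norm_convolution[OF r2(1,2)])
    fix K :: real
    assume pos: "K > 0" and conv: "\<And>s c k C. 1 \<le> s \<Longrightarrow> C > 0 \<Longrightarrow> (\<And>j. c j \<ge> 0) \<Longrightarrow> (\<And>j. k j \<ge> 0) \<Longrightarrow>
      (\<And>i::int. ennreal (c i) \<le> ennreal C * (\<integral>\<^sup>+j. ennreal (r2 ^ nat \<bar>i - j\<bar>) * ennreal (k j) \<partial>count_space UNIV)) \<Longrightarrow>
      lseq_norm s c \<le> ennreal (C * K) * lseq_norm s k"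
    show thesis by (rule that[OF pos conv[OF s r2(3)]])
  qed
  have cj0: "cj x j \<ge> 0" and kj0: "kj x j \<ge> 0" for x j by (auto simp: cj_def kj_def K_nonneg)
  define C where "C = 4 * (1 + C1 * K1) + 2 * (C2 * K2)"
  have pos: "C1 * K1 > 0" "C2 * K2 > 0" using r1 r2 K1 K2 by auto
  have C: "C > 0" "4 * (1 + C1 * K1) \<le> C" "2 * (C2 * K2) \<le> C" using pos by (auto simp: C_def)
  have main: "ennreal (norm x) + lseq_norm s (cj x) \<le> ennreal C * real_interp_norm D (graph_norm A) \<theta> s x \<and>
      real_interp_norm D (graph_norm A) \<theta> s x \<le> ennreal C * (ennreal (norm x) + lseq_norm s (cj x))" for x
  proof -
    interpret dc: dyadic_comparison "\<lambda>t. K t x" \<theta> s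
      by unfold_locales (auto simp: K_nonneg K_mono K_double \<theta> s)
    have k: "dc.k = kj x" by (simp add: fun_eq_iff dc.k_def kj_def)
    have N: "dc.N = real_interp_norm D (graph_norm A) \<theta> s x" by (simp add: dc.N_def real_interp_norm_def)
    have up: "lseq_norm s (kj x) \<le> ennreal 4 * real_interp_norm D (graph_norm A) \<theta> s x" using dc.le_N unfolding k N .
    have lo: "real_interp_norm D (graph_norm A) \<theta> s x \<le> ennreal 2 * lseq_norm s (kj x)" using dc.N_le unfolding k N .
    \<comment> \<open>The entry with index 0 is K(1, x), so the interpolation norm controls the norm
      of X as well.\<close>
    have "norm x \<le> \<bar>kj x 0\<bar>" using norm_le_K_one[of x] by (simp add: kj_def)
    then have n: "ennreal (norm x) \<le> lseq_norm s (kj x)"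
      by (rule order_trans[OF ennreal_leI lseq_norm_point[OF s]])
    have "lseq_norm s (cj x) \<le> ennreal (C1 * K1) * lseq_norm s (kj x)"
      by (rule K1(2)[OF cj0 kj0 r1(4)])
    with n have "ennreal (norm x) + lseq_norm s (cj x) \<le> ennreal 1 * lseq_norm s (kj x) + ennreal (C1 * K1) * lseq_norm s (kj x)"
      by (intro add_mono) auto
    also have "\<dots> = ennreal (1 + C1 * K1) * lseq_norm s (kj x)"
      using pos by (subst ennreal_plus) (auto simp: distrib_right)
    also have "\<dots> \<le> ennreal (1 + C1 * K1) * (ennreal 4 * real_interp_norm D (graph_norm A) \<theta> s x)"
      by (rule mult_left_mono[OF up]) simp
    also have "\<dots> = ennreal (4 * (1 + C1 * K1)) * real_interp_norm D (graph_norm A) \<theta> s x"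
    proof -
      have "ennreal (4 * (1 + C1 * K1)) = ennreal 4 * ennreal (1 + C1 * K1)"
        by (rule ennreal_mult) (use pos in auto)
      then show ?thesis by (simp only: mult_ac)
    qed
    also have "\<dots> \<le> ennreal C * real_interp_norm D (graph_norm A) \<theta> s x"
      by (rule mult_right_mono[OF ennreal_leI[OF C(2)]]) simp
    finally have A: "ennreal (norm x) + lseq_norm s (cj x) \<le> ennreal C * real_interp_norm D (graph_norm A) \<theta> s x" .
    let ?c = "\<lambda>j. cj x j + (if j = 0 then norm x else 0)"
    have "lseq_norm s (kj x) \<le> ennreal (C2 * K2) * lseq_norm s ?c"
      by (rule K2(2)[OF kj0 _ r2(4)]) (simp add: cj0)
    also have "\<dots> \<le> ennreal (C2 * K2) * (lseq_norm s (cj x) + lseq_norm s (\<lambda>j. if j = 0 then norm x else 0))"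
      by (intro mult_left_mono lseq_norm_triangle[OF s]) (auto simp: cj0)
    also have "\<dots> = ennreal (C2 * K2) * (ennreal (norm x) + lseq_norm s (cj x))"
      by (simp add: lseq_norm_delta[OF s] add.commute)
    finally have "real_interp_norm D (graph_norm A) \<theta> s x \<le> ennreal 2 * (ennreal (C2 * K2) * (ennreal (norm x) + lseq_norm s (cj x)))"
      by (intro order_trans[OF lo] mult_left_mono) auto
    also have "\<dots> = ennreal (2 * (C2 * K2)) * (ennreal (norm x) + lseq_norm s (cj x))"
    proof -
      have "ennreal (2 * (C2 * K2)) = ennreal 2 * ennreal (C2 * K2)" by (rule ennreal_mult) (use pos in auto)
      then show ?thesis by (simp only: mult.assoc)
    qed
    also have "\<dots> \<le> ennreal C * (ennreal (norm x) + lseq_norm s (cj x))"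
      by (rule mult_right_mono[OF ennreal_leI[OF C(3)]]) simp
    finally show ?thesis using A by blast
  qed
  show ?thesis using that[OF C(1)] main by blast
qed

lemma defines_equivalent_norm_cj:
  assumes s: "1 \<le> s"
  shows "defines_equivalent_norm (\<lambda>x. ennreal (norm x) + lseq_norm s (cj x))
    (real_interp_space D (graph_norm A) \<theta> s) (real_interp_norm D (graph_norm A) \<theta> s)"
proof -
  let ?N = "\<lambda>x. ennreal (norm x) + lseq_norm s (cj x)" and ?n = "real_interp_norm D (graph_norm A) \<theta> s"
  obtain C where C: "C > 0" "\<And>x. ?N x \<le> ennreal C * ?n x" "\<And>x. ?n x \<le> ennreal C * ?N x"
    using equivalent_norms[OF s] by blast
  have fin: "?n x < \<infinity> \<longleftrightarrow> ?N x < \<infinity>" for x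
  proof -
    have "ennreal C * ?n x < \<infinity>" if "?n x < \<infinity>" using that by (simp add: ennreal_mult_less_top)
    then have "?N x < \<infinity>" if "?n x < \<infinity>" using that le_less_trans[OF C(2)] by blast
    moreover have "ennreal C * ?N x < \<infinity>" if "?N x < \<infinity>" using that by (simp add: ennreal_mult_less_top)
    then have "?n x < \<infinity>" if "?N x < \<infinity>" using that le_less_trans[OF C(3)] by blast
    ultimately show ?thesis by blast
  qed
  have cz: "cj 0 = (\<lambda>_. 0)" using cj_scale[of 0 0] by (simp add: fun_eq_iff)
  have scale: "?N (c *\<^sub>C x) = ennreal (cmod c) * ?N x" for c x
  proof (cases "c = 0")
    case True
    then show ?thesis using s by (simp add: cz)
  next
    case False
    have e: "cj (c *\<^sub>C x) = (\<lambda>j. cmod c * cj x j)" by (simp add: fun_eq_iff cj_scale)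
    \<comment> \<open>\<open>lseq_norm_scale\<close> is only an inequality; applied with 1/c to the
      scaled sequence it gives the converse.\<close>
    have "lseq_norm s (\<lambda>j. cmod c * cj x j) = ennreal (cmod c) * lseq_norm s (cj x)"
    proof (rule antisym)
      show "lseq_norm s (\<lambda>j. cmod c * cj x j) \<le> ennreal (cmod c) * lseq_norm s (cj x)"
        using lseq_norm_scale[OF s, of "cmod c" "cj x"] False by simp
      have "lseq_norm s (cj x) \<le> ennreal (1 / cmod c) * lseq_norm s (\<lambda>j. cmod c * cj x j)"
        using lseq_norm_scale[OF s, of "1 / cmod c" "\<lambda>j. cmod c * cj x j"] False by simp
      then have "ennreal (cmod c) * lseq_norm s (cj x) \<le> ennreal (cmod c) * (ennreal (1 / cmod c) * lseq_norm s (\<lambda>j. cmod c * cj x j))"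
        by (rule mult_left_mono) simp
      also have "\<dots> = lseq_norm s (\<lambda>j. cmod c * cj x j)"
        using False by (simp add: mult.assoc[symmetric] ennreal_mult[symmetric])
      finally show "ennreal (cmod c) * lseq_norm s (cj x) \<le> lseq_norm s (\<lambda>j. cmod c * cj x j)" .
    qed
    then show ?thesis by (simp add: e norm_scaleC ennreal_mult distrib_left)
  qed
  have triangle: "?N (x + y) \<le> ?N x + ?N y" for x y
  proof -
    have "ennreal (norm (x + y)) \<le> ennreal (norm x) + ennreal (norm y)"
      using norm_triangle_ineq[of x y] by (simp add: ennreal_leI flip: ennreal_plus)
    moreover have "lseq_norm s (cj (x + y)) \<le> lseq_norm s (cj x) + lseq_norm s (cj y)"
      by (rule lseq_norm_triangle[OF s cj_add])
    ultimately have "?N (x + y) \<le> (ennreal (norm x) + ennreal (norm y)) + (lseq_norm s (cj x) + lseq_norm s (cj y))"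
      by (rule add_mono)
    then show ?thesis by (simp only: add_ac)
  qed
  have zero: "?N x = 0 \<longleftrightarrow> x = 0" for x using s by (auto simp: cz)
  have space: "real_interp_space D (graph_norm A) \<theta> s = {x. ?N x < \<infinity>}"
    unfolding real_interp_space_def using fin by blast
  show ?thesis
    unfolding defines_equivalent_norm_def
  proof (intro conjI ballI allI)
    show "\<exists>C>0. \<forall>x\<in>real_interp_space D (graph_norm A) \<theta> s. ?N x \<le> ennreal C * ?n x \<and> ?n x \<le> ennreal C * ?N x"
      by (rule exI[of _ C], intro conjI ballI) (rule C)+
  qed (rule space zero scale triangle)+
qed

end

section \<open>Sectorial operators and the classes of auxiliary functions\<close>

text \<open>The bridge between closed sectors, in which sectoriality is phrased, and the cosine
  condition of \<open>sectorial_operator\<close>.\<close>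

lemma closure_sector_subset:
  assumes "0 \<le> a" "a \<le> \<delta>" "\<delta> < pi"
  shows "closure (sector a) \<subseteq> {z. cos \<delta> * cmod z \<le> Re z}"
proof (rule closure_minimal)
  show "sector a \<subseteq> {z. cos \<delta> * cmod z \<le> Re z}"
  proof
    fix z assume z: "z \<in> sector a"
    show "z \<in> {z. cos \<delta> * cmod z \<le> Re z}"
    proof (cases "a = 0")
      case True
      then obtain t where t: "t > 0" "z = complex_of_real t" using z by (auto simp: sector_def)
      then show ?thesis using mult_right_mono[OF cos_le_one[of \<delta>], of t] by simp
    next
      case False
      then have w: "exp (Ln z) = z" "\<bar>Im (Ln z)\<bar> < a" using sector_Ln[of a z] z assms by auto
      have "cos \<delta> \<le> cos \<bar>Im (Ln z)\<bar>" using w assms by (intro cos_monotone_0_pi_le) auto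
      then have "exp (Re (Ln z)) * cos \<delta> \<le> exp (Re (Ln z)) * cos (Im (Ln z))" by simp
      then have "cos \<delta> * cmod (exp (Ln z)) \<le> Re (exp (Ln z))" by (simp add: Re_exp mult.commute)
      then show ?thesis using w(1) by simp
    qed
  qed
  show "closed {z. cos \<delta> * cmod z \<le> Re z}" by (intro closed_Collect_le continuous_intros)
qed

lemma sectorial_imp_sectorial_operator:
  assumes "sectorial D A" "inj_on A D" "sectoriality_angle D A < \<nu>" "\<nu> < pi"
  obtains \<delta> M where "\<delta> < \<nu>" "0 \<le> M" "sectorial_operator D A \<delta> M"
proof -
  have "{\<omega>. sectorial_of_type D A \<omega>} \<noteq> {}" using assms(1) by (auto simp: sectorial_def)
  from cInf_lessD[OF this] obtain \<omega> where \<omega>: "sectorial_of_type D A \<omega>" "\<omega> < \<nu>"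
    using assms(3) unfolding sectoriality_angle_def by blast
  \<comment> \<open>\<delta> has to exceed \<omega>, since the resolvent bound is uniform only off
    larger sectors, and to stay below \<nu>, so that the contour runs where the bound holds.\<close>
  define \<delta> where "\<delta> = (\<omega> + \<nu>) / 2"
  have \<omega>0: "0 \<le> \<omega>" and lin: "linear_operator D A" and spec: "op_spectrum D A \<subseteq> closure (sector \<omega>)"
    and bdd: "\<And>\<sigma>. \<omega> < \<sigma> \<Longrightarrow> \<sigma> < pi \<Longrightarrow>
      bdd_above ((\<lambda>z. onorm (\<lambda>x. z *\<^sub>C resolvent D A z x)) ` (- closure (sector \<sigma>)))"
    using \<omega>(1) by (auto simp: sectorial_of_type_def)
  have \<delta>: "\<omega> < \<delta>" "0 < \<delta>" "\<delta> < \<nu>" "\<delta> < pi" using \<omega>(2) \<omega>0 assms(4) by (auto simp: \<delta>_def)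
  obtain B where B: "\<And>z. z \<notin> closure (sector \<delta>) \<Longrightarrow> onorm (\<lambda>x. z *\<^sub>C resolvent D A z x) \<le> B"
    using bdd[OF \<delta>(1,4)] by (auto simp: bdd_above_def)
  have out: "z \<in> resolvent_set D A" if "Re z < cos \<delta> * cmod z" for z
    using spec closure_sector_subset[of \<omega> \<delta>] \<omega>0 \<delta> that by (fastforce simp: op_spectrum_def)
  have bound: "norm (z *\<^sub>C resolvent D A z x) \<le> max B 0 * norm x" if z: "Re z < cos \<delta> * cmod z" for z x
  proof -
    have "bounded_linear (resolvent D A z)" using out[OF z] by (simp add: resolvent_set_def)
    then have "bounded_linear (\<lambda>x. z *\<^sub>C resolvent D A z x)"
      by (rule bounded_linear_compose[OF scaleC.bounded_linear_right])
    then have "norm (z *\<^sub>C resolvent D A z x) \<le> onorm (\<lambda>x. z *\<^sub>C resolvent D A z x) * norm x" by (rule onorm)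
    also have "onorm (\<lambda>x. z *\<^sub>C resolvent D A z x) \<le> max B 0"
      using B[of z] closure_sector_subset[of \<delta> \<delta>] \<delta> z by fastforce
    finally show ?thesis by (simp add: mult_right_mono)
  qed
  have "sectorial_operator D A \<delta> (max B 0)"
    by (unfold_locales) (use lin assms(2) \<delta> out bound in auto)
  then show ?thesis by (rule that[OF \<delta>(3) max.cobounded2])
qed

lemma norm_powr_minus_mult:
  "cmod (z powr (- complex_of_real \<theta>) * c) = cmod z powr (- \<theta>) * cmod c"
  by (simp add: norm_mult norm_powr_real_powr')

text \<open>Membership of \<open>z powr (-\<theta>) * \<phi> z\<close> in the decaying class forces the limit of \<open>\<phi>\<close> at 0 to
  vanish, and for angle \<open>pi\<close> also the absence of a pole of \<open>\<phi>\<close> at \<open>-1\<close>.\<close>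

lemma Phi_Sigma_decomposition:
  assumes \<sigma>: "0 < \<sigma>" "\<sigma> \<le> pi" and \<theta>: "0 < \<theta>" and \<phi>: "\<phi> \<in> Phi_Sigma \<sigma> \<theta>"
  obtains \<phi>0 b \<epsilon> C H and d :: int where "\<phi>0 \<in> H0_inf \<sigma>"
    "\<And>z. z \<in> sector \<sigma> \<Longrightarrow> \<phi> z = \<phi>0 z + b * (z / (1 + z))"
    "\<And>z. z \<in> sector \<sigma> \<Longrightarrow> \<phi> z \<noteq> 0" "\<epsilon> > 0"
    "\<And>w. \<bar>Im w\<bar> < \<sigma> \<Longrightarrow> Re w \<le> 0 \<Longrightarrow> cmod (\<phi> (exp w)) \<le> C * exp ((\<theta> + \<epsilon>) * Re w)"
    "\<And>z t. z \<in> sector \<sigma> \<Longrightarrow> t \<in> {1..2} \<Longrightarrow>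
      cmod (\<phi> (complex_of_real t * z)) \<le> H * cmod (\<phi> (complex_of_real (2 powr (- d)) * z))"
    "\<sigma> = pi \<Longrightarrow> b = 0"
proof -
  let ?\<psi> = "\<lambda>z. z powr (- complex_of_real \<theta>) * \<phi> z"
  have \<psi>: "?\<psi> \<in> Phi_Sigma_zero \<sigma>" and "\<phi> \<in> elementary_class \<sigma>"
    using \<phi> by (auto simp: Phi_Sigma_def Phi_class_def)
  then obtain \<phi>0 a b where \<phi>0: "\<phi>0 \<in> H0_inf \<sigma>" and eq: "\<And>z. z \<in> sector \<sigma> \<Longrightarrow> \<phi> z = \<phi>0 z + a / (1 + z) + b"
    by (auto simp: elementary_class_def)
  have \<psi>0: "?\<psi> \<in> H0_inf \<sigma>" using \<psi> by (simp add: Phi_Sigma_zero_def)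
  have nonzero: "\<phi> z \<noteq> 0" if "z \<in> sector \<sigma>" for z
  proof -
    have "0 \<notin> ?\<psi> ` sector \<sigma>" using \<psi> by (simp add: Phi_Sigma_zero_def)
    then have "0 \<noteq> ?\<psi> z" using imageI[OF that, of ?\<psi>] by metis
    then show ?thesis by auto
  qed
  obtain \<epsilon> C where e: "\<epsilon> > 0" "C \<ge> 0" "\<And>w. \<bar>Im w\<bar> < \<sigma> \<Longrightarrow> cmod (?\<psi> (exp w)) \<le> C * exp (-\<epsilon> * \<bar>Re w\<bar>)"
    using H0_infE[OF \<sigma> \<psi>0] by blast
  have bound: "cmod (\<phi> (exp w)) \<le> C * exp (\<theta> * Re w - \<epsilon> * \<bar>Re w\<bar>)" if "\<bar>Im w\<bar> < \<sigma>" for w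
  proof -
    have "exp (Re w) powr (- \<theta>) * cmod (\<phi> (exp w)) \<le> C * exp (-\<epsilon> * \<bar>Re w\<bar>)"
      using e(3)[OF that] unfolding norm_powr_minus_mult norm_exp_eq_Re .
    then have "exp (\<theta> * Re w) * (exp (- (\<theta> * Re w)) * cmod (\<phi> (exp w))) \<le> exp (\<theta> * Re w) * (C * exp (-\<epsilon> * \<bar>Re w\<bar>))"
      by (intro mult_left_mono) (auto simp: exp_powr_real mult.commute)
    moreover have "exp (\<theta> * Re w) * (exp (- (\<theta> * Re w)) * cmod (\<phi> (exp w))) = cmod (\<phi> (exp w))"
      by (simp add: exp_minus)
    moreover have "exp (\<theta> * Re w) * (C * exp (-\<epsilon> * \<bar>Re w\<bar>)) = C * exp (\<theta> * Re w - \<epsilon> * \<bar>Re w\<bar>)"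
      by (simp add: exp_diff exp_minus field_simps)
    ultimately show ?thesis by linarith
  qed
  have near0: "cmod (\<phi> (exp w)) \<le> C * exp ((\<theta> + \<epsilon>) * Re w)" if "\<bar>Im w\<bar> < \<sigma>" "Re w \<le> 0" for w
    using bound[OF that(1)] that(2) by (simp add: algebra_simps)
  have ab: "a + b = 0"
  proof -
    have 1: "((\<lambda>t. \<phi> (exp (complex_of_real t))) \<longlongrightarrow> 0 + (a + b)) at_bot"
    proof -
      have "\<phi> (exp (complex_of_real t)) = \<phi>0 (exp (complex_of_real t)) + (a / (1 + exp (complex_of_real t)) + b)" for t
        using eq[of "exp (complex_of_real t)"] exp_in_sector[of \<sigma> "complex_of_real t"] \<sigma> by simp
      then show ?thesis
        using tendsto_add[OF H0_inf_tendsto_zero(2)[OF \<sigma> \<phi>0] inverse_one_plus_exp_tendsto(2)] by presburger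
    qed
    have 2: "((\<lambda>t. \<phi> (exp (complex_of_real t))) \<longlongrightarrow> 0) at_bot"
    proof (rule Lim_null_comparison)
      show "\<forall>\<^sub>F t in at_bot. norm (\<phi> (exp (complex_of_real t))) \<le> C * exp ((\<theta> + \<epsilon>) * t)"
        using near0[of "complex_of_real _"] \<sigma> by (intro eventually_at_bot_linorderI[of 0]) simp
      have "\<theta> + \<epsilon> > 0" using \<theta> e(1) by simp
      then show "((\<lambda>t. C * exp ((\<theta> + \<epsilon>) * t)) \<longlongrightarrow> 0) at_bot" by real_asymp
    qed
    show ?thesis using tendsto_unique[OF _ 1 2] by simp
  qed
  have eq': "\<phi> z = \<phi>0 z + b * (z / (1 + z))" if z: "z \<in> sector \<sigma>" for z
  proof -
    have "1 + z \<noteq> 0" using one_plus_sector_nonzero[OF \<sigma>(1) z, of 1] by simp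
    moreover have "a = - b" using ab by (simp add: eq_neg_iff_add_eq_0)
    ultimately show ?thesis using eq[OF z] by (simp add: field_simps)
  qed
  have b0: "b = 0" if "\<sigma> = pi"
  proof -
    obtain \<epsilon>' C' where e': "\<epsilon>' > 0" "C' \<ge> 0" "\<And>w. \<bar>Im w\<bar> < \<sigma> \<Longrightarrow> cmod (\<phi>0 (exp w)) \<le> C' * exp (-\<epsilon>' * \<bar>Re w\<bar>)"
      using H0_infE[OF \<sigma> \<phi>0] by blast
    \<comment> \<open>On the unit circle \<phi> and \<phi>0 are bounded by C and C', while the
      modulus of z/(1 + z) is 1/\<bar>1 + z\<bar>; letting t tend to pi forces b = 0.\<close>
    have le: "cmod b \<le> (C + C') * cmod (1 + cis t)" if t: "0 < t" "t < pi" for t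
    proof -
      let ?w = "\<i> * complex_of_real t"
      have w: "\<bar>Im ?w\<bar> < \<sigma>" using t \<open>\<sigma> = pi\<close> by simp
      have cis: "exp ?w = cis t" by (simp add: cis_conv_exp)
      have s: "cis t \<in> sector \<sigma>" using exp_in_sector[OF \<sigma>(2) w] cis by simp
      have nz: "1 + cis t \<noteq> 0" using one_plus_sector_nonzero[OF \<sigma>(1) s, of 1] by simp
      have "b * (cis t / (1 + cis t)) = \<phi> (cis t) - \<phi>0 (cis t)" using eq'[OF s] by simp
      also have "cmod \<dots> \<le> C + C'"
        using norm_triangle_ineq4[of "\<phi> (cis t)" "\<phi>0 (cis t)"] bound[OF w] e'(3)[OF w] unfolding cis by simp
      finally have "cmod b / cmod (1 + cis t) \<le> C + C'" by (simp add: norm_mult norm_divide)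
      then show ?thesis using nz by (simp add: divide_le_eq)
    qed
    have "((\<lambda>t. (C + C') * cmod (1 + cis t)) \<longlongrightarrow> (C + C') * cmod (1 + cis pi)) (at_left pi)"
      by (intro tendsto_intros)
    moreover have "\<forall>\<^sub>F t in at_left pi. cmod b \<le> (C + C') * cmod (1 + cis t)"
      by (rule eventually_at_leftI[of 0]) (use le in auto)
    ultimately have "cmod b \<le> (C + C') * cmod (1 + cis pi)" by (rule tendsto_lowerbound) simp
    then show ?thesis by simp
  qed
  obtain d :: int and F where bdd: "bdd_above {cmod (f z) | f z. f \<in> F \<and> z \<in> sector \<sigma>}"
    and F: "\<And>j t. t \<in> {1..2::real} \<Longrightarrow> \<exists>f\<in>F. \<exists>r>0. \<forall>z\<in>sector \<sigma>.
        ?\<psi> (2 powi j * complex_of_real t * z) / ?\<psi> (2 powi (j - d) * z) = f (complex_of_real r * z)"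
    using \<psi> unfolding Phi_Sigma_zero_def by blast
  obtain B where B: "\<And>f z. f \<in> F \<Longrightarrow> z \<in> sector \<sigma> \<Longrightarrow> cmod (f z) \<le> B"
    using bdd by (auto simp: bdd_above_def)
  \<comment> \<open>The first family of quotients at j = 0. Undoing the factors z^(-\<theta>) costs
    t^\<theta> 2^(d\<theta>), and t \<le> 2.\<close>
  have harnack: "cmod (\<phi> (complex_of_real t * z)) \<le>
      2 powr \<theta> * B * 2 powr (d * \<theta>) * cmod (\<phi> (complex_of_real (2 powr (- d)) * z))"
    if z: "z \<in> sector \<sigma>" and t: "t \<in> {1..2}" for z t
  proof -
    obtain f r where fr: "f \<in> F" "r > 0" "?\<psi> (2 powi 0 * complex_of_real t * z) / ?\<psi> (2 powi (0 - d) * z) = f (complex_of_real r * z)"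
      using F[OF t, of 0] z by blast
    let ?c = "complex_of_real (2 powr (- d))"
    have c: "2 powi (0 - d) = ?c" using powr_real_of_int'[of 2 "-d"] by simp
    have cz: "?c * z \<in> sector \<sigma>" by (rule mult_in_sector[OF \<sigma> z]) simp
    have z0: "cmod z > 0" using sector_Ln(1)[OF \<sigma>(1) z] by simp
    have n: "cmod (?c * z) powr (- \<theta>) = 2 powr (d * \<theta>) * cmod z powr (- \<theta>)"
      "cmod (complex_of_real t * z) powr (- \<theta>) = t powr (- \<theta>) * cmod z powr (- \<theta>)"
      using t z0 by (simp_all only: norm_mult norm_of_real) (simp_all add: powr_mult powr_powr)
    have "cmod (?\<psi> (complex_of_real t * z) / ?\<psi> (?c * z)) \<le> B"
      using fr(3) B[OF fr(1) mult_in_sector[OF \<sigma> z fr(2)]] unfolding c by simp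
    moreover have "cmod (?\<psi> (complex_of_real t * z) / ?\<psi> (?c * z)) =
        cmod (\<phi> (complex_of_real t * z)) / (t powr \<theta> * 2 powr (d * \<theta>) * cmod (\<phi> (?c * z)))"
      unfolding norm_divide norm_powr_minus_mult n
      using t z0 by (simp add: powr_minus divide_simps)
    moreover have "t powr \<theta> * 2 powr (d * \<theta>) * cmod (\<phi> (?c * z)) > 0" using t nonzero[OF cz] by simp
    ultimately have le: "cmod (\<phi> (complex_of_real t * z)) \<le> B * (t powr \<theta> * 2 powr (d * \<theta>) * cmod (\<phi> (?c * z)))"
      by (simp only: pos_divide_le_eq)
    have "0 \<le> B" using order_trans[OF norm_ge_zero B[OF fr(1) z]] .
    moreover have "t powr \<theta> \<le> 2 powr \<theta>" using t \<theta> by (intro powr_mono2) auto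
    ultimately have "B * (t powr \<theta> * 2 powr (d * \<theta>) * cmod (\<phi> (?c * z))) \<le>
        B * (2 powr \<theta> * 2 powr (d * \<theta>) * cmod (\<phi> (?c * z)))"
      by (intro mult_left_mono mult_right_mono) auto
    with le show ?thesis by (simp add: mult_ac)
  qed
  show ?thesis by (rule that[OF \<phi>0 eq' nonzero e(1) near0 harnack b0])
qed

text \<open>The dilated function contains b/(1 + cz), whereas the elementary class is built on 1/(1
  + z); the difference of the two is put into the decaying part. For \<Sigma> = pi that difference
  is unbounded near its poles when c differs from 1, but then b = 0.\<close>

lemma (in interpolation_data) elementary_calculus_scaled:
  assumes \<Sigma>: "\<sigma> \<le> \<Sigma>" "\<Sigma> \<le> pi" and \<phi>0': "\<phi>0 \<in> H0_inf \<Sigma>"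
    and eq: "\<And>z. z \<in> sector \<Sigma> \<Longrightarrow> \<phi> z = \<phi>0 z + b * (z / (1 + z))" and b: "\<Sigma> = pi \<Longrightarrow> b = 0" and c: "c > 0"
  shows "elementary_calculus D A \<Sigma> \<nu> (\<lambda>z. \<phi> (complex_of_real c * z)) x = T c x"
proof -
  let ?u = "\<lambda>z. 1 / (1 + z) - 1 / (1 + complex_of_real c * z)"
  have \<Sigma>0: "0 < \<Sigma>" using \<sigma> \<Sigma> by simp
  have s: "(\<lambda>z. \<phi>0 (complex_of_real c * z)) \<in> H0_inf \<Sigma>" by (rule H0_inf_scale[OF \<Sigma>0 \<Sigma>(2) \<phi>0' c])
  have "(\<lambda>z. \<phi>0 (complex_of_real c * z) + b * ?u z) \<in> H0_inf \<Sigma>"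
  proof (cases "\<Sigma> = pi")
    case True
    then show ?thesis using s b by simp
  next
    case False
    then show ?thesis using \<Sigma>0 \<Sigma> c
      by (intro H0_inf_add H0_inf_cmult s resolvent_difference_in_H0) auto
  qed
  moreover have "\<phi> (complex_of_real c * z) = (\<phi>0 (complex_of_real c * z) + b * ?u z) + (- b) / (1 + z) + b"
    if z: "z \<in> sector \<Sigma>" for z
  proof -
    have "1 + complex_of_real c * z \<noteq> 0" using one_plus_sector_nonzero[OF \<Sigma>0 z c] .
    then show ?thesis using eq[OF mult_in_sector[OF \<Sigma>0 \<Sigma>(2) z c]] by (simp add: field_simps)
  qed
  ultimately have "elementary_calculus D A \<Sigma> \<nu> (\<lambda>z. \<phi> (complex_of_real c * z)) x =
      hc \<nu> (\<lambda>z. \<phi>0 (complex_of_real c * z) + b * ?u z) x + (- b) *\<^sub>C J 1 x + b *\<^sub>C x"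
    by (rule elementary_calculus_eq[OF \<Sigma> \<nu>])
  also have "hc \<nu> (\<lambda>z. \<phi>0 (complex_of_real c * z) + b * ?u z) x = hc \<nu> (\<lambda>z. \<phi>0 (complex_of_real c * z)) x + b *\<^sub>C (J 1 x - J c x)"
    using \<phi>0_scale[OF c] \<sigma> c \<nu>
    by (subst hc_add_left[OF _ _ \<nu>])
       (auto simp: hc_cmult_left hc_resolvent_difference H0_inf_cmult resolvent_difference_in_H0)
  finally show ?thesis by (simp add: T_def scaleC_simps algebra_simps)
qed

theorem mainTheorem5:
  fixes D :: "'a::complex_banach set" and A :: "'a \<Rightarrow> 'a"
    and s :: ennreal and \<theta> \<sigma> \<nu> :: real and \<phi> :: "complex \<Rightarrow> complex"
  assumes "sectorial D A"
    and "inj_on A D"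
    and "closure D = UNIV"
    and "closure (A ` D) = UNIV"
    and "1 \<le> s"
    and "0 < \<theta>" and "\<theta> < 1"
    and "sectoriality_angle D A < \<sigma>" and "\<sigma> \<le> pi"
    and "sectoriality_angle D A < \<nu>" and "\<nu> < \<sigma>"
    and "\<phi> \<in> Phi_Sigma \<sigma> \<theta>"
  shows "defines_equivalent_norm
    (\<lambda>x. ennreal (norm x) + lseq_norm s (\<lambda>j::int. 2 powr (- (of_int j * \<theta>)) *
       norm (elementary_calculus D A \<sigma> \<nu> (\<lambda>z. \<phi> (2 powi j * z)) x)))
    (real_interp_space D (graph_norm A) \<theta> s)
    (real_interp_norm D (graph_norm A) \<theta> s)"
proof -
  obtain \<delta> M where dM: "\<delta> < \<nu>" "0 \<le> M" "sectorial_operator D A \<delta> M"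
    using sectorial_imp_sectorial_operator[OF assms(1,2,10)] assms(9,11) by auto
  interpret sectorial_operator D A \<delta> M by (rule dM(3))
  \<comment> \<open>The smaller sector still contains the contour, and its angle is strictly below
    pi even if \<sigma> = pi.\<close>
  define \<sigma>' where "\<sigma>' = (\<nu> + \<sigma>) / 2"
  have \<sigma>': "\<delta> < \<sigma>'" "\<nu> < \<sigma>'" "\<sigma>' \<le> \<sigma>" "\<sigma>' < pi" "0 < \<sigma>'" "0 < \<sigma>"
    using \<delta> dM(1) assms(9,11) by (auto simp: \<sigma>'_def)
  obtain \<phi>0 b \<epsilon> C H and d :: int where data: "\<phi>0 \<in> H0_inf \<sigma>"
    "\<And>z. z \<in> sector \<sigma> \<Longrightarrow> \<phi> z = \<phi>0 z + b * (z / (1 + z))"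
    "\<And>z. z \<in> sector \<sigma> \<Longrightarrow> \<phi> z \<noteq> 0" "\<epsilon> > 0"
    "\<And>w. \<bar>Im w\<bar> < \<sigma> \<Longrightarrow> Re w \<le> 0 \<Longrightarrow> cmod (\<phi> (exp w)) \<le> C * exp ((\<theta> + \<epsilon>) * Re w)"
    "\<And>z t. z \<in> sector \<sigma> \<Longrightarrow> t \<in> {1..2} \<Longrightarrow>
      cmod (\<phi> (complex_of_real t * z)) \<le> H * cmod (\<phi> (complex_of_real (2 powr (- d)) * z))"
    "\<sigma> = pi \<Longrightarrow> b = 0"
    using Phi_Sigma_decomposition[OF \<sigma>'(6) assms(9,6,12)] by blast
  have sub: "z \<in> sector \<sigma>" if "z \<in> sector \<sigma>'" for z using sector_mono[OF \<sigma>'(5,3)] that by blast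
  interpret interpolation_data D A \<delta> M \<sigma>' \<nu> \<theta> \<epsilon> C H \<phi> \<phi>0 b d
  proof unfold_locales
    show "\<phi>0 \<in> H0_inf \<sigma>'" by (rule H0_inf_mono[OF \<sigma>'(5,3) data(1)])
    show "cmod (\<phi> (exp w)) \<le> C * exp ((\<theta> + \<epsilon>) * Re w)" if "\<bar>Im w\<bar> < \<sigma>'" "Re w \<le> 0" for w
      using data(5)[of w] that \<sigma>'(3) by simp
  qed (use \<sigma>' dM assms(6,7) data(4) sub data(2,3,6) in blast)+
  have "elementary_calculus D A \<sigma> \<nu> (\<lambda>z. \<phi> (2 powi j * z)) x = T (2 powr j) x" for j :: int and x
  proof -
    have e: "2 powi j = complex_of_real (2 powr j)" using powr_real_of_int'[of 2 j] by simp
    show ?thesis unfolding e by (rule elementary_calculus_scaled[OF \<sigma>'(3) assms(9) data(1,2,7)]) simp_all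
  qed
  then show ?thesis using defines_equivalent_norm_cj[OF assms(5)] unfolding cj_def by simp
qed

end
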